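(* Let $u$ be the periodic entropy solution (in the sense defined in the context) of $\partial_tu+\partial_x\cdot f(u)=\mathcal{L}^\mu[u]$ in $D_T$, $u(\cdot,0)=u_0$, and for $\epsilon>0$ let $u_\epsilon$ be a smooth ($\Lambda$-periodic) solution of the viscous problem $$\partial_tu_\epsilon+\partial_x\cdot f(u_\epsilon)=\mathcal{L}^\mu[u_\epsilon]+\epsilon\Delta u_\epsilon\ \text{ in }D_T,\qquad u_\epsilon(\cdot,0)=u_0\ \text{ in }\Lambda.$$ Then there is a constant $C$, independent of $\epsilon$, such that for $t\in(0,T)$ $$\|u(\cdot,t)-u_\epsilon(\cdot,t)\|_{L^1(\Lambda)}\le C\sqrt{\epsilon}.$$
   Context: Let $d\ge1$, $T>0$, $\Lambda=(0,2\pi)^d$, $D_T=\Lambda\times(0,T)$. A function is $\Lambda$-periodic if it is $2\pi$-periodic in each space coordinate; a subscript $p$ on a function space indicates $\Lambda$-periodicity in the space variables. $\partial_x=(\partial_1,\dots,\partial_d)$ is the spatial gradient. Standing assumptions. $f=(f_1,\dots,f_d)$ with $f_j\in C^s(\mathbb{R})$ for an integer $s>4+[d/2]$ ($[\cdot]$ is the integer part). $\mu\ge0$ is a Radon measure on $\mathbb{R}^d\setminus\{0\}$ with $\int_{|z|>0}|z|^2\wedge1\,d\mu(z)<\infty$. $u_0\in L^\infty(\Lambda)\cap BV(\Lambda)$ is $\Lambda$-periodic. It is assumed throughout that for every $\epsilon>0$ the viscous problem admits a unique classical solution $u_\epsilon$. The nonlocal operator is $$\mathcal{L}^\mu[\phi](x)=\int_{|z|>0}\phi(x+z)-\phi(x)-z\cdot\partial_x\phi(x)\mathbf{1}_{|z|<1}\,d\mu(z).$$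 For $r>0$ set $$\mathcal{L}^{*,\mu}_r[\phi](x)=\int_{|z|\le r}\phi(x-z)-\phi(x)+z\cdot\partial_x\phi(x)\mathbf{1}_{|z|<1}\,d\mu(z),$$ $$\mathcal{L}^{\mu,r}[\phi](x)=\int_{|z|>r}\phi(x+z)-\phi(x)\,d\mu(z),\qquad \gamma_\mu^r=\int_{r<|z|<1}z\,d\mu(z)$$ (with $\gamma_\mu^r=0$ if $r>1$), and $\eta(u,k)=|u-k|$, $\eta'(u,k)=\mathrm{sgn}(u-k)$, $q_j(u,k)=\eta'(u,k)(f_j(u)-f_j(k))$, $q=(q_1,\dots,q_d)$. Definition. $u$ is a periodic entropy solution of the initial value problem with datum $u_0$ if: (i) $u$ is $\Lambda$-periodic in space, essentially bounded, and $u\in C([0,T];L^1(\Lambda))$; (ii) for all $k\in\mathbb{R}$, all $r>0$, and all nonnegative $\varphi\in C_p^\infty(\mathbb{R}^d\times(0,T))$ (smooth, $\Lambda$-periodic in $x$) with compact support in time in $(0,T)$, $$\iint_{D_T}\eta(u,k)\partial_t\varphi+q(u,k)\cdot\partial_x\varphi+\eta(u,k)\mathcal{L}^{*,\mu}_r[\varphi]+\eta'(u,k)\mathcal{L}^{\mu,r}[u]\varphi+\eta(u,k)\gamma_\mu^r\cdot\partial_x\varphi\;dx\,dt\ge0;$$ (iii) $\mathrm{esslim}_{t\to0}\|u(\cdot,t)-u_0\|_{L^1(\Lambda)}=0$. *)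

theory Defs
  imports "HOL-Analysis.Analysis"
begin

(* Conventions: space is real^'n with d = CARD('n); functions of space and time are
   written "u t x", so that "u t" is the spatial slice u(.,t).  Measurable functions are
   represented by Borel functions: the nonlocal operator evaluates them against a measure
   that may be singular with respect to Lebesgue measure and is not completed. *)

section \<open>Differentiability classes and differential operators\<close>

(* C^k on an open set S, by iterating directional derivatives. *)
primrec Ck_on ::
  "nat \<Rightarrow> 'a::real_normed_vector set \<Rightarrow> ('a \<Rightarrow> 'b::real_normed_vector) \<Rightarrow> bool" where
  "Ck_on 0 S g \<longleftrightarrow> continuous_on S g"
| "Ck_on (Suc k) S g \<longleftrightarrow>
     g differentiable_on S \<and> (\<forall>v. Ck_on k S (\<lambda>x. frechet_derivative g (at x) v))"

definition smooth_on ::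
  "'a::real_normed_vector set \<Rightarrow> ('a \<Rightarrow> 'b::real_normed_vector) \<Rightarrow> bool" where
  "smooth_on S g \<longleftrightarrow> (\<forall>k. Ck_on k S g)"

definition partial :: "'n::finite \<Rightarrow> (real^'n \<Rightarrow> real) \<Rightarrow> real^'n \<Rightarrow> real" where
  "partial j g x = frechet_derivative g (at x) (axis j 1)"

definition grad :: "(real^'n::finite \<Rightarrow> real) \<Rightarrow> real^'n \<Rightarrow> real^'n" where
  "grad g x = (\<chi> j. partial j g x)"

definition divergence :: "(real^'n::finite \<Rightarrow> real^'n) \<Rightarrow> real^'n \<Rightarrow> real" where
  "divergence G x = (\<Sum>j\<in>UNIV. partial j (\<lambda>y. G y $ j) x)"

definition laplacian :: "(real^'n::finite \<Rightarrow> real) \<Rightarrow> real^'n \<Rightarrow> real" where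
  "laplacian g x = (\<Sum>j\<in>UNIV. partial j (partial j g) x)"


section \<open>Periodicity and function spaces on the cell\<close>

definition cell :: "(real^'n::finite) set" where
  "cell = box 0 (\<chi> j. 2 * pi)"

definition periodic :: "(real^'n::finite \<Rightarrow> 'b) \<Rightarrow> bool" where
  "periodic g \<longleftrightarrow> (\<forall>x j. g (x + axis j (2 * pi)) = g x)"

definition L1_norm :: "'a::euclidean_space set \<Rightarrow> ('a \<Rightarrow> real) \<Rightarrow> real" where
  "L1_norm A g = (LINT x:A|lborel. \<bar>g x\<bar>)"

definition ess_bounded_on :: "'a::euclidean_space set \<Rightarrow> ('a \<Rightarrow> real) \<Rightarrow> bool" where
  "ess_bounded_on A g \<longleftrightarrow> (\<exists>M. AE x in lborel. x \<in> A \<longrightarrow> \<bar>g x\<bar> \<le> M)"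

(* BV on a bounded open set A: the variation, i.e. the supremum of the integrals of
   g * div psi over psi in C^1_c(A) with |psi| <= 1, is finite. *)
definition BV_on :: "(real^'n::finite) set \<Rightarrow> (real^'n \<Rightarrow> real) \<Rightarrow> bool" where
  "BV_on A g \<longleftrightarrow> set_integrable lborel A g \<and>
     (\<exists>M. \<forall>\<psi> :: real^'n \<Rightarrow> real^'n.
        Ck_on 1 UNIV \<psi> \<and> closure {x. \<psi> x \<noteq> 0} \<subseteq> A \<and> (\<forall>x. norm (\<psi> x) \<le> 1) \<longrightarrow>
        (LINT x:A|lborel. g x * divergence \<psi> x) \<le> M)"


section \<open>The nonlocal operator\<close>

definition radon_measure_on :: "'a::euclidean_space set \<Rightarrow> 'a measure \<Rightarrow> bool" where
  "radon_measure_on X \<mu> \<longleftrightarrow> sets \<mu> = sets (restrict_space borel X) \<and>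
     (\<forall>K. compact K \<and> K \<subseteq> X \<longrightarrow> emeasure \<mu> K < \<infinity>) \<and>
     (\<forall>A\<in>sets \<mu>. emeasure \<mu> A = (SUP K\<in>{K. compact K \<and> K \<subseteq> A}. emeasure \<mu> K))"

(* The space of mu is the complement of 0, so the domain {|z| <= r} below stands for
   {0 < |z| <= r}. *)
definition levy_measure :: "(real^'n::finite) measure \<Rightarrow> bool" where
  "levy_measure \<mu> \<longleftrightarrow> radon_measure_on (- {0}) \<mu> \<and>
     (\<integral>\<^sup>+ z. ennreal (min ((norm z)\<^sup>2) 1) \<partial>\<mu>) < \<infinity>"

definition levy_op ::
  "(real^'n::finite) measure \<Rightarrow> (real^'n \<Rightarrow> real) \<Rightarrow> real^'n \<Rightarrow> real" where
  "levy_op \<mu> \<phi> x = (LINT z:{z. norm z > 0}|\<mu>.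
     \<phi> (x + z) - \<phi> x - (z \<bullet> grad \<phi> x) * indicator {z. norm z < 1} z)"

definition levy_adj_small ::
  "(real^'n::finite) measure \<Rightarrow> real \<Rightarrow> (real^'n \<Rightarrow> real) \<Rightarrow> real^'n \<Rightarrow> real" where
  "levy_adj_small \<mu> r \<phi> x = (LINT z:{z. norm z \<le> r}|\<mu>.
     \<phi> (x - z) - \<phi> x + (z \<bullet> grad \<phi> x) * indicator {z. norm z < 1} z)"

definition levy_large ::
  "(real^'n::finite) measure \<Rightarrow> real \<Rightarrow> (real^'n \<Rightarrow> real) \<Rightarrow> real^'n \<Rightarrow> real" where
  "levy_large \<mu> r \<phi> x = (LINT z:{z. norm z > r}|\<mu>. \<phi> (x + z) - \<phi> x)"

definition levy_drift :: "(real^'n::finite) measure \<Rightarrow> real \<Rightarrow> real^'n" where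
  "levy_drift \<mu> r = (LINT z:{z. r < norm z \<and> norm z < 1}|\<mu>. z)"


section \<open>Entropy solutions\<close>

definition eta :: "real \<Rightarrow> real \<Rightarrow> real" where
  "eta u k = \<bar>u - k\<bar>"

definition eta' :: "real \<Rightarrow> real \<Rightarrow> real" where
  "eta' u k = sgn (u - k)"

definition entropy_flux :: "(real \<Rightarrow> real^'n::finite) \<Rightarrow> real \<Rightarrow> real \<Rightarrow> real^'n" where
  "entropy_flux f u k = (\<chi> j. eta' u k * (f u $ j - f k $ j))"

definition test_function :: "real \<Rightarrow> (real \<Rightarrow> real^'n::finite \<Rightarrow> real) \<Rightarrow> bool" where
  "test_function T \<phi> \<longleftrightarrow>
     smooth_on ({0<..<T} \<times> UNIV) (\<lambda>(t, x). \<phi> t x) \<and>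
     (\<forall>t\<in>{0<..<T}. periodic (\<phi> t)) \<and>
     (\<forall>t\<in>{0<..<T}. \<forall>x. \<phi> t x \<ge> 0) \<and>
     (\<exists>a b. 0 < a \<and> a < b \<and> b < T \<and> (\<forall>t\<in>{0<..<T} - {a..b}. \<forall>x. \<phi> t x = 0))"

definition C_time_L1 :: "real \<Rightarrow> (real \<Rightarrow> real^'n::finite \<Rightarrow> real) \<Rightarrow> bool" where
  "C_time_L1 T u \<longleftrightarrow>
     (\<forall>t\<in>{0..T}. set_integrable lborel cell (u t)) \<and>
     (\<forall>t\<in>{0..T}. ((\<lambda>s. L1_norm cell (\<lambda>x. u s x - u t x)) \<longlongrightarrow> 0) (at t within {0..T}))"

(* The last conjunct is the essential limit of the L^1 distance to the datum as t -> 0. *)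
definition entropy_solution ::
  "real \<Rightarrow> (real^'n::finite) measure \<Rightarrow> (real \<Rightarrow> real^'n) \<Rightarrow> (real^'n \<Rightarrow> real) \<Rightarrow>
   (real \<Rightarrow> real^'n \<Rightarrow> real) \<Rightarrow> bool" where
  "entropy_solution T \<mu> f u0 u \<longleftrightarrow>
     set_borel_measurable borel ({0..T} \<times> UNIV) (\<lambda>(t, x). u t x) \<and>
     (\<forall>t\<in>{0..T}. periodic (u t)) \<and>
     ess_bounded_on ({0<..<T} \<times> cell) (\<lambda>(t, x). u t x) \<and>
     C_time_L1 T u \<and>
     (\<forall>k r \<phi>. r > 0 \<and> test_function T \<phi> \<longrightarrow>
        (LINT (t, x):{0<..<T} \<times> cell|lborel.
             eta (u t x) k * deriv (\<lambda>s. \<phi> s x) t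
           + entropy_flux f (u t x) k \<bullet> grad (\<phi> t) x
           + eta (u t x) k * levy_adj_small \<mu> r (\<phi> t) x
           + eta' (u t x) k * levy_large \<mu> r (u t) x * \<phi> t x
           + eta (u t x) k * (levy_drift \<mu> r \<bullet> grad (\<phi> t) x)) \<ge> 0) \<and>
     (\<forall>e>0. \<exists>\<tau>>0. AE t in lborel. 0 < t \<and> t < \<tau> \<longrightarrow> L1_norm cell (\<lambda>x. u t x - u0 x) < e)"


section \<open>The viscous problem\<close>

(* Classical regularity is C^1 in time and C^2 in space for 0 < t < T.  The datum is only
   bounded and of bounded variation, so it is attained in L^1. *)
definition viscous_solution ::
  "real \<Rightarrow> (real^'n::finite) measure \<Rightarrow> (real \<Rightarrow> real^'n) \<Rightarrow> (real^'n \<Rightarrow> real) \<Rightarrow>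
   real \<Rightarrow> (real \<Rightarrow> real^'n \<Rightarrow> real) \<Rightarrow> bool" where
  "viscous_solution T \<mu> f u0 \<epsilon> v \<longleftrightarrow>
     Ck_on 1 ({0<..<T} \<times> UNIV) (\<lambda>(t, x). v t x) \<and>
     (\<forall>t\<in>{0<..<T}. Ck_on 2 UNIV (v t)) \<and>
     (\<forall>i j. continuous_on ({0<..<T} \<times> UNIV) (\<lambda>(t, x). partial i (partial j (v t)) x)) \<and>
     (\<forall>t\<in>{0<..<T}. periodic (v t)) \<and>
     (\<forall>t\<in>{0<..<T}. \<forall>x\<in>cell.
        deriv (\<lambda>s. v s x) t + divergence (\<lambda>y. f (v t y)) x
          = levy_op \<mu> (v t) x + \<epsilon> * laplacian (v t) x) \<and>
     (AE x in lborel. x \<in> cell \<longrightarrow> v 0 x = u0 x) \<and>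
     ((\<lambda>t. L1_norm cell (\<lambda>x. v t x - u0 x)) \<longlongrightarrow> 0) (at_right 0)"

end

theory Submission
  imports Defs
begin

text \<open>
The proof is Kuznetsov's doubling of variables. Let \<open>K\<close> be a nonnegative trigonometric kernel of mass one on the
torus that is concentrated at scale \<open>1 / sqrt n\<close>, let \<open>v\<close> be the viscous solution, and put
\<open>F t s = \<integral>\<integral> K (x - y) * \<bar>u t x - v s y\<bar>\<close>. The entropy inequality for \<open>u\<close> with the constant \<open>v s y\<close> and the test
function \<open>g t * K (x - y)\<close>, integrated over \<open>y\<close>, bounds the growth of \<open>F\<close> in \<open>t\<close> (\<open>doubled_entropy_inequality\<close>).
The equation for \<open>v\<close> holds classically, so the derivative \<open>B\<close> of \<open>F\<close> in \<open>s\<close> is explicit (\<open>viscous_step\<close>) and Kruzkov's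
argument bounds it (\<open>kruzkov_pair\<close>). In the sum of the two bounds the fluxes and the drifts cancel. The part of the
nonlocal operator with \<open>\<bar>z\<bar> > r\<close> contributes a nonpositive term, because moving \<open>x\<close> and \<open>y\<close> by the same \<open>z\<close> leaves
\<open>K (x - y)\<close> alone (\<open>levy_large_doubled_le\<close>), and the part with \<open>\<bar>z\<bar> \<le> r\<close> disappears as \<open>r\<close> tends to 0. What remains
is \<open>\<epsilon> * \<integral>\<integral> (laplacian K) (x - y) * \<bar>u t x - v s y\<bar>\<close> (\<open>pair_production_le\<close>).

This remainder sees only the translations of \<open>v\<close>: second derivatives of \<open>K\<close> have mean zero, so \<open>v s y\<close> may be
exchanged for \<open>v s x\<close>, at the price of a translation of \<open>v\<close> (\<open>kernel_comparison\<close>). If translations by \<open>h\<close> cost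
at most \<open>C * (\<Sum>j. \<bar>sin (h j / 2)\<bar>)\<close> in \<open>L1\<close>, the remainder is of order \<open>\<epsilon> * sqrt n\<close>. In the same way \<open>F t t\<close> differs
from the \<open>L1\<close> distance of \<open>u t\<close> and \<open>v t\<close> by \<open>O (1 / sqrt n)\<close> (\<open>F_diagonal\<close>). Hence the distance grows by at most
\<open>O (1 / sqrt n + \<epsilon> * sqrt n)\<close> from a time near 0, where it is arbitrarily small, and \<open>n\<close> of the size of \<open>1 / \<epsilon>\<close> gives
the rate. For \<open>\<epsilon> > 1\<close> the trivial bound of the distance is enough.

Three further facts are used. Viscous flows contract in \<open>L1\<close> (\<open>viscous_flow_contraction\<close>); applied to \<open>v\<close> and to a
translate of \<open>v\<close>, this reduces the translation bound to the datum, where it follows from bounded variation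
(\<open>BV_translation_torus\<close>). The sum of the \<open>\<bar>sin (h j / 2)\<bar>\<close> replaces \<open>\<bar>h\<bar>\<close> because it is periodic and
because the moments of the kernel against it follow from the Wallis recursion. Finally, \<open>F\<close> need not be differentiable
on the diagonal; \<open>diagonal_estimate\<close> smooths both time variables with the same bump, along which the two derivatives
add up.
\<close>

section \<open>Calculus of differentiability classes\<close>

lemma Ck_on_cong:
  assumes "open S" and "\<And>x. x \<in> S \<Longrightarrow> f x = g x" and "Ck_on k S f"
  shows "Ck_on k S g"
  using assms(2,3)
proof (induction k arbitrary: f g)
  case 0
  then show ?case by (simp cong: continuous_on_cong)
next
  case (Suc k)
  have diff: "g differentiable_on S"
    using Suc.prems by (simp add: differentiable_on_def differentiable_def)
      (metis has_derivative_transform)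
  have eq: "frechet_derivative f (at x) = frechet_derivative g (at x)" if "x \<in> S" for x
  proof (rule frechet_derivative_transform_within_open[OF _ assms(1) that])
    show "f differentiable at x"
      using Suc.prems(2) assms(1) that by (simp add: differentiable_on_eq_differentiable_at)
  qed (use Suc.prems in auto)
  have "Ck_on k S (\<lambda>x. frechet_derivative g (at x) v)" for v
    by (rule Suc.IH[of "\<lambda>x. frechet_derivative f (at x) v"]) (use eq Suc.prems in auto)
  with diff show ?case by simp
qed

text \<open>Derivatives only have to be supplied as a formula; this is how membership in \<open>Ck_on\<close> is proved by induction.\<close>
lemma Ck_on_SucI:
  assumes "open S" and "\<And>x. x \<in> S \<Longrightarrow> (f has_derivative f' x) (at x)"
    and "\<And>v. Ck_on k S (\<lambda>x. f' x v)"
  shows "Ck_on (Suc k) S f"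
proof -
  have "f differentiable_on S"
    using assms(1,2) by (meson differentiable_on_eq_differentiable_at differentiable_def)
  moreover have "Ck_on k S (\<lambda>x. frechet_derivative f (at x) v)" for v
    by (rule Ck_on_cong[OF assms(1) _ assms(3)[of v]])
       (use assms(2) frechet_derivative_at in metis)
  ultimately show ?thesis by simp
qed

lemma Ck_on_SucD:
  assumes "Ck_on (Suc k) S f" "open S" "x \<in> S"
  shows "(f has_derivative frechet_derivative f (at x)) (at x)"
  using assms by (auto simp: differentiable_on_eq_differentiable_at frechet_derivative_works)

lemma Ck_on_decrease:
  assumes "Ck_on (Suc k) S f" shows "Ck_on k S f"
  using assms
proof (induction k arbitrary: f)
  case 0
  then show ?case by (simp add: differentiable_imp_continuous_on)
next
  case (Suc k)
  then show ?case by simp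
qed

lemma Ck_on_le:
  assumes "Ck_on m S f" "k \<le> m" shows "Ck_on k S f"
  using assms(2,1) by (induction rule: dec_induct) (auto intro: Ck_on_decrease simp del: Ck_on.simps)

lemma Ck_on_const: "open S \<Longrightarrow> Ck_on k S (\<lambda>x. c)"
proof (induction k arbitrary: c)
  case (Suc k)
  show ?case
    by (rule Ck_on_SucI[where f'="\<lambda>_ _. 0"]) (use Suc in auto)
qed simp

lemma Ck_on_add:
  assumes "open S" "Ck_on k S f" "Ck_on k S g"
  shows "Ck_on k S (\<lambda>x. f x + g x)"
  using assms(2,3)
proof (induction k arbitrary: f g)
  case (Suc k)
  show ?case
    by (rule Ck_on_SucI[where f'="\<lambda>x v. frechet_derivative f (at x) v + frechet_derivative g (at x) v"])
       (use Suc assms(1) in \<open>auto intro!: has_derivative_add Ck_on_SucD simp del: Ck_on.simps\<close>,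
        use Suc in auto)
qed (auto intro: continuous_on_add)

lemma Ck_on_mult:
  fixes f g :: "_ \<Rightarrow> real"
  assumes "open S" "Ck_on k S f" "Ck_on k S g"
  shows "Ck_on k S (\<lambda>x. f x * g x)"
  using assms(2,3)
proof (induction k arbitrary: f g)
  case (Suc k)
  show ?case
  proof (rule Ck_on_SucI[where f'="\<lambda>x v. f x * frechet_derivative g (at x) v + frechet_derivative f (at x) v * g x"])
    fix v
    have "Ck_on k S f" "Ck_on k S g" using Suc.prems Ck_on_decrease by blast+
    then show "Ck_on k S (\<lambda>x. f x * frechet_derivative g (at x) v + frechet_derivative f (at x) v * g x)"
      using Suc by (intro Ck_on_add[OF assms(1)] Suc.IH) auto
  qed (use Suc.prems assms(1) in \<open>auto intro!: has_derivative_mult Ck_on_SucD simp del: Ck_on.simps\<close>)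
qed (auto intro: continuous_on_mult)

lemma Ck_on_power:
  fixes f :: "_ \<Rightarrow> real"
  assumes "open S" "Ck_on k S f"
  shows "Ck_on k S (\<lambda>x. f x ^ n)"
  by (induction n) (auto intro: Ck_on_const Ck_on_mult assms)

lemma Ck_on_prod:
  fixes f :: "'i \<Rightarrow> _ \<Rightarrow> real"
  assumes "open S" "\<And>i. i \<in> I \<Longrightarrow> Ck_on k S (f i)"
  shows "Ck_on k S (\<lambda>x. \<Prod>i\<in>I. f i x)"
  using assms(2)
  by (induction I rule: infinite_finite_induct) (auto intro: Ck_on_const Ck_on_mult assms(1))

lemma Ck_on_divide:
  fixes f g :: "_ \<Rightarrow> real"
  assumes "open S" "Ck_on k S f" "Ck_on k S g" "\<And>x. x \<in> S \<Longrightarrow> g x \<noteq> 0"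
  shows "Ck_on k S (\<lambda>x. f x / g x)"
proof -
  have "Ck_on k S (\<lambda>x. inverse (g x))"
    using assms(3)
  proof (induction k)
    case 0
    then show ?case using assms(4) by (auto intro: continuous_on_inverse)
  next
    case (Suc k)
    show ?case
    proof (rule Ck_on_SucI[where f'="\<lambda>x v. - 1 * (inverse (g x) * frechet_derivative g (at x) v * inverse (g x))"])
      show "((\<lambda>x. inverse (g x)) has_derivative
          (\<lambda>v. - 1 * (inverse (g x) * frechet_derivative g (at x) v * inverse (g x)))) (at x)"
        if "x \<in> S" for x
        using Ck_on_SucD[OF Suc.prems assms(1) that] assms(4)[OF that] has_derivative_inverse
        by fastforce
      fix v
      have "Ck_on k S (\<lambda>x. inverse (g x))" using Suc Ck_on_decrease by blast
      then show "Ck_on k S (\<lambda>x. - 1 * (inverse (g x) * frechet_derivative g (at x) v * inverse (g x)))"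
        using Suc by (intro Ck_on_mult[OF assms(1)] Ck_on_const[OF assms(1)]) auto
    qed (use assms in auto)
  qed
  then show ?thesis unfolding divide_inverse by (intro Ck_on_mult assms)
qed

lemma Ck_on_affine:
  assumes "open S" "bounded_linear l" "Ck_on k UNIV h"
  shows "Ck_on k S (\<lambda>x. h (l x + c))"
  using assms(3)
proof (induction k arbitrary: h)
  case 0
  have "continuous_on S (\<lambda>x. l x + c)"
    by (intro continuous_intros linear_continuous_on assms(2))
  with 0 show ?case
    using continuous_on_compose2[of UNIV h S "\<lambda>x. l x + c"] by auto
next
  case (Suc k)
  show ?case
  proof (rule Ck_on_SucI[where f'="\<lambda>x v. frechet_derivative h (at (l x + c)) (l v)"])
    fix x assume "x \<in> S"
    have "((\<lambda>x. l x + c) has_derivative l) (at x)"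
      by (rule derivative_eq_intros bounded_linear_imp_has_derivative[OF assms(2)] | simp)+
    then show "((\<lambda>x. h (l x + c)) has_derivative (\<lambda>v. frechet_derivative h (at (l x + c)) (l v))) (at x)"
      by (rule has_derivative_compose[OF _ Ck_on_SucD[OF Suc.prems]]) auto
  qed (use assms Suc in auto)
qed

lemma Ck_on_cos:
  fixes l :: "'a::real_normed_vector \<Rightarrow> real"
  assumes "open S" "bounded_linear l"
  shows "Ck_on k S (\<lambda>x. cos (l x + c))"
proof -
  have "Ck_on k UNIV (\<lambda>x::real. cos (x + c))" for c
  proof (induction k arbitrary: c)
    case 0 then show ?case by (auto intro!: continuous_intros)
  next
    case (Suc k)
    show ?case
    proof (rule Ck_on_SucI[where f'="\<lambda>x v. cos (x + (c + pi/2)) * v"])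
      show "((\<lambda>x. cos (x + c)) has_derivative (\<lambda>v. cos (x + (c + pi/2)) * v)) (at x)" for x
        by (rule derivative_eq_intros refl | simp add: cos_add sin_add algebra_simps)+
      show "Ck_on k UNIV (\<lambda>x. cos (x + (c + pi/2)) * v)" for v
        by (intro Ck_on_mult Suc Ck_on_const) auto
    qed auto
  qed
  from Ck_on_affine[OF assms this[of 0], of c] show ?thesis by simp
qed

section \<open>A smooth step\<close>

text \<open>The functions \<open>exp (- 1 / x) / x ^ m\<close>, extended by 0, are closed under differentiation up to linear combination.
Their family therefore carries the induction that proves \<open>flat_exp 0\<close> smooth.\<close>
definition flat_exp :: "nat \<Rightarrow> real \<Rightarrow> real" where
  "flat_exp m x = (if x \<le> 0 then 0 else exp (- 1 / x) / x ^ m)"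

lemma flat_exp_nonneg: "flat_exp m x \<ge> 0"
  by (simp add: flat_exp_def)

lemma flat_exp_deriv:
  "(flat_exp m has_real_derivative flat_exp (m + 2) x - of_nat m * flat_exp (m + 1) x) (at x)"
proof -
  consider "x < 0" | "x = 0" | "x > 0" by linarith
  then show ?thesis
  proof cases
    case 1
    have "((\<lambda>_. 0) has_real_derivative flat_exp (m + 2) x - of_nat m * flat_exp (m + 1) x) (at x)"
      using 1 by (auto simp: flat_exp_def)
    then show ?thesis
      by (rule DERIV_cong_ev[THEN iffD1, rotated -1])
         (use 1 in \<open>auto simp: flat_exp_def eventually_at_topological intro!: exI[of _ "{..<0}"]
            simp: eventually_nhds\<close>)
  next
    case 3
    have "((\<lambda>x. exp (- 1 / x) / x ^ m) has_real_derivative flat_exp (m + 2) x - of_nat m * flat_exp (m + 1) x) (at x)"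
      using 3
      apply (auto simp: flat_exp_def intro!: derivative_eq_intros)
      apply (cases m)
       apply (auto simp: field_simps power2_eq_square)
      done
    then show ?thesis
      by (rule DERIV_cong_ev[THEN iffD1, rotated -1])
         (use 3 in \<open>auto simp: flat_exp_def eventually_nhds intro!: exI[of _ "{0<..}"]\<close>)
  next
    case 2
    have "((\<lambda>h. flat_exp m h / h) \<longlongrightarrow> 0) (at 0)"
    proof (rule filterlim_split_at)
      show "((\<lambda>h. flat_exp m h / h) \<longlongrightarrow> 0) (at_left 0)"
        by (rule tendsto_eventually)
           (auto simp: flat_exp_def eventually_at_filter intro!: always_eventually)
      have "((\<lambda>y::real. y ^ (m + 1) / exp y) \<longlongrightarrow> 0) at_top"
        by (rule tendsto_power_div_exp_0)
      then have "((\<lambda>h. (inverse h) ^ (m + 1) / exp (inverse h)) \<longlongrightarrow> 0) (at_right (0::real))"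
        by (rule filterlim_compose) (rule filterlim_inverse_at_top_right)
      then show "((\<lambda>h. flat_exp m h / h) \<longlongrightarrow> 0) (at_right 0)"
        by (rule Lim_transform_eventually)
           (auto simp: flat_exp_def eventually_at_filter exp_minus field_simps intro!: always_eventually)
    qed
    then show ?thesis
      using 2 unfolding DERIV_def by (simp add: flat_exp_def)
  qed
qed

lemma Ck_on_flat_exp: "Ck_on k UNIV (flat_exp m)"
proof (induction k arbitrary: m)
  case 0
  show ?case
    using flat_exp_deriv by (auto intro!: continuous_at_imp_continuous_on DERIV_isCont)
next
  case (Suc k)
  show ?case
  proof (rule Ck_on_SucI[where f'="\<lambda>x v. (flat_exp (m + 2) x + (- of_nat m) * flat_exp (m + 1) x) * v"])
    show "(flat_exp m has_derivative (\<lambda>v. (flat_exp (m + 2) x + (- of_nat m) * flat_exp (m + 1) x) * v)) (at x)" for x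
      using flat_exp_deriv[of m x] by (simp add: has_field_derivative_def)
    show "Ck_on k UNIV (\<lambda>x. (flat_exp (m + 2) x + (- of_nat m) * flat_exp (m + 1) x) * v)" for v
      by (intro Ck_on_mult Ck_on_add Ck_on_const Suc) auto
  qed auto
qed

definition smooth_step :: "real \<Rightarrow> real" where
  "smooth_step x = flat_exp 0 x / (flat_exp 0 x + flat_exp 0 (1 - x))"

text \<open>The derivative of \<open>smooth_step\<close>, written so that its sign is visible.\<close>
definition smooth_step' :: "real \<Rightarrow> real" where
  "smooth_step' x = (flat_exp 2 x * flat_exp 0 (1 - x) + flat_exp 0 x * flat_exp 2 (1 - x))
     / (flat_exp 0 x + flat_exp 0 (1 - x))\<^sup>2"

lemma flat_exp_sum_pos: "flat_exp 0 x + flat_exp 0 (1 - x) > 0"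
  by (cases "x \<le> 0"; cases "x \<ge> 1") (auto simp: flat_exp_def add_pos_pos)

lemma smooth_step_eq_0: "x \<le> 0 \<Longrightarrow> smooth_step x = 0"
  and smooth_step_eq_1: "x \<ge> 1 \<Longrightarrow> smooth_step x = 1"
  by (auto simp: smooth_step_def flat_exp_def)

lemma smooth_step_range: "0 \<le> smooth_step x" "smooth_step x \<le> 1"
  using flat_exp_nonneg[of 0 x] flat_exp_nonneg[of 0 "1-x"] flat_exp_sum_pos[of x]
  by (auto simp: smooth_step_def field_simps)

lemma smooth_step'_nonneg: "smooth_step' x \<ge> 0"
  by (simp add: smooth_step'_def flat_exp_nonneg)

lemma smooth_step'_eq_0: "x \<le> 0 \<or> x \<ge> 1 \<Longrightarrow> smooth_step' x = 0"
  by (auto simp: smooth_step'_def flat_exp_def)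

lemma smooth_step_deriv: "(smooth_step has_real_derivative smooth_step' x) (at x)"
proof -
  have 1: "((\<lambda>x. flat_exp 0 (1 - x)) has_real_derivative - flat_exp 2 (1 - x)) (at x)"
  proof -
    have "((\<lambda>x. 1 - x) has_real_derivative - 1) (at x)"
      by (auto intro!: derivative_eq_intros)
    from DERIV_chain2[OF flat_exp_deriv[of 0 "1 - x"] this] show ?thesis
      by (simp add: numeral_2_eq_2)
  qed
  have 2: "(flat_exp 0 has_real_derivative flat_exp 2 x) (at x)"
    using flat_exp_deriv[of 0 x] by (simp add: numeral_2_eq_2)
  have 3: "flat_exp 0 x + flat_exp 0 (1 - x) \<noteq> 0" using flat_exp_sum_pos[of x] by simp
  show ?thesis
    unfolding smooth_step_def[abs_def]
    by (rule DERIV_cong[OF DERIV_divide[OF 2 DERIV_add[OF 2 1] 3]])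
       (simp add: smooth_step'_def power2_eq_square algebra_simps)
qed

lemma Ck_on_smooth_step: "Ck_on k UNIV smooth_step"
  unfolding smooth_step_def[abs_def]
proof (intro Ck_on_divide Ck_on_add Ck_on_flat_exp)
  show "Ck_on k UNIV (\<lambda>x. flat_exp 0 (1 - x))"
    using Ck_on_affine[of UNIV "\<lambda>x. - x" k "flat_exp 0" 1] Ck_on_flat_exp
    by (simp add: bounded_linear_minus bounded_linear_ident)
qed (use flat_exp_sum_pos in \<open>auto simp: less_imp_neq[symmetric]\<close>)

lemma continuous_on_smooth_step': "continuous_on A smooth_step'"
proof -
  have c: "continuous_on A (\<lambda>x. flat_exp m (g x))" if "continuous_on A g" for m and g :: "real \<Rightarrow> real"
    using continuous_on_compose2[OF _ that, of UNIV "flat_exp m"] Ck_on_flat_exp[of 0 m] by auto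
  show ?thesis
    unfolding smooth_step'_def[abs_def]
    by (intro continuous_intros c) (use flat_exp_sum_pos in \<open>auto simp: less_imp_neq[symmetric]\<close>)
qed

section \<open>The torus\<close>

text \<open>The torus is the open cell with Lebesgue measure. Functions on it are periodic functions on the whole space, so
that translates and nonlocal operators make sense; the measure is invariant under translation only on such functions.\<close>
definition torus :: "(real^'n::finite) measure" where
  "torus = density lborel (indicator cell)"

lemma sets_torus [simp, measurable_cong]: "sets torus = sets borel"
  and space_torus [simp]: "space torus = UNIV"
  by (simp_all add: torus_def)

lemma cell_borel [measurable]: "cell \<in> sets borel"
  by (simp add: cell_def)

lemma integral_torus:
  fixes g :: "real^'n::finite \<Rightarrow> real"
  assumes [measurable]: "g \<in> borel_measurable borel"
  shows "(LINT x|torus. g x) = (LINT x:cell|lborel. g x)"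
  unfolding torus_def set_lebesgue_integral_def ennreal_indicator[symmetric, abs_def]
  by (subst integral_density) auto

lemma integrable_torus:
  fixes g :: "real^'n::finite \<Rightarrow> real"
  assumes [measurable]: "g \<in> borel_measurable borel"
  shows "integrable torus g \<longleftrightarrow> set_integrable lborel cell g"
  unfolding torus_def set_integrable_def ennreal_indicator[symmetric, abs_def]
  by (subst integrable_density) auto

lemma AE_torus: "(AE x in torus. P x) \<longleftrightarrow> (AE x in lborel. x \<in> cell \<longrightarrow> P x)"
  unfolding torus_def by (subst AE_density) (auto simp: indicator_def)

lemma emeasure_torus: "emeasure (torus :: (real^'n::finite) measure) UNIV = ennreal ((2 * pi) ^ CARD('n))"
proof -
  have "emeasure (torus :: (real^'n) measure) UNIV = emeasure lborel (cell :: (real^'n) set)"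
    unfolding torus_def by (subst emeasure_density) auto
  also have "\<dots> = ennreal ((2 * pi) ^ CARD('n))"
    unfolding cell_def emeasure_lborel_box_eq
    by (auto simp: Basis_vec_def inner_axis prod.UNION_disjoint axis_eq_axis
        simp flip: card_image[of "\<lambda>i. axis i (1::real)" UNIV] intro!: prod.cong)
  finally show ?thesis .
qed

interpretation torus: finite_measure torus
  by standard (simp add: emeasure_torus)

lemma AE_coordinate_neq: "AE x :: real^'n::finite in lborel. x $ j \<noteq> c"
proof -
  have "{x :: real^'n. x $ j = c} = {x. x \<bullet> axis j 1 = c}"
    by (simp add: inner_axis)
  moreover have "negligible {x :: real^'n. x \<bullet> axis j 1 = c}"
    by (rule negligible_standard_hyperplane) (auto simp: Basis_vec_def)
  moreover have "{x :: real^'n. x $ j = c} \<in> sets borel" by measurable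
  ultimately have "{x :: real^'n. x $ j = c} \<in> null_sets lborel"
    by (simp add: negligible_iff_null_sets null_sets_completion_iff)
  from AE_not_in[OF this] show ?thesis by simp
qed

lemma nn_integral_lborel_shift:
  fixes g :: "real^'n::finite \<Rightarrow> ennreal"
  assumes [measurable]: "g \<in> borel_measurable borel"
  shows "(\<integral>\<^sup>+x. g (x + h) \<partial>lborel) = (\<integral>\<^sup>+x. g x \<partial>lborel)"
proof -
  have "(\<integral>\<^sup>+x. g x \<partial>lborel) = (\<integral>\<^sup>+x. g x \<partial>distr lborel borel ((+) h))"
    by (simp add: lborel_distr_plus)
  also have "\<dots> = (\<integral>\<^sup>+x. g (x + h) \<partial>lborel)"
    by (subst nn_integral_distr) (auto simp: add.commute)
  finally show ?thesis by simp
qed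

lemma periodic_axis_int:
  assumes "periodic g"
  shows "g (x + axis j (2 * pi * of_int k)) = g x"
proof -
  have step: "g (x + axis j (2 * pi * real n)) = g x" for n x
  proof (induction n)
    case (Suc n)
    have "x + axis j (2 * pi * real (Suc n)) = (x + axis j (2 * pi * real n)) + axis j (2 * pi)"
      by (simp add: vec_eq_iff axis_def algebra_simps)
    with Suc assms show ?case unfolding periodic_def by metis
  qed (simp add: axis_def vec_eq_iff[symmetric] zero_vec_def[symmetric])
  show ?thesis
  proof (cases "k \<ge> 0")
    case True
    with step[of x "nat k"] show ?thesis by simp
  next
    case False
    have "(x + axis j (2 * pi * of_int k)) + axis j (2 * pi * real (nat (- k))) = x"
      using False by (simp add: vec_eq_iff axis_def)
    with step[of "x + axis j (2 * pi * of_int k)" "nat (- k)"] show ?thesis by simp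
  qed
qed

lemma vec_eq_sum_axis: "(h :: real^'n::finite) = (\<Sum>j\<in>UNIV. axis j (h $ j))"
  by (simp add: vec_eq_iff axis_def if_distrib cong: if_cong)

lemma periodic_lattice:
  assumes "periodic (g :: real^'n::finite \<Rightarrow> 'b)"
  shows "g (x + (\<chi> j. 2 * pi * of_int (k j))) = g x"
proof -
  have "g (x + (\<Sum>j\<in>J. axis j (2 * pi * of_int (k j)))) = g x" if "finite J" for J :: "'n set" and x
    using that
    by (induction J arbitrary: x) (use periodic_axis_int[OF assms] in \<open>auto simp: add.assoc[symmetric]\<close>)
  from this[of UNIV] show ?thesis
    by (subst vec_eq_sum_axis[of "\<chi> j. 2 * pi * of_int (k j)"]) auto
qed

lemma periodic_comp: "periodic g \<Longrightarrow> periodic (\<lambda>x. F (g x))"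
  by (simp add: periodic_def)

lemma periodic_comp2: "periodic g \<Longrightarrow> periodic g' \<Longrightarrow> periodic (\<lambda>x. F (g x) (g' x))"
  by (simp add: periodic_def)

lemma periodic_shift: "periodic g \<Longrightarrow> periodic (\<lambda>x. g (x + h))"
  unfolding periodic_def by (metis add.assoc add.commute)

lemma periodic_shift_diff: "periodic g \<Longrightarrow> periodic (\<lambda>x. g (x - h))"
  using periodic_shift[of g "- h"] by simp

lemma periodic_const: "periodic (\<lambda>x. c)"
  by (simp add: periodic_def)

lemma periodic_reflect:
  fixes g :: "real^'n::finite \<Rightarrow> 'b"
  shows "periodic g \<Longrightarrow> periodic (\<lambda>y. g (x - y))"
proof -
  assume g: "periodic g"
  have "g (x - (y + axis j (2 * pi))) = g (x - y)" for y and j :: 'n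
  proof -
    have "x - (y + axis j (2 * pi)) + axis j (2 * pi) = x - y" by simp
    with g show ?thesis unfolding periodic_def by metis
  qed
  then show ?thesis unfolding periodic_def by blast
qed

text \<open>A translation along one axis moves a slab of the cell across the opposite face, and periodicity moves it back.\<close>
lemma nn_integral_torus_shift_axis:
  fixes g :: "real^'n::finite \<Rightarrow> ennreal"
  assumes [measurable]: "g \<in> borel_measurable borel" and per: "periodic g"
  shows "(\<integral>\<^sup>+x. g (x + axis j \<tau>) \<partial>torus) = (\<integral>\<^sup>+x. g x \<partial>torus)"
proof -
  define S :: "real \<Rightarrow> real \<Rightarrow> (real^'n) set" where
    "S a b = {x. (\<forall>i. i \<noteq> j \<longrightarrow> 0 \<le> x $ i \<and> x $ i < 2 * pi) \<and> a \<le> x $ j \<and> x $ j < b}" for a b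
  have [measurable]: "S a b \<in> sets borel" for a b
    unfolding S_def by measurable
  define I where "I a b = (\<integral>\<^sup>+x. indicator (S a b) x * g x \<partial>lborel)" for a b
  have torus: "(\<integral>\<^sup>+x. G x \<partial>torus) = (\<integral>\<^sup>+x. indicator (S 0 (2 * pi)) x * G x \<partial>lborel)"
    if [measurable]: "G \<in> borel_measurable borel" for G :: "real^'n \<Rightarrow> ennreal"
  proof -
    have "(\<integral>\<^sup>+x. G x \<partial>torus) = (\<integral>\<^sup>+x. indicator cell x * G x \<partial>lborel)"
      unfolding torus_def by (subst nn_integral_density) auto
    also have "\<dots> = (\<integral>\<^sup>+x. indicator (S 0 (2 * pi)) x * G x \<partial>lborel)"
    proof (rule nn_integral_cong_AE)
      have "AE x in lborel. \<forall>i\<in>(UNIV::'n set). (x :: real^'n) $ i \<noteq> 0"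
        by (subst AE_finite_all) (auto intro: AE_coordinate_neq)
      then show "AE x in lborel. indicator cell x * G x = indicator (S 0 (2 * pi)) x * G x"
      proof eventually_elim
        case (elim x)
        have "x \<in> cell \<longleftrightarrow> (\<forall>i. 0 < x $ i \<and> x $ i < 2 * pi)"
          by (simp add: cell_def mem_box_cart)
        also have "\<dots> \<longleftrightarrow> (\<forall>i. 0 \<le> x $ i \<and> x $ i < 2 * pi)"
          using elim by (auto simp: less_le)
        also have "\<dots> \<longleftrightarrow> x \<in> S 0 (2 * pi)" unfolding S_def by auto
        finally have "x \<in> cell \<longleftrightarrow> x \<in> S 0 (2 * pi)" .
        then show ?case by (simp add: indicator_def)
      qed
    qed
    finally show ?thesis .
  qed
  have split: "I a b = I a m + I m b" if "a \<le> m" "m \<le> b" for a m b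
    unfolding I_def
    by (subst nn_integral_add[symmetric])
       (use that in \<open>auto intro!: nn_integral_cong simp: S_def indicator_def\<close>)
  have shift: "(\<integral>\<^sup>+x. indicator (S a b) x * g (x + axis j t) \<partial>lborel) = I (a + t) (b + t)" for a b t
  proof -
    have "indicator (S a b) x = (indicator (S (a + t) (b + t)) (x + axis j t) :: ennreal)" for x
      by (auto simp: S_def indicator_def axis_def)
    then show ?thesis
      unfolding I_def using nn_integral_lborel_shift[of "\<lambda>x. indicator (S (a + t) (b + t)) x * g x" "axis j t"]
      by simp
  qed
  have per2: "I a b = I (a + 2 * pi) (b + 2 * pi)" for a b
    using shift[of a b "2 * pi"] per by (simp add: I_def periodic_def)
  define k where "k = \<lfloor>\<tau> / (2 * pi)\<rfloor>"
  define t where "t = \<tau> - 2 * pi * of_int k"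
  have t: "0 \<le> t" "t < 2 * pi"
    using floor_correct[of "\<tau> / (2 * pi)"] unfolding t_def k_def[symmetric] by (simp_all add: field_simps)
  have "(\<integral>\<^sup>+x. g (x + axis j \<tau>) \<partial>torus) = (\<integral>\<^sup>+x. g (x + axis j t) \<partial>torus)"
  proof (rule nn_integral_cong)
    fix x
    have "x + axis j \<tau> = (x + axis j t) + axis j (2 * pi * of_int k)"
      by (simp add: t_def vec_eq_iff axis_def)
    then show "g (x + axis j \<tau>) = g (x + axis j t)" using periodic_axis_int[OF per] by metis
  qed
  also have "\<dots> = I t (2 * pi + t)"
    using shift[of 0 "2 * pi" t] by (subst torus) auto
  also have "\<dots> = I t (2 * pi) + I 0 t"
    using t split[of t "2 * pi" "2 * pi + t"] per2[of 0 t] by (simp add: add.commute)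
  also have "\<dots> = I 0 (2 * pi)" using t split[of 0 t "2 * pi"] by (simp add: add.commute)
  also have "\<dots> = (\<integral>\<^sup>+x. g x \<partial>torus)" by (subst torus) (auto simp: I_def)
  finally show ?thesis .
qed

lemma nn_integral_torus_shift:
  fixes g :: "real^'n::finite \<Rightarrow> ennreal"
  assumes [measurable]: "g \<in> borel_measurable borel" and per: "periodic g"
  shows "(\<integral>\<^sup>+x. g (x + h) \<partial>torus) = (\<integral>\<^sup>+x. g x \<partial>torus)"
proof -
  have "(\<integral>\<^sup>+x. g (x + (\<Sum>j\<in>J. axis j (h $ j))) \<partial>torus) = (\<integral>\<^sup>+x. g x \<partial>torus)"
    if "finite J" for J :: "'n set"
    using that
  proof (induction J)
    case (insert j J)
    have "(\<integral>\<^sup>+x. g (x + (\<Sum>j\<in>insert j J. axis j (h $ j))) \<partial>torus)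
        = (\<integral>\<^sup>+x. g ((x + axis j (h $ j)) + (\<Sum>j\<in>J. axis j (h $ j))) \<partial>torus)"
      using insert by (simp add: add.assoc)
    also have "\<dots> = (\<integral>\<^sup>+x. g (x + (\<Sum>j\<in>J. axis j (h $ j))) \<partial>torus)"
      by (rule nn_integral_torus_shift_axis[of "\<lambda>x. g (x + (\<Sum>j\<in>J. axis j (h $ j)))"])
         (auto intro: periodic_shift per)
    finally show ?case using insert by simp
  qed simp
  from this[of UNIV] show ?thesis using vec_eq_sum_axis[of h] by simp
qed

lemma AE_torus_shift:
  fixes P :: "real^'n::finite \<Rightarrow> bool"
  assumes "AE x in torus. P x" and per: "periodic P" and [measurable]: "Measurable.pred borel P"
  shows "AE x in torus. P (x + h)"
proof -
  define g :: "real^'n \<Rightarrow> ennreal" where "g x = (if P x then 0 else 1)" for x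
  have [measurable]: "g \<in> borel_measurable borel" unfolding g_def by measurable
  have "periodic g" unfolding g_def by (rule periodic_comp[OF per])
  then have "(\<integral>\<^sup>+x. g (x + h) \<partial>torus) = (\<integral>\<^sup>+x. g x \<partial>torus)"
    by (rule nn_integral_torus_shift[rotated]) measurable
  also have "\<dots> = (\<integral>\<^sup>+x. 0 \<partial>(torus :: (real^'n) measure))"
    using assms(1) by (intro nn_integral_cong_AE) (auto simp: g_def)
  finally have "AE x in torus. g (x + h) = 0"
    by (simp add: nn_integral_0_iff_AE)
  then show ?thesis by (rule AE_mp) (auto simp: g_def split: if_splits)
qed

lemma integral_torus_shift:
  fixes g :: "real^'n::finite \<Rightarrow> real"
  assumes [measurable]: "g \<in> borel_measurable borel" and per: "periodic g"
  shows "integrable torus (\<lambda>x. g (x + h)) \<longleftrightarrow> integrable torus g" (is ?th1)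
    and "(LINT x|torus. g (x + h)) = (LINT x|torus. g x)" (is ?th2)
proof -
  have 1: "(\<integral>\<^sup>+x. ennreal (norm (g (x + h))) \<partial>torus) = (\<integral>\<^sup>+x. ennreal (norm (g x)) \<partial>torus)"
    by (rule nn_integral_torus_shift[of "\<lambda>x. ennreal (norm (g x))"]) (auto intro: periodic_comp[OF per])
  then show i: ?th1 by (simp add: integrable_iff_bounded)
  have 2: "(\<integral>\<^sup>+x. ennreal (g (x + h)) \<partial>torus) = (\<integral>\<^sup>+x. ennreal (g x) \<partial>torus)"
    by (rule nn_integral_torus_shift[of "\<lambda>x. ennreal (g x)"]) (auto intro: periodic_comp[OF per])
  have 3: "(\<integral>\<^sup>+x. ennreal (- g (x + h)) \<partial>torus) = (\<integral>\<^sup>+x. ennreal (- g x) \<partial>torus)"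
    by (rule nn_integral_torus_shift[of "\<lambda>x. ennreal (- g x)"]) (auto intro: periodic_comp[OF per])
  show ?th2
  proof (cases "integrable torus g")
    case True
    with i have "integrable torus (\<lambda>x. g (x + h))" by simp
    from real_lebesgue_integral_def[OF this] real_lebesgue_integral_def[OF True] 2 3 show ?thesis by simp
  next
    case False
    with i show ?thesis by (simp add: not_integrable_integral_eq)
  qed
qed

section \<open>Differential calculus on the torus\<close>

lemma partial_eq:
  assumes "(g has_derivative g') (at x)" shows "partial j g x = g' (axis j 1)"
  using frechet_derivative_at[OF assms] by (simp add: partial_def)

lemma has_derivative_partials:
  fixes g :: "real^'n::finite \<Rightarrow> real"
  assumes "g differentiable (at x)"
  shows "(g has_derivative (\<lambda>v. \<Sum>j\<in>UNIV. v $ j * partial j g x)) (at x)"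
proof -
  have d: "(g has_derivative frechet_derivative g (at x)) (at x)"
    using assms frechet_derivative_works by blast
  interpret bounded_linear "frechet_derivative g (at x)"
    using d has_derivative_bounded_linear by blast
  have "frechet_derivative g (at x) v = (\<Sum>j\<in>UNIV. v $ j * partial j g x)" for v
  proof -
    have "frechet_derivative g (at x) v = frechet_derivative g (at x) (\<Sum>j\<in>UNIV. v $ j *\<^sub>R axis j 1)"
      using basis_expansion[of v] by (simp add: scalar_mult_eq_scaleR)
    also have "\<dots> = (\<Sum>j\<in>UNIV. v $ j * partial j g x)"
      by (simp add: sum scaleR partial_def)
    finally show ?thesis .
  qed
  then have "frechet_derivative g (at x) = (\<lambda>v. \<Sum>j\<in>UNIV. v $ j * partial j g x)" by (rule ext)
  with d show ?thesis by simp
qed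

lemma inner_grad: "z \<bullet> grad g x = (\<Sum>j\<in>UNIV. z $ j * partial j g x)"
  by (simp add: grad_def inner_vec_def)

lemma DERIV_along_line:
  fixes g :: "real^'n::finite \<Rightarrow> real"
  assumes "g differentiable (at (x + \<tau> *\<^sub>R z))"
  shows "((\<lambda>\<tau>. g (x + \<tau> *\<^sub>R z)) has_real_derivative (\<Sum>j\<in>UNIV. z $ j * partial j g (x + \<tau> *\<^sub>R z))) (at \<tau>)"
proof -
  have "((\<lambda>\<tau>. x + \<tau> *\<^sub>R z) has_derivative (\<lambda>s. s *\<^sub>R z)) (at \<tau>)"
    by (auto intro!: derivative_eq_intros)
  from has_derivative_compose[OF this has_derivative_partials[OF assms]]
  show ?thesis
    by (rule has_derivative_imp_has_field_derivative)
       (simp add: sum_distrib_left mult.assoc)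
qed

definition C1_torus :: "(real^'n::finite \<Rightarrow> real) \<Rightarrow> bool" where
  "C1_torus g \<longleftrightarrow> periodic g \<and> (\<forall>x. g differentiable (at x)) \<and> (\<forall>j. continuous_on UNIV (partial j g))"

definition C2_torus :: "(real^'n::finite \<Rightarrow> real) \<Rightarrow> bool" where
  "C2_torus g \<longleftrightarrow> C1_torus g \<and> (\<forall>j. C1_torus (partial j g))"

lemma C1_torusD:
  assumes "C1_torus g"
  shows "periodic g" "g differentiable (at x)" "continuous_on UNIV (partial j g)"
    "continuous_on UNIV g" "g \<in> borel_measurable borel" "partial j g \<in> borel_measurable borel"
proof -
  show "periodic g" "g differentiable (at x)" "continuous_on UNIV (partial j g)"
    using assms by (auto simp: C1_torus_def)
  then show "partial j g \<in> borel_measurable borel" by (intro borel_measurable_continuous_onI)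
  show c: "continuous_on UNIV g"
    using assms by (auto simp: C1_torus_def intro!: continuous_at_imp_continuous_on differentiable_imp_continuous_within)
  then show "g \<in> borel_measurable borel" by (intro borel_measurable_continuous_onI)
qed

lemma C2_torusD:
  assumes "C2_torus g" shows "C1_torus g" "C1_torus (partial j g)"
  using assms by (auto simp: C2_torus_def)

lemma partial_shift:
  fixes g :: "real^'n::finite \<Rightarrow> real"
  assumes "\<And>x. g differentiable (at x)"
  shows "(\<lambda>x. g (x + h)) differentiable (at x)" and "partial j (\<lambda>x. g (x + h)) x = partial j g (x + h)"
proof -
  have 1: "((\<lambda>x. x + h) has_derivative (\<lambda>v. v)) (at x)"
    by (auto intro!: derivative_eq_intros)
  have 2: "(g has_derivative frechet_derivative g (at (x + h))) (at (x + h))"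
    using assms frechet_derivative_works by blast
  note 3 = has_derivative_compose[OF 1 2]
  show "(\<lambda>x. g (x + h)) differentiable (at x)" using 3 by (rule differentiableI)
  show "partial j (\<lambda>x. g (x + h)) x = partial j g (x + h)"
    using partial_eq[OF 3] by (simp add: partial_def)
qed

lemma partial_reflect:
  fixes g :: "real^'n::finite \<Rightarrow> real"
  assumes "\<And>x. g differentiable (at x)"
  shows "(\<lambda>y. g (x - y)) differentiable (at y)" and "partial j (\<lambda>y. g (x - y)) y = - partial j g (x - y)"
proof -
  have 1: "((\<lambda>y. x - y) has_derivative (\<lambda>v. - v)) (at y)"
    by (auto intro!: derivative_eq_intros)
  have 2: "(g has_derivative frechet_derivative g (at (x - y))) (at (x - y))"
    using assms frechet_derivative_works by blast
  note 3 = has_derivative_compose[OF 1 2]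
  have lin: "linear (frechet_derivative g (at (x - y)))"
    using 2 has_derivative_linear by blast
  show "(\<lambda>y. g (x - y)) differentiable (at y)" using 3 by (rule differentiableI)
  show "partial j (\<lambda>y. g (x - y)) y = - partial j g (x - y)"
    using partial_eq[OF 3] by (simp add: partial_def linear_neg[OF lin])
qed

lemma periodic_partial:
  fixes g :: "real^'n::finite \<Rightarrow> real"
  assumes "periodic g" "\<And>x. g differentiable (at x)"
  shows "periodic (partial j g)"
  unfolding periodic_def
proof (intro allI)
  fix x i
  have "(\<lambda>x. g (x + axis i (2 * pi))) = g" using assms(1) by (auto simp: periodic_def)
  with partial_shift(2)[OF assms(2), where h="axis i (2 * pi)" and x=x and j=j]
  show "partial j g (x + axis i (2 * pi)) = partial j g x" by simp
qed

lemma C1_torus_shift: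
  assumes "C1_torus g" shows "C1_torus (\<lambda>x. g (x + h))"
proof -
  note g = C1_torusD[OF assms]
  have "continuous_on UNIV (\<lambda>x. partial j g (x + h))" for j
    by (rule continuous_on_compose2[OF g(3)]) (auto intro!: continuous_intros)
  with g show ?thesis
    by (auto simp: C1_torus_def periodic_shift partial_shift[of g])
qed

lemma C1_torus_uminus:
  assumes "C1_torus g" shows "C1_torus (\<lambda>x. - g x)" "partial j (\<lambda>x. - g x) x = - partial j g x"
proof -
  note g = C1_torusD[OF assms]
  have p: "partial j (\<lambda>x. - g x) x = - partial j g x" for j x
    using has_derivative_minus[OF frechet_derivative_works[THEN iffD1, OF g(2)]]
    by (subst partial_eq) (auto simp: partial_def)
  show "partial j (\<lambda>x. - g x) x = - partial j g x" by (rule p)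
  show "C1_torus (\<lambda>x. - g x)"
    using g(1,2,3) p by (auto simp: C1_torus_def periodic_comp intro!: continuous_intros)
qed

lemma C1_torus_reflect:
  assumes "C1_torus g" shows "C1_torus (\<lambda>y. g (x - y))"
proof -
  note g = C1_torusD[OF assms]
  have "continuous_on UNIV (\<lambda>y. partial j g (x - y))" for j
    by (rule continuous_on_compose2[OF g(3)]) (auto intro!: continuous_intros)
  with g show ?thesis
    by (auto simp: C1_torus_def periodic_reflect partial_reflect[of g] intro!: continuous_intros)
qed

lemma C1_torus_const: "C1_torus (\<lambda>x. c)" "partial j (\<lambda>x. c) x = 0"
proof -
  have p: "partial j (\<lambda>x :: real^'n::finite. c :: real) x = 0" for j x
    by (subst partial_eq[of _ "\<lambda>_. 0"]) auto
  show "partial j (\<lambda>x. c) x = 0" by (rule p)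
  show "C1_torus (\<lambda>x. c)" by (simp add: C1_torus_def periodic_const p)
qed

lemma C1_torus_add:
  assumes "C1_torus g" "C1_torus h"
  shows "C1_torus (\<lambda>x. g x + h x)" "partial j (\<lambda>x. g x + h x) x = partial j g x + partial j h x"
proof -
  note g = C1_torusD[OF assms(1)] and h = C1_torusD[OF assms(2)]
  have p: "partial j (\<lambda>x. g x + h x) x = partial j g x + partial j h x" for j x
    using has_derivative_add[OF frechet_derivative_works[THEN iffD1, OF g(2)] frechet_derivative_works[THEN iffD1, OF h(2)]]
    by (subst partial_eq) (auto simp: partial_def)
  show "partial j (\<lambda>x. g x + h x) x = partial j g x + partial j h x" by (rule p)
  show "C1_torus (\<lambda>x. g x + h x)"
    using g(1,2,3) h(1,2,3) p by (auto simp: C1_torus_def periodic_comp2 intro!: continuous_intros)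
qed

lemma C1_torus_diff:
  assumes "C1_torus g" "C1_torus h"
  shows "C1_torus (\<lambda>x. g x - h x)" "partial j (\<lambda>x. g x - h x) x = partial j g x - partial j h x"
  using C1_torus_add[OF assms(1) C1_torus_uminus(1)[OF assms(2)]] C1_torus_uminus(2)[OF assms(2)] by simp_all

lemma C1_torus_mult:
  assumes "C1_torus g" "C1_torus h"
  shows "C1_torus (\<lambda>x. g x * h x)" "partial j (\<lambda>x. g x * h x) x = g x * partial j h x + partial j g x * h x"
proof -
  note g = C1_torusD[OF assms(1)] and h = C1_torusD[OF assms(2)]
  have p: "partial j (\<lambda>x. g x * h x) x = g x * partial j h x + partial j g x * h x" for j x
    using has_derivative_mult[OF frechet_derivative_works[THEN iffD1, OF g(2)] frechet_derivative_works[THEN iffD1, OF h(2)]]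
    by (subst partial_eq) (auto simp: partial_def)
  show "partial j (\<lambda>x. g x * h x) x = g x * partial j h x + partial j g x * h x" by (rule p)
  show "C1_torus (\<lambda>x. g x * h x)"
    using g h p by (auto simp: C1_torus_def periodic_comp2 intro!: continuous_intros)
qed

lemma C1_torus_compose:
  assumes "C1_torus g" and h: "\<And>x. (h has_real_derivative h' x) (at x)" and c: "continuous_on UNIV h'"
  shows "C1_torus (\<lambda>x. h (g x))" "partial j (\<lambda>x. h (g x)) x = h' (g x) * partial j g x"
proof -
  note g = C1_torusD[OF assms(1)]
  have d: "((\<lambda>x. h (g x)) has_derivative (\<lambda>v. h' (g x) * frechet_derivative g (at x) v)) (at x)" for x
    using has_derivative_compose[OF frechet_derivative_works[THEN iffD1, OF g(2)]
        h[of "g x", unfolded has_field_derivative_def]] .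
  have p: "partial j (\<lambda>x. h (g x)) x = h' (g x) * partial j g x" for j x
    by (subst partial_eq[OF d]) (simp add: partial_def)
  show "partial j (\<lambda>x. h (g x)) x = h' (g x) * partial j g x" by (rule p)
  have "continuous_on UNIV (\<lambda>x. h' (g x) * partial j g x)" for j
    by (intro continuous_intros g(3) continuous_on_compose2[OF c g(4)]) auto
  then show "C1_torus (\<lambda>x. h (g x))"
    using g(1) d by (auto simp: C1_torus_def periodic_comp p intro: differentiableI)
qed

lemma Ck_on_imp_C1_torus:
  assumes "Ck_on (Suc k) UNIV g" "periodic g"
  shows "C1_torus g" "Ck_on k UNIV (partial j g)"
proof -
  show k: "Ck_on k UNIV (partial j g)" for j using assms(1) by (simp add: partial_def[abs_def])
  then have "continuous_on UNIV (partial j g)" for j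
    using Ck_on_le[of k UNIV "partial j g" 0] by simp
  moreover have "g differentiable (at x)" for x
    using Ck_on_SucD[OF assms(1), of x] differentiableI by auto
  ultimately show "C1_torus g" using assms(2) by (simp add: C1_torus_def)
qed

lemma Ck_on_imp_C2_torus:
  assumes "Ck_on 2 UNIV g" "periodic g" shows "C2_torus g"
proof -
  have 1: "Ck_on (Suc (Suc 0)) UNIV g" using assms(1) by (simp add: numeral_2_eq_2)
  have "C1_torus (partial j g)" for j
    using Ck_on_imp_C1_torus(2)[OF 1 assms(2)] periodic_partial[OF assms(2)] C1_torusD(2)[OF Ck_on_imp_C1_torus(1)[OF 1 assms(2)]]
    by (intro Ck_on_imp_C1_torus(1)[of 0]) auto
  with Ck_on_imp_C1_torus(1)[OF 1 assms(2)] show ?thesis by (simp add: C2_torus_def)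
qed

lemma periodic_continuous_bounded:
  fixes g :: "real^'n::finite \<Rightarrow> real"
  assumes "periodic g" "continuous_on UNIV g"
  obtains B where "B > 0" "\<And>x. \<bar>g x\<bar> \<le> B"
proof -
  define Q :: "(real^'n) set" where "Q = cbox 0 (\<chi> j. 2 * pi)"
  have "compact (g ` Q)"
    unfolding Q_def by (intro compact_continuous_image continuous_on_subset[OF assms(2)]) auto
  then have "\<exists>B>0. \<forall>y\<in>g ` Q. norm y \<le> B"
    using compact_imp_bounded bounded_pos by blast
  then obtain B where B: "B > 0" "\<And>x. x \<in> Q \<Longrightarrow> \<bar>g x\<bar> \<le> B"
    by auto
  have "\<bar>g x\<bar> \<le> B" for x
  proof -
    define y where "y = x + (\<chi> j. 2 * pi * of_int (- \<lfloor>x $ j / (2 * pi)\<rfloor>))"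
    have "0 \<le> y $ j \<and> y $ j \<le> 2 * pi" for j
    proof -
      define k :: real where "k = of_int \<lfloor>x $ j / (2 * pi)\<rfloor>"
      have "k \<le> x $ j / (2 * pi)" "x $ j / (2 * pi) < k + 1"
        using floor_correct[of "x $ j / (2 * pi)"] by (auto simp: k_def)
      then have "k * (2 * pi) \<le> x $ j" "x $ j < (k + 1) * (2 * pi)"
        by (simp_all add: pos_le_divide_eq pos_divide_less_eq)
      then show ?thesis unfolding y_def k_def by (simp add: algebra_simps)
    qed
    then have "y \<in> Q" by (simp add: Q_def mem_box_cart)
    moreover have "g y = g x" unfolding y_def by (rule periodic_lattice[OF assms(1)])
    ultimately show ?thesis using B by metis
  qed
  with B that show ?thesis by blast
qed

lemma integrable_torus_bounded:
  fixes g :: "real^'n::finite \<Rightarrow> real"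
  assumes "g \<in> borel_measurable borel" "\<And>x. \<bar>g x\<bar> \<le> B"
  shows "integrable torus g"
  by (rule torus.integrable_const_bound[of _ B]) (use assms in auto)

lemma integrable_torus_continuous:
  fixes g :: "real^'n::finite \<Rightarrow> real"
  assumes "periodic g" "continuous_on UNIV g"
  shows "integrable torus g"
proof -
  obtain B where "B > 0" "\<And>x. \<bar>g x\<bar> \<le> B" using periodic_continuous_bounded[OF assms] by blast
  then show ?thesis
    by (intro integrable_torus_bounded[where B=B] borel_measurable_continuous_onI[OF assms(2)])
qed

lemma integrable_torus_mult:
  fixes g h :: "real^'n::finite \<Rightarrow> real"
  assumes "periodic g" "continuous_on UNIV g" "periodic h" "continuous_on UNIV h"
  shows "integrable torus (\<lambda>x. g x * h x)"
  by (rule integrable_torus_continuous[OF periodic_comp2[OF assms(1,3)] continuous_on_mult[OF assms(2,4)]])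

lemma partial_abs_le:
  fixes g :: "real^'n::finite \<Rightarrow> real"
  assumes "\<And>x. g differentiable (at x)" "\<And>x. \<bar>partial j g x\<bar> \<le> B"
  shows "\<bar>g (x + t *\<^sub>R axis j 1) - g x\<bar> \<le> B * \<bar>t\<bar>"
proof -
  have d: "((\<lambda>\<tau>. g (x + \<tau> *\<^sub>R axis j 1)) has_real_derivative partial j g (x + \<tau> *\<^sub>R axis j 1)) (at \<tau>)" for \<tau>
    using DERIV_along_line[of g x \<tau> "axis j 1"] assms(1)
    by (simp add: axis_def if_distrib[of "\<lambda>a. a * _"] cong: if_cong)
  have "norm (g (x + t *\<^sub>R axis j 1) - g (x + 0 *\<^sub>R axis j 1)) \<le> B * norm (t - 0)"
    by (rule field_differentiable_bound[of UNIV _ "\<lambda>\<tau>. partial j g (x + \<tau> *\<^sub>R axis j 1)"])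
       (use d assms(2) in auto)
  then show ?thesis by simp
qed

lemma integral_partial_zero:
  fixes g :: "real^'n::finite \<Rightarrow> real"
  assumes "C1_torus g"
  shows "(LINT x|torus. partial j g x) = 0"
proof -
  note g = C1_torusD[OF assms]
  have [measurable]: "g \<in> borel_measurable borel" by (rule g)
  obtain B where B: "B > 0" "\<And>x. \<bar>partial j g x\<bar> \<le> B"
    using periodic_continuous_bounded[OF periodic_partial[OF g(1,2)] g(3)] by blast
  define t where "t n = inverse (real (Suc n))" for n
  define D where "D n x = (g (x + t n *\<^sub>R axis j 1) - g x) / t n" for n x
  have t: "t n > 0" for n by (simp add: t_def)
  have "(\<lambda>n. LINT x|torus. D n x) \<longlonglongrightarrow> (LINT x|torus. partial j g x)"
  proof (rule integral_dominated_convergence[where w="\<lambda>_. B"])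
    show "partial j g \<in> borel_measurable torus" using g(6) by simp
    show "AE x in torus. (\<lambda>n. D n x) \<longlonglongrightarrow> partial j g x"
    proof (intro always_eventually allI)
      fix x
      have "((\<lambda>\<tau>. g (x + \<tau> *\<^sub>R axis j 1)) has_real_derivative partial j g x) (at 0)"
        using DERIV_along_line[of g x 0 "axis j 1"] g(2)
        by (simp add: axis_def if_distrib[of "\<lambda>a. a * _"] cong: if_cong)
      then have "((\<lambda>h. (g (x + h *\<^sub>R axis j 1) - g x) / h) \<longlongrightarrow> partial j g x) (at 0)"
        unfolding DERIV_def by simp
      moreover have "filterlim t (at 0) sequentially"
        using LIMSEQ_inverse_real_of_nat t unfolding filterlim_at t_def[abs_def]
        by (auto simp: less_imp_neq[symmetric])
      ultimately show "(\<lambda>n. D n x) \<longlonglongrightarrow> partial j g x"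
        unfolding D_def by (rule filterlim_compose)
    qed
    show "AE x in torus. norm (D n x) \<le> B" for n
      using partial_abs_le[OF g(2) B(2), of _ "t n"] t[of n]
      by (auto simp: D_def abs_divide divide_le_eq)
    show "D n \<in> borel_measurable torus" for n unfolding D_def by measurable
  qed auto
  moreover have "(LINT x|torus. D n x) = 0" for n
  proof -
    have "integrable torus g" by (rule integrable_torus_continuous[OF g(1) g(4)])
    moreover have "integrable torus (\<lambda>x. g (x + t n *\<^sub>R axis j 1))"
      using integral_torus_shift(1)[OF g(5,1)] \<open>integrable torus g\<close> by simp
    ultimately show ?thesis
      using integral_torus_shift(2)[OF g(5,1), of "t n *\<^sub>R axis j 1"] by (simp add: D_def)
  qed
  ultimately show ?thesis by (simp add: LIMSEQ_const_iff)
qed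

lemma integral_by_parts:
  fixes g h :: "real^'n::finite \<Rightarrow> real"
  assumes "C1_torus g" "C1_torus h"
  shows "(LINT x|torus. g x * partial j h x) = - (LINT x|torus. partial j g x * h x)"
proof -
  note g = C1_torusD[OF assms(1)] and h = C1_torusD[OF assms(2)]
  have 1: "integrable torus (\<lambda>x. g x * partial j h x)"
    by (intro integrable_torus_mult g h periodic_partial)
  have 2: "integrable torus (\<lambda>x. partial j g x * h x)"
    by (intro integrable_torus_mult g h periodic_partial)
  have "(LINT x|torus. g x * partial j h x + partial j g x * h x) = 0"
    using integral_partial_zero[OF C1_torus_mult(1)[OF assms], of j] C1_torus_mult(2)[OF assms, of j] by simp
  with 1 2 show ?thesis by simp
qed

section \<open>Bounded Borel functions\<close>

abbreviation borel2 where "borel2 \<equiv> borel \<Otimes>\<^sub>M borel"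

text \<open>Bounded measurable functions are integrable for all the finite measures used below and are closed under the
operations that occur; the predicate reduces integrability to syntax.\<close>
definition bounded_borel :: "'a measure \<Rightarrow> ('a \<Rightarrow> real) \<Rightarrow> bool" where
  "bounded_borel M h \<longleftrightarrow> h \<in> borel_measurable M \<and> (\<exists>B. \<forall>p. \<bar>h p\<bar> \<le> B)"

lemma bounded_borelD: "bounded_borel M h \<Longrightarrow> h \<in> borel_measurable M"
  by (simp add: bounded_borel_def)

lemma bounded_borelI: "h \<in> borel_measurable M \<Longrightarrow> (\<And>p. \<bar>h p\<bar> \<le> B) \<Longrightarrow> bounded_borel M h"
  by (auto simp: bounded_borel_def)

lemma bounded_borel_const: "bounded_borel M (\<lambda>p. c)"
  by (auto simp: bounded_borel_def)

lemma bounded_borel_add: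
  assumes "bounded_borel M h" "bounded_borel M h'" shows "bounded_borel M (\<lambda>p. h p + h' p)"
proof -
  obtain B B' where "\<And>p. \<bar>h p\<bar> \<le> B" "\<And>p. \<bar>h' p\<bar> \<le> B'" using assms by (auto simp: bounded_borel_def)
  then have "\<bar>h p + h' p\<bar> \<le> B + B'" for p by (meson abs_triangle_ineq add_mono order_trans)
  then show ?thesis using assms by (auto simp: bounded_borel_def)
qed

lemma bounded_borel_mult:
  assumes "bounded_borel M h" "bounded_borel M h'" shows "bounded_borel M (\<lambda>p. h p * h' p)"
proof -
  obtain B B' where B: "\<And>p. \<bar>h p\<bar> \<le> B" "\<And>p. \<bar>h' p\<bar> \<le> B'" using assms by (auto simp: bounded_borel_def)
  have "\<bar>h p * h' p\<bar> \<le> B * B'" for p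
    unfolding abs_mult using B[of p] by (intro mult_mono) auto
  then show ?thesis using assms by (auto simp: bounded_borel_def)
qed

lemma bounded_borel_diff:
  assumes "bounded_borel M h" "bounded_borel M h'" shows "bounded_borel M (\<lambda>p. h p - h' p)"
  using bounded_borel_add[OF assms(1) bounded_borel_mult[OF bounded_borel_const[of M "-1"] assms(2)]] by simp

lemma bounded_borel_abs: "bounded_borel M h \<Longrightarrow> bounded_borel M (\<lambda>p. \<bar>h p\<bar>)"
  by (auto simp: bounded_borel_def)

lemma bounded_borel_sgn: "bounded_borel M h \<Longrightarrow> bounded_borel M (\<lambda>p. sgn (h p))"
  by (auto simp: bounded_borel_def sgn_if intro!: exI[of _ 1])

lemma bounded_borel_sum:
  assumes "\<And>i. i \<in> I \<Longrightarrow> bounded_borel M (h i)" shows "bounded_borel M (\<lambda>p. \<Sum>i\<in>I. h i p)"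
  using assms by (induction I rule: infinite_finite_induct) (simp_all add: bounded_borel_const bounded_borel_add)

lemmas bounded_borel_intros = bounded_borel_add bounded_borel_diff bounded_borel_mult
  bounded_borel_abs bounded_borel_sgn bounded_borel_sum

lemma bounded_borel_compose:
  assumes "bounded_borel N h" "S \<in> measurable M N" shows "bounded_borel M (\<lambda>p. h (S p))"
  using assms by (auto simp: bounded_borel_def)

lemma bounded_borel_continuous:
  fixes h :: "real \<Rightarrow> real"
  assumes "continuous_on UNIV h" "bounded_borel M v" shows "bounded_borel M (\<lambda>p. h (v p))"
proof -
  obtain B where B: "\<And>p. \<bar>v p\<bar> \<le> B" using assms(2) by (auto simp: bounded_borel_def)
  have "compact (h ` {- B..B})"
    by (rule compact_continuous_image) (use assms(1) in \<open>auto intro: continuous_on_subset\<close>)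
  then obtain B' where B': "\<And>y. y \<in> h ` {- B..B} \<Longrightarrow> norm y \<le> B'"
    using compact_imp_bounded bounded_iff by metis
  have "\<bar>h (v p)\<bar> \<le> B'" for p using B'[of "h (v p)"] B[of p] by (auto simp: abs_le_iff)
  moreover have "(\<lambda>p. h (v p)) \<in> borel_measurable M"
    using measurable_compose[OF bounded_borelD[OF assms(2)] borel_measurable_continuous_onI[OF assms(1)]] .
  ultimately show ?thesis by (rule bounded_borelI[rotated])
qed

lemma bounded_borel_periodic:
  assumes "continuous_on UNIV h" "periodic h" shows "bounded_borel borel h"
proof -
  obtain B where "\<And>x. \<bar>h x\<bar> \<le> B" using periodic_continuous_bounded[OF assms(2,1)] by blast
  then show ?thesis by (intro bounded_borelI borel_measurable_continuous_onI assms)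
qed

lemma bounded_borel_uminus: "bounded_borel M h \<Longrightarrow> bounded_borel M (\<lambda>p. - h p)"
  by (simp add: bounded_borel_def)

section \<open>One-dimensional kernel\<close>

definition cosq :: "real \<Rightarrow> real" where "cosq x = (1 + cos x) / 2"
definition sinq :: "real \<Rightarrow> real" where "sinq x = (1 - cos x) / 2"

lemma cosq_sinq: "cosq x = 1 - sinq x" "0 \<le> cosq x" "cosq x \<le> 1" "0 \<le> sinq x" "sinq x \<le> 1"
proof -
  have "0 \<le> 1 + cos x" "cos x \<le> 1" using cos_ge_minus_one[of x] cos_le_one[of x] by linarith+
  then show "cosq x = 1 - sinq x" "0 \<le> cosq x" "cosq x \<le> 1" "0 \<le> sinq x" "sinq x \<le> 1"
    by (simp_all add: cosq_def sinq_def field_simps)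
qed

lemma sinq_eq: "sinq x = (sin (x / 2))\<^sup>2"
  using cos_double_sin[of "x / 2"] by (simp add: sinq_def)

lemma cosq_deriv [derivative_intros]:
  "(g has_real_derivative g') (at x within A) \<Longrightarrow> ((\<lambda>x. cosq (g x)) has_real_derivative - sin (g x) / 2 * g') (at x within A)"
  unfolding cosq_def by (auto intro!: derivative_eq_intros)

lemma continuous_on_cosq [continuous_intros]:
  fixes g :: "'a::t2_space \<Rightarrow> real"
  shows
  "continuous_on A g \<Longrightarrow> continuous_on A (\<lambda>x. cosq (g x))"
  "continuous_on A g \<Longrightarrow> continuous_on A (\<lambda>x. sinq (g x))"
  unfolding cosq_def sinq_def by (auto intro!: continuous_intros)

abbreviation circ :: "(real \<Rightarrow> real) \<Rightarrow> real" where
  "circ g \<equiv> integral {0..2 * pi} g"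

text \<open>The kernel in one variable is a power of \<open>cosq x = cos (x / 2) ^ 2\<close>, normalised by its Wallis integral.\<close>
definition wallis :: "nat \<Rightarrow> real" where "wallis n = circ (\<lambda>x. cosq x ^ n)"

lemma circ_int: "continuous_on UNIV (g :: real \<Rightarrow> real) \<Longrightarrow> g integrable_on {0..2 * pi}"
  by (rule integrable_continuous_real, erule continuous_on_subset) auto

lemma circ_mono: "continuous_on UNIV g \<Longrightarrow> continuous_on UNIV h \<Longrightarrow> (\<And>x. g x \<le> h x) \<Longrightarrow> circ g \<le> circ h"
  by (intro integral_le circ_int) auto

lemma circ_add: "continuous_on UNIV g \<Longrightarrow> continuous_on UNIV h \<Longrightarrow> circ (\<lambda>x. g x + h x) = circ g + circ h"
  by (intro integral_add circ_int) auto

lemma circ_diff: "continuous_on UNIV g \<Longrightarrow> continuous_on UNIV h \<Longrightarrow> circ (\<lambda>x. g x - h x) = circ g - circ h"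
  by (intro integral_diff circ_int) auto

lemma circ_cmult: "circ (\<lambda>x. c * g x) = c * circ g"
  by simp

lemma cosq_power_sin_deriv:
  "((\<lambda>x. cosq x ^ n * sin x) has_real_derivative
      (2 * real n + 2) * cosq x ^ Suc n - (2 * real n + 1) * cosq x ^ n) (at x)"
proof -
  have s: "sin x * sin x = 4 * cosq x * (1 - cosq x)"
  proof -
    have "4 * cosq x * (1 - cosq x) = 1 - cos x * cos x" by (simp add: cosq_def field_simps)
    then show ?thesis using sin_cos_squared_add3[of x] by linarith
  qed
  have c: "cos x = 2 * cosq x - 1" by (simp add: cosq_def field_simps)
  show ?thesis
  proof (cases n)
    case 0
    show ?thesis unfolding 0 by (auto intro!: derivative_eq_intros simp: c)
  next
    case (Suc m)
    have "((\<lambda>x. cosq x ^ n * sin x) has_real_derivative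
        real n * (- sin x / 2 * 1) * cosq x ^ (n - Suc 0) * sin x + cosq x ^ n * cos x) (at x)"
      by (auto intro!: derivative_eq_intros simp: mult_ac)
    also have "real n * (- sin x / 2 * 1) * cosq x ^ (n - Suc 0) * sin x + cosq x ^ n * cos x
        = - real n / 2 * cosq x ^ m * (sin x * sin x) + cosq x ^ n * cos x" by (simp add: Suc field_simps)
    also have "\<dots> = (2 * real n + 2) * cosq x ^ Suc n - (2 * real n + 1) * cosq x ^ n"
      unfolding s c Suc by (simp add: field_simps)
    finally show ?thesis .
  qed
qed

text \<open>Integrate the derivative of \<open>cosq x ^ n * sin x\<close> over a period.\<close>
lemma wallis_Suc: "(2 * real n + 2) * wallis (Suc n) = (2 * real n + 1) * wallis n"
proof -
  have "((\<lambda>x. (2 * real n + 2) * cosq x ^ Suc n - (2 * real n + 1) * cosq x ^ n)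
      has_integral cosq (2*pi) ^ n * sin (2*pi) - cosq 0 ^ n * sin 0) {0..2*pi}"
    by (rule fundamental_theorem_of_calculus)
       (auto intro!: has_field_derivative_at_within cosq_power_sin_deriv
          simp flip: has_real_derivative_iff_has_vector_derivative simp del: power_Suc)
  then have "circ (\<lambda>x. (2 * real n + 2) * cosq x ^ Suc n - (2 * real n + 1) * cosq x ^ n) = 0"
    by (simp add: integral_unique del: power_Suc)
  moreover have "circ (\<lambda>x. (2 * real n + 2) * cosq x ^ Suc n - (2 * real n + 1) * cosq x ^ n)
      = (2 * real n + 2) * wallis (Suc n) - (2 * real n + 1) * wallis n"
    unfolding wallis_def circ_cmult[symmetric] by (intro circ_diff continuous_intros)
  ultimately show ?thesis by simp
qed

lemma wallis_pos: "wallis n > 0"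
proof (induction n)
  case 0 show ?case by (simp add: wallis_def)
next
  case (Suc n)
  then show ?case using wallis_Suc[of n]
    by (metis add_nonneg_pos mult_pos_pos of_nat_0_le_iff zero_less_mult_pos zero_less_numeral zero_less_one
        mult_nonneg_nonneg zero_le_numeral)
qed

text \<open>The second moment of the kernel, since \<open>sinq x = sin (x / 2) ^ 2\<close>: the Wallis recursion gives it exactly.\<close>
lemma circ_cosq_sinq: "circ (\<lambda>x. cosq x ^ n * sinq x) = wallis n / (2 * real n + 2)"
proof -
  have "circ (\<lambda>x. cosq x ^ n * sinq x) = circ (\<lambda>x. cosq x ^ n - cosq x ^ Suc n)"
    by (simp add: cosq_sinq(1) algebra_simps)
  also have "\<dots> = wallis n - wallis (Suc n)"
    unfolding wallis_def by (intro circ_diff continuous_intros)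
  finally have "(2 * real n + 2) * circ (\<lambda>x. cosq x ^ n * sinq x) = wallis n"
    by (simp only: right_diff_distrib wallis_Suc) (simp add: algebra_simps)
  then show ?thesis by (simp add: eq_divide_eq mult.commute)
qed

text \<open>A tensor product of even trigonometric polynomials. Its mass lies at distance \<open>1 / sqrt n\<close> from the lattice, it is
smooth and periodic by construction, and its moments factorise.\<close>
definition kernel1 :: "nat \<Rightarrow> real \<Rightarrow> real" where "kernel1 n x = cosq x ^ n / wallis n"
definition kernel1' :: "nat \<Rightarrow> real \<Rightarrow> real" where
  "kernel1' n x = - real n / 2 * (cosq x ^ (n - 1) * sin x) / wallis n"
definition kernel1'' :: "nat \<Rightarrow> real \<Rightarrow> real" where
  "kernel1'' n x = - real n / 2 * (2 * real n * cosq x ^ n - (2 * real n - 1) * cosq x ^ (n - 1)) / wallis n"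
text \<open>A majorant of \<open>\<bar>kernel1'' n x\<bar>\<close> that is positive term by term, so that its integral and its moment reduce to
Wallis integrals.\<close>
definition kernel1_majorant :: "nat \<Rightarrow> real \<Rightarrow> real" where
  "kernel1_majorant n x = (real n * (2 * real n - 1) / 2 * (cosq x ^ (n - 1) * sinq x) + real n / 2 * cosq x ^ n) / wallis n"

lemma kernel1_deriv: "(kernel1 n has_real_derivative kernel1' n x) (at x)"
  unfolding kernel1_def[abs_def] kernel1'_def using wallis_pos[of n]
  by (auto intro!: derivative_eq_intros)

lemma kernel1'_deriv: "n \<ge> 1 \<Longrightarrow> (kernel1' n has_real_derivative kernel1'' n x) (at x)"
  unfolding kernel1'_def[abs_def] kernel1''_def
  using DERIV_cdivide[OF DERIV_cmult[OF cosq_power_sin_deriv[of "n - 1" x], of "- real n / 2"], of "wallis n"]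
  by (cases n) (simp_all add: algebra_simps)

lemma kernel1_nonneg: "kernel1 n x \<ge> 0" using wallis_pos[of n] by (simp add: kernel1_def cosq_sinq)
lemma kernel1_majorant_nonneg: "n \<ge> 1 \<Longrightarrow> kernel1_majorant n x \<ge> 0"
  using wallis_pos[of n] unfolding kernel1_majorant_def by (intro divide_nonneg_pos add_nonneg_nonneg mult_nonneg_nonneg) (auto simp: cosq_sinq)

lemma kernel1''_bound: assumes "n \<ge> 1" shows "\<bar>kernel1'' n x\<bar> \<le> kernel1_majorant n x"
proof -
  obtain m where m: "n = Suc m" using assms by (cases n) auto
  define a b where "a = cosq x ^ m" and "b = sinq x"
  have ab: "a \<ge> 0" "0 \<le> b" "b \<le> 1" using cosq_sinq by (auto simp: a_def b_def)
  have "kernel1'' n x = (real n * (2 * real n - 1) / 2 * (a * b) - real n / 2 * (a * (1 - b))) / wallis n"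
  proof -
    have *: "- N / 2 * (2 * N * ((1 - b) * a) - (2 * N - 1) * a)
        = N * (2 * N - 1) / 2 * (a * b) - N / 2 * (a * (1 - b))" for N :: real
      by (simp add: field_simps)
    have "cosq x ^ n = (1 - b) * a" by (simp add: m a_def b_def cosq_sinq(1))
    moreover have "cosq x ^ (n - 1) = a" by (simp add: m a_def)
    ultimately show ?thesis unfolding kernel1''_def by (simp only: *)
  qed
  also have "\<bar>\<dots>\<bar> = \<bar>real n * (2 * real n - 1) / 2 * (a * b) - real n / 2 * (a * (1 - b))\<bar> / wallis n"
    using wallis_pos[of n] by simp
  also have "\<dots> \<le> (\<bar>real n * (2 * real n - 1) / 2 * (a * b)\<bar> + \<bar>real n / 2 * (a * (1 - b))\<bar>) / wallis n"
    using wallis_pos[of n] by (intro divide_right_mono abs_triangle_ineq4) auto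
  also have "\<dots> = (real n * (2 * real n - 1) / 2 * (a * b) + real n / 2 * (a * (1 - b))) / wallis n"
    using ab assms by (simp add: abs_mult)
  also have "\<dots> = kernel1_majorant n x"
    by (simp add: kernel1_majorant_def m a_def b_def cosq_sinq(1) mult_ac)
  finally show ?thesis .
qed

lemma continuous_kernel1 [continuous_intros]:
  fixes g :: "'a::t2_space \<Rightarrow> real"
  assumes "continuous_on A g"
  shows "continuous_on A (\<lambda>x. kernel1 n (g x))" "continuous_on A (\<lambda>x. kernel1_majorant n (g x))"
    "continuous_on A (\<lambda>x. kernel1'' n (g x))" "continuous_on A (\<lambda>x. kernel1' n (g x))"
  unfolding kernel1_def kernel1_majorant_def kernel1''_def kernel1'_def using wallis_pos[of n]
  by (intro continuous_intros assms; simp)+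

lemma circ_kernel1: "circ (kernel1 n) = 1"
proof -
  have "circ (kernel1 n) = circ (\<lambda>x. (1 / wallis n) * cosq x ^ n)" by (simp add: kernel1_def[abs_def])
  also have "\<dots> = 1" using wallis_pos[of n] unfolding circ_cmult by (simp add: wallis_def)
  finally show ?thesis .
qed

lemma circ_kernel1_majorant: assumes "n \<ge> 1"
  shows "circ (kernel1_majorant n) = real n" "circ (\<lambda>x. kernel1_majorant n x * sinq x) \<le> 1"
proof -
  obtain m where m: "n = Suc m" using assms by (cases n) auto
  define N W where "N = real n" and "W = wallis n"
  have pos: "N > 0" "2 * N - 1 > 0" "2 * N + 2 > 0" "W > 0"
    using assms wallis_pos by (auto simp: N_def W_def)
  have N: "2 * real m + 2 = 2 * N" by (simp add: N_def m)
  have w: "wallis m / (2 * N) = W / (2 * N - 1)"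
    using wallis_Suc[of m] pos by (simp add: frac_eq_eq N_def W_def m algebra_simps)
  define \<alpha> \<beta> where "\<alpha> = N * (2 * N - 1) / 2 / W" and "\<beta> = N / 2 / W"
  have kernel1_majorant: "kernel1_majorant n x = \<alpha> * (cosq x ^ m * sinq x) + \<beta> * cosq x ^ n" for x
  proof -
    have "n - 1 = m" by (simp add: m)
    then show ?thesis
      unfolding kernel1_majorant_def \<alpha>_def \<beta>_def N_def W_def by (simp only: add_divide_distrib times_divide_eq_left)
  qed
  have "circ (kernel1_majorant n) = circ (\<lambda>x. \<alpha> * (cosq x ^ m * sinq x) + \<beta> * cosq x ^ n)"
    by (simp only: kernel1_majorant[abs_def])
  also have "\<dots> = \<alpha> * circ (\<lambda>x. cosq x ^ m * sinq x) + \<beta> * W"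
    unfolding W_def wallis_def circ_cmult[symmetric] by (intro circ_add continuous_intros)
  also have "\<dots> = \<alpha> * (W / (2 * N - 1)) + \<beta> * W"
    by (simp only: circ_cosq_sinq N w)
  also have "\<dots> = N"
  proof -
    have "N * P / 2 / W * (W / P) + N / 2 / W * W = N" if "P > 0" for P
      using pos that by simp
    from this[OF pos(2)] show ?thesis by (simp only: \<alpha>_def \<beta>_def)
  qed
  finally show "circ (kernel1_majorant n) = real n" by (simp add: N_def)
  have "cosq x ^ m * sinq x * sinq x = cosq x ^ m * sinq x - cosq x ^ n * sinq x" for x
  proof -
    have *: "cosq x ^ n = cosq x ^ m * (1 - sinq x)"
      by (simp only: m power_Suc2 cosq_sinq(1)[symmetric])
    show ?thesis unfolding * by (simp add: algebra_simps)
  qed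
  then have "circ (\<lambda>x. cosq x ^ m * sinq x * sinq x) = circ (\<lambda>x. cosq x ^ m * sinq x - cosq x ^ n * sinq x)"
    by simp
  also have "\<dots> = circ (\<lambda>x. cosq x ^ m * sinq x) - circ (\<lambda>x. cosq x ^ n * sinq x)"
    by (intro circ_diff continuous_intros)
  also have "\<dots> = W / (2 * N - 1) - W / (2 * N + 2)"
    by (simp only: circ_cosq_sinq N w) (simp add: N_def W_def)
  finally have 2: "circ (\<lambda>x. cosq x ^ m * sinq x * sinq x) = W / (2 * N - 1) - W / (2 * N + 2)" .
  have "circ (\<lambda>x. kernel1_majorant n x * sinq x) = circ (\<lambda>x. \<alpha> * (cosq x ^ m * sinq x * sinq x) + \<beta> * (cosq x ^ n * sinq x))"
    by (simp only: kernel1_majorant[abs_def] distrib_right mult.assoc)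
  also have "\<dots> = \<alpha> * circ (\<lambda>x. cosq x ^ m * sinq x * sinq x) + \<beta> * circ (\<lambda>x. cosq x ^ n * sinq x)"
    unfolding circ_cmult[symmetric] by (intro circ_add continuous_intros)
  also have "\<dots> = \<alpha> * (W / (2 * N - 1) - W / (2 * N + 2)) + \<beta> * (W / (2 * N + 2))"
    by (simp only: 2 circ_cosq_sinq N_def W_def)
  also have "\<dots> = N / 2 - N * (2 * N - 1) / (2 * (2 * N + 2)) + N / (2 * (2 * N + 2))"
  proof -
    have "N * P / 2 / W * (W / P - W / Q) + N / 2 / W * (W / Q) = N / 2 - N * P / (2 * Q) + N / (2 * Q)"
      if "P > 0" "Q > 0" for P Q
      using pos(4) that by (simp add: right_diff_distrib)
    from this[OF pos(2,3)] show ?thesis by (simp only: \<alpha>_def \<beta>_def)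
  qed
  also have "\<dots> = 2 * N / (2 * N + 2)"
  proof -
    have "N / 2 - N * (2 * N - 1) / (2 * Q) + N / (2 * Q) = (N * Q - N * (2 * N - 1) + N) / (2 * Q)"
      if "Q > 0" for Q
      using that by (simp add: add_divide_distrib diff_divide_distrib)
    from this[OF pos(3)] have "N / 2 - N * (2 * N - 1) / (2 * (2 * N + 2)) + N / (2 * (2 * N + 2))
        = (2 * (2 * N)) / (2 * (2 * N + 2))" by (simp only:) (simp add: algebra_simps)
    also have "\<dots> = 2 * N / (2 * N + 2)" by (rule mult_divide_mult_cancel_left) simp
    finally show ?thesis .
  qed
  also have "\<dots> \<le> 1" using pos by simp
  finally show "circ (\<lambda>x. kernel1_majorant n x * sinq x) \<le> 1" .
qed

text \<open>The inequality of arithmetic and geometric means turns the first moment into a second moment and a mass.\<close>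
lemma abs_sin_half_le:
  assumes "n \<ge> 1" shows "\<bar>sin (x / 2)\<bar> \<le> sqrt (real n) / 2 * sinq x + 1 / (2 * sqrt (real n))"
proof -
  define a r where "a = \<bar>sin (x / 2)\<bar>" and "r = sqrt (real n)"
  have r: "r > 0" using assms by (simp add: r_def)
  have "0 \<le> (r * a - 1)\<^sup>2" by simp
  then have "2 * r * a \<le> r\<^sup>2 * a\<^sup>2 + 1" by (simp add: power2_eq_square algebra_simps)
  then have "a \<le> r / 2 * a\<^sup>2 + 1 / (2 * r)" using r by (simp add: field_simps power2_eq_square)
  then show ?thesis by (simp add: a_def r_def sinq_eq)
qed

lemma circ_kernel1_sin:
  assumes "n \<ge> 1" shows "circ (\<lambda>x. kernel1 n x * \<bar>sin (x / 2)\<bar>) \<le> 1 / sqrt (real n)"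
proof -
  define r where "r = sqrt (real n)"
  have r: "r > 0" "real n = r * r" using assms by (auto simp: r_def)
  have "circ (\<lambda>x. kernel1 n x * \<bar>sin (x / 2)\<bar>) \<le> circ (\<lambda>x. kernel1 n x * (r / 2 * sinq x + 1 / (2 * r)))"
    using abs_sin_half_le[OF assms] kernel1_nonneg
    by (intro circ_mono continuous_intros mult_left_mono) (auto simp: r_def)
  also have "\<dots> = circ (\<lambda>x. (r / 2 / wallis n) * (cosq x ^ n * sinq x) + 1 / (2 * r) * kernel1 n x)"
    by (simp add: kernel1_def algebra_simps)
  also have "\<dots> = (r / 2 / wallis n) * circ (\<lambda>x. cosq x ^ n * sinq x) + 1 / (2 * r) * circ (kernel1 n)"
    unfolding circ_cmult[symmetric] by (intro circ_add continuous_intros)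
  also have "\<dots> = r / 2 / (2 * (r * r) + 2) + 1 / (2 * r)"
    using wallis_pos[of n] by (simp add: circ_cosq_sinq circ_kernel1 r(2))
  also have "\<dots> \<le> r / 2 / (r * r) + 1 / (2 * r)"
    using r by (intro add_mono divide_left_mono mult_pos_pos) auto
  also have "\<dots> = 1 / r" using r by (simp add: field_simps)
  finally show ?thesis by (simp add: r_def)
qed

lemma circ_kernel1_majorant_sin:
  assumes "n \<ge> 1" shows "circ (\<lambda>x. kernel1_majorant n x * \<bar>sin (x / 2)\<bar>) \<le> sqrt (real n)"
proof -
  define r where "r = sqrt (real n)"
  have r: "r > 0" "real n = r * r" using assms by (auto simp: r_def)
  have "circ (\<lambda>x. kernel1_majorant n x * \<bar>sin (x / 2)\<bar>) \<le> circ (\<lambda>x. kernel1_majorant n x * (r / 2 * sinq x + 1 / (2 * r)))"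
    using abs_sin_half_le[OF assms] kernel1_majorant_nonneg[OF assms]
    by (intro circ_mono continuous_intros mult_left_mono) (auto simp: r_def)
  also have "\<dots> = circ (\<lambda>x. (r / 2) * (kernel1_majorant n x * sinq x) + 1 / (2 * r) * kernel1_majorant n x)"
    by (simp add: algebra_simps)
  also have "\<dots> = (r / 2) * circ (\<lambda>x. kernel1_majorant n x * sinq x) + 1 / (2 * r) * circ (kernel1_majorant n)"
    unfolding circ_cmult[symmetric] by (intro circ_add continuous_intros)
  also have "\<dots> \<le> r / 2 * 1 + 1 / (2 * r) * (r * r)"
    using r circ_kernel1_majorant[OF assms] by (intro add_mono mult_left_mono) auto
  also have "\<dots> = r" using r by (simp add: field_simps)
  finally show ?thesis by (simp add: r_def)
qed

section \<open>The product kernel\<close>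

lemma circ_nonneg_nn_integral:
  fixes g :: "real \<Rightarrow> real"
  assumes "continuous_on UNIV g" "\<And>x. 0 \<le> g x"
  shows "(\<integral>\<^sup>+x. ennreal (indicator {0<..<2 * pi} x * g x) \<partial>lborel) = ennreal (circ g)" "circ g \<ge> 0"
proof -
  have [measurable]: "g \<in> borel_measurable borel"
    using assms(1) by (rule borel_measurable_continuous_onI)
  have "(g has_integral circ g) {0<..<2 * pi}"
    using integrable_integral[OF circ_int[OF assms(1)]] by (simp add: has_integral_Icc_iff_Ioo)
  then have "((\<lambda>x. indicator {0<..<2 * pi} x * g x) has_integral circ g) UNIV"
  proof -
    have "(\<lambda>x. indicator {0<..<2 * pi} x * g x) = (\<lambda>x. if x \<in> {0<..<2 * pi} then g x else 0)"
      by (auto simp: indicator_def)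
    with \<open>(g has_integral circ g) {0<..<2 * pi}\<close> show ?thesis
      by (simp only: has_integral_restrict_UNIV)
  qed
  then show "(\<integral>\<^sup>+x. ennreal (indicator {0<..<2 * pi} x * g x) \<partial>lborel) = ennreal (circ g)"
    by (intro nn_integral_has_integral_lborel) (auto simp: assms(2))
  show "circ g \<ge> 0" using assms by (intro integral_nonneg circ_int) auto
qed

lemma nn_integral_torus_prod:
  fixes g :: "'n::finite \<Rightarrow> real \<Rightarrow> real"
  assumes c: "\<And>i. continuous_on UNIV (g i)" and nn: "\<And>i x. 0 \<le> g i x"
  shows "(\<integral>\<^sup>+x. ennreal (\<Prod>i\<in>UNIV. g i (x $ i)) \<partial>torus) = ennreal (\<Prod>i\<in>UNIV. circ (g i))"
proof -
  have [measurable]: "g i \<in> borel_measurable borel" for i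
    using c by (rule borel_measurable_continuous_onI)
  define F :: "real^'n \<Rightarrow> real \<Rightarrow> ennreal" where
    "F b y = ennreal (indicator {0<..<2 * pi} y * g (SOME i. axis i 1 = b) y)" for b y
  have F: "F (axis i 1) y = ennreal (indicator {0<..<2 * pi} y * g i y)" for i y
    unfolding F_def by (subst some_equality[of _ i]) (auto simp: axis_eq_axis)
  have B: "prod h (Basis :: (real^'n) set) = (\<Prod>i\<in>UNIV. h (axis i 1))" for h :: "_ \<Rightarrow> ennreal"
  proof -
    have b1: "Basis = range (\<lambda>i :: 'n. axis i (1::real))" by (auto simp: Basis_vec_def)
    have b2: "inj (\<lambda>i :: 'n. axis i (1::real))" by (auto simp: inj_on_def axis_eq_axis)
    show ?thesis by (simp only: b1 prod.reindex[OF b2] o_def)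
  qed
  have "(\<integral>\<^sup>+x. ennreal (\<Prod>i\<in>UNIV. g i (x $ i)) \<partial>torus)
      = (\<integral>\<^sup>+x. indicator cell x * ennreal (\<Prod>i\<in>UNIV. g i (x $ i)) \<partial>lborel)"
    unfolding torus_def by (subst nn_integral_density) auto
  also have "\<dots> = (\<integral>\<^sup>+x. (\<Prod>b\<in>Basis. F b (x \<bullet> b)) \<partial>lborel)"
  proof (rule nn_integral_cong)
    fix x :: "real^'n"
    have "(\<Prod>b\<in>Basis. F b (x \<bullet> b)) = (\<Prod>i\<in>UNIV. ennreal (indicator {0<..<2 * pi} (x $ i) * g i (x $ i)))"
      by (simp add: B F inner_axis)
    also have "\<dots> = ennreal (\<Prod>i\<in>UNIV. indicator {0<..<2 * pi} (x $ i) * g i (x $ i))"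
      by (subst prod_ennreal) (auto simp: nn)
    also have "(\<Prod>i\<in>UNIV. indicator {0<..<2 * pi} (x $ i) * g i (x $ i)) = indicator cell x * (\<Prod>i\<in>UNIV. g i (x $ i))"
    proof (cases "x \<in> cell")
      case True
      then show ?thesis by (simp add: cell_def mem_box_cart)
    next
      case False
      then obtain i where "x $ i \<notin> {0<..<2 * pi}" by (auto simp: cell_def mem_box_cart)
      then have "(\<Prod>i\<in>UNIV. indicator {0<..<2 * pi} (x $ i) * g i (x $ i)) = 0"
        by (intro prod_zero) (auto simp: indicator_def)
      with False show ?thesis by simp
    qed
    finally show "indicator cell x * ennreal (\<Prod>i\<in>UNIV. g i (x $ i)) = (\<Prod>b\<in>Basis. F b (x \<bullet> b))"
      by (simp add: indicator_def)
  qed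
  also have "\<dots> = (\<Prod>b\<in>Basis. \<integral>\<^sup>+y. F b y \<partial>lborel)"
    by (rule nn_integral_lborel_prod) (auto simp: F_def)
  also have "\<dots> = (\<Prod>i\<in>UNIV. ennreal (circ (g i)))"
  proof -
    have "(\<integral>\<^sup>+y. F (axis i 1) y \<partial>lborel) = ennreal (circ (g i))" for i
      unfolding F by (rule circ_nonneg_nn_integral(1)[OF c nn])
    then show ?thesis by (simp only: B)
  qed
  also have "\<dots> = ennreal (\<Prod>i\<in>UNIV. circ (g i))"
    by (rule prod_ennreal) (rule circ_nonneg_nn_integral(2)[OF c nn])
  finally show ?thesis .
qed

lemma integral_torus_prod:
  fixes g :: "'n::finite \<Rightarrow> real \<Rightarrow> real"
  assumes c: "\<And>i. continuous_on UNIV (g i)" and nn: "\<And>i x. 0 \<le> g i x"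
  shows "integrable torus (\<lambda>x. \<Prod>i\<in>UNIV. g i (x $ i))"
    and "(LINT x|torus. (\<Prod>i\<in>UNIV. g i (x $ i))) = (\<Prod>i\<in>UNIV. circ (g i))"
proof -
  have [measurable]: "g i \<in> borel_measurable borel" for i
    using c by (rule borel_measurable_continuous_onI)
  have 1: "(\<lambda>x. \<Prod>i\<in>UNIV. g i (x $ i)) \<in> borel_measurable (torus :: (real^'n) measure)" by measurable
  have 2: "0 \<le> (\<Prod>i\<in>UNIV. circ (g i))"
    by (intro prod_nonneg ballI circ_nonneg_nn_integral(2) c nn)
  have 3: "AE x in torus. 0 \<le> (\<Prod>i\<in>UNIV. g i (x $ i))"
    by (intro always_eventually allI prod_nonneg ballI nn)
  have "integrable torus (\<lambda>x. \<Prod>i\<in>UNIV. g i (x $ i))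
      \<and> (LINT x|torus. (\<Prod>i\<in>UNIV. g i (x $ i))) = (\<Prod>i\<in>UNIV. circ (g i))"
    by (rule nn_integral_eq_integrable[OF 1 3 2, THEN iffD1, OF nn_integral_torus_prod[of g, OF c nn]])
  then show "integrable torus (\<lambda>x. \<Prod>i\<in>UNIV. g i (x $ i))"
    and "(LINT x|torus. (\<Prod>i\<in>UNIV. g i (x $ i))) = (\<Prod>i\<in>UNIV. circ (g i))"
    by (rule conjunct1, rule conjunct2)
qed

definition kernel :: "nat \<Rightarrow> real^'n::finite \<Rightarrow> real" where
  "kernel n x = (\<Prod>i\<in>UNIV. kernel1 n (x $ i))"

text \<open>A periodic replacement for the size of a translation, comparable with the distance to the lattice.\<close>
definition sin_modulus :: "real^'n::finite \<Rightarrow> real" where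
  "sin_modulus h = (\<Sum>i\<in>UNIV. \<bar>sin (h $ i / 2)\<bar>)"

lemma kernel_nonneg: "kernel n x \<ge> 0"
  by (simp add: kernel_def prod_nonneg kernel1_nonneg)

lemma bounded_linear_nth: "bounded_linear (\<lambda>x :: real^'n::finite. x $ i)"
  by (rule bounded_linear_vec_nth)

lemma Ck_on_kernel1: "Ck_on k UNIV (kernel1 n)"
proof -
  have "Ck_on k UNIV (\<lambda>x. (1 / (2 ^ n * wallis n)) * (1 + cos (x + 0)) ^ n)"
    by (intro Ck_on_mult Ck_on_const Ck_on_power Ck_on_add Ck_on_cos bounded_linear_ident) auto
  also have "(\<lambda>x. (1 / (2 ^ n * wallis n)) * (1 + cos (x + 0)) ^ n) = kernel1 n"
    by (auto simp: kernel1_def cosq_def power_divide)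
  finally show ?thesis .
qed

lemma Ck_on_kernel: "Ck_on k UNIV (kernel n :: real^'n::finite \<Rightarrow> real)"
proof -
  have "Ck_on k UNIV (\<lambda>x. kernel1 n (x $ i + 0))" for i :: 'n
    by (rule Ck_on_affine) (auto intro: Ck_on_kernel1 bounded_linear_vec_nth)
  then show ?thesis unfolding kernel_def[abs_def] by (intro Ck_on_prod) auto
qed

lemma periodic_kernel: "periodic (kernel n)"
  unfolding periodic_def kernel_def
  by (auto intro!: prod.cong simp: axis_def kernel1_def cosq_def)

lemma C2_torus_kernel: "C2_torus (kernel n)"
  by (rule Ck_on_imp_C2_torus[OF Ck_on_kernel periodic_kernel])

lemma integral_kernel: "integrable torus (kernel n)" "(LINT x|torus. kernel n x) = 1"
  using integral_torus_prod[of "\<lambda>_. kernel1 n", OF continuous_kernel1(1)[OF continuous_on_id] kernel1_nonneg]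
  by (simp_all only: kernel_def[abs_def] circ_kernel1 prod.neutral_const)

lemma kernel_along_axis:
  fixes x :: "real^'n::finite" and g :: "'n \<Rightarrow> real \<Rightarrow> real"
  shows
  "(\<Prod>i\<in>UNIV. g i ((x + t *\<^sub>R axis j 1) $ i)) = g j (x $ j + t) * (\<Prod>i\<in>UNIV - {j}. g i (x $ i))"
proof -
  have "(\<Prod>i\<in>UNIV - {j}. g i ((x + t *\<^sub>R axis j 1) $ i)) = (\<Prod>i\<in>UNIV - {j}. g i (x $ i))"
    by (intro prod.cong) (auto simp: axis_def)
  then show ?thesis by (simp add: prod.remove[of UNIV j] axis_def)
qed

lemma partial_along_axis:
  fixes g :: "real^'n::finite \<Rightarrow> real"
  assumes "g differentiable (at x)"
    and "((\<lambda>t. g (x + t *\<^sub>R axis j 1)) has_real_derivative d) (at 0)"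
  shows "partial j g x = d"
proof -
  have "((\<lambda>t. g (x + t *\<^sub>R axis j 1)) has_real_derivative partial j g x) (at 0)"
    using DERIV_along_line[of g x 0 "axis j 1"] assms(1)
    by (simp add: axis_def if_distrib[of "\<lambda>a. a * _"] cong: if_cong)
  with assms(2) show ?thesis using DERIV_unique by blast
qed

lemma DERIV_at_offset:
  "(f has_real_derivative D) (at a) \<Longrightarrow> ((\<lambda>t. f (a + t)) has_real_derivative D) (at 0)"
  using DERIV_shift[of f D 0 a] by (simp add: add.commute)

lemma partial_kernel:
  "partial j (kernel n) x = kernel1' n (x $ j) * (\<Prod>i\<in>UNIV - {j}. kernel1 n (x $ i))"
proof (rule partial_along_axis)
  show "kernel n differentiable (at x)" by (rule C1_torusD(2)[OF C2_torusD(1)[OF C2_torus_kernel]])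
  show "((\<lambda>t. kernel n (x + t *\<^sub>R axis j 1)) has_real_derivative
      kernel1' n (x $ j) * (\<Prod>i\<in>UNIV - {j}. kernel1 n (x $ i))) (at 0)"
    unfolding kernel_def kernel_along_axis[where g="\<lambda>_. kernel1 n"]
    by (intro DERIV_cmult_right DERIV_at_offset kernel1_deriv)
qed

lemma partial2_kernel:
  assumes "n \<ge> 1"
  shows "partial j (partial j (kernel n)) x = kernel1'' n (x $ j) * (\<Prod>i\<in>UNIV - {j}. kernel1 n (x $ i))"
proof (rule partial_along_axis)
  show "partial j (kernel n) differentiable (at x)" by (rule C1_torusD(2)[OF C2_torusD(2)[OF C2_torus_kernel]])
  have *: "(\<Prod>i\<in>UNIV - {j}. kernel1 n ((x + t *\<^sub>R axis j 1) $ i)) = (\<Prod>i\<in>UNIV - {j}. kernel1 n (x $ i))" for t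
    by (intro prod.cong) (auto simp: axis_def)
  have **: "(x + t *\<^sub>R axis j 1) $ j = x $ j + t" for t by (simp add: axis_def)
  show "((\<lambda>t. partial j (kernel n) (x + t *\<^sub>R axis j 1)) has_real_derivative
      kernel1'' n (x $ j) * (\<Prod>i\<in>UNIV - {j}. kernel1 n (x $ i))) (at 0)"
    unfolding partial_kernel * **
    by (intro DERIV_cmult_right DERIV_at_offset kernel1'_deriv assms)
qed

lemma integral_prod_sin:
  fixes g :: "'n::finite \<Rightarrow> real \<Rightarrow> real"
  assumes c: "\<And>i. continuous_on UNIV (g i)" and nn: "\<And>i x. 0 \<le> g i x"
  shows "integrable torus (\<lambda>x. (\<Prod>i\<in>UNIV. g i (x $ i)) * \<bar>sin (x $ l / 2)\<bar>)"
    and "(LINT x|torus. (\<Prod>i\<in>UNIV. g i (x $ i)) * \<bar>sin (x $ l / 2)\<bar>)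
      = circ (\<lambda>x. g l x * \<bar>sin (x / 2)\<bar>) * (\<Prod>i\<in>UNIV - {l}. circ (g i))"
proof -
  define g' where "g' i x = (if i = l then g i x * \<bar>sin (x / 2)\<bar> else g i x)" for i x
  have c': "continuous_on UNIV (g' i)" for i
    unfolding g'_def by (cases "i = l") (auto intro!: continuous_intros c)
  have nn': "0 \<le> g' i x" for i x by (simp add: g'_def nn)
  have eq: "(\<Prod>i\<in>UNIV. g' i (x $ i)) = (\<Prod>i\<in>UNIV. g i (x $ i)) * \<bar>sin (x $ l / 2)\<bar>" for x :: "real^'n"
  proof -
    have "(\<Prod>i\<in>UNIV - {l}. g' i (x $ i)) = (\<Prod>i\<in>UNIV - {l}. g i (x $ i))"
      by (intro prod.cong) (auto simp: g'_def)
    then show ?thesis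
      by (simp add: prod.remove[of UNIV l] g'_def[of l])
  qed
  have "(\<Prod>i\<in>UNIV. circ (g' i)) = circ (\<lambda>x. g l x * \<bar>sin (x / 2)\<bar>) * (\<Prod>i\<in>UNIV - {l}. circ (g i))"
  proof -
    have "g' l = (\<lambda>x. g l x * \<bar>sin (x / 2)\<bar>)" by (auto simp: g'_def)
    moreover have "(\<Prod>i\<in>UNIV - {l}. circ (g' i)) = (\<Prod>i\<in>UNIV - {l}. circ (g i))"
    proof (intro prod.cong refl)
      fix i assume "i \<in> UNIV - {l}"
      then have "g' i = g i" by (auto simp: g'_def)
      then show "circ (g' i) = circ (g i)" by simp
    qed
    ultimately show ?thesis by (simp add: prod.remove[of UNIV l])
  qed
  with integral_torus_prod[of g', OF c' nn']
  show "integrable torus (\<lambda>x. (\<Prod>i\<in>UNIV. g i (x $ i)) * \<bar>sin (x $ l / 2)\<bar>)"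
    and "(LINT x|torus. (\<Prod>i\<in>UNIV. g i (x $ i)) * \<bar>sin (x $ l / 2)\<bar>)
      = circ (\<lambda>x. g l x * \<bar>sin (x / 2)\<bar>) * (\<Prod>i\<in>UNIV - {l}. circ (g i))"
    by (simp_all add: eq)
qed

lemma kernel_sin_modulus:
  assumes "n \<ge> 1"
  shows "integrable torus (\<lambda>x :: real^'n::finite. kernel n x * sin_modulus x)"
    and "(LINT x :: real^'n|torus. kernel n x * sin_modulus x) \<le> real CARD('n) / sqrt (real n)"
proof -
  note i = integral_prod_sin[of "\<lambda>_ :: 'n. kernel1 n", OF continuous_kernel1(1)[OF continuous_on_id] kernel1_nonneg]
  have eq: "kernel n x * sin_modulus x = (\<Sum>l\<in>UNIV. (\<Prod>i\<in>UNIV. kernel1 n (x $ i)) * \<bar>sin (x $ l / 2)\<bar>)" for x :: "real^'n"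
    by (simp add: kernel_def sin_modulus_def sum_distrib_left)
  show "integrable torus (\<lambda>x :: real^'n. kernel n x * sin_modulus x)"
    unfolding eq using i(1) by auto
  have "(LINT x :: real^'n|torus. kernel n x * sin_modulus x)
      = (\<Sum>l\<in>(UNIV::'n set). circ (\<lambda>x. kernel1 n x * \<bar>sin (x / 2)\<bar>))"
    unfolding eq using i by (subst Bochner_Integration.integral_sum) (auto simp: circ_kernel1)
  also have "\<dots> \<le> (\<Sum>l\<in>(UNIV::'n set). 1 / sqrt (real n))"
    by (intro sum_mono circ_kernel1_sin assms)
  finally show "(LINT x :: real^'n|torus. kernel n x * sin_modulus x) \<le> real CARD('n) / sqrt (real n)" by simp
qed

text \<open>Two derivatives cost a factor \<open>n\<close>, one power of the modulus gains \<open>1 / sqrt n\<close>.\<close>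
lemma partial2_kernel_sin_modulus:
  assumes "n \<ge> 1"
  shows "(LINT x :: real^'n::finite|torus. \<bar>partial j (partial j (kernel n)) x\<bar> * sin_modulus x)
    \<le> real CARD('n) * sqrt (real n)"
proof -
  define g where "g i = (if i = j then kernel1_majorant n else kernel1 n)" for i
  have c: "continuous_on UNIV (g i)" for i by (auto simp: g_def intro!: continuous_intros)
  have nn: "0 \<le> g i x" for i x using kernel1_majorant_nonneg[OF assms] kernel1_nonneg by (auto simp: g_def)
  note i = integral_prod_sin[of g, OF c nn]
  have each: "circ (\<lambda>x. g l x * \<bar>sin (x / 2)\<bar>) * (\<Prod>i\<in>UNIV - {l}. circ (g i)) \<le> sqrt (real n)" for l
  proof (cases "l = j")
    case True
    then have "(\<Prod>i\<in>UNIV - {l}. circ (g i)) = 1"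
      by (intro prod.neutral) (auto simp: g_def circ_kernel1)
    with True circ_kernel1_majorant_sin[OF assms] show ?thesis by (simp add: g_def)
  next
    case False
    have "(\<Prod>i\<in>UNIV - {l}. circ (g i)) = circ (g j) * (\<Prod>i\<in>UNIV - {l} - {j}. circ (g i))"
      using False by (subst prod.remove[of _ j]) auto
    also have "(\<Prod>i\<in>UNIV - {l} - {j}. circ (g i)) = 1"
      by (intro prod.neutral) (auto simp: g_def circ_kernel1)
    finally have "(\<Prod>i\<in>UNIV - {l}. circ (g i)) = real n" using circ_kernel1_majorant(1)[OF assms] by (simp add: g_def)
    moreover have "circ (\<lambda>x. g l x * \<bar>sin (x / 2)\<bar>) * real n \<le> 1 / sqrt (real n) * real n"
      using False circ_kernel1_sin[OF assms] by (intro mult_right_mono) (auto simp: g_def)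
    ultimately show ?thesis using real_div_sqrt[of "real n"] by simp
  qed
  have bound: "\<bar>partial j (partial j (kernel n)) x\<bar> \<le> (\<Prod>i\<in>UNIV. g i (x $ i))" for x :: "real^'n"
  proof -
    have "(\<Prod>i\<in>UNIV. g i (x $ i)) = kernel1_majorant n (x $ j) * (\<Prod>i\<in>UNIV - {j}. kernel1 n (x $ i))"
      by (subst prod.remove[of _ j]) (auto simp: g_def intro!: prod.cong)
    then show ?thesis unfolding partial2_kernel[OF assms] abs_mult
      using kernel1''_bound[OF assms] by (simp add: abs_prod kernel1_nonneg mult_right_mono prod_nonneg)
  qed
  have sm: "sin_modulus x \<ge> 0" for x :: "real^'n" by (simp add: sin_modulus_def sum_nonneg)
  have eq: "(\<Prod>i\<in>UNIV. g i (x $ i)) * sin_modulus x = (\<Sum>l\<in>UNIV. (\<Prod>i\<in>UNIV. g i (x $ i)) * \<bar>sin (x $ l / 2)\<bar>)" for x :: "real^'n"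
    by (simp add: sin_modulus_def sum_distrib_left)
  have int: "integrable torus (\<lambda>x :: real^'n. (\<Prod>i\<in>UNIV. g i (x $ i)) * sin_modulus x)"
    unfolding eq using i(1) by auto
  have [measurable]: "partial j (partial j (kernel n)) \<in> borel_measurable borel"
    by (rule C1_torusD(6)[OF C2_torusD(2)[OF C2_torus_kernel]])
  have [measurable]: "sin_modulus \<in> borel_measurable borel"
    unfolding sin_modulus_def[abs_def] by measurable
  have "(LINT x :: real^'n|torus. \<bar>partial j (partial j (kernel n)) x\<bar> * sin_modulus x)
      \<le> (LINT x :: real^'n|torus. (\<Prod>i\<in>UNIV. g i (x $ i)) * sin_modulus x)"
    by (rule integral_mono_AE'[OF int])
      (auto intro!: always_eventually mult_right_mono mult_nonneg_nonneg prod_nonneg bound sm nn)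
  also have "\<dots> = (\<Sum>l\<in>UNIV. circ (\<lambda>x. g l x * \<bar>sin (x / 2)\<bar>) * (\<Prod>i\<in>UNIV - {l}. circ (g i)))"
    unfolding eq using i by (subst Bochner_Integration.integral_sum) auto
  also have "\<dots> \<le> (\<Sum>l\<in>(UNIV::'n set). sqrt (real n))"
    by (intro sum_mono each)
  finally show ?thesis by simp
qed

section \<open>The sign function and integration by parts\<close>

text \<open>The regularised modulus \<open>sqrt (w ^ 2 + d ^ 2)\<close>, with its first and second derivative.\<close>
definition smooth_abs :: "real \<Rightarrow> real \<Rightarrow> real" where "smooth_abs d w = sqrt (w\<^sup>2 + d\<^sup>2)"
definition smooth_sgn :: "real \<Rightarrow> real \<Rightarrow> real" where "smooth_sgn d w = w / sqrt (w\<^sup>2 + d\<^sup>2)"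
definition smooth_dirac :: "real \<Rightarrow> real \<Rightarrow> real" where "smooth_dirac d w = d\<^sup>2 / (sqrt (w\<^sup>2 + d\<^sup>2)) ^ 3"

lemma smooth_root_pos: "d > 0 \<Longrightarrow> sqrt (w\<^sup>2 + d\<^sup>2) > 0"
  by (simp add: sum_power2_gt_zero_iff)

lemma smooth_abs_deriv: assumes "d > 0" shows "(smooth_abs d has_real_derivative smooth_sgn d w) (at w)"
proof -
  have "w\<^sup>2 + d\<^sup>2 > 0" using assms by (simp add: sum_power2_gt_zero_iff)
  then show ?thesis
    unfolding smooth_abs_def[abs_def] smooth_sgn_def
    by (auto intro!: derivative_eq_intros simp: field_simps)
qed

lemma smooth_sgn_deriv: assumes "d > 0" shows "(smooth_sgn d has_real_derivative smooth_dirac d w) (at w)"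
proof -
  define R where "R = sqrt (w\<^sup>2 + d\<^sup>2)"
  have pos: "w\<^sup>2 + d\<^sup>2 > 0" using assms by (simp add: sum_power2_gt_zero_iff)
  have R: "R > 0" "R\<^sup>2 = w\<^sup>2 + d\<^sup>2" using pos by (auto simp: R_def)
  have "(smooth_sgn d has_real_derivative (1 * R - w * (w / R)) / (R * R)) (at w)"
    unfolding smooth_sgn_def[abs_def] R_def using pos
    by (intro DERIV_divide DERIV_ident smooth_abs_deriv[OF assms, unfolded smooth_abs_def[abs_def] smooth_sgn_def]) auto
  also have "(1 * R - w * (w / R)) / (R * R) = (R\<^sup>2 - w\<^sup>2) / R ^ 3"
    using R(1) by (simp add: field_simps power2_eq_square power3_eq_cube)
  also have "\<dots> = smooth_dirac d w" unfolding R(2) by (simp add: smooth_dirac_def R_def)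
  finally show ?thesis .
qed

lemma continuous_on_smooth:
  assumes "d > 0" shows "continuous_on UNIV (smooth_sgn d)" "continuous_on UNIV (smooth_dirac d)"
  unfolding smooth_sgn_def[abs_def] smooth_dirac_def[abs_def] using smooth_root_pos[OF assms]
  by (auto intro!: continuous_intros simp: less_imp_neq[symmetric])

lemma smooth_sgn_bound: "\<bar>smooth_sgn d w\<bar> \<le> 1"
proof -
  have "\<bar>w\<bar> \<le> sqrt (w\<^sup>2 + d\<^sup>2)" by (rule real_le_rsqrt) simp
  then have "\<bar>w\<bar> / sqrt (w\<^sup>2 + d\<^sup>2) \<le> 1"
    by (cases "sqrt (w\<^sup>2 + d\<^sup>2) = 0") (simp_all add: pos_divide_le_eq less_le del: real_sqrt_eq_0_iff)
  then show ?thesis by (simp add: smooth_sgn_def abs_divide)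
qed

lemma smooth_abs_bound: "d > 0 \<Longrightarrow> \<bar>smooth_abs d w\<bar> \<le> \<bar>w\<bar> + d"
  using sqrt_sum_squares_le_sum_abs[of w d] by (simp add: smooth_abs_def)

lemma smooth_dirac_nonneg: "smooth_dirac d w \<ge> 0"
  by (simp add: smooth_dirac_def)

text \<open>The approximate Dirac function is large only where \<open>w\<close> is small. This bound is the reason why the singular
terms vanish in the limit by dominated convergence.\<close>
lemma smooth_dirac_mult_bound:
  assumes "d > 0" shows "\<bar>w\<bar> * smooth_dirac d w \<le> 1"
proof -
  define R where "R = sqrt (w\<^sup>2 + d\<^sup>2)"
  have R: "R > 0" using smooth_root_pos[OF assms] by (simp add: R_def)
  have "\<bar>w\<bar> \<le> R" "d\<^sup>2 \<le> R\<^sup>2" using smooth_root_pos[OF assms] by (auto simp: R_def intro: real_le_rsqrt)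
  then have "\<bar>w\<bar> * d\<^sup>2 \<le> R * R\<^sup>2" using R by (intro mult_mono) auto
  then have "\<bar>w\<bar> * d\<^sup>2 \<le> R ^ 3" by (simp add: power3_eq_cube power2_eq_square)
  moreover have "smooth_dirac d w = d\<^sup>2 / R ^ 3" by (simp add: smooth_dirac_def R_def)
  ultimately show ?thesis using R by (simp add: pos_divide_le_eq)
qed

definition smoothing_width :: "nat \<Rightarrow> real" where "smoothing_width n = inverse (real (Suc n))"

lemma smoothing_width: "smoothing_width n > 0" "smoothing_width n \<le> 1" "smoothing_width \<longlonglongrightarrow> 0"
  using LIMSEQ_inverse_real_of_nat by (auto simp: smoothing_width_def[abs_def] inverse_le_1_iff)

lemma smooth_sgn_limit: "(\<lambda>n. smooth_sgn (smoothing_width n) w) \<longlonglongrightarrow> sgn w"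
proof (cases "w = 0")
  case False
  have "(\<lambda>n. w / sqrt (w\<^sup>2 + (smoothing_width n)\<^sup>2)) \<longlonglongrightarrow> w / sqrt (w\<^sup>2 + 0\<^sup>2)"
    by (intro tendsto_intros smoothing_width) (use False in auto)
  then show ?thesis using False by (simp add: smooth_sgn_def real_sgn_eq)
qed (simp add: smooth_sgn_def)

lemma smooth_abs_limit: "(\<lambda>n. smooth_abs (smoothing_width n) w) \<longlonglongrightarrow> \<bar>w\<bar>"
proof -
  have "(\<lambda>n. sqrt (w\<^sup>2 + (smoothing_width n)\<^sup>2)) \<longlonglongrightarrow> sqrt (w\<^sup>2 + 0\<^sup>2)"
    by (intro tendsto_intros smoothing_width)
  then show ?thesis by (simp add: smooth_abs_def)
qed

lemma smooth_dirac_limit: assumes "w \<noteq> 0" shows "(\<lambda>n. smooth_dirac (smoothing_width n) w) \<longlonglongrightarrow> 0"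
proof -
  have "(\<lambda>n. (smoothing_width n)\<^sup>2 / (sqrt (w\<^sup>2 + (smoothing_width n)\<^sup>2)) ^ 3) \<longlonglongrightarrow> 0\<^sup>2 / (sqrt (w\<^sup>2 + 0\<^sup>2)) ^ 3"
    by (intro tendsto_intros smoothing_width) (use assms in auto)
  then show ?thesis by (simp add: smooth_dirac_def)
qed

text \<open>The sign can be carried through an integration by parts as if it were constant, as long as \<open>G\<close> vanishes where \<open>m\<close>
does, at a linear rate: the derivative of the sign is concentrated there. For the proof the sign is regularised.\<close>
lemma integral_sgn_by_parts:
  fixes \<phi> m G :: "real^'n::finite \<Rightarrow> real"
  assumes \<phi>: "C1_torus \<phi>" and m: "C1_torus m" and G: "C1_torus G"
    and L: "\<And>x. \<bar>G x\<bar> \<le> L * \<bar>m x\<bar>"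
  shows "(LINT x|torus. \<phi> x * (sgn (m x) * partial j G x)) = - (LINT x|torus. partial j \<phi> x * (sgn (m x) * G x))"
proof -
  note p = C1_torusD[OF \<phi>] and q = C1_torusD[OF m] and g = C1_torusD[OF G]
  note per = periodic_partial[OF p(1,2)] periodic_partial[OF q(1,2)] periodic_partial[OF g(1,2)]
  note [measurable] = p(5,6) q(5,6) g(5,6)
  let ?d = smoothing_width
  define S where "S n x = smooth_sgn (?d n) (m x)" for n x
  define D where "D n x = smooth_dirac (?d n) (m x)" for n x
  have [measurable]: "S n \<in> borel_measurable borel" "D n \<in> borel_measurable borel" for n
    unfolding S_def D_def smooth_sgn_def smooth_dirac_def by measurable
  have S: "C1_torus (S n)" "partial j (S n) x = D n x * partial j m x" for n x
    unfolding S_def D_def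
    using C1_torus_compose[OF m smooth_sgn_deriv[OF smoothing_width(1)[of n]] continuous_on_smooth(2)[OF smoothing_width(1)]]
    by auto
  have parts: "(LINT x|torus. \<phi> x * (S n x * partial j G x + D n x * partial j m x * G x))
      = - (LINT x|torus. partial j \<phi> x * (S n x * G x))" for n
    using integral_by_parts[OF \<phi> C1_torus_mult(1)[OF S(1)[of n] G], of j]
    by (simp add: C1_torus_mult(2)[OF S(1) G] S(2))
  have "(\<lambda>n. LINT x|torus. \<phi> x * (S n x * partial j G x + D n x * partial j m x * G x))
      \<longlonglongrightarrow> (LINT x|torus. \<phi> x * (sgn (m x) * partial j G x))"
  proof (rule integral_dominated_convergence[where w="\<lambda>x. \<bar>\<phi> x\<bar> * (\<bar>partial j G x\<bar> + \<bar>L\<bar> * \<bar>partial j m x\<bar>)"])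
    show "integrable torus (\<lambda>x. \<bar>\<phi> x\<bar> * (\<bar>partial j G x\<bar> + \<bar>L\<bar> * \<bar>partial j m x\<bar>))"
      by (rule integrable_torus_continuous)
         (use p q g per in \<open>auto simp: periodic_def intro!: continuous_intros\<close>)
    have D0: "\<bar>D n x * G x\<bar> \<le> \<bar>L\<bar>" for n x
    proof -
      have "\<bar>D n x * G x\<bar> = D n x * \<bar>G x\<bar>"
        by (simp add: abs_mult D_def smooth_dirac_nonneg)
      also have "\<dots> \<le> D n x * (\<bar>L\<bar> * \<bar>m x\<bar>)"
        by (intro mult_left_mono order_trans[OF L] mult_right_mono) (auto simp: D_def smooth_dirac_nonneg)
      also have "\<dots> = \<bar>L\<bar> * (\<bar>m x\<bar> * D n x)" by simp
      also have "\<dots> \<le> \<bar>L\<bar> * 1"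
        unfolding D_def by (intro mult_left_mono smooth_dirac_mult_bound smoothing_width) auto
      finally show ?thesis by simp
    qed
    show "AE x in torus. norm (\<phi> x * (S n x * partial j G x + D n x * partial j m x * G x))
        \<le> \<bar>\<phi> x\<bar> * (\<bar>partial j G x\<bar> + \<bar>L\<bar> * \<bar>partial j m x\<bar>)" for n
    proof (intro always_eventually allI)
      fix x
      have "\<bar>S n x * partial j G x\<bar> \<le> 1 * \<bar>partial j G x\<bar>"
        unfolding abs_mult S_def by (intro mult_right_mono smooth_sgn_bound) auto
      moreover have "\<bar>D n x * partial j m x * G x\<bar> \<le> \<bar>L\<bar> * \<bar>partial j m x\<bar>"
        using mult_right_mono[OF D0[of n x], of "\<bar>partial j m x\<bar>"] by (simp add: abs_mult mult_ac)
      ultimately show "norm (\<phi> x * (S n x * partial j G x + D n x * partial j m x * G x))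
        \<le> \<bar>\<phi> x\<bar> * (\<bar>partial j G x\<bar> + \<bar>L\<bar> * \<bar>partial j m x\<bar>)"
        unfolding real_norm_def abs_mult[of "\<phi> x"] by (intro mult_left_mono) linarith+
    qed
    show "AE x in torus. (\<lambda>n. \<phi> x * (S n x * partial j G x + D n x * partial j m x * G x))
        \<longlonglongrightarrow> \<phi> x * (sgn (m x) * partial j G x)"
    proof (intro always_eventually allI)
      fix x
      have "(\<lambda>n. D n x * partial j m x * G x) \<longlonglongrightarrow> 0"
      proof (cases "m x = 0")
        case True
        then show ?thesis using L[of x] by simp
      next
        case False
        have "(\<lambda>n. D n x * partial j m x * G x) \<longlonglongrightarrow> 0 * partial j m x * G x"
          unfolding D_def by (intro tendsto_intros smooth_dirac_limit False)
        then show ?thesis by simp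
      qed
      then have "(\<lambda>n. \<phi> x * (S n x * partial j G x + D n x * partial j m x * G x))
          \<longlonglongrightarrow> \<phi> x * (sgn (m x) * partial j G x + 0)"
        unfolding S_def by (intro tendsto_intros smooth_sgn_limit)
      then show "(\<lambda>n. \<phi> x * (S n x * partial j G x + D n x * partial j m x * G x))
          \<longlonglongrightarrow> \<phi> x * (sgn (m x) * partial j G x)" by simp
    qed
  qed measurable
  moreover have "(\<lambda>n. LINT x|torus. partial j \<phi> x * (S n x * G x))
      \<longlonglongrightarrow> (LINT x|torus. partial j \<phi> x * (sgn (m x) * G x))"
  proof (rule integral_dominated_convergence[where w="\<lambda>x. \<bar>partial j \<phi> x\<bar> * \<bar>G x\<bar>"])
    show "integrable torus (\<lambda>x. \<bar>partial j \<phi> x\<bar> * \<bar>G x\<bar>)"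
      by (rule integrable_torus_continuous)
         (use p q g per in \<open>auto simp: periodic_def intro!: continuous_intros\<close>)
    show "AE x in torus. norm (partial j \<phi> x * (S n x * G x)) \<le> \<bar>partial j \<phi> x\<bar> * \<bar>G x\<bar>" for n
      using smooth_sgn_bound[of "?d n"]
      by (auto simp: abs_mult S_def intro!: always_eventually mult_left_mono mult_left_le_one_le)
    show "AE x in torus. (\<lambda>n. partial j \<phi> x * (S n x * G x)) \<longlonglongrightarrow> partial j \<phi> x * (sgn (m x) * G x)"
      unfolding S_def by (intro always_eventually allI tendsto_intros smooth_sgn_limit)
  qed measurable
  ultimately show ?thesis
    unfolding parts using LIMSEQ_unique tendsto_minus by blast
qed

text \<open>Kato's inequality on the torus. The term \<open>smooth_dirac (m x) * (partial j m x) ^ 2\<close> that appears when the regularised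
sign is differentiated is nonnegative and is dropped.\<close>
lemma integral_sgn_second_derivative_le:
  fixes \<phi> m :: "real^'n::finite \<Rightarrow> real"
  assumes \<phi>: "C2_torus \<phi>" and m: "C2_torus m" and nn: "\<And>x. \<phi> x \<ge> 0"
  shows "(LINT x|torus. \<phi> x * (sgn (m x) * partial j (partial j m) x)) \<le> (LINT x|torus. partial j (partial j \<phi>) x * \<bar>m x\<bar>)"
proof -
  note \<phi>1 = C2_torusD(1)[OF \<phi>] and \<phi>2 = C2_torusD(2)[OF \<phi>, of j]
  note m1 = C2_torusD(1)[OF m] and m2 = C2_torusD(2)[OF m, of j]
  note p = C1_torusD[OF \<phi>1] and q = C1_torusD[OF m1] and p2 = C1_torusD[OF \<phi>2] and q2 = C1_torusD[OF m2]
  note per = periodic_partial[OF p(1,2)] periodic_partial[OF q(1,2)] periodic_partial[OF p2(1,2)] periodic_partial[OF q2(1,2)]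
  note [measurable] = p(5,6) q(5,6) p2(5,6) q2(5,6)
  let ?d = smoothing_width
  define S where "S n x = smooth_sgn (?d n) (m x)" for n x
  define D where "D n x = smooth_dirac (?d n) (m x)" for n x
  define A where "A n x = smooth_abs (?d n) (m x)" for n x
  have [measurable]: "S n \<in> borel_measurable borel" "D n \<in> borel_measurable borel" "A n \<in> borel_measurable borel" for n
    unfolding S_def D_def A_def smooth_sgn_def smooth_dirac_def smooth_abs_def by measurable
  have S: "C1_torus (S n)" "partial j (S n) x = D n x * partial j m x" for n x
    unfolding S_def D_def
    using C1_torus_compose[OF m1 smooth_sgn_deriv[OF smoothing_width(1)[of n]] continuous_on_smooth(2)[OF smoothing_width(1)]]
    by auto
  have A: "C1_torus (A n)" "partial j (A n) x = S n x * partial j m x" for n x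
    unfolding S_def A_def
    using C1_torus_compose[OF m1 smooth_abs_deriv[OF smoothing_width(1)[of n]] continuous_on_smooth(1)[OF smoothing_width(1)]]
    by auto
  have Sm: "C1_torus (\<lambda>x. S n x * partial j m x)"
    "partial j (\<lambda>x. S n x * partial j m x) x = S n x * partial j (partial j m) x + D n x * partial j m x * partial j m x" for n x
    using C1_torus_mult[OF S(1)[of n] m2] by (auto simp: S(2))
  have ineq: "(LINT x|torus. \<phi> x * (S n x * partial j (partial j m) x)) \<le> (LINT x|torus. partial j (partial j \<phi>) x * A n x)" for n
  proof -
    have "(LINT x|torus. \<phi> x * (S n x * partial j (partial j m) x))
        \<le> (LINT x|torus. \<phi> x * partial j (\<lambda>x. S n x * partial j m x) x)"
    proof (rule integral_mono)
      note s = C1_torusD[OF S(1)[of n]] and sm = C1_torusD[OF Sm(1)[of n]]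
      show "integrable torus (\<lambda>x. \<phi> x * (S n x * partial j (partial j m) x))"
        by (rule integrable_torus_continuous)
           (use p q s q2 per in \<open>auto simp: periodic_def intro!: continuous_intros\<close>)
      show "integrable torus (\<lambda>x. \<phi> x * partial j (\<lambda>x. S n x * partial j m x) x)"
        by (intro integrable_torus_mult p sm periodic_partial)
      show "\<phi> x * (S n x * partial j (partial j m) x) \<le> \<phi> x * partial j (\<lambda>x. S n x * partial j m x) x" for x
        unfolding Sm(2) mult.assoc by (intro mult_left_mono nn) (simp add: D_def smooth_dirac_nonneg)
    qed
    also have "\<dots> = - (LINT x|torus. partial j \<phi> x * (S n x * partial j m x))"
      by (rule integral_by_parts[OF \<phi>1 Sm(1)])
    also have "\<dots> = - (LINT x|torus. partial j \<phi> x * partial j (A n) x)"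
      by (simp add: A(2))
    also have "\<dots> = (LINT x|torus. partial j (partial j \<phi>) x * A n x)"
      using integral_by_parts[OF \<phi>2 A(1), where j=j] by simp
    finally show ?thesis .
  qed
  have "(\<lambda>n. LINT x|torus. \<phi> x * (S n x * partial j (partial j m) x))
      \<longlonglongrightarrow> (LINT x|torus. \<phi> x * (sgn (m x) * partial j (partial j m) x))"
  proof (rule integral_dominated_convergence[where w="\<lambda>x. \<bar>\<phi> x\<bar> * \<bar>partial j (partial j m) x\<bar>"])
    show "integrable torus (\<lambda>x. \<bar>\<phi> x\<bar> * \<bar>partial j (partial j m) x\<bar>)"
      by (rule integrable_torus_continuous)
         (use p q q2 per in \<open>auto simp: periodic_def intro!: continuous_intros\<close>)
    show "AE x in torus. norm (\<phi> x * (S n x * partial j (partial j m) x)) \<le> \<bar>\<phi> x\<bar> * \<bar>partial j (partial j m) x\<bar>" for n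
      using smooth_sgn_bound[of "?d n"]
      by (auto simp: abs_mult S_def intro!: always_eventually mult_left_mono mult_left_le_one_le)
    show "AE x in torus. (\<lambda>n. \<phi> x * (S n x * partial j (partial j m) x)) \<longlonglongrightarrow> \<phi> x * (sgn (m x) * partial j (partial j m) x)"
      unfolding S_def by (intro always_eventually allI tendsto_intros smooth_sgn_limit)
  qed measurable
  moreover have "(\<lambda>n. LINT x|torus. partial j (partial j \<phi>) x * A n x)
      \<longlonglongrightarrow> (LINT x|torus. partial j (partial j \<phi>) x * \<bar>m x\<bar>)"
  proof (rule integral_dominated_convergence[where w="\<lambda>x. \<bar>partial j (partial j \<phi>) x\<bar> * (\<bar>m x\<bar> + 1)"])
    show "integrable torus (\<lambda>x. \<bar>partial j (partial j \<phi>) x\<bar> * (\<bar>m x\<bar> + 1))"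
      by (rule integrable_torus_continuous)
         (use p2 q per in \<open>auto simp: periodic_def intro!: continuous_intros\<close>)
    have "\<bar>A n x\<bar> \<le> \<bar>m x\<bar> + 1" for n x
      using smooth_abs_bound[OF smoothing_width(1)[of n], of "m x"] smoothing_width(2)[of n] by (simp add: A_def)
    then show "AE x in torus. norm (partial j (partial j \<phi>) x * A n x) \<le> \<bar>partial j (partial j \<phi>) x\<bar> * (\<bar>m x\<bar> + 1)" for n
      by (auto simp: abs_mult intro!: always_eventually mult_left_mono)
    show "AE x in torus. (\<lambda>n. partial j (partial j \<phi>) x * A n x) \<longlonglongrightarrow> partial j (partial j \<phi>) x * \<bar>m x\<bar>"
      unfolding A_def by (intro always_eventually allI tendsto_intros smooth_abs_limit)
  qed measurable
  ultimately show ?thesis using ineq by (intro LIMSEQ_le) auto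
qed

text \<open>Chain rule for the modulus of a \<open>C1\<close> function, which may fail to be differentiable at its zeros. The weight \<open>\<rho>\<close>
later serves as a test function in time.\<close>
lemma abs_increment_eq_integral:
  fixes a a' \<rho> \<rho>' :: "real \<Rightarrow> real"
  assumes "s1 \<le> s2" and d: "\<And>s. s1 \<le> s \<Longrightarrow> s \<le> s2 \<Longrightarrow> (a has_real_derivative a' s) (at s)"
    and c: "continuous_on {s1..s2} a'"
    and \<rho>: "\<And>s. (\<rho> has_real_derivative \<rho>' s) (at s)" "continuous_on UNIV \<rho>'"
  shows "\<rho> s2 * \<bar>a s2\<bar> - \<rho> s1 * \<bar>a s1\<bar> = (LINT s:{s1..s2}|lborel. \<rho>' s * \<bar>a s\<bar> + \<rho> s * (sgn (a s) * a' s))"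
proof -
  let ?d = smoothing_width
  let ?A = "\<lambda>n s. smooth_abs (?d n) (a s)" and ?S = "\<lambda>n s. smooth_sgn (?d n) (a s)"
  have ca: "continuous_on {s1..s2} a"
    using d by (auto intro!: continuous_at_imp_continuous_on DERIV_isCont)
  have c\<rho>: "continuous_on A \<rho>" "continuous_on A \<rho>'" for A
  proof -
    show "continuous_on A \<rho>"
      using \<rho>(1) by (intro continuous_at_imp_continuous_on ballI DERIV_isCont)
    show "continuous_on A \<rho>'" by (rule continuous_on_subset[OF \<rho>(2)]) simp
  qed
  have cA: "continuous_on {s1..s2} (?A n)" for n
    unfolding smooth_abs_def by (intro continuous_intros ca)
  have cS: "continuous_on {s1..s2} (?S n)" for n
    by (intro continuous_on_compose2[OF continuous_on_smooth(1)[OF smoothing_width(1)] ca]) auto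
  have eq: "(LINT s:{s1..s2}|lborel. \<rho>' s * ?A n s + \<rho> s * (?S n s * a' s)) = \<rho> s2 * ?A n s2 - \<rho> s1 * ?A n s1" for n
    unfolding set_lebesgue_integral_def
  proof (rule integral_FTC_Icc[OF assms(1)])
    show "((\<lambda>s. \<rho> s * ?A n s) has_vector_derivative \<rho>' s * ?A n s + \<rho> s * (?S n s * a' s)) (at s within {s1..s2})"
      if "s1 \<le> s" "s \<le> s2" for s
      using DERIV_mult[OF \<rho>(1) DERIV_chain2[OF smooth_abs_deriv[OF smoothing_width(1)] d[OF that]]]
      by (simp add: has_field_derivative_at_within mult.commute add.commute flip: has_real_derivative_iff_has_vector_derivative)
    show "continuous_on {s1..s2} (\<lambda>s. \<rho>' s * ?A n s + \<rho> s * (?S n s * a' s))"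
      by (intro continuous_intros c c\<rho> cA cS)
  qed
  have bm: "(\<lambda>s. indicator {s1..s2} s *\<^sub>R g s) \<in> borel_measurable borel" if "continuous_on {s1..s2} g" for g :: "real \<Rightarrow> real"
    using borel_measurable_continuous_on_indicator[OF _ that] by simp
  have meas: "(\<lambda>s. indicator {s1..s2} s *\<^sub>R (\<rho>' s * \<bar>a s\<bar> + \<rho> s * (sgn (a s) * a' s))) \<in> borel_measurable lborel"
  proof -
    have [measurable]: "(\<lambda>s. indicator {s1..s2} s *\<^sub>R a s) \<in> borel_measurable borel"
      "(\<lambda>s. indicator {s1..s2} s *\<^sub>R a' s) \<in> borel_measurable borel"
      "\<rho> \<in> borel_measurable borel" "\<rho>' \<in> borel_measurable borel"
      using bm[OF ca] bm[OF c] c\<rho> by (auto intro: borel_measurable_continuous_onI)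
    have "(\<lambda>s. indicator {s1..s2} s *\<^sub>R (\<rho>' s * \<bar>a s\<bar> + \<rho> s * (sgn (a s) * a' s)))
        = (\<lambda>s. \<rho>' s * \<bar>indicator {s1..s2} s *\<^sub>R a s\<bar> + \<rho> s * (sgn (indicator {s1..s2} s *\<^sub>R a s) * (indicator {s1..s2} s *\<^sub>R a' s)))"
      by (auto simp: indicator_def)
    also have "\<dots> \<in> borel_measurable lborel" by measurable
    finally show ?thesis .
  qed
  have "(\<lambda>n. LINT s:{s1..s2}|lborel. \<rho>' s * ?A n s + \<rho> s * (?S n s * a' s))
      \<longlonglongrightarrow> (LINT s:{s1..s2}|lborel. \<rho>' s * \<bar>a s\<bar> + \<rho> s * (sgn (a s) * a' s))"
    unfolding set_lebesgue_integral_def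
  proof (rule integral_dominated_convergence[where w="\<lambda>s. indicator {s1..s2} s *\<^sub>R (\<bar>\<rho>' s\<bar> * (\<bar>a s\<bar> + 1) + \<bar>\<rho> s\<bar> * \<bar>a' s\<bar>)"])
    show "integrable lborel (\<lambda>s. indicator {s1..s2} s *\<^sub>R (\<bar>\<rho>' s\<bar> * (\<bar>a s\<bar> + 1) + \<bar>\<rho> s\<bar> * \<bar>a' s\<bar>))"
      by (rule borel_integrable_compact) (auto intro!: continuous_intros c ca c\<rho>)
    show "(\<lambda>s. indicator {s1..s2} s *\<^sub>R (\<rho>' s * \<bar>a s\<bar> + \<rho> s * (sgn (a s) * a' s))) \<in> borel_measurable lborel"
      by (rule meas)
    show "(\<lambda>s. indicator {s1..s2} s *\<^sub>R (\<rho>' s * ?A n s + \<rho> s * (?S n s * a' s))) \<in> borel_measurable lborel" for n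
    proof -
      have "continuous_on {s1..s2} (\<lambda>s. \<rho>' s * ?A n s + \<rho> s * (?S n s * a' s))"
        by (intro continuous_intros c c\<rho> cA cS)
      from bm[OF this] show ?thesis by simp
    qed
    have "\<bar>\<rho>' s * ?A n s + \<rho> s * (?S n s * a' s)\<bar> \<le> \<bar>\<rho>' s\<bar> * (\<bar>a s\<bar> + 1) + \<bar>\<rho> s\<bar> * \<bar>a' s\<bar>" for n s
    proof -
      have "\<bar>?A n s\<bar> \<le> \<bar>a s\<bar> + 1"
        using smooth_abs_bound[OF smoothing_width(1)[of n], of "a s"] smoothing_width(2)[of n] by linarith
      then have "\<bar>\<rho>' s * ?A n s\<bar> \<le> \<bar>\<rho>' s\<bar> * (\<bar>a s\<bar> + 1)" unfolding abs_mult by (intro mult_left_mono) auto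
      moreover have "\<bar>\<rho> s * (?S n s * a' s)\<bar> \<le> \<bar>\<rho> s\<bar> * \<bar>a' s\<bar>"
        unfolding abs_mult by (intro mult_left_mono mult_left_le_one_le smooth_sgn_bound) auto
      ultimately show ?thesis by linarith
    qed
    then show "AE s in lborel. norm (indicator {s1..s2} s *\<^sub>R (\<rho>' s * ?A n s + \<rho> s * (?S n s * a' s)))
        \<le> indicator {s1..s2} s *\<^sub>R (\<bar>\<rho>' s\<bar> * (\<bar>a s\<bar> + 1) + \<bar>\<rho> s\<bar> * \<bar>a' s\<bar>)" for n
      by (auto simp: indicator_def)
    show "AE s in lborel. (\<lambda>n. indicator {s1..s2} s *\<^sub>R (\<rho>' s * ?A n s + \<rho> s * (?S n s * a' s)))
        \<longlonglongrightarrow> indicator {s1..s2} s *\<^sub>R (\<rho>' s * \<bar>a s\<bar> + \<rho> s * (sgn (a s) * a' s))"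
      by (intro always_eventually allI tendsto_intros smooth_sgn_limit smooth_abs_limit)
  qed
  moreover have "(\<lambda>n. \<rho> s2 * ?A n s2 - \<rho> s1 * ?A n s1) \<longlonglongrightarrow> \<rho> s2 * \<bar>a s2\<bar> - \<rho> s1 * \<bar>a s1\<bar>"
    by (intro tendsto_intros smooth_abs_limit)
  ultimately show ?thesis unfolding eq using LIMSEQ_unique by blast
qed

section \<open>The nonlocal operator\<close>

lemma C2_torus_taylor:
  fixes w :: "real^'n::finite \<Rightarrow> real"
  assumes "C2_torus w"
  obtains C where "C \<ge> 0" "\<And>x z. \<bar>w (x + z) - w x - z \<bullet> grad w x\<bar> \<le> C * (norm z)\<^sup>2"
proof -
  note w1 = C2_torusD(1)[OF assms] and w2 = C2_torusD(2)[OF assms]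
  have "\<exists>B>0. \<forall>x. \<bar>partial i (partial j w) x\<bar> \<le> B" for i j
    using periodic_continuous_bounded[OF periodic_partial[OF C1_torusD(1,2)[OF w2]] C1_torusD(3)[OF w2]] by metis
  then obtain b where b: "b i j > 0" "\<bar>partial i (partial j w) x\<bar> \<le> b i j" for i j x by metis
  define B where "B = (\<Sum>i\<in>UNIV. \<Sum>j\<in>UNIV. b i j)"
  have B: "B \<ge> 0" unfolding B_def by (intro sum_nonneg less_imp_le b)
  have "\<bar>w (x + z) - w x - z \<bullet> grad w x\<bar> \<le> B * (norm z)\<^sup>2" for x z
  proof -
    define h h' h'' where "h \<tau> = w (x + \<tau> *\<^sub>R z)" and "h' \<tau> = (\<Sum>j\<in>UNIV. z $ j * partial j w (x + \<tau> *\<^sub>R z))"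
      and "h'' \<tau> = (\<Sum>j\<in>UNIV. z $ j * (\<Sum>i\<in>UNIV. z $ i * partial i (partial j w) (x + \<tau> *\<^sub>R z)))" for \<tau>
    have d1: "(h has_real_derivative h' \<tau>) (at \<tau>)" for \<tau>
      unfolding h_def[abs_def] h'_def by (rule DERIV_along_line) (rule C1_torusD[OF w1])
    have d2: "(h' has_real_derivative h'' \<tau>) (at \<tau>)" for \<tau>
      unfolding h'_def[abs_def] h''_def
      by (intro DERIV_sum DERIV_cmult DERIV_along_line) (rule C1_torusD[OF w2])
    have b2: "\<bar>h'' \<tau>\<bar> \<le> B * (norm z)\<^sup>2" for \<tau>
    proof -
      have "\<bar>h'' \<tau>\<bar> \<le> (\<Sum>j\<in>UNIV. \<bar>z $ j\<bar> * (\<Sum>i\<in>UNIV. \<bar>z $ i\<bar> * \<bar>partial i (partial j w) (x + \<tau> *\<^sub>R z)\<bar>))"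
        unfolding h''_def
        by (intro order_trans[OF sum_abs] sum_mono)
           (auto simp: abs_mult intro!: mult_left_mono order_trans[OF sum_abs] sum_mono)
      also have "\<dots> \<le> (\<Sum>j\<in>UNIV. norm z * (\<Sum>i\<in>UNIV. norm z * b i j))"
        by (intro sum_mono mult_mono b component_le_norm_cart sum_nonneg mult_nonneg_nonneg norm_ge_zero abs_ge_zero)
      also have "\<dots> = (norm z)\<^sup>2 * (\<Sum>j\<in>UNIV. \<Sum>i\<in>UNIV. b i j)"
        by (simp add: sum_distrib_left power2_eq_square mult.assoc)
      also have "\<dots> = B * (norm z)\<^sup>2" unfolding B_def by (subst sum.swap) simp
      finally show ?thesis .
    qed
    have s1: "\<bar>h' \<tau> - h' 0\<bar> \<le> B * (norm z)\<^sup>2" if "\<tau> \<in> {0..1}" for \<tau>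
    proof -
      have "norm (h' \<tau> - h' 0) \<le> B * (norm z)\<^sup>2 * norm (\<tau> - 0)"
        by (rule field_differentiable_bound[of UNIV _ h'']) (use d2 b2 in auto)
      also have "\<dots> \<le> B * (norm z)\<^sup>2 * 1"
        using that B by (intro mult_left_mono) auto
      finally show ?thesis by simp
    qed
    have "norm ((h 1 - 1 * h' 0) - (h 0 - 0 * h' 0)) \<le> B * (norm z)\<^sup>2 * norm (1 - 0 :: real)"
    proof (rule field_differentiable_bound[of "{0..1}" _ "\<lambda>\<tau>. h' \<tau> - h' 0"])
      show "((\<lambda>\<tau>. h \<tau> - \<tau> * h' 0) has_field_derivative h' \<tau> - h' 0) (at \<tau> within {0..1})" for \<tau>
        by (auto intro!: derivative_eq_intros has_field_derivative_at_within[OF d1])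
    qed (use s1 in auto)
    then show ?thesis by (simp add: h_def h'_def inner_grad algebra_simps)
  qed
  with B that show ?thesis by blast
qed

text \<open>Taylor's formula for small \<open>z\<close>, boundedness for the others: the compensated increments are dominated by the
weight that a Levy measure integrates.\<close>
lemma levy_integrand_bound:
  fixes w :: "real^'n::finite \<Rightarrow> real"
  assumes w: "C2_torus w"
  obtains C where "C \<ge> 0"
    "\<And>x z. \<bar>w (x + z) - w x - (z \<bullet> grad w x) * indicator {z. norm z < 1} z\<bar> \<le> C * min ((norm z)\<^sup>2) 1"
proof -
  note w1 = C1_torusD[OF C2_torusD(1)[OF w]]
  obtain C1 where C1: "C1 \<ge> 0" "\<And>x z. \<bar>w (x + z) - w x - z \<bullet> grad w x\<bar> \<le> C1 * (norm z)\<^sup>2"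
    using C2_torus_taylor[OF w] by blast
  obtain C0 where C0: "C0 > 0" "\<And>x. \<bar>w x\<bar> \<le> C0"
    using periodic_continuous_bounded[OF w1(1,4)] by blast
  have "\<bar>w (x + z) - w x - (z \<bullet> grad w x) * indicator {z. norm z < 1} z\<bar> \<le> (C1 + 2 * C0) * min ((norm z)\<^sup>2) 1" for x z
  proof (cases "norm z < 1")
    case True
    then have "(norm z)\<^sup>2 \<le> 1" by (simp add: power_le_one)
    moreover have "C1 * (norm z)\<^sup>2 \<le> (C1 + 2 * C0) * (norm z)\<^sup>2" using C0 by (intro mult_right_mono) auto
    ultimately show ?thesis using C1(2)[of x z] True by simp
  next
    case False
    then have "(norm z)\<^sup>2 \<ge> 1" by simp
    moreover have "\<bar>w (x + z) - w x\<bar> \<le> 2 * C0" using C0(2)[of x] C0(2)[of "x + z"] by linarith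
    ultimately show ?thesis using C1 False by simp
  qed
  moreover have "0 \<le> C1 + 2 * C0" using C0 C1 by simp
  ultimately show ?thesis by (rule that[rotated])
qed

context
  fixes \<mu> :: "(real^'n::finite) measure"
  assumes levy: "levy_measure \<mu>"
begin

lemma levy_sets: "sets \<mu> = sets (restrict_space borel (- {0}))"
  using levy by (simp add: levy_measure_def radon_measure_on_def)

lemma levy_space: "space \<mu> = - {0}"
  using sets_eq_imp_space_eq[OF levy_sets] by (simp add: space_restrict_space)

lemma levy_borel: "g \<in> measurable borel N \<Longrightarrow> g \<in> measurable \<mu> N"
  using measurable_restrict_space1[of g borel N "- {0}"] measurable_cong_sets[OF levy_sets refl] by blast

lemma levy_ident: "(\<lambda>z. z) \<in> measurable \<mu> borel"
  by (rule levy_borel) simp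

lemma levy_weight: "integrable \<mu> (\<lambda>z. min ((norm z)\<^sup>2) 1)"
proof (rule integrableI_nonneg)
  show "(\<lambda>z. min ((norm z)\<^sup>2) 1) \<in> borel_measurable \<mu>" by (rule levy_borel) measurable
  show "(\<integral>\<^sup>+ z. ennreal (min ((norm z)\<^sup>2) 1) \<partial>\<mu>) < \<infinity>" using levy by (simp add: levy_measure_def)
qed auto

text \<open>The restriction of the Levy measure to large jumps, transported to a finite Borel measure on the whole space so
that Fubini's theorem applies without the punctured space.\<close>
definition levy_tail :: "real \<Rightarrow> (real^'n) measure" where
  "levy_tail r = distr (density \<mu> (indicator {z. norm z > r})) borel (\<lambda>z. z)"

lemma sets_levy_tail [simp, measurable_cong]: "sets (levy_tail r) = sets borel"
  and space_levy_tail [simp]: "space (levy_tail r) = UNIV"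
  by (simp_all add: levy_tail_def)

lemma levy_ident_density: "(\<lambda>z. z) \<in> measurable (density \<mu> h) borel"
  using levy_ident by (simp add: measurable_def)

lemma levy_indicator:
   "(indicator {z. norm z > r} :: _ \<Rightarrow> ennreal) \<in> borel_measurable \<mu>"
   "(indicator {z. norm z > r} :: _ \<Rightarrow> real) \<in> borel_measurable \<mu>"
   "(indicator {z. norm z \<le> r} :: _ \<Rightarrow> real) \<in> borel_measurable \<mu>"
   "(indicator {z. norm z < r} :: _ \<Rightarrow> real) \<in> borel_measurable \<mu>"
  by (rule levy_borel, measurable)+

lemma integral_levy_tail:
  fixes g :: "real^'n \<Rightarrow> real"
  assumes [measurable]: "g \<in> borel_measurable borel"
  shows "(LINT z|levy_tail r. g z) = (LINT z:{z. norm z > r}|\<mu>. g z)"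
proof -
  have gm: "g \<in> borel_measurable \<mu>" by (rule levy_borel) simp
  have "(LINT z|levy_tail r. g z) = (LINT z|density \<mu> (indicator {z. norm z > r}). g z)"
    unfolding levy_tail_def by (rule integral_distr[OF levy_ident_density]) simp
  also have "\<dots> = (LINT z:{z. norm z > r}|\<mu>. g z)"
    unfolding set_lebesgue_integral_def ennreal_indicator[symmetric, abs_def]
    by (rule integral_density[OF gm]) (auto intro: levy_indicator)
  finally show ?thesis .
qed

lemma finite_levy_tail:
  assumes "r > 0" shows "finite_measure (levy_tail r)"
proof
  define c where "c = min (r\<^sup>2) 1"
  have c: "c > 0" using assms by (simp add: c_def)
  have "emeasure (levy_tail r) (space (levy_tail r)) = emeasure (density \<mu> (indicator {z. norm z > r})) (space \<mu>)"
    unfolding levy_tail_def by (subst emeasure_distr[OF levy_ident_density]) auto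
  also have "\<dots> = (\<integral>\<^sup>+z. indicator {z. norm z > r} z \<partial>\<mu>)"
    by (subst emeasure_density) (auto intro!: nn_integral_cong levy_indicator)
  also have "\<dots> \<le> (\<integral>\<^sup>+z. ennreal (1 / c) * ennreal (min ((norm z)\<^sup>2) 1) \<partial>\<mu>)"
  proof (rule nn_integral_mono)
    fix z :: "real^'n"
    have "1 \<le> 1 / c * min ((norm z)\<^sup>2) 1" if "norm z > r"
    proof -
      have "c \<le> min ((norm z)\<^sup>2) 1" unfolding c_def using that assms by (intro min.mono power_mono) auto
      then show ?thesis using c by (simp add: field_simps)
    qed
    then show "indicator {z. norm z > r} z \<le> ennreal (1 / c) * ennreal (min ((norm z)\<^sup>2) 1)"
      using c by (subst ennreal_mult[symmetric]) (auto simp: indicator_def)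
  qed
  also have "\<dots> = ennreal (1 / c) * (\<integral>\<^sup>+z. ennreal (min ((norm z)\<^sup>2) 1) \<partial>\<mu>)"
    by (intro nn_integral_cmult levy_borel) simp
  also have "\<dots> < \<infinity>" using levy by (simp add: levy_measure_def ennreal_mult_less_top)
  finally show "emeasure (levy_tail r) (space (levy_tail r)) \<noteq> \<infinity>" by simp
qed

text \<open>The truncated second moment of the small jumps. It controls every term that the cutoff at radius \<open>r\<close> leaves out,
and it tends to 0 with \<open>r\<close>.\<close>
definition levy_core :: "real \<Rightarrow> real" where
  "levy_core r = (LINT z|\<mu>. indicator {z. norm z \<le> r} z * min ((norm z)\<^sup>2) 1)"

lemma levy_core_int: "integrable \<mu> (\<lambda>z. indicator {z. norm z \<le> r} z * min ((norm z)\<^sup>2) 1)"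
proof (rule Bochner_Integration.integrable_bound[OF levy_weight])
  show "(\<lambda>z. indicator {z. norm z \<le> r} z * min ((norm z)\<^sup>2) 1) \<in> borel_measurable \<mu>"
    by (rule levy_borel) measurable
qed (auto simp: indicator_def intro!: always_eventually)

lemma levy_core_limit: "(\<lambda>n. levy_core (inverse (real (Suc (Suc n))))) \<longlonglongrightarrow> 0"
proof -
  have "(\<lambda>n. levy_core (inverse (real (Suc (Suc n))))) \<longlonglongrightarrow> (LINT z|\<mu>. 0)"
    unfolding levy_core_def
  proof (rule integral_dominated_convergence[OF _ _ levy_weight])
    show "AE z in \<mu>. (\<lambda>n. indicator {z. norm z \<le> inverse (real (Suc (Suc n)))} z * min ((norm z)\<^sup>2) 1) \<longlonglongrightarrow> 0"
    proof (rule AE_I2)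
      fix z assume "z \<in> space \<mu>"
      then have "norm z > 0" by (simp add: levy_space)
      have "(\<lambda>n. inverse (real (Suc (Suc n)))) \<longlonglongrightarrow> 0"
        using LIMSEQ_inverse_real_of_nat by (rule LIMSEQ_Suc)
      then have "\<forall>\<^sub>F n in sequentially. inverse (real (Suc (Suc n))) < norm z"
        using \<open>norm z > 0\<close> by (rule order_tendstoD)
      then show "(\<lambda>n. indicator {z. norm z \<le> inverse (real (Suc (Suc n)))} z * min ((norm z)\<^sup>2) 1) \<longlonglongrightarrow> 0"
        by (intro tendsto_eventually) (auto elim!: eventually_mono)
    qed
    show "AE z in \<mu>. norm (indicator {z. norm z \<le> inverse (real (Suc (Suc n)))} z * min ((norm z)\<^sup>2) 1) \<le> min ((norm z)\<^sup>2) 1" for n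
      by (auto simp: indicator_def)
  qed (auto intro!: borel_measurable_integrable levy_core_int)
  then show ?thesis by simp
qed

lemma levy_large_eq:
  assumes [measurable]: "w \<in> borel_measurable borel"
  shows "levy_large \<mu> r w x = (LINT z|levy_tail r. w (x + z) - w x)"
  unfolding levy_large_def by (subst integral_levy_tail) auto

lemma levy_drift_inner:
  assumes "r > 0"
  shows "levy_drift \<mu> r \<bullet> p = (LINT z|levy_tail r. indicator {z. norm z < 1} z * (z \<bullet> p))"
proof -
  interpret finite_measure "levy_tail r" by (rule finite_levy_tail[OF assms])
  have "levy_drift \<mu> r = (LINT z:{z. norm z > r}|\<mu>. indicator {z. norm z < 1} z *\<^sub>R z)"
    unfolding levy_drift_def set_lebesgue_integral_def
    by (intro Bochner_Integration.integral_cong) (auto simp: indicator_def)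
  also have "\<dots> = (LINT z|density \<mu> (indicator {z. norm z > r}). indicator {z. norm z < 1} z *\<^sub>R z)"
    unfolding set_lebesgue_integral_def ennreal_indicator[symmetric, abs_def]
  proof (rule integral_density[symmetric])
    show "(\<lambda>z. indicator {z. norm z < 1} z *\<^sub>R z) \<in> borel_measurable \<mu>" by (rule levy_borel) measurable
  qed (auto intro: levy_indicator)
  also have "\<dots> = (LINT z|levy_tail r. indicator {z. norm z < 1} z *\<^sub>R z)"
    unfolding levy_tail_def by (rule integral_distr[OF levy_ident_density, symmetric]) simp
  finally have "levy_drift \<mu> r \<bullet> p = (LINT z|levy_tail r. indicator {z. norm z < 1} z *\<^sub>R z) \<bullet> p" by simp
  also have "\<dots> = (LINT z|levy_tail r. (indicator {z. norm z < 1} z *\<^sub>R z) \<bullet> p)"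
  proof (rule integral_inner_left[symmetric], goal_cases)
    case 1
    have [measurable]: "(\<lambda>z :: real^'n. indicator {z. norm z < 1} z *\<^sub>R z) \<in> borel_measurable borel" by measurable
    show "integrable (levy_tail r) (\<lambda>z. indicator {z. norm z < 1} z *\<^sub>R z)"
    proof (rule integrable_const_bound[of _ 1])
      show "AE z in levy_tail r. norm (indicator {z. norm z < 1} z *\<^sub>R z) \<le> 1"
        by (auto simp: indicator_def)
    qed (simp add: measurable_cong_sets[OF sets_levy_tail refl])
  qed
  finally show ?thesis by simp
qed

text \<open>One constant serves all radii, which is what allows the limit \<open>r \<rightarrow> 0\<close> after all other estimates.\<close>
lemma levy_operators_split:
  assumes w: "C2_torus w"
  obtains C where "C \<ge> 0"
    "\<And>r x. 0 < r \<Longrightarrow> r < 1 \<Longrightarrow> \<bar>levy_op \<mu> w x - (levy_large \<mu> r w x - levy_drift \<mu> r \<bullet> grad w x)\<bar> \<le> C * levy_core r"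
    "\<And>r x. 0 < r \<Longrightarrow> r < 1 \<Longrightarrow> \<bar>levy_adj_small \<mu> r w x\<bar> \<le> C * levy_core r"
proof -
  note w1 = C1_torusD[OF C2_torusD(1)[OF w]]
  note [measurable] = w1(5)
  obtain C0 where C0: "C0 > 0" "\<And>x. \<bar>w x\<bar> \<le> C0"
    using periodic_continuous_bounded[OF w1(1,4)] by blast
  define g where "g x z = w (x + z) - w x - (z \<bullet> grad w x) * indicator {z. norm z < 1} z" for x z
  obtain C where C: "C \<ge> 0" and g: "\<And>x z. \<bar>g x z\<bar> \<le> C * min ((norm z)\<^sup>2) 1"
    using levy_integrand_bound[OF w] unfolding g_def by blast
  have gm[measurable]: "g x \<in> borel_measurable borel" for x unfolding g_def by measurable
  have gmu: "g x \<in> borel_measurable \<mu>" for x by (rule levy_borel) measurable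
  have int: "integrable \<mu> (g x)" for x
    by (rule Bochner_Integration.integrable_bound[OF integrable_mult_right[OF levy_weight, of C]])
       (use g gmu in \<open>auto intro!: always_eventually order_trans[OF g] abs_ge_self\<close>)
  have small: "\<bar>LINT z:{z. norm z \<le> r}|\<mu>. h z\<bar> \<le> C * levy_core r"
    if h: "\<And>z. \<bar>h z\<bar> \<le> C * min ((norm z)\<^sup>2) 1" and [measurable]: "h \<in> borel_measurable borel" for h r
  proof -
    have "\<bar>LINT z:{z. norm z \<le> r}|\<mu>. h z\<bar> \<le> (LINT z|\<mu>. C * (indicator {z. norm z \<le> r} z * min ((norm z)\<^sup>2) 1))"
      unfolding set_lebesgue_integral_def
      by (rule integral_abs_bound[THEN order_trans], rule integral_mono_AE'[OF integrable_mult_right[OF levy_core_int]])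
         (use h C in \<open>auto simp: indicator_def\<close>)
    then show ?thesis by (simp add: levy_core_def)
  qed
  have op: "\<bar>levy_op \<mu> w x - (levy_large \<mu> r w x - levy_drift \<mu> r \<bullet> grad w x)\<bar> \<le> C * levy_core r"
    if r: "0 < r" "r < 1" for r x
  proof -
    interpret finite_measure "levy_tail r" by (rule finite_levy_tail[OF r(1)])
    have "levy_op \<mu> w x = (LINT z|\<mu>. g x z)"
      unfolding levy_op_def set_lebesgue_integral_def g_def
      by (intro Bochner_Integration.integral_cong) (auto simp: levy_space)
    also have "\<dots> = (LINT z|\<mu>. indicator {z. norm z \<le> r} z *\<^sub>R g x z + indicator {z. norm z > r} z *\<^sub>R g x z)"
      by (intro Bochner_Integration.integral_cong) (auto simp: indicator_def)
    also have "\<dots> = (LINT z:{z. norm z \<le> r}|\<mu>. g x z) + (LINT z:{z. norm z > r}|\<mu>. g x z)"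
      unfolding set_lebesgue_integral_def
    proof (rule Bochner_Integration.integral_add)
      have "integrable \<mu> (\<lambda>z. indicator A z *\<^sub>R g x z)" if [measurable]: "A \<in> sets borel" for A
        by (rule Bochner_Integration.integrable_bound[OF int[of x] levy_borel])
           (measurable, auto simp: indicator_def)
      then show "integrable \<mu> (\<lambda>z. indicator {z. norm z \<le> r} z *\<^sub>R g x z)"
        "integrable \<mu> (\<lambda>z. indicator {z. norm z > r} z *\<^sub>R g x z)"
        by auto
    qed
    also have "(LINT z:{z. norm z > r}|\<mu>. g x z) = (LINT z|levy_tail r. g x z)"
      by (simp add: integral_levy_tail)
    also have "\<dots> = (LINT z|levy_tail r. (w (x + z) - w x) - indicator {z. norm z < 1} z * (z \<bullet> grad w x))"
      by (simp add: g_def mult.commute)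
    also have "\<dots> = levy_large \<mu> r w x - levy_drift \<mu> r \<bullet> grad w x"
      unfolding levy_large_eq[OF w1(5)] levy_drift_inner[OF r(1)]
    proof (rule Bochner_Integration.integral_diff)
      show "integrable (levy_tail r) (\<lambda>z. w (x + z) - w x)"
      proof (rule integrable_const_bound[of _ "2 * C0"])
        have "\<bar>w (x + z) - w x\<bar> \<le> 2 * C0" for z using C0(2)[of x] C0(2)[of "x + z"] by linarith
        then show "AE z in levy_tail r. norm (w (x + z) - w x) \<le> 2 * C0" by simp
        have "(\<lambda>z. w (x + z) - w x) \<in> borel_measurable borel" by measurable
        then show "(\<lambda>z. w (x + z) - w x) \<in> borel_measurable (levy_tail r)"
          by (simp add: measurable_cong_sets[OF sets_levy_tail refl])
      qed
      have "\<bar>z \<bullet> grad w x\<bar> \<le> norm (grad w x)" if "norm z < 1" for z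
        using Cauchy_Schwarz_ineq2[of z "grad w x"] mult_right_mono[of "norm z" 1 "norm (grad w x)"] that by simp
      then show "integrable (levy_tail r) (\<lambda>z. indicator {z. norm z < 1} z * (z \<bullet> grad w x))"
      proof (intro integrable_const_bound[of _ "norm (grad w x)"])
        assume *: "\<And>z. norm z < 1 \<Longrightarrow> \<bar>z \<bullet> grad w x\<bar> \<le> norm (grad w x)"
        then show "AE z in levy_tail r. norm (indicator {z. norm z < 1} z * (z \<bullet> grad w x)) \<le> norm (grad w x)"
          by (simp add: indicator_def)
        have "(\<lambda>z. indicator {z. norm z < 1} z * (z \<bullet> grad w x)) \<in> borel_measurable borel" by measurable
        then show "(\<lambda>z. indicator {z. norm z < 1} z * (z \<bullet> grad w x)) \<in> borel_measurable (levy_tail r)"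
          by (simp only: measurable_cong_sets[OF sets_levy_tail refl])
      qed
    qed
    finally have "levy_op \<mu> w x - (levy_large \<mu> r w x - levy_drift \<mu> r \<bullet> grad w x) = (LINT z:{z. norm z \<le> r}|\<mu>. g x z)"
      by simp
    then show ?thesis using small[OF g gm] by simp
  qed
  have adj: "\<bar>levy_adj_small \<mu> r w x\<bar> \<le> C * levy_core r" for r x
  proof -
    have "levy_adj_small \<mu> r w x = (LINT z:{z. norm z \<le> r}|\<mu>. g x (- z))"
      unfolding levy_adj_small_def by (simp add: g_def indicator_def)
    moreover have "\<bar>g x (- z)\<bar> \<le> C * min ((norm z)\<^sup>2) 1" for z using g[of x "- z"] by simp
    ultimately show ?thesis using small[of "\<lambda>z. g x (- z)" r] by simp
  qed
  show ?thesis using that[OF C op] adj by blast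
qed

end

section \<open>Kato and Kruzkov inequalities\<close>

text \<open>Pointwise, \<open>sgn a * (b - a) \<le> \<bar>b\<bar> - \<bar>a\<bar>\<close>; if \<open>\<bar>b\<bar>\<close> and \<open>\<bar>a\<bar>\<close> have the same weighted integral, the sum over all jumps is
nonpositive. Stated abstractly because it is used once for functions on the torus and once for functions of two
points.\<close>
lemma kato_tail:
  fixes a :: "'m \<Rightarrow> real" and as :: "'m \<Rightarrow> 'z \<Rightarrow> real" and k :: "'m \<Rightarrow> real"
  assumes "finite_measure M" "finite_measure N"
    and [measurable]: "a \<in> borel_measurable M" "k \<in> borel_measurable M" "case_prod as \<in> borel_measurable (M \<Otimes>\<^sub>M N)"
    and B: "\<And>p. \<bar>a p\<bar> \<le> B" "\<And>p z. \<bar>as p z\<bar> \<le> B" "\<And>p. 0 \<le> k p" "\<And>p. k p \<le> B'"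
    and inv: "\<And>z. (LINT p|M. k p * \<bar>as p z\<bar>) = (LINT p|M. k p * \<bar>a p\<bar>)"
  shows "(LINT p|M. k p * (sgn (a p) * (LINT z|N. as p z - a p))) \<le> 0"
proof -
  interpret M: finite_measure M by fact
  interpret N: finite_measure N by fact
  interpret P: pair_sigma_finite M N ..
  interpret PF: finite_measure "M \<Otimes>\<^sub>M N" by (rule finite_measure_pair_measure) fact+
  have int: "integrable M g" if "g \<in> borel_measurable M" "\<And>p. \<bar>g p\<bar> \<le> c" for g :: "'m \<Rightarrow> real" and c
    by (rule M.integrable_const_bound[of _ c]) (use that in auto)
  have ip: "integrable (M \<Otimes>\<^sub>M N) g" if "g \<in> borel_measurable (M \<Otimes>\<^sub>M N)" "\<And>p. \<bar>g p\<bar> \<le> c" for g :: "'m \<times> 'z \<Rightarrow> real" and c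
    by (rule PF.integrable_const_bound[of _ c]) (use that in auto)
  have B'0: "0 \<le> B'" using B(3,4)[of undefined] by linarith
  have Bk: "\<bar>k p\<bar> \<le> B'" for p using B(3,4)[of p] by simp
  have b1: "\<bar>k p * (\<bar>as p z\<bar> - \<bar>a p\<bar>)\<bar> \<le> B' * (2 * B)" for p z
    unfolding abs_mult using B(1)[of p] B(2)[of p z] by (intro mult_mono Bk B'0) auto
  have b2: "\<bar>k p * (sgn (a p) * (as p z - a p))\<bar> \<le> B' * (2 * B)" for p z
  proof -
    have "\<bar>sgn (a p) * (as p z - a p)\<bar> \<le> 2 * B"
      using B(1)[of p] B(2)[of p z] by (auto simp: sgn_if)
    then show ?thesis unfolding abs_mult[of "k p"] by (intro mult_mono Bk B'0) auto
  qed
  have b3: "\<bar>k p * \<bar>a p\<bar>\<bar> \<le> B' * B" for p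
    unfolding abs_mult using B(1)[of p] by (intro mult_mono Bk B'0) auto
  have b4: "\<bar>k p * \<bar>as p z\<bar>\<bar> \<le> B' * B" for p z
    unfolding abs_mult using B(2)[of p] by (intro mult_mono Bk B'0) auto
  have "(LINT p|M. k p * (sgn (a p) * (LINT z|N. as p z - a p)))
      = (LINT p|M. (LINT z|N. k p * (sgn (a p) * (as p z - a p))))"
    by simp
  also have "\<dots> \<le> (LINT p|M. (LINT z|N. k p * (\<bar>as p z\<bar> - \<bar>a p\<bar>)))"
  proof (rule integral_mono)
    show "integrable M (\<lambda>p. LINT z|N. k p * (sgn (a p) * (as p z - a p)))"
      by (rule P.integrable_fst) (rule ip[of _ "B' * (2 * B)"], measurable, use b2 in auto)
    show "integrable M (\<lambda>p. LINT z|N. k p * (\<bar>as p z\<bar> - \<bar>a p\<bar>))"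
      by (rule P.integrable_fst) (rule ip[of _ "B' * (2 * B)"], measurable, use b1 in auto)
    fix p assume p: "p \<in> space M"
    have m: "as p \<in> borel_measurable N"
      using measurable_Pair2[OF assms(5) p] by simp
    show "(LINT z|N. k p * (sgn (a p) * (as p z - a p))) \<le> (LINT z|N. k p * (\<bar>as p z\<bar> - \<bar>a p\<bar>))"
    proof (rule integral_mono)
      show "integrable N (\<lambda>z. k p * (sgn (a p) * (as p z - a p)))"
        by (rule N.integrable_const_bound[of _ "B' * (2 * B)"]) (use b2 m in auto)
      show "integrable N (\<lambda>z. k p * (\<bar>as p z\<bar> - \<bar>a p\<bar>))"
        by (rule N.integrable_const_bound[of _ "B' * (2 * B)"]) (use b1 m in auto)
      show "k p * (sgn (a p) * (as p z - a p)) \<le> k p * (\<bar>as p z\<bar> - \<bar>a p\<bar>)" for z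
        by (intro mult_left_mono B) (auto simp: sgn_if)
    qed
  qed
  also have "\<dots> = (LINT z|N. (LINT p|M. k p * (\<bar>as p z\<bar> - \<bar>a p\<bar>)))"
    by (rule P.Fubini_integral[symmetric]) (rule ip[of _ "B' * (2 * B)"], measurable, use b1 in auto)
  also have "\<dots> = (LINT z|N. 0)"
  proof (rule Bochner_Integration.integral_cong[OF refl])
    fix z assume z: "z \<in> space N"
    have m: "(\<lambda>p. as p z) \<in> borel_measurable M"
      using measurable_Pair1[OF assms(5) z] by simp
    have "(LINT p|M. k p * (\<bar>as p z\<bar> - \<bar>a p\<bar>)) = (LINT p|M. k p * \<bar>as p z\<bar> - k p * \<bar>a p\<bar>)"
      by (simp add: right_diff_distrib)
    also have "\<dots> = (LINT p|M. k p * \<bar>as p z\<bar>) - (LINT p|M. k p * \<bar>a p\<bar>)"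
      by (rule Bochner_Integration.integral_diff; rule int[of _ "B' * B"]) (use m b3 b4 in auto)
    finally show "(LINT p|M. k p * (\<bar>as p z\<bar> - \<bar>a p\<bar>)) = 0" using inv by simp
  qed
  finally show ?thesis by simp
qed

lemma C1_real_function:
  fixes h :: "real \<Rightarrow> real"
  assumes "Ck_on (Suc k) UNIV h"
  obtains h' where "\<And>x. (h has_real_derivative h' x) (at x)" "continuous_on UNIV h'"
proof -
  define h' where "h' x = frechet_derivative h (at x) 1" for x
  have d: "(h has_derivative frechet_derivative h (at x)) (at x)" for x
    by (rule Ck_on_SucD[OF assms]) auto
  have "(h has_real_derivative h' x) (at x)" for x
  proof (rule has_derivative_imp_has_field_derivative[OF d])
    interpret bounded_linear "frechet_derivative h (at x)" using d has_derivative_bounded_linear by blast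
    show "v * h' x = frechet_derivative h (at x) v" for v using scaleR[of v 1] by (simp add: h'_def)
  qed
  moreover have "continuous_on UNIV h'"
    using assms Ck_on_le[of k UNIV "\<lambda>x. frechet_derivative h (at x) 1" 0] by (simp add: h'_def[abs_def])
  ultimately show ?thesis using that by blast
qed

lemma C1_real_Lipschitz:
  fixes h :: "real \<Rightarrow> real"
  assumes "Ck_on (Suc k) UNIV h"
  obtains L where "L \<ge> 0" "\<And>a b. \<bar>a\<bar> \<le> B \<Longrightarrow> \<bar>b\<bar> \<le> B \<Longrightarrow> \<bar>h a - h b\<bar> \<le> L * \<bar>a - b\<bar>"
proof -
  obtain h' where h': "\<And>x. (h has_real_derivative h' x) (at x)" "continuous_on UNIV h'"
    using C1_real_function[OF assms] by blast
  have "compact (h' ` {- B..B})"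
    by (intro compact_continuous_image continuous_on_subset[OF h'(2)]) auto
  then have "\<exists>L>0. \<forall>y\<in>h' ` {- B..B}. norm y \<le> L" using compact_imp_bounded bounded_pos by blast
  then obtain L where L: "L > 0" "\<And>x. \<bar>x\<bar> \<le> B \<Longrightarrow> \<bar>h' x\<bar> \<le> L" by (auto simp: abs_le_iff)
  have "\<bar>h a - h b\<bar> \<le> L * \<bar>a - b\<bar>" if "\<bar>a\<bar> \<le> B" "\<bar>b\<bar> \<le> B" for a b
    using field_differentiable_bound[of "{- B..B}" h h' L a b] h'(1) L that
    by (auto simp: abs_le_iff has_field_derivative_at_within)
  with L that show ?thesis by (metis less_imp_le)
qed

lemma C1_torus_flux:
  assumes "C1_torus w" "Ck_on 1 UNIV (h :: real \<Rightarrow> real)"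
  shows "C1_torus (\<lambda>x. h (w x))"
proof -
  obtain h' where h': "\<And>x. (h has_real_derivative h' x) (at x)" "continuous_on UNIV h'"
    using C1_real_function[of 0 h] assms(2) by (metis One_nat_def)
  show ?thesis by (rule C1_torus_compose(1)[OF assms(1) h'])
qed

lemma C2_torus_diff:
  assumes "C2_torus w1" "C2_torus w2"
  shows "C2_torus (\<lambda>x. w1 x - w2 x)"
    and "partial j (partial j (\<lambda>x. w1 x - w2 x)) x = partial j (partial j w1) x - partial j (partial j w2) x"
proof -
  note a = C2_torusD(1)[OF assms(1)] C2_torusD(1)[OF assms(2)]
  have eq: "partial j (\<lambda>x. w1 x - w2 x) = (\<lambda>x. partial j w1 x - partial j w2 x)" for j
    using C1_torus_diff(2)[OF a] by auto
  show "C2_torus (\<lambda>x. w1 x - w2 x)"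
    using C1_torus_diff(1)[OF a] C1_torus_diff(1)[OF C2_torusD(2)[OF assms(1)] C2_torusD(2)[OF assms(2)]]
    by (auto simp: C2_torus_def eq)
  show "partial j (partial j (\<lambda>x. w1 x - w2 x)) x = partial j (partial j w1) x - partial j (partial j w2) x"
    unfolding eq by (rule C1_torus_diff(2)[OF C2_torusD(2)[OF assms(1)] C2_torusD(2)[OF assms(2)]])
qed

lemma C2_torus_const: "C2_torus (\<lambda>x :: real^'n::finite. c)"
proof -
  have "partial j (\<lambda>x :: real^'n. c) = (\<lambda>x. 0)" for j and c :: real
    using C1_torus_const(2) by auto
  then show ?thesis by (auto simp: C2_torus_def C1_torus_const(1))
qed

lemma levy_large_bounded:
  assumes "levy_measure \<mu>" "r > 0" and [measurable]: "w \<in> borel_measurable borel" and B: "\<And>x. \<bar>w x\<bar> \<le> B"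
  shows "(\<lambda>x. levy_large \<mu> r w x) \<in> borel_measurable borel"
    and "\<bar>levy_large \<mu> r w x\<bar> \<le> 2 * B * measure (levy_tail \<mu> r) UNIV"
proof -
  interpret N: finite_measure "levy_tail \<mu> r" by (rule finite_levy_tail[OF assms(1,2)])
  note [measurable_cong] = sets_levy_tail[OF assms(1)]
  have "(\<lambda>x. LINT z|levy_tail \<mu> r. w (x + z) - w x) \<in> borel_measurable borel"
    by measurable
  then show "(\<lambda>x. levy_large \<mu> r w x) \<in> borel_measurable borel"
    by (simp add: levy_large_eq[OF assms(1)])
  have b: "\<bar>w (x + z) - w x\<bar> \<le> 2 * B" for z using B[of x] B[of "x + z"] by linarith
  have "\<bar>LINT z|levy_tail \<mu> r. w (x + z) - w x\<bar> \<le> (LINT z|levy_tail \<mu> r. 2 * B)"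
    by (rule integral_abs_bound[THEN order_trans], rule integral_mono)
       (use b in \<open>auto intro!: N.integrable_const_bound[of _ "2 * B"]\<close>)
  then show "\<bar>levy_large \<mu> r w x\<bar> \<le> 2 * B * measure (levy_tail \<mu> r) UNIV"
    using space_levy_tail[OF assms(1)] by (simp add: levy_large_eq[OF assms(1)] mult.commute)
qed

lemma levy_large_difference:
  fixes U w :: "real^'n::finite \<Rightarrow> real"
  assumes levy: "levy_measure \<mu>" and r: "0 < r"
    and U: "U \<in> borel_measurable borel" "\<And>x. \<bar>U x\<bar> \<le> A" and w: "w \<in> borel_measurable borel" "\<And>x. \<bar>w x\<bar> \<le> B"
  shows "(LINT z|levy_tail \<mu> r. (U (x + z) - w (y + z)) - (U x - w y)) = levy_large \<mu> r U x - levy_large \<mu> r w y"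
proof -
  interpret N: finite_measure "levy_tail \<mu> r" by (rule finite_levy_tail[OF levy r])
  note [measurable_cong] = sets_levy_tail[OF levy]
  have i: "integrable (levy_tail \<mu> r) (\<lambda>z. v (x + z) - v x)" if [measurable]: "v \<in> borel_measurable borel" and "\<And>x. \<bar>v x\<bar> \<le> D"
    for v :: "real^'n \<Rightarrow> real" and x D
  proof (rule N.integrable_const_bound[of _ "2 * D"])
    have "\<bar>v (x + z) - v x\<bar> \<le> 2 * D" for z using that(2)[of x] that(2)[of "x + z"] by linarith
    then show "AE z in levy_tail \<mu> r. norm (v (x + z) - v x) \<le> 2 * D" by simp
  qed measurable
  show ?thesis
    using i[OF U, of x] i[OF w, of y]
    by (simp add: levy_large_eq[OF levy U(1)] levy_large_eq[OF levy w(1)] flip: Bochner_Integration.integral_diff)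
      (simp add: algebra_simps)
qed

text \<open>Two approximate solutions are subtracted and tested with \<open>\<phi> * sgn (w1 - w2)\<close>. The flux difference is Lipschitz in
\<open>w1 - w2\<close>, so \<open>integral_sgn_by_parts\<close> moves the derivatives to \<open>\<phi>\<close>; the drift is handled in the same way and the
Laplacian with Kato's inequality. The operator with the large jumps stays as it is: its sign is exploited
differently for one and for two space variables.\<close>
lemma kruzkov_pair:
  fixes f :: "real \<Rightarrow> real^'n::finite" and w1 w2 \<phi> :: "real^'n \<Rightarrow> real"
  assumes levy: "levy_measure \<mu>" and r: "0 < r" and \<epsilon>: "\<epsilon> \<ge> 0"
    and f: "\<And>j. Ck_on 1 UNIV (\<lambda>w. f w $ j)"
    and w1: "C2_torus w1" and w2: "C2_torus w2" and \<phi>: "C2_torus \<phi>" and nn: "\<And>x. \<phi> x \<ge> 0"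
    and c1: "continuous_on UNIV wt1" "periodic wt1" and c2: "continuous_on UNIV wt2" "periodic wt2"
    and E1: "AE x in torus. \<bar>wt1 x + divergence (\<lambda>y. f (w1 y)) x - \<epsilon> * laplacian w1 x
        - (levy_large \<mu> r w1 x - levy_drift \<mu> r \<bullet> grad w1 x)\<bar> \<le> E1"
    and E2: "AE x in torus. \<bar>wt2 x + divergence (\<lambda>y. f (w2 y)) x - \<epsilon> * laplacian w2 x
        - (levy_large \<mu> r w2 x - levy_drift \<mu> r \<bullet> grad w2 x)\<bar> \<le> E2"
  shows "(LINT x|torus. \<phi> x * (sgn (w1 x - w2 x) * (wt1 x - wt2 x)))
    \<le> (LINT x|torus. (\<Sum>j\<in>UNIV. partial j \<phi> x * (sgn (w1 x - w2 x) * (f (w1 x) $ j - f (w2 x) $ j)))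
        + \<phi> x * (sgn (w1 x - w2 x) * (levy_large \<mu> r w1 x - levy_large \<mu> r w2 x))
        + (levy_drift \<mu> r \<bullet> grad \<phi> x) * \<bar>w1 x - w2 x\<bar>
        + \<epsilon> * (laplacian \<phi> x * \<bar>w1 x - w2 x\<bar>) + (E1 + E2) * \<phi> x)"
proof -
  define m where "m x = w1 x - w2 x" for x
  define F where "F j x = f (w1 x) $ j - f (w2 x) $ j" for j x
  define \<gamma> where "\<gamma> = levy_drift \<mu> r"
  define Q where "Q x = levy_large \<mu> r w1 x - levy_large \<mu> r w2 x" for x
  note w11 = C2_torusD(1)[OF w1] and w21 = C2_torusD(1)[OF w2] and \<phi>1 = C2_torusD(1)[OF \<phi>]
  have m2: "C2_torus m" unfolding m_def by (rule C2_torus_diff[OF w1 w2])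
  note m1 = C2_torusD(1)[OF m2]
  note fl1 = C1_torus_flux[OF w11 f] and fl2 = C1_torus_flux[OF w21 f]
  have F1: "C1_torus (F j)" for j unfolding F_def by (rule C1_torus_diff[OF fl1 fl2])
  have pF: "partial j (F j) x = partial j (\<lambda>y. f (w1 y) $ j) x - partial j (\<lambda>y. f (w2 y) $ j) x" for j x
    unfolding F_def by (rule C1_torus_diff[OF fl1 fl2])
  have pm: "partial j m x = partial j w1 x - partial j w2 x" for j x
    unfolding m_def by (rule C1_torus_diff[OF w11 w21])
  have pm2: "partial j (partial j m) x = partial j (partial j w1) x - partial j (partial j w2) x" for j x
    unfolding m_def by (rule C2_torus_diff[OF w1 w2])
  obtain B1 where B1: "B1 > 0" "\<And>x. \<bar>w1 x\<bar> \<le> B1"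
    using periodic_continuous_bounded[OF C1_torusD(1,4)[OF w11]] by blast
  obtain B2 where B2: "B2 > 0" "\<And>x. \<bar>w2 x\<bar> \<le> B2"
    using periodic_continuous_bounded[OF C1_torusD(1,4)[OF w21]] by blast
  \<comment> \<open>This linear bound is what \<open>integral_sgn_by_parts\<close> asks for.\<close>
  have "\<exists>L. \<forall>x. \<bar>F j x\<bar> \<le> L * \<bar>m x\<bar>" for j
  proof -
    obtain L where "L \<ge> 0" "\<And>a b. \<bar>a\<bar> \<le> max B1 B2 \<Longrightarrow> \<bar>b\<bar> \<le> max B1 B2 \<Longrightarrow> \<bar>f a $ j - f b $ j\<bar> \<le> L * \<bar>a - b\<bar>"
      using C1_real_Lipschitz[of 0 "\<lambda>w. f w $ j" "max B1 B2"] f by (metis One_nat_def)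
    then show ?thesis unfolding F_def m_def using B1 B2 by (meson max.coboundedI1 max.coboundedI2)
  qed
  then obtain L where L: "\<bar>F j x\<bar> \<le> L j * \<bar>m x\<bar>" for j x by metis
  note mm = C1_torusD[OF m1] and pp = C1_torusD[OF \<phi>1]
  note cont = mm(3,4) pp(3,4) C1_torusD(3,4)[OF F1] C1_torusD(3,4)[OF C2_torusD(2)[OF m2]] C1_torusD(3,4)[OF C2_torusD(2)[OF \<phi>]]
  note per = mm(1) pp(1) C1_torusD(1)[OF F1] C1_torusD(1)[OF C2_torusD(2)[OF m2]] C1_torusD(1)[OF C2_torusD(2)[OF \<phi>]]
    periodic_partial[OF C1_torusD(1,2)[OF F1]] periodic_partial[OF C1_torusD(1,2)[OF C2_torusD(2)[OF m2]]]
    periodic_partial[OF C1_torusD(1,2)[OF C2_torusD(2)[OF \<phi>]]]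
  have meas [measurable]: "m \<in> borel_measurable borel" "\<phi> \<in> borel_measurable borel"
    "w1 \<in> borel_measurable borel" "w2 \<in> borel_measurable borel"
    using mm pp C1_torusD(5)[OF w11] C1_torusD(5)[OF w21] by auto
  \<comment> \<open>every term is a bounded factor times a continuous periodic function\<close>
  have int: "integrable torus (\<lambda>x. s x * g x)"
    if g: "continuous_on UNIV g" "periodic g" and s: "s \<in> borel_measurable borel" "\<And>x. \<bar>s x\<bar> \<le> c"
    for s g :: "real^'n \<Rightarrow> real" and c
  proof -
    obtain B where B: "B > 0" "\<And>x. \<bar>g x\<bar> \<le> B" using periodic_continuous_bounded[OF g(2,1)] by blast
    show ?thesis
    proof (rule integrable_torus_bounded[where B="c * B"])
      show "(\<lambda>x. s x * g x) \<in> borel_measurable borel"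
        using s(1) borel_measurable_continuous_onI[OF g(1)] by measurable
      show "\<bar>s x * g x\<bar> \<le> c * B" for x
        unfolding abs_mult using s(2)[of x] B by (intro mult_mono) auto
    qed
  qed
  have sm: "(\<lambda>x. sgn (m x)) \<in> borel_measurable borel" by measurable
  have sb: "\<bar>sgn (m x)\<bar> \<le> 1" for x by (simp add: abs_sgn_eq)
  note ints = int[OF _ _ sm sb]
  have Qm: "Q \<in> borel_measurable borel"
    unfolding Q_def[abs_def]
    by (intro borel_measurable_diff levy_large_bounded(1)[OF levy r meas(3) B1(2)] levy_large_bounded(1)[OF levy r meas(4) B2(2)])
  have Qb: "\<bar>Q x\<bar> \<le> 2 * B1 * measure (levy_tail \<mu> r) UNIV + 2 * B2 * measure (levy_tail \<mu> r) UNIV" for x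
    unfolding Q_def using levy_large_bounded(2)[OF levy r meas(3) B1(2), of x] levy_large_bounded(2)[OF levy r meas(4) B2(2), of x]
    by linarith
  have sQ: "(\<lambda>x. sgn (m x) * Q x) \<in> borel_measurable borel" using Qm by measurable
  have sQb: "\<bar>sgn (m x) * Q x\<bar> \<le> 2 * B1 * measure (levy_tail \<mu> r) UNIV + 2 * B2 * measure (levy_tail \<mu> r) UNIV" for x
    unfolding abs_mult using mult_mono[OF sb Qb[of x], of x] Qb[of x] by simp
  have iQ: "integrable torus (\<lambda>x. \<phi> x * (sgn (m x) * Q x))"
    using int[OF cont(4) per(2) sQ sQb] by (simp add: mult.commute)
  have iF: "integrable torus (\<lambda>x. \<phi> x * (sgn (m x) * partial j (F j) x))" for j
    using ints[of "\<lambda>x. \<phi> x * partial j (F j) x"] cont per by (simp add: mult_ac continuous_intros periodic_def)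
  have iF': "integrable torus (\<lambda>x. partial j \<phi> x * (sgn (m x) * F j x))" for j
    using ints[of "\<lambda>x. partial j \<phi> x * F j x"] cont per by (simp add: mult_ac continuous_intros periodic_def)
  have iM: "integrable torus (\<lambda>x. \<phi> x * (sgn (m x) * partial j m x))" for j
    using ints[of "\<lambda>x. \<phi> x * partial j m x"] cont per by (simp add: mult_ac continuous_intros periodic_def)
  have iM': "integrable torus (\<lambda>x. partial j \<phi> x * \<bar>m x\<bar>)" for j
    by (rule integrable_torus_continuous) (use cont per in \<open>auto simp: periodic_def intro!: continuous_intros\<close>)
  have iL: "integrable torus (\<lambda>x. \<phi> x * (sgn (m x) * partial j (partial j m) x))" for j
    using ints[of "\<lambda>x. \<phi> x * partial j (partial j m) x"] cont per by (simp add: mult_ac continuous_intros periodic_def)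
  have iL': "integrable torus (\<lambda>x. partial j (partial j \<phi>) x * \<bar>m x\<bar>)" for j
    by (rule integrable_torus_continuous) (use cont per in \<open>auto simp: periodic_def intro!: continuous_intros\<close>)
  have i\<phi>: "integrable torus \<phi>"
    by (rule integrable_torus_continuous) (use cont per in auto)
  have iT: "integrable torus (\<lambda>x. \<phi> x * (sgn (m x) * (wt1 x - wt2 x)))"
    using ints[of "\<lambda>x. \<phi> x * (wt1 x - wt2 x)"] cont per c1 c2 by (simp add: mult_ac continuous_intros periodic_def)
  have AE: "AE x in torus. \<phi> x * (sgn (m x) * (wt1 x - wt2 x))
      \<le> (- (\<Sum>j\<in>UNIV. \<phi> x * (sgn (m x) * partial j (F j) x)) + \<epsilon> * (\<Sum>j\<in>UNIV. \<phi> x * (sgn (m x) * partial j (partial j m) x)))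
        + (\<phi> x * (sgn (m x) * Q x) - (\<Sum>j\<in>UNIV. \<gamma> $ j * (\<phi> x * (sgn (m x) * partial j m x))) + (E1 + E2) * \<phi> x)"
    using E1 E2
  proof eventually_elim
    case (elim x)
    define R where "R = (wt1 x - wt2 x) + (\<Sum>j\<in>UNIV. partial j (F j) x) - \<epsilon> * (\<Sum>j\<in>UNIV. partial j (partial j m) x)
       - (Q x - (\<Sum>j\<in>UNIV. \<gamma> $ j * partial j m x))"
    have "R = (wt1 x + divergence (\<lambda>y. f (w1 y)) x - \<epsilon> * laplacian w1 x - (levy_large \<mu> r w1 x - levy_drift \<mu> r \<bullet> grad w1 x))
      - (wt2 x + divergence (\<lambda>y. f (w2 y)) x - \<epsilon> * laplacian w2 x - (levy_large \<mu> r w2 x - levy_drift \<mu> r \<bullet> grad w2 x))"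
      unfolding R_def divergence_def laplacian_def inner_grad pF pm pm2 Q_def \<gamma>_def
      by (simp add: sum_subtractf algebra_simps)
    then have R: "\<bar>R\<bar> \<le> E1 + E2" using elim by linarith
    have "\<phi> x * (sgn (m x) * R) \<le> \<phi> x * (E1 + E2)"
    proof (intro mult_left_mono nn)
      show "sgn (m x) * R \<le> E1 + E2" using R by (auto simp: sgn_if)
    qed
    moreover have "\<phi> x * (sgn (m x) * R) = \<phi> x * (sgn (m x) * (wt1 x - wt2 x))
       + (\<Sum>j\<in>UNIV. \<phi> x * (sgn (m x) * partial j (F j) x)) - \<epsilon> * (\<Sum>j\<in>UNIV. \<phi> x * (sgn (m x) * partial j (partial j m) x))
       - (\<phi> x * (sgn (m x) * Q x) - (\<Sum>j\<in>UNIV. \<gamma> $ j * (\<phi> x * (sgn (m x) * partial j m x))))"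
      unfolding R_def by (simp add: algebra_simps sum_distrib_left)
    ultimately show ?case by (simp add: algebra_simps)
  qed
  have "(LINT x|torus. \<phi> x * (sgn (m x) * (wt1 x - wt2 x)))
      \<le> (LINT x|torus. (- (\<Sum>j\<in>UNIV. \<phi> x * (sgn (m x) * partial j (F j) x)) + \<epsilon> * (\<Sum>j\<in>UNIV. \<phi> x * (sgn (m x) * partial j (partial j m) x)))
        + (\<phi> x * (sgn (m x) * Q x) - (\<Sum>j\<in>UNIV. \<gamma> $ j * (\<phi> x * (sgn (m x) * partial j m x))) + (E1 + E2) * \<phi> x))"
    by (rule integral_mono_AE[OF iT _ AE])
       (intro Bochner_Integration.integrable_add Bochner_Integration.integrable_diff Bochner_Integration.integrable_minus
          Bochner_Integration.integrable_sum integrable_mult_right iF iL iQ iM i\<phi>)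
  also have "\<dots> = - (\<Sum>j\<in>UNIV. LINT x|torus. \<phi> x * (sgn (m x) * partial j (F j) x))
      + \<epsilon> * (\<Sum>j\<in>UNIV. LINT x|torus. \<phi> x * (sgn (m x) * partial j (partial j m) x))
      + ((LINT x|torus. \<phi> x * (sgn (m x) * Q x)) - (\<Sum>j\<in>UNIV. \<gamma> $ j * (LINT x|torus. \<phi> x * (sgn (m x) * partial j m x))) + (E1 + E2) * (LINT x|torus. \<phi> x))"
    using iF iL iQ iM i\<phi> by (simp add: Bochner_Integration.integral_sum)
  also have "\<dots> \<le> (\<Sum>j\<in>UNIV. LINT x|torus. partial j \<phi> x * (sgn (m x) * F j x))
      + \<epsilon> * (\<Sum>j\<in>UNIV. LINT x|torus. partial j (partial j \<phi>) x * \<bar>m x\<bar>)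
      + ((LINT x|torus. \<phi> x * (sgn (m x) * Q x)) + (\<Sum>j\<in>UNIV. \<gamma> $ j * (LINT x|torus. partial j \<phi> x * \<bar>m x\<bar>)) + (E1 + E2) * (LINT x|torus. \<phi> x))"
  proof -
    have 1: "(LINT x|torus. \<phi> x * (sgn (m x) * partial j (F j) x)) = - (LINT x|torus. partial j \<phi> x * (sgn (m x) * F j x))" for j
      by (rule integral_sgn_by_parts[OF \<phi>1 m1 F1 L])
    have 2: "(LINT x|torus. \<phi> x * (sgn (m x) * partial j m x)) = - (LINT x|torus. partial j \<phi> x * \<bar>m x\<bar>)" for j
      using integral_sgn_by_parts[OF \<phi>1 m1 m1, of 1 j] by (simp add: abs_sgn mult.commute)
    have 3: "(\<Sum>j\<in>UNIV. LINT x|torus. \<phi> x * (sgn (m x) * partial j (partial j m) x))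
        \<le> (\<Sum>j\<in>UNIV. LINT x|torus. partial j (partial j \<phi>) x * \<bar>m x\<bar>)"
      by (intro sum_mono integral_sgn_second_derivative_le[OF \<phi> m2 nn])
    show ?thesis unfolding 1 2 using mult_left_mono[OF 3 \<epsilon>] by (simp add: sum_negf)
  qed
  also have "\<dots> = (LINT x|torus. (\<Sum>j\<in>UNIV. partial j \<phi> x * (sgn (m x) * F j x))
        + \<phi> x * (sgn (m x) * Q x)
        + (\<Sum>j\<in>UNIV. \<gamma> $ j * (partial j \<phi> x * \<bar>m x\<bar>))
        + \<epsilon> * (\<Sum>j\<in>UNIV. partial j (partial j \<phi>) x * \<bar>m x\<bar>) + (E1 + E2) * \<phi> x)"
    using iF' iL' iQ iM' i\<phi> by (simp add: Bochner_Integration.integral_sum)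
  also have "\<dots> = (LINT x|torus. (\<Sum>j\<in>UNIV. partial j \<phi> x * (sgn (m x) * F j x))
        + \<phi> x * (sgn (m x) * Q x) + (\<gamma> \<bullet> grad \<phi> x) * \<bar>m x\<bar>
        + \<epsilon> * (laplacian \<phi> x * \<bar>m x\<bar>) + (E1 + E2) * \<phi> x)"
    by (simp add: inner_grad laplacian_def sum_distrib_right mult.assoc)
  finally show ?thesis by (simp add: m_def F_def Q_def \<gamma>_def)
qed

section \<open>Viscous flows\<close>

text \<open>Everything that the comparison arguments use of a viscous solution, with the time derivative as an explicit second
function. No initial datum occurs, so that the notion is invariant under translation in space, and the zero function is
an instance.\<close>
definition viscous_flow ::
  "real \<Rightarrow> (real^'n::finite) measure \<Rightarrow> (real \<Rightarrow> real^'n) \<Rightarrow> real \<Rightarrow>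
   (real \<Rightarrow> real^'n \<Rightarrow> real) \<Rightarrow> (real \<Rightarrow> real^'n \<Rightarrow> real) \<Rightarrow> bool" where
  "viscous_flow T \<mu> f \<epsilon> v v' \<longleftrightarrow>
     (\<lambda>(t, x). v t x) \<in> borel_measurable borel \<and> (\<lambda>(t, x). v' t x) \<in> borel_measurable borel \<and>
     (\<forall>t\<in>{0<..<T}. C2_torus (v t) \<and> continuous_on UNIV (v' t) \<and> periodic (v' t) \<and>
        (\<forall>x. ((\<lambda>s. v s x) has_real_derivative v' t x) (at t)) \<and>
        (AE x in torus. v' t x + divergence (\<lambda>y. f (v t y)) x = levy_op \<mu> (v t) x + \<epsilon> * laplacian (v t) x)) \<and>
     (\<forall>x. continuous_on {0<..<T} (\<lambda>t. v' t x)) \<and>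
     (\<forall>a b. 0 < a \<longrightarrow> b < T \<longrightarrow> (\<exists>B. \<forall>t\<in>{a..b}. \<forall>x. \<bar>v t x\<bar> \<le> B \<and> \<bar>v' t x\<bar> \<le> B))"

lemma continuous_slices_bounded:
  fixes g :: "real \<Rightarrow> real^'n::finite \<Rightarrow> real"
  assumes c: "continuous_on ({0<..<T} \<times> UNIV) (\<lambda>(t, x). g t x)"
    and per: "\<And>t. t \<in> {0<..<T} \<Longrightarrow> periodic (g t)" and ab: "0 < a" "b < T"
  shows "\<exists>B. \<forall>t\<in>{a..b}. \<forall>x. \<bar>g t x\<bar> \<le> B"
proof -
  define Q :: "(real^'n) set" where "Q = cbox 0 (\<chi> j. 2 * pi)"
  have "compact ((\<lambda>(t, x). g t x) ` ({a..b} \<times> Q))"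
    by (intro compact_continuous_image continuous_on_subset[OF c] compact_Times)
       (use ab in \<open>auto simp: Q_def\<close>)
  then have "\<exists>B>0. \<forall>y\<in>(\<lambda>(t, x). g t x) ` ({a..b} \<times> Q). norm y \<le> B"
    using compact_imp_bounded bounded_pos by blast
  then have "\<exists>B. \<forall>t\<in>{a..b}. \<forall>x\<in>Q. \<bar>g t x\<bar> \<le> B" by auto
  then obtain B where B: "\<And>t x. t \<in> {a..b} \<Longrightarrow> x \<in> Q \<Longrightarrow> \<bar>g t x\<bar> \<le> B" by blast
  have "\<bar>g t x\<bar> \<le> B" if t: "t \<in> {a..b}" for t x
  proof -
    define y where "y = x + (\<chi> j. 2 * pi * of_int (- \<lfloor>x $ j / (2 * pi)\<rfloor>))"
    have "0 \<le> y $ j \<and> y $ j \<le> 2 * pi" for j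
    proof -
      define k :: real where "k = of_int \<lfloor>x $ j / (2 * pi)\<rfloor>"
      have "k \<le> x $ j / (2 * pi)" "x $ j / (2 * pi) < k + 1"
        using floor_correct[of "x $ j / (2 * pi)"] by (auto simp: k_def)
      then have "k * (2 * pi) \<le> x $ j" "x $ j < (k + 1) * (2 * pi)"
        by (simp_all add: pos_le_divide_eq pos_divide_less_eq)
      then show ?thesis unfolding y_def k_def by (simp add: algebra_simps)
    qed
    then have "y \<in> Q" by (simp add: Q_def mem_box_cart)
    moreover have "g t y = g t x" unfolding y_def
      by (rule periodic_lattice) (use per t ab in auto)
    ultimately show ?thesis using B[OF t] by metis
  qed
  then show ?thesis by blast
qed

lemma AE_torus_periodic:
  fixes P :: "real^'n::finite \<Rightarrow> bool"
  assumes "\<And>x. x \<in> cell \<Longrightarrow> P x" and per: "periodic P"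
  shows "AE x in torus. P (x + h)"
proof -
  define G :: "real^'n \<Rightarrow> bool" where "G x \<longleftrightarrow> (\<forall>j. \<forall>k::int. x $ j \<noteq> 2 * pi * of_int k)" for x
  have "periodic G"
  proof -
    have "G (x + axis i (2 * pi)) = G x" for x :: "real^'n" and i
    proof -
      have "(x + axis i (2 * pi)) $ j = x $ j + 2 * pi * of_int (if i = j then 1 else 0)" for j
        by (simp add: axis_def)
      then have eq: "G (x + axis i (2 * pi)) \<longleftrightarrow> (\<forall>j. \<forall>k::int. x $ j + 2 * pi * of_int (if i = j then 1 else 0) \<noteq> 2 * pi * of_int k)"
        by (simp add: G_def)
      have st: "(\<forall>k::int. x $ j + 2 * pi * of_int l \<noteq> 2 * pi * of_int k) \<longleftrightarrow> (\<forall>k::int. x $ j \<noteq> 2 * pi * of_int k)" for j l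
      proof -
        have "x $ j + 2 * pi * of_int l = 2 * pi * of_int k \<longleftrightarrow> x $ j = 2 * pi * of_int (k - l)" for k
          by (auto simp: algebra_simps)
        then show ?thesis by (metis add_diff_cancel_right')
      qed
      show ?thesis unfolding eq unfolding G_def by (rule arg_cong[where f=All], rule ext, rule st)
    qed
    then show ?thesis by (simp add: periodic_def)
  qed
  moreover have "AE x in torus. G x"
    unfolding AE_torus
  proof (intro always_eventually allI impI)
    fix x :: "real^'n" assume x: "x \<in> cell"
    show "G x" unfolding G_def
    proof (intro allI notI)
      fix j and k :: int assume k: "x $ j = 2 * pi * of_int k"
      have "0 < x $ j" "x $ j < 2 * pi" using x by (auto simp: cell_def mem_box_cart)
      then have "0 < real_of_int k" "real_of_int k < 1" unfolding k by (auto simp: zero_less_mult_iff)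
      then have "0 < k" "k < 1" by simp_all
      then show False by linarith
    qed
  qed
  moreover have "Measurable.pred borel G" unfolding G_def by measurable
  ultimately have "AE x in torus. G (x + h)" by (intro AE_torus_shift) auto
  moreover have "P y" if "G y" for y
  proof -
    define z where "z = y + (\<chi> j. 2 * pi * of_int (- \<lfloor>y $ j / (2 * pi)\<rfloor>))"
    have "0 < z $ j \<and> z $ j < 2 * pi" for j
    proof -
      define k :: int where "k = \<lfloor>y $ j / (2 * pi)\<rfloor>"
      have "of_int k \<le> y $ j / (2 * pi)" "y $ j / (2 * pi) < of_int k + 1"
        using floor_correct[of "y $ j / (2 * pi)"] by (auto simp: k_def)
      then have "of_int k * (2 * pi) \<le> y $ j" "y $ j < (of_int k + 1) * (2 * pi)"
        by (simp_all add: pos_le_divide_eq pos_divide_less_eq)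
      moreover have "y $ j \<noteq> 2 * pi * of_int k" using that by (simp add: G_def)
      moreover have "z $ j = y $ j - 2 * pi * of_int k" by (simp add: z_def k_def)
      ultimately show ?thesis by (simp add: algebra_simps)
    qed
    then have "z \<in> cell" by (simp add: cell_def mem_box_cart)
    moreover have "P z = P y" unfolding z_def by (rule periodic_lattice[OF per])
    ultimately show ?thesis using assms(1) by simp
  qed
  ultimately show ?thesis by (auto elim: eventually_mono)
qed

lemma C2_torus_shift:
  assumes "C2_torus w" shows "C2_torus (\<lambda>x. w (x + h))"
    and "partial j (\<lambda>x. w (x + h)) x = partial j w (x + h)"
    and "laplacian (\<lambda>x. w (x + h)) x = laplacian w (x + h)"
    and "levy_op \<mu> (\<lambda>x. w (x + h)) x = levy_op \<mu> w (x + h)"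
proof -
  note w1 = C2_torusD(1)[OF assms] and w2 = C2_torusD(2)[OF assms]
  have p: "partial j (\<lambda>x. w (x + h)) = (\<lambda>x. partial j w (x + h))" for j
    using partial_shift(2)[OF C1_torusD(2)[OF w1]] by auto
  have p2: "partial i (partial j (\<lambda>x. w (x + h))) x = partial i (partial j w) (x + h)" for i j x
    unfolding p by (rule partial_shift(2)[OF C1_torusD(2)[OF w2]])
  show "partial j (\<lambda>x. w (x + h)) x = partial j w (x + h)" by (simp add: p)
  show "C2_torus (\<lambda>x. w (x + h))"
    by (auto simp: C2_torus_def p intro: C1_torus_shift w1 w2)
  show "laplacian (\<lambda>x. w (x + h)) x = laplacian w (x + h)"
    by (simp add: laplacian_def p2)
  have "grad (\<lambda>x. w (x + h)) x = grad w (x + h)" by (simp add: grad_def p vec_eq_iff)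
  then show "levy_op \<mu> (\<lambda>x. w (x + h)) x = levy_op \<mu> w (x + h)"
    by (simp add: levy_op_def add_ac)
qed

text \<open>Outside the open time interval nothing is known of the solution, so it is replaced by 0 there. The equation is given on
the cell; periodicity of both sides extends it to almost every point of every translate.\<close>
lemma viscous_solution_flow:
  fixes f :: "real \<Rightarrow> real^'n::finite"
  assumes sol: "viscous_solution T \<mu> f u0 \<epsilon> v" and f: "\<And>j. Ck_on 1 UNIV (\<lambda>w. f w $ j)"
  obtains v' where "\<And>h. viscous_flow T \<mu> f \<epsilon>
      (\<lambda>t x. indicator {0<..<T} t * v t (x + h)) (\<lambda>t x. indicator {0<..<T} t * v' t (x + h))"
proof -
  define v' where "v' t x = deriv (\<lambda>s. v s x) t" for t x
  let ?S = "{0<..<T} \<times> (UNIV :: (real^'n) set)"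
  have openS: "open ?S" by (intro open_Times) auto
  have C1: "Ck_on 1 ?S (\<lambda>(t, x). v t x)" and C2: "\<And>t. t \<in> {0<..<T} \<Longrightarrow> Ck_on 2 UNIV (v t)"
    and per: "\<And>t. t \<in> {0<..<T} \<Longrightarrow> periodic (v t)"
    and eq: "\<And>t x. t \<in> {0<..<T} \<Longrightarrow> x \<in> cell \<Longrightarrow> v' t x + divergence (\<lambda>y. f (v t y)) x = levy_op \<mu> (v t) x + \<epsilon> * laplacian (v t) x"
    using sol by (auto simp: viscous_solution_def v'_def)
  have C2t: "C2_torus (v t)" if "t \<in> {0<..<T}" for t using Ck_on_imp_C2_torus C2 per that by blast
  let ?g = "\<lambda>(t, x). v t x"
  have C1': "Ck_on (Suc 0) ?S ?g" using C1 by simp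
  have cv: "continuous_on ?S ?g" using Ck_on_decrease[OF C1'] by simp
  have der: "((\<lambda>s. v s x) has_real_derivative frechet_derivative ?g (at (t, x)) (1, 0)) (at t)"
    if t: "t \<in> {0<..<T}" for t x
  proof -
    have d: "(?g has_derivative frechet_derivative ?g (at (t, x))) (at (t, x))"
      by (rule Ck_on_SucD[OF C1' openS]) (use t in auto)
    have "((\<lambda>s. (s, x)) has_derivative (\<lambda>s. (s, 0))) (at t)" by (auto intro!: derivative_eq_intros)
    from has_derivative_compose[OF this d]
    have "((\<lambda>s. v s x) has_derivative (\<lambda>s. frechet_derivative ?g (at (t, x)) (s, 0))) (at t)" by simp
    then show ?thesis
    proof (rule has_derivative_imp_has_field_derivative)
      fix s
      interpret bounded_linear "frechet_derivative ?g (at (t, x))" using d has_derivative_bounded_linear by blast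
      show "s * frechet_derivative ?g (at (t, x)) (1, 0) = frechet_derivative ?g (at (t, x)) (s, 0)"
        using scaleR[of s "(1, 0)"] by simp
    qed
  qed
  then have v'_eq: "v' t x = frechet_derivative ?g (at (t, x)) (1, 0)" if "t \<in> {0<..<T}" for t x
    unfolding v'_def using that by (intro DERIV_imp_deriv) auto
  have der': "((\<lambda>s. v s x) has_real_derivative v' t x) (at t)" if "t \<in> {0<..<T}" for t x
    using der v'_eq that by simp
  have "continuous_on ?S (\<lambda>p. frechet_derivative ?g (at p) (1, 0))" using C1' by simp
  then have cv': "continuous_on ?S (\<lambda>(t, x). v' t x)"
    by (rule continuous_on_cong[THEN iffD1, rotated -1, OF _ refl]) (use v'_eq in auto)
  have per': "periodic (v' t)" if t: "t \<in> {0<..<T}" for t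
    unfolding periodic_def
  proof (intro allI)
    fix x j
    have "((\<lambda>s. v s (x + axis j (2 * pi))) has_real_derivative v' t x) (at t)"
    proof (rule DERIV_cong_ev[THEN iffD1, OF refl _ refl, OF _ der'[OF t]])
      have "\<forall>\<^sub>F s in nhds t. s \<in> {0<..<T}" using t by (intro eventually_nhds_in_open) auto
      then show "\<forall>\<^sub>F s in nhds t. v s x = v s (x + axis j (2 * pi))"
        by eventually_elim (use per in \<open>simp add: periodic_def\<close>)
    qed
    with der'[OF t] show "v' t (x + axis j (2 * pi)) = v' t x" using DERIV_unique by blast
  qed
  have slice: "continuous_on UNIV (v' t)" if "t \<in> {0<..<T}" for t
  proof -
    have "continuous_on UNIV (\<lambda>x. (\<lambda>(t, x). v' t x) (t, x))"
      by (rule continuous_on_compose2[OF cv']) (use that in \<open>auto intro!: continuous_intros\<close>)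
    then show ?thesis by simp
  qed
  have slice': "continuous_on {0<..<T} (\<lambda>t. v' t x)" for x
  proof -
    have "continuous_on {0<..<T} (\<lambda>t. (\<lambda>(t, x). v' t x) (t, x))"
      by (rule continuous_on_compose2[OF cv']) (auto intro!: continuous_intros)
    then show ?thesis by simp
  qed
  have meas: "(\<lambda>(t, x). indicator {0<..<T} t * g t (x + h)) \<in> borel_measurable borel"
    if "continuous_on ?S (\<lambda>(t, x). g t x)" for g :: "real \<Rightarrow> real^'n \<Rightarrow> real" and h
  proof -
    have "continuous_on ?S (\<lambda>p. (\<lambda>(t, x). g t x) (fst p, snd p + h))"
      by (rule continuous_on_compose2[OF that]) (auto intro!: continuous_intros)
    from borel_measurable_continuous_on_indicator[OF _ this] openS
    have "(\<lambda>p. indicator ?S p *\<^sub>R (\<lambda>(t, x). g t x) (fst p, snd p + h)) \<in> borel_measurable borel" by auto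
    also have "(\<lambda>p. indicator ?S p *\<^sub>R (\<lambda>(t, x). g t x) (fst p, snd p + h)) = (\<lambda>(t, x). indicator {0<..<T} t * g t (x + h))"
      by (auto simp: indicator_def)
    finally show ?thesis .
  qed
  have flow: "viscous_flow T \<mu> f \<epsilon> (\<lambda>t x. indicator {0<..<T} t * v t (x + h)) (\<lambda>t x. indicator {0<..<T} t * v' t (x + h))" for h
    unfolding viscous_flow_def
  proof (intro conjI ballI allI impI)
    show "(\<lambda>(t, x). indicator {0<..<T} t * v t (x + h)) \<in> borel_measurable borel" by (rule meas[OF cv])
    show "(\<lambda>(t, x). indicator {0<..<T} t * v' t (x + h)) \<in> borel_measurable borel" by (rule meas[OF cv'])
    fix t assume t: "t \<in> {0<..<T}"
    then have ind: "indicator {0<..<T} t = (1::real)" by simp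
    note S = C2_torus_shift[OF C2t[OF t], where h=h]
    show "C2_torus (\<lambda>x. indicator {0<..<T} t * v t (x + h))" using S(1) by (simp add: ind)
    show "continuous_on UNIV (\<lambda>x. indicator {0<..<T} t * v' t (x + h))"
      unfolding ind mult_1 by (rule continuous_on_compose2[OF slice[OF t]]) (auto intro!: continuous_intros)
    show "periodic (\<lambda>x. indicator {0<..<T} t * v' t (x + h))"
      unfolding ind mult_1 by (rule periodic_shift[OF per'[OF t]])
    show "((\<lambda>s. indicator {0<..<T} s * v s (x + h)) has_real_derivative indicator {0<..<T} t * v' t (x + h)) (at t)" for x
      unfolding ind mult_1
    proof (rule DERIV_cong_ev[THEN iffD1, OF refl _ refl, OF _ der'[OF t]])
      have "\<forall>\<^sub>F s in nhds t. s \<in> {0<..<T}" using t by (intro eventually_nhds_in_open) auto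
      then show "\<forall>\<^sub>F s in nhds t. v s (x + h) = indicator {0<..<T} s * v s (x + h)"
        by eventually_elim simp
    qed
    define P where "P x \<longleftrightarrow> v' t x + divergence (\<lambda>y. f (v t y)) x = levy_op \<mu> (v t) x + \<epsilon> * laplacian (v t) x" for x
    have dshift: "divergence (\<lambda>y. f (v t (y + a))) x = divergence (\<lambda>y. f (v t y)) (x + a)" for a x
      unfolding divergence_def
      by (intro sum.cong refl partial_shift(2) C1_torusD(2)[OF C1_torus_flux[OF C2_torusD(1)[OF C2t[OF t]] f]])
    have "periodic P"
    proof -
      have "P (x + axis i (2 * pi)) = P x" for x i
      proof -
        have e: "v t (y + axis i (2 * pi)) = v t y" for y using per[OF t] by (simp add: periodic_def)
        then have "(\<lambda>y. v t (y + axis i (2 * pi))) = v t" by auto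
        moreover have "divergence (\<lambda>y. f (v t y)) (x + axis i (2 * pi)) = divergence (\<lambda>y. f (v t y)) x"
          using dshift[of "axis i (2 * pi)" x] by (simp add: e)
        moreover have "v' t (x + axis i (2 * pi)) = v' t x" using per'[OF t] by (simp add: periodic_def)
        ultimately show ?thesis
          unfolding P_def using C2_torus_shift(3,4)[OF C2t[OF t], where h="axis i (2 * pi)" and x=x]
          by simp
      qed
      then show ?thesis by (simp add: periodic_def)
    qed
    then have "AE x in torus. P (x + h)" by (rule AE_torus_periodic[rotated]) (use eq[OF t] in \<open>auto simp: P_def\<close>)
    then show "AE x in torus. indicator {0<..<T} t * v' t (x + h) + divergence (\<lambda>y. f (indicator {0<..<T} t * v t (y + h))) x
        = levy_op \<mu> (\<lambda>x. indicator {0<..<T} t * v t (x + h)) x + \<epsilon> * laplacian (\<lambda>x. indicator {0<..<T} t * v t (x + h)) x"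
      unfolding ind mult_1 P_def S(3,4) dshift .
  next
    show "continuous_on {0<..<T} (\<lambda>t. indicator {0<..<T} t * v' t (x + h))" for x
      by (rule continuous_on_cong[THEN iffD1, OF refl _ slice'[of "x + h"]]) simp
    fix a b :: real assume ab: "0 < a" "b < T"
    obtain B1 where B1: "\<forall>t\<in>{a..b}. \<forall>x. \<bar>v t x\<bar> \<le> B1" using continuous_slices_bounded[OF cv per ab] by blast
    obtain B2 where B2: "\<forall>t\<in>{a..b}. \<forall>x. \<bar>v' t x\<bar> \<le> B2" using continuous_slices_bounded[OF cv' per' ab] by blast
    show "\<exists>B. \<forall>t\<in>{a..b}. \<forall>x. \<bar>indicator {0<..<T} t * v t (x + h)\<bar> \<le> B \<and> \<bar>indicator {0<..<T} t * v' t (x + h)\<bar> \<le> B"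
    proof (intro exI[of _ "max B1 B2"] ballI allI)
      fix t x assume t: "t \<in> {a..b}"
      then have "indicator {0<..<T} t = (1::real)" using ab by simp
      then show "\<bar>indicator {0<..<T} t * v t (x + h)\<bar> \<le> max B1 B2 \<and> \<bar>indicator {0<..<T} t * v' t (x + h)\<bar> \<le> max B1 B2"
        using B1 B2 t by (simp add: le_max_iff_disj)
    qed
  qed
  then show ?thesis by (rule that)
qed

lemma viscous_flow_zero: "viscous_flow T \<mu> f \<epsilon> (\<lambda>t x. 0) (\<lambda>t x. 0)"
proof -
  have g: "grad (\<lambda>x :: real^'n::finite. 0) x = 0" for x
    by (simp add: grad_def vec_eq_iff C1_torus_const(2))
  have p: "partial j (\<lambda>x :: real^'n::finite. 0) = (\<lambda>x. 0)" for j using C1_torus_const(2) by auto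
  show ?thesis
    unfolding viscous_flow_def
    by (auto simp: C2_torus_const periodic_const divergence_def laplacian_def levy_op_def g p C1_torus_const(2))
qed

section \<open>Contraction of viscous flows\<close>

text \<open>Lebesgue measure on a time interval, as a finite measure on all reals: together with \<open>torus\<close> this puts every space-time
integral on one product of finite measures.\<close>
definition timespan :: "real \<Rightarrow> real \<Rightarrow> real measure" where
  "timespan a b = density lborel (indicator {a..b})"

lemma sets_timespan [simp, measurable_cong]: "sets (timespan a b) = sets borel"
  and space_timespan [simp]: "space (timespan a b) = UNIV"
  by (simp_all add: timespan_def)

lemma integral_timespan:
  fixes g :: "real \<Rightarrow> real"
  assumes [measurable]: "g \<in> borel_measurable borel"
  shows "(LINT t|timespan a b. g t) = (LINT t:{a..b}|lborel. g t)"
  unfolding timespan_def set_lebesgue_integral_def ennreal_indicator[symmetric, abs_def]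
  by (subst integral_density) auto

lemma AE_timespan: "(AE t in timespan a b. P t) \<longleftrightarrow> (AE t in lborel. t \<in> {a..b} \<longrightarrow> P t)"
  unfolding timespan_def by (subst AE_density) (auto simp: indicator_def)

lemma AE_timespanI: "(\<And>t. a \<le> t \<Longrightarrow> t \<le> b \<Longrightarrow> P t) \<Longrightarrow> AE t in timespan a b. P t"
  unfolding AE_timespan by auto

lemma emeasure_timespan: "a \<le> b \<Longrightarrow> emeasure (timespan a b) UNIV = ennreal (b - a)"
  unfolding timespan_def by (subst emeasure_density) auto

interpretation timespan: finite_measure "timespan a b"
  by standard (cases "a \<le> b"; simp add: emeasure_timespan; simp add: timespan_def emeasure_density)

lemma pair_torus:
  "pair_sigma_finite (timespan a b) (torus :: (real^'n::finite) measure)"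
  "finite_measure (timespan a b \<Otimes>\<^sub>M (torus :: (real^'n::finite) measure))"
  "finite_measure ((torus :: (real^'n::finite) measure) \<Otimes>\<^sub>M (torus :: (real^'n::finite) measure))"
  "pair_sigma_finite (torus :: (real^'n::finite) measure) (torus :: (real^'n::finite) measure)"
  by (auto intro!: finite_measure_pair_measure timespan.finite_measure_axioms torus.finite_measure_axioms
      simp: pair_sigma_finite_def timespan.sigma_finite_measure_axioms torus.sigma_finite_measure_axioms)

lemma viscous_flowD:
  assumes "viscous_flow T \<mu> f \<epsilon> v v'"
  shows "(\<lambda>(t, x). v t x) \<in> borel_measurable borel" "(\<lambda>(t, x). v' t x) \<in> borel_measurable borel"
    "t \<in> {0<..<T} \<Longrightarrow> C2_torus (v t)" "t \<in> {0<..<T} \<Longrightarrow> continuous_on UNIV (v' t)"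
    "t \<in> {0<..<T} \<Longrightarrow> periodic (v' t)"
    "t \<in> {0<..<T} \<Longrightarrow> ((\<lambda>s. v s x) has_real_derivative v' t x) (at t)"
    "t \<in> {0<..<T} \<Longrightarrow> AE x in torus. v' t x + divergence (\<lambda>y. f (v t y)) x = levy_op \<mu> (v t) x + \<epsilon> * laplacian (v t) x"
    "continuous_on {0<..<T} (\<lambda>t. v' t x)"
    "0 < a \<Longrightarrow> b < T \<Longrightarrow> \<exists>B. \<forall>t\<in>{a..b}. \<forall>x. \<bar>v t x\<bar> \<le> B \<and> \<bar>v' t x\<bar> \<le> B"
  using assms unfolding viscous_flow_def by blast+

text \<open>The viscous equation with the singular operator replaced by its large jumps and a drift. The error is uniform in
space.\<close>
lemma viscous_flow_residual:
  assumes flow: "viscous_flow T \<mu> f \<epsilon> v v'" and t: "t \<in> {0<..<T}" and levy: "levy_measure \<mu>"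
  shows "\<exists>C\<ge>0. \<forall>r. 0 < r \<longrightarrow> r < 1 \<longrightarrow> (AE x in torus. \<bar>v' t x + divergence (\<lambda>y. f (v t y)) x - \<epsilon> * laplacian (v t) x
        - (levy_large \<mu> r (v t) x - levy_drift \<mu> r \<bullet> grad (v t) x)\<bar> \<le> C * levy_core \<mu> r)"
proof -
  obtain C where C: "C \<ge> 0" "\<And>r x. 0 < r \<Longrightarrow> r < 1 \<Longrightarrow>
      \<bar>levy_op \<mu> (v t) x - (levy_large \<mu> r (v t) x - levy_drift \<mu> r \<bullet> grad (v t) x)\<bar> \<le> C * levy_core \<mu> r"
    using levy_operators_split[OF levy viscous_flowD(3)[OF flow t]] by metis
  show ?thesis
  proof (intro exI[of _ C] conjI allI impI C(1))
    fix r :: real assume r: "0 < r" "r < 1"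
    show "AE x in torus. \<bar>v' t x + divergence (\<lambda>y. f (v t y)) x - \<epsilon> * laplacian (v t) x
        - (levy_large \<mu> r (v t) x - levy_drift \<mu> r \<bullet> grad (v t) x)\<bar> \<le> C * levy_core \<mu> r"
      using viscous_flowD(7)[OF flow t]
    proof eventually_elim
      case (elim x)
      then show ?case using C(2)[OF r, of x] by (simp add: algebra_simps)
    qed
  qed
qed

definition cutoff_radius :: "nat \<Rightarrow> real" where "cutoff_radius n = inverse (real (Suc (Suc n)))"

lemma cutoff_radius: "0 < cutoff_radius n" "cutoff_radius n < 1"
  "levy_measure \<mu> \<Longrightarrow> (\<lambda>n. levy_core \<mu> (cutoff_radius n)) \<longlonglongrightarrow> 0"
  using levy_core_limit[of \<mu>] by (simp_all add: cutoff_radius_def inverse_less_1_iff)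

lemma levy_large_sgn_le:
  fixes w1 w2 :: "real^'n::finite \<Rightarrow> real"
  assumes levy: "levy_measure \<mu>" and r: "0 < r" and w: "C1_torus w1" "C1_torus w2"
  shows "(LINT x|torus. sgn (w1 x - w2 x) * (levy_large \<mu> r w1 x - levy_large \<mu> r w2 x)) \<le> 0"
proof -
  interpret N: finite_measure "levy_tail \<mu> r" by (rule finite_levy_tail[OF levy r])
  note [measurable_cong] = sets_levy_tail[OF levy]
  note a = C1_torusD[OF w(1)] and b = C1_torusD[OF w(2)]
  note [measurable] = a(5) b(5)
  obtain A where A: "A > 0" "\<And>x. \<bar>w1 x\<bar> \<le> A" using periodic_continuous_bounded[OF a(1,4)] by blast
  obtain B where B: "B > 0" "\<And>x. \<bar>w2 x\<bar> \<le> B" using periodic_continuous_bounded[OF b(1,4)] by blast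
  have AB: "\<bar>w1 x - w2 x\<bar> \<le> A + B" for x using A(2)[of x] B(2)[of x] by linarith
  have per: "periodic (\<lambda>x. \<bar>w1 x - w2 x\<bar>)" using a(1) b(1) by (simp add: periodic_def)
  have "(LINT x|torus. 1 * (sgn (w1 x - w2 x) * (LINT z|levy_tail \<mu> r. (w1 (x + z) - w2 (x + z)) - (w1 x - w2 x)))) \<le> 0"
  proof (rule kato_tail[where B="A + B" and B'=1])
    show "(LINT x|torus. 1 * \<bar>w1 (x + z) - w2 (x + z)\<bar>) = (LINT x|torus. 1 * \<bar>w1 x - w2 x\<bar>)" for z
      using integral_torus_shift(2)[OF _ per, of z] by simp
  qed (use AB in \<open>auto intro: torus.finite_measure_axioms N.finite_measure_axioms\<close>)
  then show ?thesis by (simp add: levy_large_difference[OF levy r a(5) A(2) b(5) B(2)])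
qed

text \<open>The inequality \<open>kruzkov_pair\<close> with \<open>\<phi> = 1\<close>: all terms with derivatives of \<open>\<phi>\<close> vanish, the large jumps have the good
sign, and the error disappears as the cutoff radius tends to 0.\<close>
lemma viscous_flow_dissipation:
  fixes f :: "real \<Rightarrow> real^'n::finite"
  assumes levy: "levy_measure \<mu>" and f: "\<And>j. Ck_on 1 UNIV (\<lambda>w. f w $ j)" and \<epsilon>: "\<epsilon> \<ge> 0"
    and v: "viscous_flow T \<mu> f \<epsilon> v v'" and w: "viscous_flow T \<mu> f \<epsilon> w w'" and t: "t \<in> {0<..<T}"
  shows "(LINT x|torus. sgn (v t x - w t x) * (v' t x - w' t x)) \<le> 0"
proof -
  note V = viscous_flowD[OF v] and W = viscous_flowD[OF w]
  obtain C1 where "C1 \<ge> 0" and C1: "\<And>r. 0 < r \<Longrightarrow> r < 1 \<Longrightarrow> AE x in torus. \<bar>v' t x + divergence (\<lambda>y. f (v t y)) x - \<epsilon> * laplacian (v t) x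
        - (levy_large \<mu> r (v t) x - levy_drift \<mu> r \<bullet> grad (v t) x)\<bar> \<le> C1 * levy_core \<mu> r"
    using viscous_flow_residual[OF v t levy] by blast
  obtain C2 where "C2 \<ge> 0" and C2: "\<And>r. 0 < r \<Longrightarrow> r < 1 \<Longrightarrow> AE x in torus. \<bar>w' t x + divergence (\<lambda>y. f (w t y)) x - \<epsilon> * laplacian (w t) x
        - (levy_large \<mu> r (w t) x - levy_drift \<mu> r \<bullet> grad (w t) x)\<bar> \<le> C2 * levy_core \<mu> r"
    using viscous_flow_residual[OF w t levy] by blast
  define M where "M = measure (torus :: (real^'n) measure) UNIV"
  have one: "C2_torus (\<lambda>x :: real^'n. 1)" by (rule C2_torus_const)
  have p0: "partial j (\<lambda>x :: real^'n. 1) = (\<lambda>x. 0)" "partial j (\<lambda>x :: real^'n. 0) = (\<lambda>x. 0)" for j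
    using C1_torus_const(2) by auto
  have z: "grad (\<lambda>x :: real^'n. 1) x = 0" "laplacian (\<lambda>x :: real^'n. 1) x = 0" for x
    by (simp_all add: grad_def laplacian_def p0 vec_eq_iff)
  have bound: "(LINT x|torus. sgn (v t x - w t x) * (v' t x - w' t x)) \<le> (C1 + C2) * M * levy_core \<mu> (cutoff_radius n)" for n
  proof -
    define r where "r = cutoff_radius n"
    have r: "0 < r" "r < 1" using cutoff_radius by (auto simp: r_def)
    note k = kruzkov_pair[OF levy r(1) \<epsilon> f V(3)[OF t] W(3)[OF t] one _ V(4,5)[OF t] W(4,5)[OF t] C1[OF r] C2[OF r]]
    let ?Q = "\<lambda>x. sgn (v t x - w t x) * (levy_large \<mu> r (v t) x - levy_large \<mu> r (w t) x)"
    have "(LINT x|torus. sgn (v t x - w t x) * (v' t x - w' t x)) \<le> (LINT x|torus. ?Q x + (C1 * levy_core \<mu> r + C2 * levy_core \<mu> r))"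
      using k by (simp add: p0 z)
    also have "\<dots> = (LINT x|torus. ?Q x) + (C1 + C2) * levy_core \<mu> r * M"
    proof -
      note cv = C1_torusD[OF C2_torusD(1)[OF V(3)[OF t]]] and cw = C1_torusD[OF C2_torusD(1)[OF W(3)[OF t]]]
      obtain A where A: "A > 0" "\<And>x. \<bar>v t x\<bar> \<le> A" using periodic_continuous_bounded[OF cv(1,4)] by blast
      obtain B where B: "B > 0" "\<And>x. \<bar>w t x\<bar> \<le> B" using periodic_continuous_bounded[OF cw(1,4)] by blast
      note la = levy_large_bounded[OF levy r(1) cv(5) A(2)] and lb = levy_large_bounded[OF levy r(1) cw(5) B(2)]
      note [measurable] = la(1) lb(1) cv(5) cw(5)
      have iQ: "integrable torus ?Q"
      proof (rule integrable_torus_bounded)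
        show "?Q \<in> borel_measurable borel" by measurable
        show "\<bar>?Q x\<bar> \<le> 2 * A * measure (levy_tail \<mu> r) UNIV + 2 * B * measure (levy_tail \<mu> r) UNIV" for x
          using la(2)[of x] lb(2)[of x] by (auto simp: sgn_if)
      qed
      have "(LINT x|torus. ?Q x + (C1 * levy_core \<mu> r + C2 * levy_core \<mu> r))
          = (LINT x|torus. ?Q x) + (LINT x|(torus :: (real^'n) measure). C1 * levy_core \<mu> r + C2 * levy_core \<mu> r)"
        by (rule Bochner_Integration.integral_add[OF iQ]) simp
      also have "(LINT x|(torus :: (real^'n) measure). C1 * levy_core \<mu> r + C2 * levy_core \<mu> r) = (C1 + C2) * levy_core \<mu> r * M"
        by (simp add: M_def algebra_simps)
      finally show ?thesis .
    qed
    also have "\<dots> \<le> 0 + (C1 + C2) * levy_core \<mu> r * M"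
      by (intro add_mono levy_large_sgn_le[OF levy r(1)] C2_torusD V(3) W(3) t order_refl)
    finally show ?thesis by (simp add: r_def mult_ac)
  qed
  have "(\<lambda>n. (C1 + C2) * M * levy_core \<mu> (cutoff_radius n)) \<longlonglongrightarrow> (C1 + C2) * M * 0"
    by (intro tendsto_intros cutoff_radius levy)
  then show ?thesis using bound LIMSEQ_le_const by fastforce
qed

lemma integral_abs_increment:
  fixes a a' :: "real \<Rightarrow> 'm \<Rightarrow> real" and k :: "'m \<Rightarrow> real" and \<rho> \<rho>' :: "real \<Rightarrow> real"
  assumes M: "finite_measure M" and s: "s1 \<le> s2"
    and m [measurable]: "(\<lambda>(s, p). a s p) \<in> borel_measurable (borel \<Otimes>\<^sub>M M)" "(\<lambda>(s, p). a' s p) \<in> borel_measurable (borel \<Otimes>\<^sub>M M)"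
      "k \<in> borel_measurable M"
    and B: "\<And>s p. s \<in> {s1..s2} \<Longrightarrow> \<bar>a s p\<bar> \<le> B \<and> \<bar>a' s p\<bar> \<le> B" "\<And>p. \<bar>k p\<bar> \<le> B'"
    and d: "\<And>s p. s \<in> {s1..s2} \<Longrightarrow> ((\<lambda>s. a s p) has_real_derivative a' s p) (at s)"
    and c: "\<And>p. continuous_on {s1..s2} (\<lambda>s. a' s p)"
    and \<rho>: "\<And>s. (\<rho> has_real_derivative \<rho>' s) (at s)" "continuous_on UNIV \<rho>'"
  shows "\<rho> s2 * (LINT p|M. k p * \<bar>a s2 p\<bar>) - \<rho> s1 * (LINT p|M. k p * \<bar>a s1 p\<bar>)
    = (LINT s|timespan s1 s2. \<rho>' s * (LINT p|M. k p * \<bar>a s p\<bar>) + \<rho> s * (LINT p|M. k p * (sgn (a s p) * a' s p)))"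
proof -
  interpret M: finite_measure M by fact
  interpret P: pair_sigma_finite "timespan s1 s2" M ..
  interpret PF: finite_measure "timespan s1 s2 \<Otimes>\<^sub>M M"
    by (intro finite_measure_pair_measure timespan.finite_measure_axioms M)
  have [measurable]: "(\<lambda>p. a s p) \<in> borel_measurable M" "(\<lambda>p. a' s p) \<in> borel_measurable M" for s
    using measurable_Pair2[OF m(1), of s] measurable_Pair2[OF m(2), of s] by simp_all
  have ma: "(\<lambda>s. a s p) \<in> borel_measurable borel" "(\<lambda>s. a' s p) \<in> borel_measurable borel" if "p \<in> space M" for p
    using measurable_Pair1[OF m(1) that] measurable_Pair1[OF m(2) that] by simp_all
  have c\<rho>: "continuous_on A \<rho>" "continuous_on A \<rho>'" for A
  proof -
    show "continuous_on A \<rho>"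
      using \<rho>(1) by (intro continuous_at_imp_continuous_on ballI DERIV_isCont)
    show "continuous_on A \<rho>'" by (rule continuous_on_subset[OF \<rho>(2)]) simp
  qed
  have [measurable]: "\<rho> \<in> borel_measurable borel" "\<rho>' \<in> borel_measurable borel"
    using c\<rho> by (auto intro: borel_measurable_continuous_onI)
  have "compact (\<rho> ` {s1..s2})" "compact (\<rho>' ` {s1..s2})"
    by (intro compact_continuous_image c\<rho> compact_Icc)+
  then have "\<exists>b>0. \<forall>y\<in>\<rho> ` {s1..s2}. norm y \<le> b" "\<exists>b>0. \<forall>y\<in>\<rho>' ` {s1..s2}. norm y \<le> b"
    using compact_imp_bounded bounded_pos by blast+
  then obtain b b' where b: "b > 0" "\<And>s. s \<in> {s1..s2} \<Longrightarrow> \<bar>\<rho> s\<bar> \<le> b" and b': "b' > 0" "\<And>s. s \<in> {s1..s2} \<Longrightarrow> \<bar>\<rho>' s\<bar> \<le> b'"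
    by auto
  have k1: "\<bar>k p * \<bar>a s p\<bar>\<bar> \<le> B' * B" if "s \<in> {s1..s2}" for s p
    unfolding abs_mult using B(1)[OF that, of p] B(2)[of p] by (intro mult_mono) auto
  have k2: "\<bar>k p * (sgn (a s p) * a' s p)\<bar> \<le> B' * B" if "s \<in> {s1..s2}" for s p
  proof -
    have "\<bar>sgn (a s p) * a' s p\<bar> \<le> B" using B(1)[OF that, of p] by (auto simp: sgn_if)
    then show ?thesis unfolding abs_mult[of "k p"] using B(2)[of p] by (intro mult_mono) auto
  qed
  have i1: "integrable M (\<lambda>p. k p * \<bar>a s p\<bar>)" if "s \<in> {s1..s2}" for s
    by (rule M.integrable_const_bound[of _ "B' * B"]) (use k1[OF that] in auto)
  have i2: "integrable M (\<lambda>p. k p * (sgn (a s p) * a' s p))" if "s \<in> {s1..s2}" for s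
    by (rule M.integrable_const_bound[of _ "B' * B"]) (use k2[OF that] in auto)
  let ?I = "\<lambda>s p. \<rho>' s * (k p * \<bar>a s p\<bar>) + \<rho> s * (k p * (sgn (a s p) * a' s p))"
  have "\<rho> s2 * (LINT p|M. k p * \<bar>a s2 p\<bar>) - \<rho> s1 * (LINT p|M. k p * \<bar>a s1 p\<bar>)
      = (LINT p|M. \<rho> s2 * (k p * \<bar>a s2 p\<bar>) - \<rho> s1 * (k p * \<bar>a s1 p\<bar>))"
    using s i1[of s1] i1[of s2] by simp
  also have "\<dots> = (LINT p|M. (LINT s|timespan s1 s2. ?I s p))"
  proof (rule Bochner_Integration.integral_cong[OF refl])
    fix p assume p: "p \<in> space M"
    note [measurable] = ma[OF p]
    have "\<rho> s2 * \<bar>a s2 p\<bar> - \<rho> s1 * \<bar>a s1 p\<bar> = (LINT s:{s1..s2}|lborel. \<rho>' s * \<bar>a s p\<bar> + \<rho> s * (sgn (a s p) * a' s p))"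
      by (rule abs_increment_eq_integral[OF s _ _ \<rho>]) (use d c in auto)
    also have "\<dots> = (LINT s|timespan s1 s2. \<rho>' s * \<bar>a s p\<bar> + \<rho> s * (sgn (a s p) * a' s p))"
      by (rule integral_timespan[symmetric]) measurable
    finally have "k p * (\<rho> s2 * \<bar>a s2 p\<bar> - \<rho> s1 * \<bar>a s1 p\<bar>)
        = (LINT s|timespan s1 s2. k p * (\<rho>' s * \<bar>a s p\<bar> + \<rho> s * (sgn (a s p) * a' s p)))"
      by simp
    then show "\<rho> s2 * (k p * \<bar>a s2 p\<bar>) - \<rho> s1 * (k p * \<bar>a s1 p\<bar>) = (LINT s|timespan s1 s2. ?I s p)"
      by (simp add: right_diff_distrib distrib_left mult.left_commute[of "k p"])
  qed
  also have "\<dots> = (LINT s|timespan s1 s2. (LINT p|M. ?I s p))"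
  proof (rule P.Fubini_integral)
    show "integrable (timespan s1 s2 \<Otimes>\<^sub>M M) (\<lambda>(s, p). ?I s p)"
    proof (rule PF.integrable_const_bound[of _ "b' * (B' * B) + b * (B' * B)"])
      have bd: "\<bar>?I s p\<bar> \<le> b' * (B' * B) + b * (B' * B)" if "s \<in> {s1..s2}" for s p
        by (intro order_trans[OF abs_triangle_ineq] add_mono)
           (unfold abs_mult[of "\<rho> s"] abs_mult[of "\<rho>' s"],
            (intro mult_mono b(2) b'(2) k1 k2 that; use b b' in simp)+)
      have "AE s in timespan s1 s2. AE p in M. \<bar>?I s p\<bar> \<le> b' * (B' * B) + b * (B' * B)"
        by (rule AE_timespanI) (use bd in auto)
      then show "AE x in timespan s1 s2 \<Otimes>\<^sub>M M. norm (case x of (s, p) \<Rightarrow> ?I s p) \<le> b' * (B' * B) + b * (B' * B)"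
      proof (intro P.AE_pair_measure)
        show "{x \<in> space (timespan s1 s2 \<Otimes>\<^sub>M M). norm (case x of (s, p) \<Rightarrow> ?I s p) \<le> b' * (B' * B) + b * (B' * B)}
            \<in> sets (timespan s1 s2 \<Otimes>\<^sub>M M)" by measurable
      qed simp
    qed measurable
  qed
  also have "\<dots> = (LINT s|timespan s1 s2. \<rho>' s * (LINT p|M. k p * \<bar>a s p\<bar>) + \<rho> s * (LINT p|M. k p * (sgn (a s p) * a' s p)))"
  proof (rule integral_cong_AE)
    show "AE s in timespan s1 s2. (LINT p|M. ?I s p) = \<rho>' s * (LINT p|M. k p * \<bar>a s p\<bar>) + \<rho> s * (LINT p|M. k p * (sgn (a s p) * a' s p))"
      by (rule AE_timespanI) (use i1 i2 in simp)
  qed measurable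
  finally show ?thesis .
qed

text \<open>Two flows of the same equation come no farther apart in \<open>L1\<close>. This is used for a solution and its translate, and for
a solution and zero.\<close>
lemma viscous_flow_contraction:
  fixes f :: "real \<Rightarrow> real^'n::finite"
  assumes levy: "levy_measure \<mu>" and f: "\<And>j. Ck_on 1 UNIV (\<lambda>w. f w $ j)" and \<epsilon>: "\<epsilon> \<ge> 0"
    and v: "viscous_flow T \<mu> f \<epsilon> v v'" and w: "viscous_flow T \<mu> f \<epsilon> w w'"
    and t: "0 < t1" "t1 \<le> t2" "t2 < T"
  shows "(LINT x|torus. \<bar>v t2 x - w t2 x\<bar>) \<le> (LINT x|torus. \<bar>v t1 x - w t1 x\<bar>)"
proof -
  note V = viscous_flowD[OF v] and W = viscous_flowD[OF w]
  have eq: "borel_measurable (borel \<Otimes>\<^sub>M torus) = borel_measurable (borel :: (real \<times> (real^'n)) measure)"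
    unfolding borel_prod[symmetric] by (intro measurable_cong_sets sets_pair_measure_cong) auto
  have m1: "(\<lambda>(s, p). v s p - w s p) \<in> borel_measurable (borel \<Otimes>\<^sub>M torus)"
    unfolding eq split_beta' using V(1) W(1) by (intro borel_measurable_diff) (simp_all add: split_beta')
  have m2: "(\<lambda>(s, p). v' s p - w' s p) \<in> borel_measurable (borel \<Otimes>\<^sub>M torus)"
    unfolding eq split_beta' using V(2) W(2) by (intro borel_measurable_diff) (simp_all add: split_beta')
  obtain A where A: "\<forall>t\<in>{t1..t2}. \<forall>x. \<bar>v t x\<bar> \<le> A \<and> \<bar>v' t x\<bar> \<le> A" using V(9)[of t1 t2] t by auto
  obtain B where B: "\<forall>t\<in>{t1..t2}. \<forall>x. \<bar>w t x\<bar> \<le> B \<and> \<bar>w' t x\<bar> \<le> B" using W(9)[of t1 t2] t by auto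
  have "1 * (LINT x|torus. 1 * \<bar>v t2 x - w t2 x\<bar>) - 1 * (LINT x|torus. 1 * \<bar>v t1 x - w t1 x\<bar>)
      = (LINT s|timespan t1 t2. 0 * (LINT x|torus. 1 * \<bar>v s x - w s x\<bar>) + 1 * (LINT x|torus. 1 * (sgn (v s x - w s x) * (v' s x - w' s x))))"
  proof (rule integral_abs_increment[OF torus.finite_measure_axioms t(2) m1 m2, where B="A + B" and B'=1])
    show "\<bar>v s p - w s p\<bar> \<le> A + B \<and> \<bar>v' s p - w' s p\<bar> \<le> A + B" if "s \<in> {t1..t2}" for s p
      using A B that by (smt (verit))
    show "((\<lambda>s. v s p - w s p) has_real_derivative v' s p - w' s p) (at s)" if "s \<in> {t1..t2}" for s p
      using that t by (intro DERIV_diff V(6) W(6)) auto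
    show "continuous_on {t1..t2} (\<lambda>s. v' s p - w' s p)" for p
      using t by (intro continuous_intros continuous_on_subset[OF V(8)] continuous_on_subset[OF W(8)]) auto
  qed auto
  also have "\<dots> \<le> 0"
  proof -
    have "0 \<le> (LINT s|timespan t1 t2. - (0 * (LINT x|torus. 1 * \<bar>v s x - w s x\<bar>) + 1 * (LINT x|torus. 1 * (sgn (v s x - w s x) * (v' s x - w' s x)))))"
      using t viscous_flow_dissipation[OF levy f \<epsilon> v w]
      by (intro integral_nonneg_AE AE_timespanI) auto
    then show ?thesis by simp
  qed
  finally show ?thesis by simp
qed

section \<open>Translations of functions of bounded variation\<close>

lemma real_polynomial_C1:
  fixes p :: "real^'n::finite \<Rightarrow> real"
  assumes "real_polynomial_function p"
  shows "Ck_on k UNIV p"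
  using assms
proof (induction rule: real_polynomial_function.induct)
  case (linear g)
  have "Ck_on k UNIV (\<lambda>x :: real. x)"
  proof (cases k)
    case (Suc k')
    show ?thesis unfolding Suc
      by (rule Ck_on_SucI[where f'="\<lambda>_ v. v"]) (auto intro: Ck_on_const)
  qed auto
  from Ck_on_affine[OF open_UNIV linear this, of 0] show ?case by simp
qed (auto intro: Ck_on_const Ck_on_add Ck_on_mult)

text \<open>The shift by 1 keeps the closed support at distance \<open>1 / m\<close> from the faces of the box.\<close>
definition box_cutoff :: "real^'n::finite \<Rightarrow> real^'n \<Rightarrow> nat \<Rightarrow> real^'n \<Rightarrow> real" where
  "box_cutoff a b m x = (\<Prod>j\<in>UNIV. smooth_step (real m * (x $ j - a $ j) - 1) * smooth_step (real m * (b $ j - x $ j) - 1))"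

lemma box_cutoff_range: "0 \<le> box_cutoff a b m x" "box_cutoff a b m x \<le> 1"
  unfolding box_cutoff_def
  by (auto intro!: prod_nonneg prod_le_1 mult_nonneg_nonneg mult_le_one smooth_step_range)

lemma Ck_on_box_cutoff: "Ck_on k UNIV (box_cutoff a b m)"
proof -
  have 1: "Ck_on k UNIV (\<lambda>x :: real^'n. smooth_step (real m * x $ j + c))" for j c
    using Ck_on_affine[OF open_UNIV bounded_linear_const_mult[OF bounded_linear_vec_nth] Ck_on_smooth_step] .
  have 2: "Ck_on k UNIV (\<lambda>x :: real^'n. smooth_step ((- real m) * x $ j + c))" for j c
    using Ck_on_affine[OF open_UNIV bounded_linear_const_mult[OF bounded_linear_vec_nth] Ck_on_smooth_step] .
  have "Ck_on k UNIV (\<lambda>x. \<Prod>j\<in>UNIV. smooth_step (real m * x $ j + (- real m * a $ j - 1)) * smooth_step ((- real m) * x $ j + (real m * b $ j - 1)))"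
    by (intro Ck_on_prod Ck_on_mult 1 2) auto
  then show ?thesis by (simp add: box_cutoff_def[abs_def] algebra_simps)
qed

lemma box_cutoff_support:
  assumes "m > 0" shows "closure {x. box_cutoff a b m x \<noteq> 0} \<subseteq> box a b"
proof -
  define Q where "Q = cbox (\<chi> j. a $ j + 1 / real m) (\<chi> j. b $ j - 1 / real m)"
  have "{x. box_cutoff a b m x \<noteq> 0} \<subseteq> Q"
  proof
    fix x assume x: "x \<in> {x. box_cutoff a b m x \<noteq> 0}"
    have "a $ j + 1 / real m \<le> x $ j \<and> x $ j \<le> b $ j - 1 / real m" for j
    proof -
      have "smooth_step (real m * (x $ j - a $ j) - 1) \<noteq> 0" "smooth_step (real m * (b $ j - x $ j) - 1) \<noteq> 0"
        using x by (auto simp: box_cutoff_def)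
      then have "real m * (x $ j - a $ j) - 1 > 0" "real m * (b $ j - x $ j) - 1 > 0"
        using smooth_step_eq_0 by (meson not_le)+
      then show ?thesis using assms by (simp add: field_simps)
    qed
    then show "x \<in> Q" by (simp add: Q_def mem_box_cart)
  qed
  then have "closure {x. box_cutoff a b m x \<noteq> 0} \<subseteq> Q"
    by (intro closure_minimal) (auto simp: Q_def)
  also have "Q \<subseteq> box a b"
  proof
    fix x assume "x \<in> Q"
    then have x: "a $ j + 1 / real m \<le> x $ j" "x $ j \<le> b $ j - 1 / real m" for j
      by (auto simp: Q_def mem_box_cart)
    have "1 / real m > 0" using assms by simp
    then have "a $ j < x $ j \<and> x $ j < b $ j" for j
      using x[of j] by linarith
    then show "x \<in> box a b" by (simp add: mem_box_cart)
  qed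
  finally show ?thesis .
qed

lemma box_cutoff_limit:
  assumes "x \<in> box a b" shows "(\<lambda>m. box_cutoff a b m x) \<longlonglongrightarrow> 1"
proof (rule tendsto_eventually)
  define d where "d j = min (x $ j - a $ j) (b $ j - x $ j)" for j
  have d: "d j > 0" for j using assms by (auto simp: d_def mem_box_cart)
  have "\<forall>\<^sub>F m in sequentially. 2 / d j \<le> real m" for j
    by (rule eventually_sequentiallyI[of "nat \<lceil>2 / d j\<rceil>"]) linarith
  then have "\<forall>\<^sub>F m in sequentially. \<forall>j. 2 / d j \<le> real m" by (simp add: eventually_all_finite)
  then show "\<forall>\<^sub>F m in sequentially. box_cutoff a b m x = 1"
  proof eventually_elim
    case (elim m)
    have "smooth_step (real m * (x $ j - a $ j) - 1) * smooth_step (real m * (b $ j - x $ j) - 1) = 1" for j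
    proof -
      have "2 \<le> real m * d j" using spec[OF elim, of j] d[of j] by (simp add: pos_divide_le_eq)
      moreover have "real m * d j \<le> real m * (x $ j - a $ j)" "real m * d j \<le> real m * (b $ j - x $ j)"
        by (intro mult_left_mono; simp add: d_def)+
      ultimately show ?thesis by (simp add: smooth_step_eq_1)
    qed
    then show ?case by (simp add: box_cutoff_def)
  qed
qed

text \<open>Write the translation as the integral of the derivative along the segment from \<open>0\<close> to \<open>h\<close>. By Fubini each point of the
segment contributes an integral of \<open>w\<close> against the divergence of an admissible field, namely a translate of \<open>g\<close> times
the unit vector \<open>- h / norm h\<close>.\<close>
lemma BV_test_translation:
  fixes w g :: "real^'n::finite \<Rightarrow> real"
  assumes [measurable]: "w \<in> borel_measurable borel" and wB: "\<And>x. \<bar>w x\<bar> \<le> B"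
    and M: "\<And>\<psi> :: real^'n \<Rightarrow> real^'n. Ck_on 1 UNIV \<psi> \<Longrightarrow> closure {x. \<psi> x \<noteq> 0} \<subseteq> cell \<Longrightarrow> (\<And>x. norm (\<psi> x) \<le> 1) \<Longrightarrow>
        (LINT x:cell|lborel. w x * divergence \<psi> x) \<le> M"
    and g: "Ck_on 1 UNIV g" "\<And>x. \<bar>g x\<bar> \<le> 1" "closure {x. g x \<noteq> 0} \<subseteq> box a b" "bounded (box a b)"
    and box: "\<And>x s. x \<in> box a b \<Longrightarrow> 0 \<le> s \<Longrightarrow> s \<le> 1 \<Longrightarrow> x + s *\<^sub>R h \<in> cell"
  shows "(LINT x|lborel. (w (x + h) - w x) * g x) \<le> M * norm h"
proof (cases "h = 0")
  case True
  then show ?thesis by simp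
next
  case False
  interpret P: pair_sigma_finite "timespan 0 1" "torus :: (real^'n) measure" by (rule pair_torus)
  interpret PF: finite_measure "timespan 0 1 \<Otimes>\<^sub>M (torus :: (real^'n) measure)" by (rule pair_torus)
  have g1: "Ck_on (Suc 0) UNIV g" using g(1) by simp
  have gd: "g differentiable (at x)" for x using Ck_on_SucD[OF g1, of x] differentiableI by auto
  have gc: "continuous_on UNIV g" using Ck_on_decrease[OF g1] by simp
  have pc: "continuous_on UNIV (partial j g)" for j using g1 by (simp add: partial_def[abs_def])
  have [measurable]: "g \<in> borel_measurable borel" "partial j g \<in> borel_measurable borel" for j
    using gc pc by (auto intro: borel_measurable_continuous_onI)
  define D where "D x = (\<Sum>j\<in>UNIV. h $ j * partial j g x)" for x
  have Dc: "continuous_on UNIV D" unfolding D_def by (intro continuous_intros pc)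
  have [measurable]: "D \<in> borel_measurable borel" using Dc by (rule borel_measurable_continuous_onI)
  define K where "K = closure {x. g x \<noteq> 0}"
  have g0: "g x = 0" if "x \<notin> K" for x
    using that closure_subset[of "{x. g x \<noteq> 0}"] by (auto simp: K_def)
  have D0: "D x = 0" if x: "x \<notin> K" for x
  proof -
    have "partial j g x = 0" for j
    proof -
      have "((\<lambda>y. 0) has_derivative (\<lambda>v. 0)) (at x)" by simp
      then have "(g has_derivative (\<lambda>v. 0)) (at x)"
      proof (rule has_derivative_transform_within_open)
        show "open (- K)" unfolding K_def by (rule open_Compl) (rule closed_closure)
      qed (use x g0 in auto)
      from partial_eq[OF this] show ?thesis by simp
    qed
    then show ?thesis by (simp add: D_def)
  qed
  have Kc: "compact K"
    unfolding K_def compact_closure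
    by (rule bounded_subset[OF g(4) order_trans[OF closure_subset g(3)]])
  have "compact (D ` K)" using Kc Dc by (intro compact_continuous_image) (auto intro: continuous_on_subset)
  then have "\<exists>b>0. \<forall>y\<in>D ` K. norm y \<le> b" using compact_imp_bounded bounded_pos by blast
  then obtain d where "d > 0" "\<And>x. x \<in> K \<Longrightarrow> \<bar>D x\<bar> \<le> d" by auto
  then have d: "d > 0" "\<bar>D x\<bar> \<le> d" for x using D0[of x] by (cases "x \<in> K"; force)+
  have cell0: "x - s *\<^sub>R h \<notin> K" if "x \<notin> cell" "0 \<le> s" "s \<le> 1" for x s
    using box[of "x - s *\<^sub>R h" s] that g(3) by (auto simp: K_def)
  have B: "B \<ge> 0" using wB[of 0] by linarith
  have wg: "\<bar>w x * g y\<bar> \<le> B" for x y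
    unfolding abs_mult using mult_mono[OF wB[of x] g(2)[of y]] B by simp
  have wD: "\<bar>w x * (- D y)\<bar> \<le> B * d" for x y
    unfolding abs_mult using mult_mono[OF wB[of x] d(2)[of y]] B by simp
  have tor: "(LINT x|lborel. w x * g (x - s *\<^sub>R h)) = (LINT x|torus. w x * g (x - s *\<^sub>R h))"
    and tor_int: "integrable lborel (\<lambda>x. w x * g (x - s *\<^sub>R h))" if "0 \<le> s" "s \<le> 1" for s
  proof -
    have "w x * g (x - s *\<^sub>R h) = indicator cell x *\<^sub>R (w x * g (x - s *\<^sub>R h))" for x
      using g0 cell0[of x s] that by (cases "x \<in> cell") auto
    then have eq: "(\<lambda>x. w x * g (x - s *\<^sub>R h)) = (\<lambda>x. indicator cell x *\<^sub>R (w x * g (x - s *\<^sub>R h)))" by (rule ext)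
    show "(LINT x|lborel. w x * g (x - s *\<^sub>R h)) = (LINT x|torus. w x * g (x - s *\<^sub>R h))"
      by (subst eq) (simp add: integral_torus set_lebesgue_integral_def)
    have "integrable torus (\<lambda>x. w x * g (x - s *\<^sub>R h))"
      by (rule integrable_torus_bounded[of _ B]) (measurable, rule wg)
    then have "integrable lborel (\<lambda>x. indicator cell x *\<^sub>R (w x * g (x - s *\<^sub>R h)))"
      by (subst (asm) integrable_torus) (auto simp: set_integrable_def)
    then show "integrable lborel (\<lambda>x. w x * g (x - s *\<^sub>R h))" by (subst eq)
  qed
  have inner: "(LINT x|torus. w x * (- D (x - s *\<^sub>R h))) \<le> M * norm h" if s: "0 \<le> s" "s \<le> 1" for s
  proof -
    define \<psi> where "\<psi> x = (\<chi> j. - g (x - s *\<^sub>R h) * (h $ j / norm h))" for x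
    have gs: "Ck_on 1 UNIV (\<lambda>x. g (x - s *\<^sub>R h))"
      using Ck_on_affine[OF open_UNIV bounded_linear_ident g(1), of "- s *\<^sub>R h"] by simp
    have \<psi>_eq: "\<psi> x = g (x - s *\<^sub>R h) *\<^sub>R (- (1 / norm h) *\<^sub>R h)" for x
      by (simp add: \<psi>_def vec_eq_iff)
    have "Ck_on (Suc 0) UNIV \<psi>"
    proof (rule Ck_on_SucI)
      note d = Ck_on_SucD[OF gs[unfolded One_nat_def] open_UNIV UNIV_I]
      show "(\<psi> has_derivative (\<lambda>v. frechet_derivative (\<lambda>x. g (x - s *\<^sub>R h)) (at x) v *\<^sub>R (- (1 / norm h) *\<^sub>R h))) (at x)" for x
        unfolding \<psi>_eq[abs_def] by (intro has_derivative_scaleR_left d)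
      show "Ck_on 0 UNIV (\<lambda>x. frechet_derivative (\<lambda>x. g (x - s *\<^sub>R h)) (at x) v *\<^sub>R (- (1 / norm h) *\<^sub>R h))" for v
      proof -
        have "continuous_on UNIV (\<lambda>x. frechet_derivative (\<lambda>x. g (x - s *\<^sub>R h)) (at x) v)" using gs by simp
        then show ?thesis unfolding Ck_on.simps by (intro continuous_on_scaleR continuous_on_const)
      qed
    qed auto
    then have 1: "Ck_on 1 UNIV \<psi>" by simp
    have "{x. \<psi> x \<noteq> 0} \<subseteq> (\<lambda>x. x + s *\<^sub>R h) ` {x. g x \<noteq> 0}"
    proof
      fix x assume "x \<in> {x. \<psi> x \<noteq> 0}"
      then have "g (x - s *\<^sub>R h) \<noteq> 0" by (auto simp: \<psi>_eq)
      then show "x \<in> (\<lambda>x. x + s *\<^sub>R h) ` {x. g x \<noteq> 0}" by (intro image_eqI[of _ _ "x - s *\<^sub>R h"]) auto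
    qed
    then have "closure {x. \<psi> x \<noteq> 0} \<subseteq> (\<lambda>x. x + s *\<^sub>R h) ` K"
      unfolding K_def using closure_mono closure_translation[of "s *\<^sub>R h" "{x. g x \<noteq> 0}"] by (simp add: add.commute) blast
    also have "\<dots> \<subseteq> cell" using box g(3) s by (auto simp: K_def)
    finally have 2: "closure {x. \<psi> x \<noteq> 0} \<subseteq> cell" .
    have 3: "norm (\<psi> x) \<le> 1" for x using g(2)[of "x - s *\<^sub>R h"] False by (simp add: \<psi>_eq)
    have div: "divergence \<psi> x = - D (x - s *\<^sub>R h) / norm h" for x
    proof -
      have p: "partial j (\<lambda>y. \<psi> y $ j) x = - (h $ j / norm h) * partial j g (x - s *\<^sub>R h)" for j
      proof -
        have d: "((\<lambda>x. g (x - s *\<^sub>R h)) has_derivative frechet_derivative (\<lambda>x. g (x - s *\<^sub>R h)) (at x)) (at x)"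
          by (rule Ck_on_SucD[OF gs[unfolded One_nat_def]]) auto
        have hd: "((\<lambda>y. - (h $ j / norm h) * g (y - s *\<^sub>R h)) has_derivative
            (\<lambda>v. - (h $ j / norm h) * frechet_derivative (\<lambda>x. g (x - s *\<^sub>R h)) (at x) v)) (at x)"
          by (intro has_derivative_mult_right d)
        have eq: "(\<lambda>y. \<psi> y $ j) = (\<lambda>y. - (h $ j / norm h) * g (y - s *\<^sub>R h))" by (auto simp: \<psi>_def)
        have "partial j (\<lambda>x. g (x - s *\<^sub>R h)) x = partial j g (x - s *\<^sub>R h)"
          using partial_shift(2)[OF gd, of j "- (s *\<^sub>R h)" x] by simp
        then show ?thesis unfolding eq partial_eq[OF hd] by (simp add: partial_def[of j "\<lambda>x. g (x - s *\<^sub>R h)"])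
      qed
      show ?thesis unfolding divergence_def p D_def by (simp add: sum_negf sum_divide_distrib)
    qed
    have "(LINT x|torus. w x * (- D (x - s *\<^sub>R h))) = norm h * (LINT x|torus. w x * divergence \<psi> x)"
      using False by (simp add: div)
    also have "(LINT x|torus. w x * divergence \<psi> x) = (LINT x:cell|lborel. w x * divergence \<psi> x)"
      unfolding div by (rule integral_torus) measurable
    also have "norm h * \<dots> \<le> norm h * M" by (intro mult_left_mono M 1 2 3) auto
    finally show ?thesis by (simp add: mult.commute)
  qed
  have "(LINT x|lborel. (w (x + h) - w x) * g x) = (LINT x|lborel. w (x + h) * g x - w x * g x)"
    by (simp add: left_diff_distrib)
  also have "\<dots> = (LINT x|lborel. w (x + h) * g x) - (LINT x|lborel. w x * g x)"
  proof (rule Bochner_Integration.integral_diff)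
    have "integrable (distr lborel borel ((+) h)) (\<lambda>x. w x * g (x - h))"
      using tor_int[of 1] by (simp add: lborel_distr_plus)
    then show "integrable lborel (\<lambda>x. w (x + h) * g x)"
      by (subst (asm) integrable_distr_eq) (auto simp: add.commute)
    show "integrable lborel (\<lambda>x. w x * g x)" using tor_int[of 0] by simp
  qed
  also have "(LINT x|lborel. w (x + h) * g x) = (LINT x|lborel. w x * g (x - h))"
  proof -
    have "(LINT x|lborel. w x * g (x - h)) = (LINT x|distr lborel borel ((+) h). w x * g (x - h))"
      by (simp add: lborel_distr_plus)
    also have "\<dots> = (LINT x|lborel. w (x + h) * g x)"
      by (subst integral_distr) (auto simp: add.commute)
    finally show ?thesis by simp
  qed
  also have "\<dots> - (LINT x|lborel. w x * g x) = (LINT x|torus. w x * g (x - h)) - (LINT x|torus. w x * g x)"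
    using tor[of 1] tor[of 0] by simp
  also have "\<dots> = (LINT x|torus. w x * g (x - h) - w x * g x)"
    by (rule Bochner_Integration.integral_diff[symmetric]; rule integrable_torus_bounded[of _ B])
       (measurable, use wg in auto)
  also have "\<dots> = (LINT x|torus. (LINT s|timespan 0 1. w x * (- D (x - s *\<^sub>R h))))"
  proof (rule Bochner_Integration.integral_cong[OF refl])
    fix x
    have "(LBINT s. indicator {0..1} s *\<^sub>R (- D (x - s *\<^sub>R h))) = g (x - 1 *\<^sub>R h) - g (x - 0 *\<^sub>R h)"
    proof (rule integral_FTC_Icc)
      fix s :: real
      have "((\<lambda>s. g (x + s *\<^sub>R (- h))) has_real_derivative (\<Sum>j\<in>UNIV. (- h) $ j * partial j g (x + s *\<^sub>R (- h)))) (at s)"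
        by (rule DERIV_along_line) (rule gd)
      then show "((\<lambda>s. g (x - s *\<^sub>R h)) has_vector_derivative - D (x - s *\<^sub>R h)) (at s within {0..1})"
        by (simp add: D_def sum_negf has_field_derivative_at_within flip: has_real_derivative_iff_has_vector_derivative)
      show "continuous_on {0..1} (\<lambda>s. - D (x - s *\<^sub>R h))"
        by (intro continuous_intros continuous_on_compose2[OF Dc]) auto
    qed simp
    then have "(LINT s|timespan 0 1. - D (x - s *\<^sub>R h)) = g (x - h) - g x"
      by (subst integral_timespan) (auto simp: set_lebesgue_integral_def)
    then have "(LINT s|timespan 0 1. w x * (- D (x - s *\<^sub>R h))) = w x * (g (x - h) - g x)"
      by (simp only: integral_mult_right_zero)
    then show "w x * g (x - h) - w x * g x = (LINT s|timespan 0 1. w x * (- D (x - s *\<^sub>R h)))"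
      by (simp add: right_diff_distrib)
  qed
  also have "\<dots> = (LINT s|timespan 0 1. (LINT x|torus. w x * (- D (x - s *\<^sub>R h))))"
  proof (rule P.Fubini_integral)
    show "integrable (timespan 0 1 \<Otimes>\<^sub>M torus) (\<lambda>(s, x). w x * (- D (x - s *\<^sub>R h)))"
      by (rule PF.integrable_const_bound[of _ "B * d"])
         (use wD in \<open>auto simp del: mult_minus_right\<close>)
  qed
  also have "\<dots> \<le> (LINT s|timespan 0 1. M * norm h)"
  proof (rule integral_mono_AE)
    show "integrable (timespan 0 1) (\<lambda>s. LINT x|torus. w x * (- D (x - s *\<^sub>R h)))"
      by (rule P.integrable_fst, rule PF.integrable_const_bound[of _ "B * d"])
         (use wD in \<open>auto simp del: mult_minus_right\<close>)
    show "AE s in timespan 0 1. (LINT x|torus. w x * (- D (x - s *\<^sub>R h))) \<le> M * norm h"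
      by (rule AE_timespanI) (rule inner)
  qed simp
  also have "\<dots> = M * norm h" by (simp add: measure_def emeasure_timespan)
  finally show ?thesis .
qed

text \<open>The modulus is the supremum over test functions bounded by 1: approximate the sign of \<open>w (x + h) - w x\<close> by continuous
functions, these by polynomials, and cut off near the faces of the box.\<close>
lemma BV_translation_box:
  fixes w :: "real^'n::finite \<Rightarrow> real"
  assumes [measurable]: "w \<in> borel_measurable borel" and wB: "\<And>x. \<bar>w x\<bar> \<le> B"
    and M: "\<And>\<psi> :: real^'n \<Rightarrow> real^'n. Ck_on 1 UNIV \<psi> \<Longrightarrow> closure {x. \<psi> x \<noteq> 0} \<subseteq> cell \<Longrightarrow> (\<And>x. norm (\<psi> x) \<le> 1) \<Longrightarrow>
        (LINT x:cell|lborel. w x * divergence \<psi> x) \<le> M"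
    and box: "\<And>x s. x \<in> box a b \<Longrightarrow> 0 \<le> s \<Longrightarrow> s \<le> 1 \<Longrightarrow> x + s *\<^sub>R h \<in> cell"
  shows "(LINT x:box a b|lborel. \<bar>w (x + h) - w x\<bar>) \<le> M * norm h"
proof -
  define S where "S x = sgn (w (x + h) - w x)" for x
  have [measurable]: "S \<in> borel_measurable borel" unfolding S_def by measurable
  have "S \<in> borel_measurable lebesgue"
    using \<open>S \<in> borel_measurable borel\<close> by (simp add: measurable_completion)
  then have "S measurable_on UNIV"
    by (rule lebesgue_measurable_imp_measurable_on_real) simp
  \<comment> \<open>The sign is a pointwise limit of continuous functions outside a null set.\<close>
  then obtain N G where N: "negligible N" and Gc: "\<And>n. continuous_on UNIV (G n)"
    and G: "\<And>x. x \<notin> N \<Longrightarrow> (\<lambda>n::nat. G n x) \<longlonglongrightarrow> S x"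
    unfolding measurable_on_def by auto
  define e where "e n = smoothing_width n" for n
  have e: "e n > 0" "e \<longlonglongrightarrow> 0" for n using smoothing_width by (auto simp: e_def[abs_def])
  define H where "H n x = max (- 1) (min 1 (G n x))" for n x
  have "\<exists>p. polynomial_function p \<and> (\<forall>x\<in>cbox a b. norm (H n x - p x) < e n)" for n
  proof (rule Stone_Weierstrass_polynomial_function)
    have "continuous_on UNIV (H n)" unfolding H_def by (intro continuous_intros Gc)
    then show "continuous_on (cbox a b) (H n)" by (rule continuous_on_subset) auto
  qed (auto simp: e)
  then obtain p where p: "\<And>n. polynomial_function (p n)" "\<And>n x. x \<in> cbox a b \<Longrightarrow> \<bar>H n x - p n x\<bar> < e n"
    by (metis real_norm_def)
  \<comment> \<open>The factor \<open>1 / (1 + e n)\<close> restores the bound 1 that the polynomial approximation may exceed by \<open>e n\<close>.\<close>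
  define \<theta> where "\<theta> n x = (1 / (1 + e n)) * (box_cutoff a b (Suc n) x * p n x)" for n x
  have \<theta>1: "Ck_on 1 UNIV (\<theta> n)" for n
    unfolding \<theta>_def
    by (intro Ck_on_mult Ck_on_const Ck_on_box_cutoff real_polynomial_C1)
       (use p in \<open>auto simp: real_polynomial_function_eq\<close>)
  have \<theta>0: "\<theta> n x = 0" if "x \<notin> box a b" for n x
    using box_cutoff_support[of "Suc n" a b] closure_subset[of "{x. box_cutoff a b (Suc n) x \<noteq> 0}"] that
    by (auto simp: \<theta>_def)
  have bp: "\<bar>p n x\<bar> \<le> 1 + e n" if "x \<in> box a b" for n x
  proof -
    have "x \<in> cbox a b" using that box_subset_cbox by blast
    from p(2)[OF this, of n] show ?thesis by (auto simp: H_def)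
  qed
  have \<theta>b: "\<bar>\<theta> n x\<bar> \<le> 1" for n x
  proof (cases "x \<in> box a b")
    case True
    have "\<bar>box_cutoff a b (Suc n) x * p n x\<bar> \<le> 1 * (1 + e n)"
      unfolding abs_mult using box_cutoff_range[of a b "Suc n" x] bp[OF True] by (intro mult_mono) auto
    then show ?thesis using e(1)[of n] by (simp add: \<theta>_def abs_mult divide_le_eq)
  qed (simp add: \<theta>0)
  have "{x. \<theta> n x \<noteq> 0} \<subseteq> {x. box_cutoff a b (Suc n) x \<noteq> 0}" for n by (auto simp: \<theta>_def)
  then have \<theta>s: "closure {x. \<theta> n x \<noteq> 0} \<subseteq> box a b" for n
    using closure_mono box_cutoff_support[of "Suc n" a b] by blast
  have [measurable]: "\<theta> n \<in> borel_measurable borel" for n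
    using Ck_on_le[OF \<theta>1, of 0] by (auto intro!: borel_measurable_continuous_onI)
  have fin: "integrable lborel (\<lambda>x. indicator (box a b) x * (2 * B))"
    using emeasure_lborel_box_finite[of a b] by (intro integrable_mult_left integrable_real_indicator) auto
  have "(\<lambda>n. LINT x|lborel. (w (x + h) - w x) * \<theta> n x) \<longlonglongrightarrow> (LINT x|lborel. indicator (box a b) x *\<^sub>R \<bar>w (x + h) - w x\<bar>)"
  proof (rule integral_dominated_convergence[OF _ _ fin])
    show "AE x in lborel. norm ((w (x + h) - w x) * \<theta> n x) \<le> indicator (box a b) x * (2 * B)" for n
    proof (intro always_eventually allI)
      fix x
      show "norm ((w (x + h) - w x) * \<theta> n x) \<le> indicator (box a b) x * (2 * B)"
      proof (cases "x \<in> box a b")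
        case True
        have "\<bar>w (x + h) - w x\<bar> * \<bar>\<theta> n x\<bar> \<le> (2 * B) * 1"
          using wB[of x] wB[of "x + h"] \<theta>b[of n x] by (intro mult_mono) linarith+
        with True show ?thesis by (simp add: abs_mult)
      qed (simp add: \<theta>0)
    qed
    have "AE x in lebesgue. x \<notin> N" using N negligible_iff_null_sets AE_not_in by blast
    then have "AE x in lborel. x \<notin> N" by (simp add: AE_completion_iff)
    then show "AE x in lborel. (\<lambda>n. (w (x + h) - w x) * \<theta> n x) \<longlonglongrightarrow> indicator (box a b) x *\<^sub>R \<bar>w (x + h) - w x\<bar>"
    proof eventually_elim
      case (elim x)
      show ?case
      proof (cases "x \<in> box a b")
        case True
        then have xc: "x \<in> cbox a b" using box_subset_cbox by blast
        have "(\<lambda>n. H n x) \<longlonglongrightarrow> max (- 1) (min 1 (S x))"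
          unfolding H_def by (intro tendsto_intros G elim)
        moreover have "max (- 1) (min 1 (S x)) = S x" by (simp add: S_def sgn_if)
        moreover have "(\<lambda>n. H n x - p n x) \<longlonglongrightarrow> 0"
          by (rule Lim_null_comparison[OF _ e(2)]) (use p(2)[OF xc] in \<open>auto intro!: always_eventually less_imp_le\<close>)
        ultimately have "(\<lambda>n. H n x - (H n x - p n x)) \<longlonglongrightarrow> S x - 0" by (intro tendsto_diff) auto
        then have p_lim: "(\<lambda>n. p n x) \<longlonglongrightarrow> S x" by simp
        have "(\<lambda>n. (w (x + h) - w x) * ((1 / (1 + e n)) * (box_cutoff a b (Suc n) x * p n x)))
            \<longlonglongrightarrow> (w (x + h) - w x) * ((1 / (1 + 0)) * (1 * S x))"
          by (intro tendsto_intros e p_lim LIMSEQ_Suc[OF box_cutoff_limit[OF True]]) simp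
        with True show ?thesis by (simp add: \<theta>_def S_def abs_sgn)
      qed (simp add: \<theta>0)
    qed
  qed measurable
  moreover have "(LINT x|lborel. (w (x + h) - w x) * \<theta> n x) \<le> M * norm h" for n
    by (rule BV_test_translation[OF assms(1) wB M \<theta>1 \<theta>b \<theta>s bounded_box box])
  ultimately show ?thesis
    unfolding set_lebesgue_integral_def by (intro LIMSEQ_le_const2) auto
qed

lemma prod_Basis_cart: "(\<Prod>b\<in>Basis. F b) = (\<Prod>i\<in>UNIV. F (axis i (1::real)))"
proof -
  have b1: "Basis = range (\<lambda>i. axis i (1::real))" by (auto simp: Basis_vec_def)
  have b2: "inj (\<lambda>i. axis i (1::real))" by (auto simp: inj_on_def axis_eq_axis)
  show ?thesis by (simp only: b1 prod.reindex[OF b2] o_def)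
qed

lemma abs_le_4_sin_half: assumes "\<bar>x\<bar> \<le> pi" shows "\<bar>x\<bar> \<le> 4 * \<bar>sin (x / 2)\<bar>"
proof -
  have pos: "x \<le> 4 * sin (x / 2)" if x: "0 \<le> x" "x \<le> pi" for x :: real
  proof (cases "x \<le> 2 * (pi / 3)")
    case True
    have "sin 0 - 0 / 2 \<le> sin (x / 2) - (x / 2) / 2"
    proof (rule DERIV_nonneg_imp_nondecreasing[of 0 "x / 2" "\<lambda>y. sin y - y / 2"])
      fix y assume y: "0 \<le> y" "y \<le> x / 2"
      have "cos (pi / 3) \<le> cos y" using y True by (intro cos_monotone_0_pi_le) auto
      then have "cos y - 1 / 2 \<ge> 0" by (simp add: cos_60)
      moreover have "((\<lambda>y. sin y - y / 2) has_real_derivative cos y - 1 / 2) (at y)"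
        by (auto intro!: derivative_eq_intros)
      ultimately show "\<exists>d. ((\<lambda>y. sin y - y / 2) has_real_derivative d) (at y) \<and> 0 \<le> d" by blast
    qed (use x in auto)
    then show ?thesis by simp
  next
    case False
    have "sin (pi / 3) \<le> sin (x / 2)" using False x by (intro sin_monotone_2pi_le) auto
    moreover have "sin (pi / 3) \<ge> 17 / 20"
    proof -
      have "17 / 10 \<le> sqrt 3" by (rule real_le_rsqrt) (simp add: power2_eq_square)
      then show ?thesis by (simp add: sin_60)
    qed
    moreover have "pi \<le> 34 / 10" using pi_less_4 pi_approx by simp
    ultimately show ?thesis using x by linarith
  qed
  show ?thesis
  proof (cases "x \<ge> 0")
    case True
    with pos[of x] assms show ?thesis by simp
  next
    case False
    with pos[of "- x"] assms show ?thesis by simp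
  qed
qed

lemma abs_sin_half_periodic: "\<bar>sin ((x + 2 * pi * of_int k) / 2)\<bar> = \<bar>sin (x / 2)\<bar>"
proof -
  have "cos (x + of_int k * (2 * pi)) = cos x" using cos.plus_of_int[of x k] by simp
  then have "(sin ((x + 2 * pi * of_int k) / 2))\<^sup>2 = (sin (x / 2))\<^sup>2"
    by (simp add: sinq_eq[symmetric] sinq_def mult.commute)
  then show ?thesis by (simp add: power2_eq_iff abs_eq_iff)
qed

text \<open>Inside the largest box that stays in the cell along the segment the variation applies. The rest of the cell has
measure of order \<open>\<Sum>j. \<bar>h j\<bar>\<close>, and boundedness of \<open>w\<close> suffices; in particular jumps across the faces of the cell
are covered.\<close>
lemma BV_translation_torus:
  fixes w :: "real^'n::finite \<Rightarrow> real"
  assumes [measurable]: "w \<in> borel_measurable borel" and wB: "\<And>x. \<bar>w x\<bar> \<le> B" and per: "periodic w"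
    and M: "\<And>\<psi> :: real^'n \<Rightarrow> real^'n. Ck_on 1 UNIV \<psi> \<Longrightarrow> closure {x. \<psi> x \<noteq> 0} \<subseteq> cell \<Longrightarrow> (\<And>x. norm (\<psi> x) \<le> 1) \<Longrightarrow>
        (LINT x:cell|lborel. w x * divergence \<psi> x) \<le> M"
  shows "\<exists>C\<ge>0. \<forall>h. (LINT x|torus. \<bar>w (x + h) - w x\<bar>) \<le> C * sin_modulus h"
proof -
  have B: "B \<ge> 0" using wB[of 0] by linarith
  define P where "P = (2 * pi) ^ CARD('n)"
  \<comment> \<open>The first summand comes from the box, the second from its complement; the factor 4 compares \<open>\<bar>h j\<bar>\<close> with the sine.\<close>
  define C where "C = (\<bar>M\<bar> + 2 * B * (P / (2 * pi))) * 4"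
  have C: "C \<ge> 0" using B by (simp add: C_def P_def)
  have small: "(LINT x|torus. \<bar>w (x + h) - w x\<bar>) \<le> C * sin_modulus h" if h: "\<And>j. \<bar>h $ j\<bar> \<le> pi" for h :: "real^'n"
  proof -
    \<comment> \<open>the box of all \<open>x\<close> for which both \<open>x\<close> and \<open>x + h\<close> lie in the cell\<close>
    define a b :: "real^'n" where "a = (\<chi> j. max 0 (- h $ j))" and "b = (\<chi> j. min (2 * pi) (2 * pi - h $ j))"
    have box: "x + s *\<^sub>R h \<in> cell" if "x \<in> box a b" "0 \<le> s" "s \<le> 1" for x s
    proof -
      have "0 < (x + s *\<^sub>R h) $ j \<and> (x + s *\<^sub>R h) $ j < 2 * pi" for j
      proof -
        have x: "0 < x $ j" "- h $ j < x $ j" "x $ j < 2 * pi" "x $ j < 2 * pi - h $ j"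
          using that(1) by (auto simp: mem_box_cart a_def b_def)
        have "x $ j + s * h $ j = (1 - s) * x $ j + s * (x $ j + h $ j)" by (simp add: algebra_simps)
        moreover have "0 < (1 - s) * x $ j + s * (x $ j + h $ j)"
          using x that by (cases "s = 0") (auto intro!: add_nonneg_pos)
        moreover have "(1 - s) * x $ j + s * (x $ j + h $ j) < 2 * pi"
          using convex_bound_lt[of "x $ j" "2 * pi" "x $ j + h $ j" "1 - s" s] x that by simp
        ultimately show ?thesis by simp
      qed
      then show ?thesis by (simp add: cell_def mem_box_cart)
    qed
    have sub: "box a b \<subseteq> cell" using box[of _ 0] by auto
    have meas_cell: "measure lborel (cell :: (real^'n) set) = P" "emeasure lborel (cell :: (real^'n) set) < \<infinity>"
    proof -
      have "\<forall>b\<in>Basis. (0 :: real^'n) \<bullet> b \<le> (\<chi> j. 2 * pi) \<bullet> b" by (auto simp: Basis_vec_def inner_axis)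
      then show "measure lborel (cell :: (real^'n) set) = P" "emeasure lborel (cell :: (real^'n) set) < \<infinity>"
        unfolding P_def cell_def by (simp_all only: measure_lborel_box_eq emeasure_lborel_box_eq if_True prod_Basis_cart)
          (simp_all add: inner_axis)
    qed
    have "measure lborel (box a b) = (\<Prod>j\<in>UNIV. 2 * pi - \<bar>h $ j\<bar>)"
    proof -
      have e: "b $ j - a $ j = 2 * pi - \<bar>h $ j\<bar>" for j by (auto simp: a_def b_def)
      have "a $ j \<le> b $ j" for j using e[of j] h[of j] pi_gt_zero by linarith
      then have "\<forall>i\<in>Basis. a \<bullet> i \<le> b \<bullet> i" by (auto simp: Basis_vec_def inner_axis)
      then show ?thesis
        by (simp only: measure_lborel_box_eq if_True prod_Basis_cart) (simp add: inner_axis e)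
    qed
    also have "\<dots> = P * (\<Prod>j\<in>UNIV. 1 - \<bar>h $ j\<bar> / (2 * pi))"
      unfolding P_def by (simp add: right_diff_distrib flip: prod_constant prod.distrib)
    finally have box_eq: "measure lborel (box a b) = P * (\<Prod>j\<in>UNIV. 1 - \<bar>h $ j\<bar> / (2 * pi))" .
    have "norm ((\<Prod>j\<in>(UNIV :: 'n set). 1 :: real) - (\<Prod>j\<in>UNIV. 1 - \<bar>h $ j\<bar> / (2 * pi))) \<le> (\<Sum>j\<in>UNIV. norm (1 - (1 - \<bar>h $ j\<bar> / (2 * pi))))"
    proof (rule norm_prod_diff)
      fix j
      have "\<bar>h $ j\<bar> / (2 * pi) \<le> 1" using h[of j] pi_gt_zero by (simp add: divide_le_eq)
      moreover have "0 \<le> \<bar>h $ j\<bar> / (2 * pi)" by simp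
      ultimately show "norm (1 - \<bar>h $ j\<bar> / (2 * pi)) \<le> 1" unfolding real_norm_def by linarith
    qed auto
    then have prod: "1 - (\<Prod>j\<in>UNIV. 1 - \<bar>h $ j\<bar> / (2 * pi)) \<le> (\<Sum>j\<in>UNIV. \<bar>h $ j\<bar>) / (2 * pi)"
      by (simp add: sum_divide_distrib)
    have "measure lborel (cell - box a b) = P - measure lborel (box a b)"
      using measure_Diff[OF _ _ _ sub, of lborel] meas_cell by simp
    also have "\<dots> = P * (1 - (\<Prod>j\<in>UNIV. 1 - \<bar>h $ j\<bar> / (2 * pi)))" by (simp add: box_eq right_diff_distrib)
    also have "\<dots> \<le> P * ((\<Sum>j\<in>UNIV. \<bar>h $ j\<bar>) / (2 * pi))"
      by (intro mult_left_mono prod) (simp add: P_def)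
    finally have rest: "measure lborel (cell - box a b) \<le> P / (2 * pi) * (\<Sum>j\<in>UNIV. \<bar>h $ j\<bar>)" by simp
    have wb: "\<bar>w (x + h) - w x\<bar> \<le> 2 * B" for x using wB[of x] wB[of "x + h"] by linarith
    have int: "set_integrable lborel A (\<lambda>x. \<bar>w (x + h) - w x\<bar>)" if A: "A \<subseteq> cell" and [measurable]: "A \<in> sets borel" for A
    proof -
      have "emeasure lborel A < \<infinity>" using emeasure_mono[OF A, of lborel] meas_cell(2) by (simp add: cell_borel)
      then have "integrable lborel (\<lambda>x. indicator A x * (2 * B))"
        by (intro integrable_mult_left integrable_real_indicator) auto
      then show ?thesis unfolding set_integrable_def
        by (rule Bochner_Integration.integrable_bound) (use wb B in \<open>auto simp: indicator_def\<close>)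
    qed
    have "(LINT x|torus. \<bar>w (x + h) - w x\<bar>) = (LINT x:cell|lborel. \<bar>w (x + h) - w x\<bar>)"
      by (rule integral_torus) measurable
    also have "cell = box a b \<union> (cell - box a b)" using sub by auto
    also have "(LINT x:box a b \<union> (cell - box a b)|lborel. \<bar>w (x + h) - w x\<bar>)
        = (LINT x:box a b|lborel. \<bar>w (x + h) - w x\<bar>) + (LINT x:cell - box a b|lborel. \<bar>w (x + h) - w x\<bar>)"
      by (rule set_integral_Un) (use sub in \<open>auto intro!: int\<close>)
    also have "\<dots> \<le> M * norm h + 2 * B * measure lborel (cell - box a b)"
    proof (rule add_mono)
      show "(LINT x:box a b|lborel. \<bar>w (x + h) - w x\<bar>) \<le> M * norm h"
        by (rule BV_translation_box[OF assms(1) wB M box])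
      have fin: "emeasure lborel (cell - box a b) < \<infinity>"
        using emeasure_mono[of "cell - box a b" cell lborel] meas_cell(2) by (simp add: cell_borel)
      have "(LINT x:cell - box a b|lborel. \<bar>w (x + h) - w x\<bar>) \<le> (LINT x:cell - box a b|lborel. 2 * B)"
        by (intro set_integral_mono int) (use wb fin in \<open>auto simp: set_integrable_def intro!: integrable_mult_left integrable_real_indicator\<close>)
      also have "\<dots> = 2 * B * measure lborel (cell - box a b)"
        by (simp add: set_lebesgue_integral_def)
      finally show "(LINT x:cell - box a b|lborel. \<bar>w (x + h) - w x\<bar>) \<le> 2 * B * measure lborel (cell - box a b)" .
    qed
    also have "\<dots> \<le> \<bar>M\<bar> * (\<Sum>j\<in>UNIV. \<bar>h $ j\<bar>) + 2 * B * (P / (2 * pi) * (\<Sum>j\<in>UNIV. \<bar>h $ j\<bar>))"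
      using norm_le_l1_cart[of h] B
      by (intro add_mono mult_mono mult_left_mono rest) auto
    also have "\<dots> = (\<bar>M\<bar> + 2 * B * (P / (2 * pi))) * (\<Sum>j\<in>UNIV. \<bar>h $ j\<bar>)" by (simp add: distrib_right)
    also have "\<dots> \<le> (\<bar>M\<bar> + 2 * B * (P / (2 * pi))) * (\<Sum>j\<in>UNIV. 4 * \<bar>sin (h $ j / 2)\<bar>)"
      using B by (intro mult_left_mono sum_mono abs_le_4_sin_half h) (simp add: P_def)
    also have "\<dots> = C * sin_modulus h"
      unfolding C_def sin_modulus_def by (simp only: sum_distrib_left[symmetric] mult.assoc)
    finally show ?thesis .
  qed
  have "(LINT x|torus. \<bar>w (x + h) - w x\<bar>) \<le> C * sin_modulus h" for h
  proof -
    \<comment> \<open>Reduce to \<open>\<bar>h j\<bar> \<le> pi\<close> by a lattice vector; both sides are periodic in \<open>h\<close>.\<close>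
    define k where "k j = - round (h $ j / (2 * pi))" for j
    define h' where "h' = h + (\<chi> j. 2 * pi * of_int (k j))"
    have "\<bar>h' $ j\<bar> \<le> pi" for j
    proof -
      have "\<bar>of_int (round (h $ j / (2 * pi))) - h $ j / (2 * pi)\<bar> \<le> 1 / 2" by (rule of_int_round_abs_le)
      then have "\<bar>2 * pi * (of_int (round (h $ j / (2 * pi))) - h $ j / (2 * pi))\<bar> \<le> 2 * pi * (1 / 2)"
        unfolding abs_mult[of "2 * pi"] by (intro mult_mono) auto
      then show ?thesis by (simp add: h'_def k_def right_diff_distrib abs_minus_commute)
    qed
    note s = small[OF this]
    have "sin_modulus h' = sin_modulus h"
      by (simp add: sin_modulus_def h'_def abs_sin_half_periodic)
    moreover have "w (x + h') = w (x + h)" for x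
      using periodic_lattice[OF per, of "x + h" k] by (simp add: h'_def add.assoc)
    ultimately show ?thesis using s by simp
  qed
  with C show ?thesis by blast
qed

text \<open>A bound that holds almost everywhere becomes a bound everywhere by truncation; the variation does not see the
change.\<close>
lemma clip_datum:
  fixes u0 :: "real^'n::finite \<Rightarrow> real"
  assumes u0_meas [measurable]: "u0 \<in> borel_measurable borel" and u0_periodic: "periodic u0"
    and u0_bounded: "ess_bounded_on cell u0" and u0_BV: "BV_on cell u0"
  obtains w B C where "w \<in> borel_measurable borel" "\<And>x. \<bar>w x\<bar> \<le> B" "periodic w"
    "AE x in torus. u0 x = w x" "C \<ge> 0" "\<And>h. (LINT x|torus. \<bar>w (x + h) - w x\<bar>) \<le> C * sin_modulus h"
proof -
  obtain B where B: "AE x in lborel. x \<in> cell \<longrightarrow> \<bar>u0 x\<bar> \<le> B" using u0_bounded by (auto simp: ess_bounded_on_def)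
  obtain M where M: "\<And>\<psi> :: real^'n \<Rightarrow> real^'n. Ck_on 1 UNIV \<psi> \<Longrightarrow> closure {x. \<psi> x \<noteq> 0} \<subseteq> cell \<Longrightarrow> (\<And>x. norm (\<psi> x) \<le> 1) \<Longrightarrow>
        (LINT x:cell|lborel. u0 x * divergence \<psi> x) \<le> M"
    using u0_BV unfolding BV_on_def by blast
  define w where "w x = max (- \<bar>B\<bar>) (min \<bar>B\<bar> (u0 x))" for x
  have wm [measurable]: "w \<in> borel_measurable borel" unfolding w_def by measurable
  have wB: "\<bar>w x\<bar> \<le> \<bar>B\<bar>" for x by (auto simp: w_def)
  have per: "periodic w" using u0_periodic by (simp add: periodic_def w_def)
  have eq: "AE x in lborel. x \<in> cell \<longrightarrow> u0 x = w x"
    using B by eventually_elim (auto simp: w_def)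
  have M': "(LINT x:cell|lborel. w x * divergence \<psi> x) \<le> M"
    if "Ck_on 1 UNIV \<psi>" "closure {x. \<psi> x \<noteq> 0} \<subseteq> cell" "\<And>x. norm (\<psi> x) \<le> 1" for \<psi> :: "real^'n \<Rightarrow> real^'n"
  proof -
    have "Ck_on (Suc 0) UNIV \<psi>" using that by simp
    note d = Ck_on_SucD[OF this open_UNIV UNIV_I]
    have p: "partial j (\<lambda>y. \<psi> y $ j) x = frechet_derivative \<psi> (at x) (axis j 1) $ j" for j x
      by (rule partial_eq) (rule bounded_linear.has_derivative[OF bounded_linear_vec_nth d])
    have "continuous_on UNIV (\<lambda>x. frechet_derivative \<psi> (at x) (axis j 1))" for j using that(1) by simp
    then have "continuous_on UNIV (divergence \<psi>)"
      unfolding divergence_def[abs_def] p by (intro continuous_intros)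
    then have [measurable]: "divergence \<psi> \<in> borel_measurable borel" by (rule borel_measurable_continuous_onI)
    have "(LINT x:cell|lborel. w x * divergence \<psi> x) = (LINT x:cell|lborel. u0 x * divergence \<psi> x)"
      unfolding set_lebesgue_integral_def
      by (rule Bochner_Integration.integral_cong_AE) (use eq in \<open>auto simp: indicator_def elim: eventually_mono\<close>)
    with M[OF that] show ?thesis by simp
  qed
  have "\<exists>C\<ge>0. \<forall>h. (LINT x|torus. \<bar>w (x + h) - w x\<bar>) \<le> C * sin_modulus h"
    by (rule BV_translation_torus[OF wm wB per M'])
  then obtain C where C: "C \<ge> 0" "\<And>h. (LINT x|torus. \<bar>w (x + h) - w x\<bar>) \<le> C * sin_modulus h" by blast
  have "AE x in torus. u0 x = w x" using eq by (simp add: AE_torus)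
  from that[OF wm wB per this C] show ?thesis .
qed

lemma L1_norm_torus:
  assumes "g \<in> borel_measurable borel" shows "L1_norm cell g = (LINT x|torus. \<bar>g x\<bar>)"
  unfolding L1_norm_def using assms by (subst integral_torus) auto

text \<open>Contraction from a small time \<open>s\<close> to \<open>t\<close>, followed by the limit \<open>s \<rightarrow> 0\<close> in \<open>L1\<close>.\<close>
lemma viscous_solution_bounds:
  fixes f :: "real \<Rightarrow> real^'n::finite"
  assumes levy: "levy_measure \<mu>" and f: "\<And>j. Ck_on 1 UNIV (\<lambda>w. f w $ j)" and \<epsilon>: "\<epsilon> > 0"
    and [measurable]: "u0 \<in> borel_measurable borel"
    and w: "w \<in> borel_measurable borel" "\<And>x. \<bar>w x\<bar> \<le> B" "periodic w" "AE x in torus. u0 x = w x"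
    and sol: "viscous_solution T \<mu> f u0 \<epsilon> v" and t: "t \<in> {0<..<T}"
  shows "(LINT x|torus. \<bar>v t (x + h) - v t x\<bar>) \<le> (LINT x|torus. \<bar>w (x + h) - w x\<bar>)"
    and "(LINT x|torus. \<bar>v t x\<bar>) \<le> (LINT x|torus. \<bar>w x\<bar>)"
proof -
  note [measurable] = w(1)
  obtain v' where flow: "\<And>h. viscous_flow T \<mu> f \<epsilon>
      (\<lambda>t x. indicator {0<..<T} t * v t (x + h)) (\<lambda>t x. indicator {0<..<T} t * v' t (x + h))"
    using viscous_solution_flow[OF sol f] by blast
  have vC: "C1_torus (v s)" if "s \<in> {0<..<T}" for s
    using viscous_flowD(3)[OF flow[of 0] that] that by (simp add: C2_torusD)
  note v = C1_torusD[OF vC]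
  have iv: "integrable torus (\<lambda>x. v s (x + h))" if "s \<in> {0<..<T}" for s h
    using integrable_torus_continuous[OF v(1,4)[OF that]] integral_torus_shift(1)[OF v(5,1)[OF that]] by simp
  have iw: "integrable torus (\<lambda>x. w (x + h))" for h by (rule integrable_torus_bounded) (use w(2) in auto)
  have e_lim: "((\<lambda>s. LINT x|torus. \<bar>v s x - w x\<bar>) \<longlongrightarrow> 0) (at_right 0)"
  proof (rule Lim_transform_eventually)
    show "((\<lambda>t. L1_norm cell (\<lambda>x. v t x - u0 x)) \<longlongrightarrow> 0) (at_right 0)" using sol by (simp add: viscous_solution_def)
    have "\<forall>\<^sub>F s in at_right 0. s \<in> {0<..<T}" using t by (intro eventually_at_right_real) auto
    then show "\<forall>\<^sub>F s in at_right 0. L1_norm cell (\<lambda>x. v s x - u0 x) = (LINT x|torus. \<bar>v s x - w x\<bar>)"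
    proof eventually_elim
      case (elim s)
      note [measurable] = v(5)[OF elim]
      have "L1_norm cell (\<lambda>x. v s x - u0 x) = (LINT x|torus. \<bar>v s x - u0 x\<bar>)" by (rule L1_norm_torus) measurable
      also have "\<dots> = (LINT x|torus. \<bar>v s x - w x\<bar>)"
        by (rule Bochner_Integration.integral_cong_AE) (use w(4) in \<open>auto elim: eventually_mono\<close>)
      finally show ?case .
    qed
  qed
  have near: "\<exists>s. 0 < s \<and> s \<le> t \<and> (LINT x|torus. \<bar>v s x - w x\<bar>) < e" if "e > 0" for e
  proof -
    have "\<forall>\<^sub>F s in at_right 0. (LINT x|torus. \<bar>v s x - w x\<bar>) < e" using e_lim that by (rule order_tendstoD)
    moreover have "\<forall>\<^sub>F s in at_right 0. s \<in> {0<..<t}" using t by (intro eventually_at_right_real) auto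
    ultimately have "\<forall>\<^sub>F s in at_right 0. 0 < s \<and> s \<le> t \<and> (LINT x|torus. \<bar>v s x - w x\<bar>) < e"
      by eventually_elim auto
    then show ?thesis using eventually_happens'[OF trivial_limit_at_right_real] by blast
  qed
  show "(LINT x|torus. \<bar>v t (x + h) - v t x\<bar>) \<le> (LINT x|torus. \<bar>w (x + h) - w x\<bar>)"
  proof (rule field_le_epsilon)
    fix e :: real assume "e > 0"
    then obtain s where s: "0 < s" "s \<le> t" "(LINT x|torus. \<bar>v s x - w x\<bar>) < e / 2" using near[of "e / 2"] by auto
    then have sT: "s \<in> {0<..<T}" using t by auto
    have "(LINT x|torus. \<bar>v t (x + h) - v t x\<bar>) \<le> (LINT x|torus. \<bar>v s (x + h) - v s x\<bar>)"
      using viscous_flow_contraction[OF levy f _ flow[of h] flow[of 0] s(1,2)] t sT \<epsilon> by simp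
    also have "\<dots> \<le> (LINT x|torus. (\<bar>v s (x + h) - w (x + h)\<bar> + \<bar>v s x - w x\<bar>) + \<bar>w (x + h) - w x\<bar>)"
      using iv[OF sT] iv[OF sT, of 0] iw iw[of 0] by (intro integral_mono) auto
    also have "\<dots> = (LINT x|torus. \<bar>v s (x + h) - w (x + h)\<bar>) + (LINT x|torus. \<bar>v s x - w x\<bar>) + (LINT x|torus. \<bar>w (x + h) - w x\<bar>)"
      using iv[OF sT] iv[OF sT, of 0] iw iw[of 0] by simp
    also have "(LINT x|torus. \<bar>v s (x + h) - w (x + h)\<bar>) = (LINT x|torus. \<bar>v s x - w x\<bar>)"
      by (rule integral_torus_shift(2)[of "\<lambda>x. \<bar>v s x - w x\<bar>"])
         (use v(1,5)[OF sT] w(3) in \<open>auto simp: periodic_def\<close>)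
    finally show "(LINT x|torus. \<bar>v t (x + h) - v t x\<bar>) \<le> (LINT x|torus. \<bar>w (x + h) - w x\<bar>) + e"
      using s(3) by linarith
  qed
  show "(LINT x|torus. \<bar>v t x\<bar>) \<le> (LINT x|torus. \<bar>w x\<bar>)"
  proof (rule field_le_epsilon)
    fix e :: real assume "e > 0"
    then obtain s where s: "0 < s" "s \<le> t" "(LINT x|torus. \<bar>v s x - w x\<bar>) < e" using near[of e] by auto
    then have sT: "s \<in> {0<..<T}" using t by auto
    have "(LINT x|torus. \<bar>v t x\<bar>) \<le> (LINT x|torus. \<bar>v s x\<bar>)"
      using viscous_flow_contraction[OF levy f _ flow[of 0] viscous_flow_zero s(1,2)] t sT \<epsilon> by simp
    also have "\<dots> \<le> (LINT x|torus. \<bar>v s x - w x\<bar> + \<bar>w x\<bar>)"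
      using iv[OF sT, of 0] iw[of 0] by (intro integral_mono) auto
    also have "\<dots> = (LINT x|torus. \<bar>v s x - w x\<bar>) + (LINT x|torus. \<bar>w x\<bar>)"
      using iv[OF sT, of 0] iw[of 0] by simp
    finally show "(LINT x|torus. \<bar>v t x\<bar>) \<le> (LINT x|torus. \<bar>w x\<bar>) + e" using s(3) by linarith
  qed
qed

section \<open>A bounded representative of the entropy solution\<close>

lemma AE_lborel_ex:
  assumes "AE t in lborel. P t" "a < (b::real)" shows "\<exists>t\<in>{a<..<b}. P t"
proof (rule ccontr)
  assume *: "\<not> ?thesis"
  have "AE t in lborel. t \<notin> {a<..<b}" using assms(1) by eventually_elim (use * in auto)
  then have "emeasure lborel {x. \<not> x \<notin> {a<..<b}} = 0" by (subst (asm) AE_iff_measurable[OF _ refl]) auto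
  moreover have "{x. \<not> x \<notin> {a<..<b}} = {a<..<b}" by auto
  ultimately have "emeasure lborel {a<..<b} = 0" by (simp only:)
  with assms(2) show False by simp
qed

lemma measurable_two_arguments:
  assumes "(\<lambda>p. V (fst p) (snd p)) \<in> borel_measurable borel2" "f \<in> borel_measurable N" "g \<in> borel_measurable N"
  shows "(\<lambda>x. V (f x) (g x)) \<in> borel_measurable N"
  using measurable_compose[OF measurable_Pair[OF assms(2,3)] assms(1)] by simp

text \<open>Truncation at the essential bound gives a function that is bounded everywhere and, for almost every time, equal to
the solution almost everywhere. Continuity in \<open>L1\<close> upgrades this to every time in the open interval.\<close>
lemma entropy_solution_clip:
  fixes f :: "real \<Rightarrow> real^'n::finite"
  assumes ent: "entropy_solution T \<mu> f u0 u"
  obtains U M where "(\<lambda>p. U (fst p) (snd p)) \<in> borel_measurable borel2" "\<And>t x. \<bar>U t x\<bar> \<le> M" "\<And>t. periodic (U t)"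
    "(\<lambda>p. indicator {0..T} (fst p) * u (fst p) (snd p)) \<in> borel_measurable borel2"
    "\<And>t. t \<in> {0<..<T} \<Longrightarrow> AE x in torus. u t x = U t x"
    "\<And>t e. t \<in> {0<..<T} \<Longrightarrow> e > 0 \<Longrightarrow> \<exists>d>0. \<forall>s\<in>{t..t + d}. (LINT x|torus. \<bar>U s x - U t x\<bar>) \<le> e"
proof -
  have meas: "set_borel_measurable borel ({0..T} \<times> UNIV) (\<lambda>(t, x). u t x)"
    and per: "\<And>t. t \<in> {0..T} \<Longrightarrow> periodic (u t)"
    and eb: "ess_bounded_on ({0<..<T} \<times> cell) (\<lambda>(t, x). u t x)" and CL: "C_time_L1 T u"
    using ent by (auto simp: entropy_solution_def)
  define ub where "ub t x = indicator {0..T} t * u t x" for t and x :: "real^'n"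
  have "(\<lambda>p. indicator ({0..T} \<times> UNIV) p *\<^sub>R (case p of (t, x) \<Rightarrow> u t x)) \<in> borel_measurable (borel :: (real \<times> (real^'n)) measure)"
    using meas unfolding set_borel_measurable_def .
  also have "(\<lambda>p. indicator ({0..T} \<times> UNIV) p *\<^sub>R (case p of (t, x) \<Rightarrow> u t x)) = (\<lambda>p. ub (fst p) (snd p))"
    by (auto simp: ub_def indicator_def)
  finally have ubm: "(\<lambda>p. ub (fst p) (snd p)) \<in> borel_measurable borel2" by (simp add: borel_prod)
  note [measurable] = measurable_two_arguments[OF ubm]
  have slice: "u t \<in> borel_measurable borel" if "t \<in> {0..T}" for t
  proof -
    have "ub t \<in> borel_measurable borel" using measurable_two_arguments[OF ubm, of "\<lambda>_. t" borel "\<lambda>x. x"] by simp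
    moreover have "ub t = u t" using that by (auto simp: ub_def)
    ultimately show ?thesis by simp
  qed
  obtain M0 where M0: "AE p in lborel. p \<in> {0<..<T} \<times> cell \<longrightarrow> \<bar>case p of (t, x) \<Rightarrow> u t x\<bar> \<le> M0"
    using eb by (auto simp: ess_bounded_on_def)
  define U where "U t x = max (- \<bar>M0\<bar>) (min \<bar>M0\<bar> (ub t x))" for t x
  have Um: "(\<lambda>p. U (fst p) (snd p)) \<in> borel_measurable borel2"
    unfolding U_def using ubm by measurable
  have Us [measurable]: "U t \<in> borel_measurable borel" for t
    using measurable_two_arguments[OF Um, of "\<lambda>_. t" borel "\<lambda>x. x"] by simp
  have Ub: "\<bar>U t x\<bar> \<le> \<bar>M0\<bar>" for t x by (auto simp: U_def)
  have Uper: "periodic (U t)" for t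
    using per[of t] by (cases "t \<in> {0..T}") (auto simp: periodic_def U_def ub_def)
  have lip: "\<bar>U s x - U t x\<bar> \<le> \<bar>u s x - u t x\<bar>" if "s \<in> {0..T}" "t \<in> {0..T}" for s t x
  proof -
    have "\<bar>max (- c) (min c a) - max (- c) (min c b)\<bar> \<le> \<bar>a - b\<bar>" for a b c :: real
      by (auto simp: max_def min_def)
    then show ?thesis using that by (simp add: U_def ub_def)
  qed
  have iu: "integrable torus (u t)" if "t \<in> {0..T}" for t
    using CL that integrable_torus[OF slice[OF that]] by (auto simp: C_time_L1_def)
  have iU: "integrable torus (U t)" for t by (rule integrable_torus_bounded[OF _ Ub]) simp
  have "AE p in lborel \<Otimes>\<^sub>M lborel. p \<in> {0<..<T} \<times> cell \<longrightarrow> \<bar>case p of (t, x) \<Rightarrow> u t x\<bar> \<le> M0"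
    by (subst lborel_prod) (rule M0)
  from lborel_pair.AE_pair[OF this]
  \<comment> \<open>The essential bound is one for almost every pair; Fubini turns it into one for almost every time.\<close>
  have good: "AE t in lborel. t \<in> {0<..<T} \<longrightarrow> (AE x in torus. u t x = U t x)"
  proof eventually_elim
    case (elim t)
    show ?case
    proof
      assume t: "t \<in> {0<..<T}"
      show "AE x in torus. u t x = U t x" unfolding AE_torus
        using elim by eventually_elim (use t in \<open>auto simp: U_def ub_def\<close>)
    qed
  qed
  have near: "\<exists>d>0. \<forall>s\<in>{0..T}. \<bar>s - t\<bar> < d \<longrightarrow> (LINT x|torus. \<bar>u s x - u t x\<bar>) < e" if t: "t \<in> {0<..<T}" and e: "e > 0" for t e
  proof -
    have tT: "t \<in> {0..T}" using t by auto
    have "((\<lambda>s. L1_norm cell (\<lambda>x. u s x - u t x)) \<longlongrightarrow> 0) (at t within {0..T})"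
      using CL tT by (auto simp: C_time_L1_def)
    then have "\<forall>\<^sub>F s in at t within {0..T}. L1_norm cell (\<lambda>x. u s x - u t x) < e" using e by (rule order_tendstoD)
    then obtain d where d: "d > 0" "\<And>s. s \<in> {0..T} \<Longrightarrow> s \<noteq> t \<Longrightarrow> dist s t < d \<Longrightarrow> L1_norm cell (\<lambda>x. u s x - u t x) < e"
      unfolding eventually_at by blast
    have "(LINT x|torus. \<bar>u s x - u t x\<bar>) < e" if s: "s \<in> {0..T}" "\<bar>s - t\<bar> < d" for s
    proof (cases "s = t")
      case False
      note [measurable] = slice[OF s(1)] slice[OF tT]
      have "L1_norm cell (\<lambda>x. u s x - u t x) = (LINT x|torus. \<bar>u s x - u t x\<bar>)" by (rule L1_norm_torus) measurable
      then show ?thesis using d(2)[OF s(1) False] s(2) by (simp add: dist_real_def)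
    qed (use e in simp)
    with d(1) show ?thesis by blast
  qed
  \<comment> \<open>Approximate an arbitrary time by good times; truncation does not increase \<open>L1\<close> distances.\<close>
  have all: "AE x in torus. u t x = U t x" if t: "t \<in> {0<..<T}" for t
  proof -
    have tT: "t \<in> {0..T}" using t by auto
    have "(LINT x|torus. \<bar>u t x - U t x\<bar>) \<le> 0"
    proof (rule field_le_epsilon)
      fix e :: real assume e: "e > 0"
      obtain d where d: "d > 0" "\<And>s. s \<in> {0..T} \<Longrightarrow> \<bar>s - t\<bar> < d \<Longrightarrow> (LINT x|torus. \<bar>u s x - u t x\<bar>) < e / 2"
        using near[OF t, of "e / 2"] e by auto
      have "t < min (t + d) T" using d t by simp
      from AE_lborel_ex[OF good this] obtain s where s: "t < s" "s < t + d" "s < T" "AE x in torus. u s x = U s x"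
        using t by auto
      have sT: "s \<in> {0..T}" using s t by auto
      have "(LINT x|torus. \<bar>u t x - U t x\<bar>) \<le> (LINT x|torus. \<bar>u s x - u t x\<bar> + \<bar>u s x - u t x\<bar>)"
      proof (rule integral_mono_AE)
        show "AE x in torus. \<bar>u t x - U t x\<bar> \<le> \<bar>u s x - u t x\<bar> + \<bar>u s x - u t x\<bar>"
          using s(4)
        proof eventually_elim
          case (elim x)
          then show ?case using lip[OF sT tT, of x] by linarith
        qed
      qed (use iu[OF sT] iu[OF tT] iU in auto)
      also have "\<dots> = 2 * (LINT x|torus. \<bar>u s x - u t x\<bar>)" using iu[OF sT] iu[OF tT] by simp
      also have "\<dots> \<le> 0 + e" using d(2)[OF sT] s by simp
      finally show "(LINT x|torus. \<bar>u t x - U t x\<bar>) \<le> 0 + e" .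
    qed
    moreover have "0 \<le> (LINT x|torus. \<bar>u t x - U t x\<bar>)" by simp
    ultimately have "(LINT x|torus. \<bar>u t x - U t x\<bar>) = 0" by linarith
    moreover have "integrable torus (\<lambda>x. \<bar>u t x - U t x\<bar>)" using iu[OF tT] iU by simp
    ultimately have "AE x in torus. \<bar>u t x - U t x\<bar> = 0"
      using integral_nonneg_eq_0_iff_AE[of torus "\<lambda>x. \<bar>u t x - U t x\<bar>"] by simp
    then show ?thesis by simp
  qed
  have cont: "\<exists>d>0. \<forall>s\<in>{t..t + d}. (LINT x|torus. \<bar>U s x - U t x\<bar>) \<le> e" if t: "t \<in> {0<..<T}" and e: "e > 0" for t e
  proof -
    have tT: "t \<in> {0..T}" using t by auto
    obtain d where d: "d > 0" "\<And>s. s \<in> {0..T} \<Longrightarrow> \<bar>s - t\<bar> < d \<Longrightarrow> (LINT x|torus. \<bar>u s x - u t x\<bar>) < e"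
      using near[OF t e] by auto
    show ?thesis
    proof (intro exI[of _ "min (d / 2) (T - t)"] conjI ballI)
      show "0 < min (d / 2) (T - t)" using d t by simp
      fix s assume "s \<in> {t..t + min (d / 2) (T - t)}"
      then have s: "s \<in> {0..T}" "\<bar>s - t\<bar> < d" using t d(1) by auto
      have "(LINT x|torus. \<bar>U s x - U t x\<bar>) \<le> (LINT x|torus. \<bar>u s x - u t x\<bar>)"
        using iu[OF s(1)] iu[OF tT] iU lip[OF s(1) tT] by (intro integral_mono) auto
      then show "(LINT x|torus. \<bar>U s x - U t x\<bar>) \<le> e" using d(2)[OF s] by simp
    qed
  qed
  show ?thesis using that[OF Um Ub Uper _ all cont] ubm by (simp add: ub_def)
qed

lemma levy_adj_small_continuous:
  assumes levy: "levy_measure \<mu>" and w: "C2_torus w"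
  shows "continuous_on UNIV (levy_adj_small \<mu> r w)"
proof -
  note w1 = C1_torusD[OF C2_torusD(1)[OF w]]
  note [measurable] = w1(5)
  define g where "g x z = w (x - z) - w x + (z \<bullet> grad w x) * indicator {z. norm z < 1} z" for x z
  obtain C where C: "C \<ge> 0" "\<And>x z. \<bar>w (x + z) - w x - (z \<bullet> grad w x) * indicator {z. norm z < 1} z\<bar> \<le> C * min ((norm z)\<^sup>2) 1"
    using levy_integrand_bound[OF w] by blast
  have g: "\<bar>g x z\<bar> \<le> C * min ((norm z)\<^sup>2) 1" for x z
    using C(2)[of x "- z"] by (simp add: g_def indicator_def)
  have gc: "continuous_on UNIV (grad w)"
    unfolding grad_def[abs_def] by (intro continuous_on_vec_lambda w1(3))
  have lim: "(\<lambda>n. levy_adj_small \<mu> r w (X n)) \<longlonglongrightarrow> levy_adj_small \<mu> r w x" if X: "X \<longlonglongrightarrow> x" for X x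
  proof -
    have "(\<lambda>n. LINT z|\<mu>. indicator {z. norm z \<le> r} z *\<^sub>R g (X n) z) \<longlonglongrightarrow> (LINT z|\<mu>. indicator {z. norm z \<le> r} z *\<^sub>R g x z)"
    proof (rule integral_dominated_convergence[where w="\<lambda>z. C * min ((norm z)\<^sup>2) 1"])
      show "integrable \<mu> (\<lambda>z. C * min ((norm z)\<^sup>2) 1)" by (rule integrable_mult_right[OF levy_weight[OF levy]])
      have "(\<lambda>z. indicator {z. norm z \<le> r} z *\<^sub>R g y z) \<in> borel_measurable borel" for y
        unfolding g_def by measurable
      then show "(\<lambda>z. indicator {z. norm z \<le> r} z *\<^sub>R g x z) \<in> borel_measurable \<mu>"
        "\<And>n. (\<lambda>z. indicator {z. norm z \<le> r} z *\<^sub>R g (X n) z) \<in> borel_measurable \<mu>"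
        by (auto intro: levy_borel[OF levy])
      show "AE z in \<mu>. norm (indicator {z. norm z \<le> r} z *\<^sub>R g (X n) z) \<le> C * min ((norm z)\<^sup>2) 1" for n
        using g C(1) by (auto simp: indicator_def intro!: always_eventually)
      show "AE z in \<mu>. (\<lambda>n. indicator {z. norm z \<le> r} z *\<^sub>R g (X n) z) \<longlonglongrightarrow> indicator {z. norm z \<le> r} z *\<^sub>R g x z"
      proof (intro always_eventually allI)
        fix z
        have wl: "(\<lambda>n. w (X n)) \<longlonglongrightarrow> w x" "(\<lambda>n. w (X n - z)) \<longlonglongrightarrow> w (x - z)" "(\<lambda>n. grad w (X n)) \<longlonglongrightarrow> grad w x"
          by (rule continuous_on_tendsto_compose[OF w1(4) _ UNIV_I] continuous_on_tendsto_compose[OF gc _ UNIV_I];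
              (intro tendsto_intros X)?; simp)+
        show "(\<lambda>n. indicator {z. norm z \<le> r} z *\<^sub>R g (X n) z) \<longlonglongrightarrow> indicator {z. norm z \<le> r} z *\<^sub>R g x z"
          unfolding g_def by (intro tendsto_intros wl)
      qed
    qed
    then show ?thesis by (simp add: levy_adj_small_def set_lebesgue_integral_def g_def)
  qed
  then show ?thesis
    unfolding continuous_on_sequentially by (auto simp: o_def)
qed

lemma levy_large_measurable:
  assumes levy: "levy_measure \<mu>" and r: "r > 0" and V: "(\<lambda>p. V (fst p) (snd p)) \<in> borel_measurable borel2"
  shows "(\<lambda>p. levy_large \<mu> r (V (fst p)) (snd p)) \<in> borel_measurable borel2"
proof -
  interpret N: finite_measure "levy_tail \<mu> r" by (rule finite_levy_tail[OF levy r])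
  note [measurable_cong] = sets_levy_tail[OF levy]
  have sl: "V t \<in> borel_measurable borel" for t
    using measurable_two_arguments[OF V, of "\<lambda>_. t" borel "\<lambda>x. x"] by simp
  have "(\<lambda>q. V (fst (fst q)) (snd (fst q) + snd q) - V (fst (fst q)) (snd (fst q))) \<in> borel_measurable (borel2 \<Otimes>\<^sub>M levy_tail \<mu> r)"
    by (intro borel_measurable_diff measurable_two_arguments[OF V]) measurable
  then have "(\<lambda>(p, z). V (fst p) (snd p + z) - V (fst p) (snd p)) \<in> borel_measurable (borel2 \<Otimes>\<^sub>M levy_tail \<mu> r)"
    by (simp add: split_beta')
  then have "(\<lambda>p. LINT z|levy_tail \<mu> r. V (fst p) (snd p + z) - V (fst p) (snd p)) \<in> borel_measurable borel2"
    by measurable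
  then show ?thesis by (simp add: levy_large_eq[OF levy sl])
qed

text \<open>The Levy measure may be singular, so that a null set of points can carry jumps. Fubini's theorem and translation
invariance show that this happens for almost no \<open>x\<close>.\<close>
lemma levy_large_cong_AE:
  assumes levy: "levy_measure \<mu>" and r: "r > 0"
    and [measurable]: "u \<in> borel_measurable borel" "w \<in> borel_measurable borel" and per: "periodic u" "periodic w"
    and eq: "AE x in torus. u x = w x"
  shows "AE x in torus. levy_large \<mu> r u x = levy_large \<mu> r w x"
proof -
  interpret N: finite_measure "levy_tail \<mu> r" by (rule finite_levy_tail[OF levy r])
  note [measurable_cong] = sets_levy_tail[OF levy]
  interpret P: pair_sigma_finite torus "levy_tail \<mu> r" ..
  have "AE x in torus. u (x + z) = w (x + z)" for z
    by (rule AE_torus_shift[OF eq]) (use per in \<open>auto simp: periodic_def\<close>)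
  then have "AE z in levy_tail \<mu> r. AE x in torus. u (x + z) = w (x + z)" by simp
  then have "AE x in torus. AE z in levy_tail \<mu> r. u (x + z) = w (x + z)"
    by (subst P.AE_commute) measurable
  then show ?thesis using eq
  proof eventually_elim
    case (elim x)
    have "(LINT z|levy_tail \<mu> r. u (x + z) - u x) = (LINT z|levy_tail \<mu> r. w (x + z) - w x)"
      by (rule integral_cong_AE) (use elim in \<open>auto elim: eventually_mono\<close>)
    then show ?case by (simp add: levy_large_eq[OF levy])
  qed
qed

section \<open>Doubling the time variable\<close>

text \<open>Smooth nonnegative test functions of time with support inside the open interval, together with their derivative.\<close>
definition time_test :: "real \<Rightarrow> real \<Rightarrow> (real \<Rightarrow> real) \<Rightarrow> (real \<Rightarrow> real) \<Rightarrow> bool" where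
  "time_test \<alpha> \<beta> g g' \<longleftrightarrow> (\<forall>k. Ck_on k UNIV g) \<and> (\<forall>x. g x \<ge> 0) \<and> (\<forall>x. (g has_real_derivative g' x) (at x)) \<and>
     continuous_on UNIV g' \<and> (\<exists>a b. \<alpha> < a \<and> a < b \<and> b < \<beta> \<and> (\<forall>t. t \<notin> {a..b} \<longrightarrow> g t = 0))"

lemma bounded_borel_compact_support:
  fixes h :: "real \<Rightarrow> real"
  assumes c: "continuous_on UNIV h" and 0: "\<And>x. x \<notin> {a..b} \<Longrightarrow> h x = 0"
  shows "bounded_borel borel h"
proof -
  have "compact (h ` {a..b})"
    by (rule compact_continuous_image) (use c in \<open>auto intro: continuous_on_subset\<close>)
  then obtain B where B: "\<And>y. y \<in> h ` {a..b} \<Longrightarrow> norm y \<le> B" using compact_imp_bounded bounded_iff by metis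
  have "\<bar>h x\<bar> \<le> \<bar>B\<bar>" for x
  proof (cases "x \<in> {a..b}")
    case True then have "norm (h x) \<le> B" by (intro B) auto
    then show ?thesis by simp
  qed (simp add: 0)
  then show ?thesis by (intro bounded_borelI borel_measurable_continuous_onI c)
qed

lemma time_test_bounded_borel:
  assumes g: "time_test \<alpha> \<beta> g g'"
  shows "bounded_borel borel g" "bounded_borel borel g'" "t \<notin> {\<alpha>..\<beta>} \<Longrightarrow> g t = 0" "t \<notin> {\<alpha>..\<beta>} \<Longrightarrow> g' t = 0"
proof -
  have g1: "(g has_real_derivative g' x) (at x)" "continuous_on UNIV g'" "g x \<ge> 0" for x
    using g by (auto simp: time_test_def)
  have g0: "g x = 0" if "x \<notin> {\<alpha>..\<beta>}" for x using g that by (force simp: time_test_def)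
  have g'0: "g' x = 0" if "x \<notin> {\<alpha>..\<beta>}" for x
    by (rule DERIV_local_min[OF g1(1), of 1]) (auto simp: g0[OF that] g1(3))
  have "continuous_on UNIV g" using g1(1) by (meson DERIV_isCont continuous_at_imp_continuous_on)
  then show "bounded_borel borel g" "bounded_borel borel g'"
    using bounded_borel_compact_support g0 g'0 g1(2) by blast+
  show "t \<notin> {\<alpha>..\<beta>} \<Longrightarrow> g t = 0" "t \<notin> {\<alpha>..\<beta>} \<Longrightarrow> g' t = 0" by (fact g0, fact g'0)
qed

text \<open>A bump of mass one on \<open>{t..t + h}\<close>: the rescaled derivative of the smooth step. The argument is written in affine
form so that smoothness follows from \<open>Ck_on_affine\<close>.\<close>
definition bump :: "real \<Rightarrow> real \<Rightarrow> real \<Rightarrow> real" where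
  "bump h t a = smooth_step' ((1 / h) * a + (- t / h)) / h"

lemma Ck_on_smooth_step': "Ck_on k UNIV smooth_step'"
proof -
  have "Ck_on k UNIV (\<lambda>x. frechet_derivative smooth_step (at x) 1)"
    using Ck_on_smooth_step[of "Suc k"] by simp
  moreover have "frechet_derivative smooth_step (at x) 1 = smooth_step' x" for x
    using fun_cong[OF frechet_derivative_at[OF smooth_step_deriv[of x, unfolded has_field_derivative_def]], of 1] by simp
  ultimately show ?thesis by simp
qed

lemma bump_nonneg: "h > 0 \<Longrightarrow> bump h t a \<ge> 0"
  by (simp add: bump_def smooth_step'_nonneg)

lemma bump_eq_0: "h > 0 \<Longrightarrow> a \<notin> {t..t + h} \<Longrightarrow> bump h t a = 0"
  unfolding bump_def by (subst smooth_step'_eq_0) (auto simp: field_simps)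

definition bump' :: "real \<Rightarrow> real \<Rightarrow> real \<Rightarrow> real" where
  "bump' h t a = frechet_derivative smooth_step' (at ((a - t) / h)) 1 / h\<^sup>2"

lemma smooth_step'_deriv:
  "(smooth_step' has_real_derivative frechet_derivative smooth_step' (at x) 1) (at x)"
  "continuous_on UNIV (\<lambda>x. frechet_derivative smooth_step' (at x) 1)"
proof -
  obtain \<rho>' where \<rho>': "\<And>x. (smooth_step' has_real_derivative \<rho>' x) (at x)" "continuous_on UNIV \<rho>'"
    using C1_real_function[OF Ck_on_smooth_step'[of "Suc 0"]] by blast
  have "frechet_derivative smooth_step' (at x) 1 = \<rho>' x" for x
    using fun_cong[OF frechet_derivative_at[OF \<rho>'(1)[of x, unfolded has_field_derivative_def]], of 1] by simp
  then show "(smooth_step' has_real_derivative frechet_derivative smooth_step' (at x) 1) (at x)"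
    "continuous_on UNIV (\<lambda>x. frechet_derivative smooth_step' (at x) 1)"
    using \<rho>' by simp_all
qed

lemma bump_derivative:
  assumes h: "h > 0"
  shows "((\<lambda>a. bump h t a) has_real_derivative bump' h t a) (at a)"
    and "((\<lambda>t. bump h t a) has_real_derivative - bump' h t a) (at t)"
proof -
  have eq: "bump h t a = smooth_step' ((a - t) / h) / h" for t a
    by (simp add: bump_def diff_divide_distrib)
  have 1: "((\<lambda>a. (a - t) / h) has_real_derivative 1 / h) (at a)"
    using h by (auto intro!: derivative_eq_intros)
  have 2: "((\<lambda>t. (a - t) / h) has_real_derivative - 1 / h) (at t)"
    using h by (auto intro!: derivative_eq_intros)
  show "((\<lambda>a. bump h t a) has_real_derivative bump' h t a) (at a)"
    unfolding eq bump'_def using DERIV_cdivide[OF DERIV_chain2[OF smooth_step'_deriv(1) 1], of h]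
    by (simp add: power2_eq_square)
  show "((\<lambda>t. bump h t a) has_real_derivative - bump' h t a) (at t)"
    unfolding eq bump'_def using DERIV_cdivide[OF DERIV_chain2[OF smooth_step'_deriv(1) 2], of h]
    by (simp add: power2_eq_square)
qed

lemma Ck_on_bump: "Ck_on k UNIV (bump h t)"
proof -
  have "Ck_on k UNIV (\<lambda>a. smooth_step' ((1 / h) * a + (- t / h)))"
    by (rule Ck_on_affine[OF open_UNIV _ Ck_on_smooth_step']) (rule bounded_linear_mult_right)
  then have "Ck_on k UNIV (\<lambda>a. (1 / h) * smooth_step' ((1 / h) * a + (- t / h)))"
    by (intro Ck_on_mult Ck_on_const) auto
  then show ?thesis by (simp add: bump_def[abs_def])
qed

lemma continuous_on_bump: "continuous_on A (\<lambda>x. bump h (f x) (g x))" if "continuous_on A f" "continuous_on A g"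
proof -
  have "continuous_on A (\<lambda>x. (1 / h) * g x + (- f x) * (1 / h))"
    by (intro continuous_intros that)
  then have "continuous_on A (\<lambda>x. smooth_step' ((1 / h) * g x + (- f x) * (1 / h)))"
    by (rule continuous_on_compose2[OF continuous_on_smooth_step'[of UNIV]]) auto
  then have "continuous_on A (\<lambda>x. smooth_step' ((1 / h) * g x + (- f x) * (1 / h)) * (1 / h))"
    by (intro continuous_intros)
  then show ?thesis by (simp add: bump_def)
qed

lemma continuous_on_bump': "continuous_on A (\<lambda>x. bump' h (f x) (g x))" if "continuous_on A f" "continuous_on A g"
proof -
  have "continuous_on A (\<lambda>x. (g x - f x) * (1 / h))" by (intro continuous_intros that)
  then have "continuous_on A (\<lambda>x. frechet_derivative smooth_step' (at ((g x - f x) * (1 / h))) 1)"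
    by (rule continuous_on_compose2[OF smooth_step'_deriv(2)]) auto
  then have "continuous_on A (\<lambda>x. frechet_derivative smooth_step' (at ((g x - f x) * (1 / h))) 1 * (1 / h\<^sup>2))"
    by (intro continuous_intros)
  then show ?thesis by (simp add: bump'_def)
qed

lemma bounded_borel_bump:
  assumes "h > 0" "f \<in> borel_measurable N" "g \<in> borel_measurable N"
  shows "bounded_borel N (\<lambda>x. bump h (f x) (g x))" "bounded_borel N (\<lambda>x. bump' h (f x) (g x))"
proof -
  have 1: "bounded_borel borel smooth_step'"
    by (rule bounded_borel_compact_support[OF continuous_on_smooth_step', of 0 1]) (auto intro: smooth_step'_eq_0)
  have 2: "bounded_borel borel (\<lambda>x. frechet_derivative smooth_step' (at x) 1)"
  proof (rule bounded_borel_compact_support[OF smooth_step'_deriv(2), of 0 1])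
    show "frechet_derivative smooth_step' (at x) 1 = 0" if "x \<notin> {0..1}" for x
      by (rule DERIV_local_min[OF smooth_step'_deriv(1), of 1])
        (use that in \<open>auto simp: smooth_step'_nonneg smooth_step'_eq_0\<close>)
  qed
  have q: "(\<lambda>x. (1 / h) * g x + (- f x / h)) \<in> borel_measurable N" "(\<lambda>x. (g x - f x) / h) \<in> borel_measurable N"
    using assms by measurable
  show "bounded_borel N (\<lambda>x. bump h (f x) (g x))"
    unfolding bump_def divide_inverse[of "smooth_step' _"]
    by (intro bounded_borel_mult bounded_borel_compose[OF 1 q(1)] bounded_borel_const)
  show "bounded_borel N (\<lambda>x. bump' h (f x) (g x))"
    unfolding bump'_def divide_inverse[of "frechet_derivative _ _ _"]
    by (intro bounded_borel_mult bounded_borel_compose[OF 2 q(2)] bounded_borel_const)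
qed

lemma integral_timespan2:
  fixes f :: "real \<Rightarrow> real \<Rightarrow> real"
  assumes f: "bounded_borel borel2 (\<lambda>p. f (fst p) (snd p))"
  shows "(LINT b|timespan \<alpha> \<beta>. (LINT a|timespan \<alpha> \<beta>. f a b)) = (LINT p|(timespan \<alpha> \<beta> \<Otimes>\<^sub>M timespan \<alpha> \<beta>). f (fst p) (snd p))"
    and "(LINT a|timespan \<alpha> \<beta>. (LINT b|timespan \<alpha> \<beta>. f a b)) = (LINT p|(timespan \<alpha> \<beta> \<Otimes>\<^sub>M timespan \<alpha> \<beta>). f (fst p) (snd p))"
    and "integrable (timespan \<alpha> \<beta> \<Otimes>\<^sub>M timespan \<alpha> \<beta>) (\<lambda>p. f (fst p) (snd p))"
proof -
  let ?I = "timespan \<alpha> \<beta>"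
  interpret II: pair_sigma_finite ?I ?I ..
  interpret IIf: finite_measure "?I \<Otimes>\<^sub>M ?I" by (intro finite_measure_pair_measure timespan.finite_measure_axioms)
  obtain B where "\<And>p. \<bar>f (fst p) (snd p)\<bar> \<le> B" using f by (auto simp: bounded_borel_def)
  then show i: "integrable (?I \<Otimes>\<^sub>M ?I) (\<lambda>p. f (fst p) (snd p))"
    by (intro IIf.integrable_const_bound[where B=B]) (use bounded_borelD[OF f] in auto)
  show "(LINT b|?I. (LINT a|?I. f a b)) = (LINT p|(?I \<Otimes>\<^sub>M ?I). f (fst p) (snd p))"
    "(LINT a|?I. (LINT b|?I. f a b)) = (LINT p|(?I \<Otimes>\<^sub>M ?I). f (fst p) (snd p))"
    using i II.integral_snd[of f] II.integral_fst'[of "\<lambda>p. f (fst p) (snd p)"] by (simp_all add: split_beta')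
qed

lemma integral_bump:
  assumes h: "h > 0" and t: "\<alpha> \<le> t" "t + h \<le> \<beta>"
  shows "(LINT a|timespan \<alpha> \<beta>. bump h t a) = 1"
proof -
  have m: "(\<lambda>a. bump h t a) \<in> borel_measurable borel"
    by (rule bounded_borelD[OF bounded_borel_bump(1)[OF h]]) auto
  have "(LINT a|timespan \<alpha> \<beta>. bump h t a) = (LINT a:{\<alpha>..\<beta>}|lborel. bump h t a)"
    by (rule integral_timespan[OF m])
  also have "\<dots> = smooth_step ((\<beta> - t) / h) - smooth_step ((\<alpha> - t) / h)"
    unfolding set_lebesgue_integral_def
  proof (rule integral_FTC_Icc)
    show "((\<lambda>a. smooth_step ((a - t) / h)) has_vector_derivative bump h t a) (at a within {\<alpha>..\<beta>})" for a
    proof -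
      have "((\<lambda>a. (a - t) / h) has_real_derivative 1 / h) (at a)"
        using h by (auto intro!: derivative_eq_intros)
      from DERIV_chain2[OF smooth_step_deriv this]
      have "((\<lambda>a. smooth_step ((a - t) / h)) has_real_derivative bump h t a) (at a)"
        by (simp add: bump_def diff_divide_distrib)
      then show ?thesis
        by (simp add: has_field_derivative_at_within flip: has_real_derivative_iff_has_vector_derivative)
    qed
  qed (use t h in \<open>auto intro!: continuous_on_bump continuous_intros\<close>)
  also have "\<dots> = 1"
    using t h by (subst smooth_step_eq_0) (auto simp: smooth_step_eq_1 divide_le_0_iff le_divide_eq)
  finally show ?thesis .
qed

lemma time_test_bump:
  assumes "h > 0" "\<alpha> < t" "t + h < \<beta>"
    and "\<And>a. ((\<lambda>a. bump h t a) has_real_derivative g' a) (at a)" "continuous_on UNIV g'"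
  shows "time_test \<alpha> \<beta> (bump h t) g'"
proof -
  have "\<exists>a b. \<alpha> < a \<and> a < b \<and> b < \<beta> \<and> (\<forall>s. s \<notin> {a..b} \<longrightarrow> bump h t s = 0)"
    by (rule exI[of _ t], rule exI[of _ "t + h"]) (use assms(1-3) bump_eq_0[OF assms(1)] in auto)
  moreover have "(bump h t has_real_derivative g' x) (at x)" for x using assms(4)[of x] by simp
  ultimately show ?thesis
    unfolding time_test_def using assms(5) bump_nonneg[OF assms(1)] Ck_on_bump by blast
qed

text \<open>If the derivative of \<open>F\<close> in its first variable is at most \<open>c - B\<close> and in its second variable equal to \<open>B\<close>, both in
the sense of distributions, then \<open>F t t\<close> grows at most with speed \<open>c\<close>. For the proof average \<open>F\<close> with the weight
\<open>bump h t a * bump h t b\<close>. A change of \<open>t\<close> moves both bumps at once, so the derivative of the average is the sum of the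
two distributional derivatives. Then \<open>h\<close> tends to 0; the bumps look to the right, hence continuity from
the right is enough.\<close>
lemma diagonal_estimate:
  fixes F B :: "real \<Rightarrow> real \<Rightarrow> real"
  assumes F: "bounded_borel borel2 (\<lambda>p. F (fst p) (snd p))"
    and B: "bounded_borel borel2 (\<lambda>p. B (fst p) (snd p))"
    and H1: "\<And>g g' b. time_test \<alpha> \<beta> g g' \<Longrightarrow> b \<in> {\<alpha>..\<beta>} \<Longrightarrow> 0 \<le> (LINT a|timespan \<alpha> \<beta>. g' a * F a b + g a * (c - B a b))"
    and H2: "\<And>g g' a. time_test \<alpha> \<beta> g g' \<Longrightarrow> a \<in> {\<alpha>..\<beta>} \<Longrightarrow> 0 = (LINT b|timespan \<alpha> \<beta>. g' b * F a b + g b * B a b)"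
    and cont: "\<And>t e. t \<in> {t1, t2} \<Longrightarrow> e > 0 \<Longrightarrow> \<exists>d>0. \<forall>a\<in>{t..t + d}. \<forall>b\<in>{t..t + d}. \<bar>F a b - F t t\<bar> \<le> e"
    and t: "\<alpha> < t1" "t1 \<le> t2" "t2 < \<beta>"
  shows "F t2 t2 - F t1 t1 \<le> c * (t2 - t1)"
proof -
  let ?I = "timespan \<alpha> \<beta>" and ?J = "timespan t1 t2"
  let ?N = "(borel :: real measure) \<Otimes>\<^sub>M (borel :: real measure)"
  interpret II: finite_measure "?I \<Otimes>\<^sub>M ?I" by (intro finite_measure_pair_measure timespan.finite_measure_axioms)
  interpret J: pair_sigma_finite ?J "?I \<Otimes>\<^sub>M ?I" ..
  interpret Jf: finite_measure "?J \<Otimes>\<^sub>M (?I \<Otimes>\<^sub>M ?I)"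
    by (intro finite_measure_pair_measure timespan.finite_measure_axioms)
  define G where "G h t = (LINT p|(?I \<Otimes>\<^sub>M ?I). F (fst p) (snd p) * (bump h t (fst p) * bump h t (snd p)))" for h t
  have est: "G h t2 - G h t1 \<le> c * (t2 - t1)" if h: "h > 0" "t2 + h < \<beta>" for h
  proof -
    define Z where "Z t p = F (fst p) (snd p) * (- bump' h t (fst p) * bump h t (snd p) + bump h t (fst p) * (- bump' h t (snd p)))" for t p
    have Zb: "bounded_borel (borel \<Otimes>\<^sub>M ?N) (\<lambda>x. Z (fst x) (snd x))"
      unfolding Z_def
      by (intro bounded_borel_intros bounded_borel_uminus bounded_borel_bump[OF h(1)] bounded_borel_compose[OF F]) measurable
    have iZ: "integrable (?J \<Otimes>\<^sub>M (?I \<Otimes>\<^sub>M ?I)) (\<lambda>(t, p). Z t p)"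
    proof -
      obtain M where M: "\<forall>x. \<bar>Z (fst x) (snd x)\<bar> \<le> M" using Zb unfolding bounded_borel_def by blast
      show ?thesis unfolding split_beta'
        by (rule Jf.integrable_const_bound[where B=M]) (use M bounded_borelD[OF Zb] in auto)
    qed
    have bb: "bounded_borel ?N (\<lambda>p. bump h t (fst p))" "bounded_borel ?N (\<lambda>p. bump h t (snd p))"
      "bounded_borel ?N (\<lambda>p. bump' h t (fst p))" "bounded_borel ?N (\<lambda>p. bump' h t (snd p))" for t
      by (intro bounded_borel_bump[OF h(1)]; measurable)+
    note bounded = bounded_borel_intros bounded_borel_uminus bounded_borel_const F B bb
    have "G h t2 - G h t1 = (LINT p|(?I \<Otimes>\<^sub>M ?I). F (fst p) (snd p) * (bump h t2 (fst p) * bump h t2 (snd p))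
        - F (fst p) (snd p) * (bump h t1 (fst p) * bump h t1 (snd p)))"
      unfolding G_def
      by (rule Bochner_Integration.integral_diff[symmetric]; rule integral_timespan2(3)[of "\<lambda>a b. F a b * (bump h _ a * bump h _ b)"]; intro bounded)
    also have "\<dots> = (LINT p|(?I \<Otimes>\<^sub>M ?I). (LINT t|?J. Z t p))"
    proof (rule Bochner_Integration.integral_cong[OF refl])
      fix p :: "real \<times> real"
      have cZ: "continuous_on A (\<lambda>t. Z t p)" for A
        unfolding Z_def by (intro continuous_intros continuous_on_bump continuous_on_bump')
      have "(LINT t|?J. Z t p) = (LINT t:{t1..t2}|lborel. Z t p)"
        by (rule integral_timespan) (intro borel_measurable_continuous_onI cZ)
      also have "\<dots> = F (fst p) (snd p) * (bump h t2 (fst p) * bump h t2 (snd p)) - F (fst p) (snd p) * (bump h t1 (fst p) * bump h t1 (snd p))"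
        unfolding set_lebesgue_integral_def
      proof (rule integral_FTC_Icc[OF t(2) _ cZ])
        fix t
        have "((\<lambda>t. F (fst p) (snd p) * (bump h t (fst p) * bump h t (snd p))) has_real_derivative Z t p) (at t)"
          unfolding Z_def
          using DERIV_cmult[OF DERIV_mult[OF bump_derivative(2)[OF h(1), of "fst p" t] bump_derivative(2)[OF h(1), of "snd p" t]], of "F (fst p) (snd p)"]
          by (simp add: algebra_simps)
        then show "((\<lambda>t. F (fst p) (snd p) * (bump h t (fst p) * bump h t (snd p))) has_vector_derivative Z t p) (at t within {t1..t2})"
          by (simp add: has_field_derivative_at_within flip: has_real_derivative_iff_has_vector_derivative)
      qed
      finally show "F (fst p) (snd p) * (bump h t2 (fst p) * bump h t2 (snd p)) - F (fst p) (snd p) * (bump h t1 (fst p) * bump h t1 (snd p)) = (LINT t|?J. Z t p)"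
        by simp
    qed
    also have "\<dots> = (LINT t|?J. (LINT p|(?I \<Otimes>\<^sub>M ?I). Z t p))" by (rule J.Fubini_integral[OF iZ])
    also have "\<dots> \<le> (LINT t|?J. c)"
    proof (rule integral_mono_AE[OF J.integrable_fst[OF iZ]])
      show "AE s in ?J. (LINT p|(?I \<Otimes>\<^sub>M ?I). Z s p) \<le> c"
      proof (rule AE_timespanI)
        fix s assume s: "t1 \<le> s" "s \<le> t2"
        let ?g = "bump h s" and ?g' = "bump' h s"
        have tt: "time_test \<alpha> \<beta> ?g ?g'"
          by (rule time_test_bump[OF h(1) _ _ bump_derivative(1)[OF h(1)]])
            (use h s t in \<open>auto intro!: continuous_on_bump' continuous_intros\<close>)
        have g0: "?g b \<ge> 0" for b by (rule bump_nonneg[OF h(1)])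
        \<comment> \<open>Each hypothesis, in one variable, is integrated against the same bump in the other variable.\<close>
        have "0 \<le> (LINT b|?I. ?g b * (LINT a|?I. ?g' a * F a b + ?g a * (c - B a b)))"
          by (intro integral_nonneg_AE AE_timespanI mult_nonneg_nonneg g0 H1[OF tt]) auto
        also have "\<dots> = (LINT p|(?I \<Otimes>\<^sub>M ?I). ?g (snd p) * (?g' (fst p) * F (fst p) (snd p) + ?g (fst p) * (c - B (fst p) (snd p))))"
          unfolding integral_mult_right_zero[symmetric]
          by (rule integral_timespan2(1)[of "\<lambda>a b. ?g b * (?g' a * F a b + ?g a * (c - B a b))"]) (intro bounded)
        finally have 1: "0 \<le> (LINT p|(?I \<Otimes>\<^sub>M ?I). ?g (snd p) * (?g' (fst p) * F (fst p) (snd p) + ?g (fst p) * (c - B (fst p) (snd p))))" .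
        have "0 = (LINT a|?I. ?g a * (LINT b|?I. ?g' b * F a b + ?g b * B a b))"
          by (rule integral_eq_zero_AE[symmetric], rule AE_timespanI) (use H2[OF tt] in auto)
        also have "\<dots> = (LINT p|(?I \<Otimes>\<^sub>M ?I). ?g (fst p) * (?g' (snd p) * F (fst p) (snd p) + ?g (snd p) * B (fst p) (snd p)))"
          unfolding integral_mult_right_zero[symmetric]
          by (rule integral_timespan2(2)[of "\<lambda>a b. ?g a * (?g' b * F a b + ?g b * B a b)"]) (intro bounded)
        finally have 2: "0 = (LINT p|(?I \<Otimes>\<^sub>M ?I). ?g (fst p) * (?g' (snd p) * F (fst p) (snd p) + ?g (snd p) * B (fst p) (snd p)))" .
        have "(LINT p|(?I \<Otimes>\<^sub>M ?I). c * (?g (fst p) * ?g (snd p)))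
            = (LINT b|?I. (LINT a|?I. c * (?g a * ?g b)))"
          by (rule integral_timespan2(1)[of "\<lambda>a b. c * (?g a * ?g b)", symmetric]) (intro bounded)
        also have "\<dots> = c" using integral_bump[OF h(1), of \<alpha> s \<beta>] s t h by simp
        finally have 3: "(LINT p|(?I \<Otimes>\<^sub>M ?I). c * (?g (fst p) * ?g (snd p))) = c" .
        have i: "integrable (?I \<Otimes>\<^sub>M ?I) (\<lambda>p. ?g (snd p) * (?g' (fst p) * F (fst p) (snd p) + ?g (fst p) * (c - B (fst p) (snd p))))"
          "integrable (?I \<Otimes>\<^sub>M ?I) (\<lambda>p. ?g (fst p) * (?g' (snd p) * F (fst p) (snd p) + ?g (snd p) * B (fst p) (snd p)))"
          "integrable (?I \<Otimes>\<^sub>M ?I) (\<lambda>p. c * (?g (fst p) * ?g (snd p)))"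
          by (rule integral_timespan2(3)[of "\<lambda>a b. ?g b * (?g' a * F a b + ?g a * (c - B a b))"]
              integral_timespan2(3)[of "\<lambda>a b. ?g a * (?g' b * F a b + ?g b * B a b)"]
              integral_timespan2(3)[of "\<lambda>a b. c * (?g a * ?g b)"]; intro bounded)+
        have "(LINT p|(?I \<Otimes>\<^sub>M ?I). Z s p) = (LINT p|(?I \<Otimes>\<^sub>M ?I). c * (?g (fst p) * ?g (snd p))
            - ?g (snd p) * (?g' (fst p) * F (fst p) (snd p) + ?g (fst p) * (c - B (fst p) (snd p)))
            - ?g (fst p) * (?g' (snd p) * F (fst p) (snd p) + ?g (snd p) * B (fst p) (snd p)))"
          by (rule Bochner_Integration.integral_cong[OF refl]) (simp add: Z_def algebra_simps)
        then show "(LINT p|(?I \<Otimes>\<^sub>M ?I). Z s p) \<le> c"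
          unfolding Bochner_Integration.integral_diff[OF Bochner_Integration.integrable_diff[OF i(3,1)] i(2)]
            Bochner_Integration.integral_diff[OF i(3,1)] 3
          using 1 2 by linarith
      qed
    qed simp
    also have "\<dots> = c * (t2 - t1)" using t by (simp add: measure_def emeasure_timespan)
    finally show ?thesis .
  qed
  have conc: "\<exists>d>0. \<forall>h. 0 < h \<longrightarrow> h < d \<longrightarrow> \<bar>G h t - F t t\<bar> \<le> e" if t': "t \<in> {t1, t2}" and e: "e > 0" for t e
  proof -
    obtain d where d: "d > 0" "\<And>a b. a \<in> {t..t + d} \<Longrightarrow> b \<in> {t..t + d} \<Longrightarrow> \<bar>F a b - F t t\<bar> \<le> e"
      using cont[OF t' e] by blast
    show ?thesis
    proof (intro exI[of _ "min d (\<beta> - t2)"] conjI allI impI)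
      show "0 < min d (\<beta> - t2)" using d t by simp
      fix h assume h: "0 < h" "h < min d (\<beta> - t2)"
      let ?w = "\<lambda>a b. bump h t a * bump h t b"
      have bb: "bounded_borel ?N (\<lambda>p. bump h t (fst p))" "bounded_borel ?N (\<lambda>p. bump h t (snd p))"
        by (intro bounded_borel_bump[OF h(1)]; measurable)+
      note bounded = bounded_borel_intros bounded_borel_const F bb
      have i: "integrable (?I \<Otimes>\<^sub>M ?I) (\<lambda>p. F (fst p) (snd p) * ?w (fst p) (snd p))" "integrable (?I \<Otimes>\<^sub>M ?I) (\<lambda>p. ?w (fst p) (snd p))"
        by (rule integral_timespan2(3)[of "\<lambda>a b. F a b * ?w a b"] integral_timespan2(3)[of ?w]; intro bounded)+
      have w1: "(LINT p|(?I \<Otimes>\<^sub>M ?I). ?w (fst p) (snd p)) = 1"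
      proof -
        have "(LINT p|(?I \<Otimes>\<^sub>M ?I). ?w (fst p) (snd p)) = (LINT b|?I. (LINT a|?I. ?w a b))"
          by (rule integral_timespan2(1)[of ?w, symmetric]) (intro bounded)
        then show ?thesis using integral_bump[OF h(1), of \<alpha> t \<beta>] t t' h by auto
      qed
      have "G h t - F t t = (LINT p|(?I \<Otimes>\<^sub>M ?I). F (fst p) (snd p) * ?w (fst p) (snd p)) - (LINT p|(?I \<Otimes>\<^sub>M ?I). F t t * ?w (fst p) (snd p))"
        unfolding G_def integral_mult_right_zero w1 by simp
      also have "\<dots> = (LINT p|(?I \<Otimes>\<^sub>M ?I). F (fst p) (snd p) * ?w (fst p) (snd p) - F t t * ?w (fst p) (snd p))"
        by (rule Bochner_Integration.integral_diff[symmetric, OF i(1) integrable_mult_right[OF i(2)]])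
      finally have eqG: "G h t - F t t = (LINT p|(?I \<Otimes>\<^sub>M ?I). F (fst p) (snd p) * ?w (fst p) (snd p) - F t t * ?w (fst p) (snd p))" .
      have "\<bar>LINT p|(?I \<Otimes>\<^sub>M ?I). F (fst p) (snd p) * ?w (fst p) (snd p) - F t t * ?w (fst p) (snd p)\<bar> \<le> (LINT p|(?I \<Otimes>\<^sub>M ?I). e * ?w (fst p) (snd p))"
      proof (rule integral_abs_bound[THEN order_trans], rule integral_mono)
        show "integrable (?I \<Otimes>\<^sub>M ?I) (\<lambda>p. \<bar>F (fst p) (snd p) * ?w (fst p) (snd p) - F t t * ?w (fst p) (snd p)\<bar>)"
          by (rule integrable_abs[OF Bochner_Integration.integrable_diff[OF i(1) integrable_mult_right[OF i(2)]]])
        show "integrable (?I \<Otimes>\<^sub>M ?I) (\<lambda>p. e * ?w (fst p) (snd p))" by (rule integrable_mult_right[OF i(2)])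
        fix p :: "real \<times> real"
        obtain a b where p: "p = (a, b)" by (cases p)
        have w0: "0 \<le> ?w a b" using bump_nonneg[OF h(1)] by simp
        have "\<bar>(F a b - F t t) * ?w a b\<bar> \<le> e * ?w a b"
        proof (cases "a \<in> {t..t + h} \<and> b \<in> {t..t + h}")
          case True
          then have "\<bar>F a b - F t t\<bar> \<le> e" using h by (intro d(2)) auto
          then show ?thesis unfolding abs_mult[of "F a b - F t t"] abs_of_nonneg[OF w0] using w0 by (rule mult_right_mono)
        next
          case False
          then have "?w a b = 0" using bump_eq_0[OF h(1), of a t] bump_eq_0[OF h(1), of b t] by auto
          then show ?thesis by (simp only: mult_zero_right abs_zero order_refl)
        qed
        then show "\<bar>F (fst p) (snd p) * ?w (fst p) (snd p) - F t t * ?w (fst p) (snd p)\<bar> \<le> e * ?w (fst p) (snd p)"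
          unfolding p fst_conv snd_conv left_diff_distrib .
      qed
      also have "\<dots> = e" unfolding integral_mult_right_zero w1 by simp
      finally show "\<bar>G h t - F t t\<bar> \<le> e" unfolding eqG .
    qed
  qed
  show ?thesis
  proof (rule field_le_epsilon)
    fix e :: real assume e: "e > 0"
    obtain d1 where d1: "d1 > 0" "\<And>h. 0 < h \<Longrightarrow> h < d1 \<Longrightarrow> \<bar>G h t1 - F t1 t1\<bar> \<le> e / 2" using conc[of t1 "e / 2"] e by auto
    obtain d2 where d2: "d2 > 0" "\<And>h. 0 < h \<Longrightarrow> h < d2 \<Longrightarrow> \<bar>G h t2 - F t2 t2\<bar> \<le> e / 2" using conc[of t2 "e / 2"] e by auto
    define m where "m = min (min d1 d2) (\<beta> - t2)"
    define h where "h = m / 2"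
    have "0 < m" "m \<le> d1" "m \<le> d2" "m \<le> \<beta> - t2" using d1(1) d2(1) t by (auto simp: m_def)
    then have h: "0 < h" "h < d1" "h < d2" "t2 + h < \<beta>" by (auto simp: h_def)
    show "F t2 t2 - F t1 t1 \<le> c * (t2 - t1) + e"
      using est[OF h(1,4)] d1(2)[OF h(1,2)] d2(2)[OF h(1,3)] by linarith
  qed
qed

section \<open>Comparison through the kernel\<close>

abbreviation torus2 :: "((real^'n::finite) \<times> (real^'n)) measure" where
  "torus2 \<equiv> torus \<Otimes>\<^sub>M torus"

lemma torus2_pair: "pair_sigma_finite (torus :: (real^'n::finite) measure) (torus :: (real^'n) measure)"
  by (rule pair_torus(4))

lemma integrable_torus2:
  fixes g :: "(real^'n::finite) \<times> (real^'n) \<Rightarrow> real"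
  assumes "g \<in> borel_measurable borel2" "\<And>p. \<bar>g p\<bar> \<le> B"
  shows "integrable torus2 g"
proof -
  interpret finite_measure "torus2 :: ((real^'n) \<times> (real^'n)) measure" by (rule pair_torus(3))
  show ?thesis by (rule integrable_const_bound[of _ B]) (use assms in auto)
qed

lemma integral_torus2:
  fixes H :: "real^'n::finite \<Rightarrow> real^'n \<Rightarrow> real"
  assumes m: "(\<lambda>p. H (fst p) (snd p)) \<in> borel_measurable borel2" and b: "\<And>x y. \<bar>H x y\<bar> \<le> B"
  shows "(LINT p|torus2. H (fst p) (snd p)) = (LINT x|torus. (LINT y|torus. H x y))"
    and "(LINT p|torus2. H (fst p) (snd p)) = (LINT y|torus. (LINT x|torus. H x y))"
    and "integrable torus (\<lambda>x. LINT y|torus. H x y)" "integrable torus (\<lambda>y. LINT x|torus. H x y)"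
proof -
  interpret P: pair_sigma_finite "torus :: (real^'n) measure" "torus :: (real^'n) measure" by (rule torus2_pair)
  have i: "integrable torus2 (\<lambda>p. H (fst p) (snd p))" by (rule integrable_torus2[OF m, of B]) (rule b)
  then have i': "integrable torus2 (case_prod H)" by (simp add: split_beta')
  show "(LINT p|torus2. H (fst p) (snd p)) = (LINT x|torus. (LINT y|torus. H x y))"
    using P.integral_fst'[OF i] by simp
  show "(LINT p|torus2. H (fst p) (snd p)) = (LINT y|torus. (LINT x|torus. H x y))"
    using P.integral_snd[OF i'] by (simp add: split_beta')
  show "integrable torus (\<lambda>x. LINT y|torus. H x y)" using P.integrable_fst'[OF i] by simp
  show "integrable torus (\<lambda>y. LINT x|torus. H x y)" by (rule P.integrable_snd[OF i'])
qed

text \<open>With \<open>x = y + z\<close> the double integral is \<open>\<integral> k z * (\<integral> \<bar>U (z + y) - w y\<bar> dy) dz\<close>, and the inner integral differs from its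
value with \<open>w (y + z)\<close> in place of \<open>w y\<close> by a translation of \<open>w\<close>. That value does not depend on \<open>z\<close>. For a
kernel of mass one this recovers the \<open>L1\<close> distance; for a derivative of the kernel the main term vanishes.\<close>
lemma kernel_comparison:
  fixes U w k :: "real^'n::finite \<Rightarrow> real"
  assumes U [measurable]: "U \<in> borel_measurable borel" and UB: "\<And>x. \<bar>U x\<bar> \<le> A" and Up: "periodic U"
    and w [measurable]: "w \<in> borel_measurable borel" and wB: "\<And>x. \<bar>w x\<bar> \<le> A" and wp: "periodic w"
    and k: "continuous_on UNIV k" "periodic k"
    and C: "\<And>h. (LINT x|torus. \<bar>w (x + h) - w x\<bar>) \<le> C * sin_modulus h"
  shows "\<bar>(LINT p|torus2. k (fst p - snd p) * \<bar>U (fst p) - w (snd p)\<bar>) - (LINT x|torus. \<bar>U x - w x\<bar>) * (LINT z|torus. k z)\<bar>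
    \<le> C * (LINT z|torus. \<bar>k z\<bar> * sin_modulus z)"
proof -
  have [measurable]: "k \<in> borel_measurable borel" by (rule borel_measurable_continuous_onI[OF k(1)])
  have [measurable]: "sin_modulus \<in> borel_measurable borel" unfolding sin_modulus_def[abs_def] by measurable
  obtain B where B: "B > 0" "\<And>x. \<bar>k x\<bar> \<le> B" using periodic_continuous_bounded[OF k(2,1)] by blast
  have A: "0 \<le> A" using UB[of 0] by linarith
  have UwB: "\<bar>\<bar>U x - w y\<bar>\<bar> \<le> 2 * A" for x y using UB[of x] wB[of y] by linarith
  have b1: "\<bar>k a * \<bar>U x - w y\<bar>\<bar> \<le> B * (2 * A)" for a x y
    unfolding abs_mult using UwB[of x y] B by (intro mult_mono) auto
  define h where "h z = (LINT y|torus. \<bar>U (z + y) - w y\<bar>)" for z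
  define c0 where "c0 = (LINT x|torus. \<bar>U x - w x\<bar>)"
  have sm: "0 \<le> sin_modulus z" "sin_modulus z \<le> real CARD('n)" for z :: "real^'n"
  proof -
    show "0 \<le> sin_modulus z" by (simp add: sin_modulus_def sum_nonneg)
    have "sin_modulus z \<le> (\<Sum>i\<in>(UNIV::'n set). 1)" unfolding sin_modulus_def by (intro sum_mono) simp
    then show "sin_modulus z \<le> real CARD('n)" by simp
  qed
  have hc: "\<bar>h z - c0\<bar> \<le> C * sin_modulus z" for z
  proof -
    have "(LINT y|torus. \<bar>U (y + z) - w (y + z)\<bar>) = c0"
      unfolding c0_def by (rule integral_torus_shift(2)[of "\<lambda>x. \<bar>U x - w x\<bar>"]) (use Up wp in \<open>auto simp: periodic_def\<close>)
    then have c0: "c0 = (LINT y|torus. \<bar>U (z + y) - w (y + z)\<bar>)" by (simp add: add.commute)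
    have i1: "integrable torus (\<lambda>y. \<bar>U (z + y) - w y\<bar>)" "integrable torus (\<lambda>y. \<bar>U (z + y) - w (y + z)\<bar>)"
      by (rule integrable_torus_bounded[of _ "2 * A"]; use UwB in simp)+
    have i2: "integrable torus (\<lambda>y. \<bar>w (y + z) - w y\<bar>)"
    proof (rule integrable_torus_bounded[of _ "2 * A"])
      show "\<bar>\<bar>w (y + z) - w y\<bar>\<bar> \<le> 2 * A" for y using wB[of y] wB[of "y + z"] by linarith
    qed measurable
    have "h z - c0 = (LINT y|torus. \<bar>U (z + y) - w y\<bar> - \<bar>U (z + y) - w (y + z)\<bar>)"
      unfolding h_def c0 using i1 by simp
    then have "\<bar>h z - c0\<bar> \<le> (LINT y|torus. \<bar>\<bar>U (z + y) - w y\<bar> - \<bar>U (z + y) - w (y + z)\<bar>\<bar>)"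
      by (simp only: integral_abs_bound)
    also have "\<dots> \<le> (LINT y|torus. \<bar>w (y + z) - w y\<bar>)"
    proof (rule integral_mono[OF _ i2])
      show "integrable torus (\<lambda>y. \<bar>\<bar>U (z + y) - w y\<bar> - \<bar>U (z + y) - w (y + z)\<bar>\<bar>)"
        by (rule integrable_abs[OF Bochner_Integration.integrable_diff[OF i1]])
      show "\<bar>\<bar>U (z + y) - w y\<bar> - \<bar>U (z + y) - w (y + z)\<bar>\<bar> \<le> \<bar>w (y + z) - w y\<bar>" for y by linarith
    qed
    finally show ?thesis using C[of z] by linarith
  qed
  have hm [measurable]: "h \<in> borel_measurable borel"
  proof -
    have "(\<lambda>(z, y). \<bar>U (z + y) - w y\<bar>) \<in> borel_measurable (borel \<Otimes>\<^sub>M torus)" by measurable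
    then show ?thesis unfolding h_def by measurable
  qed
  have hb: "\<bar>h z\<bar> \<le> c0 + \<bar>C\<bar> * real CARD('n)" for z
  proof -
    have "C * sin_modulus z \<le> \<bar>C\<bar> * real CARD('n)" using sm[of z] by (intro mult_mono) auto
    moreover have "0 \<le> h z" "0 \<le> c0" by (simp_all add: h_def c0_def)
    ultimately show ?thesis using hc[of z] by linarith
  qed
  have "(LINT p|torus2. k (fst p - snd p) * \<bar>U (fst p) - w (snd p)\<bar>)
      = (LINT y|torus. (LINT x|torus. k (x - y) * \<bar>U x - w y\<bar>))"
    by (rule integral_torus2(2)[of "\<lambda>x y. k (x - y) * \<bar>U x - w y\<bar>", OF _ b1]) measurable
  also have "\<dots> = (LINT y|torus. (LINT z|torus. k z * \<bar>U (z + y) - w y\<bar>))"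
  proof (rule Bochner_Integration.integral_cong[OF refl])
    fix y
    have "periodic (\<lambda>x. k (x - y) * \<bar>U x - w y\<bar>)"
      using periodic_shift_diff[OF k(2), of y] Up by (simp add: periodic_def)
    from integral_torus_shift(2)[OF _ this, of y]
    show "(LINT x|torus. k (x - y) * \<bar>U x - w y\<bar>) = (LINT z|torus. k z * \<bar>U (z + y) - w y\<bar>)" by simp
  qed
  also have "\<dots> = (LINT p|torus2. k (fst p) * \<bar>U (fst p + snd p) - w (snd p)\<bar>)"
    by (rule integral_torus2(2)[of "\<lambda>z y. k z * \<bar>U (z + y) - w y\<bar>", OF _ b1, symmetric]) measurable
  also have "\<dots> = (LINT z|torus. (LINT y|torus. k z * \<bar>U (z + y) - w y\<bar>))"
    by (rule integral_torus2(1)[of "\<lambda>z y. k z * \<bar>U (z + y) - w y\<bar>", OF _ b1]) measurable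
  also have "\<dots> = (LINT z|torus. k z * h z)" by (simp add: h_def)
  finally have eq: "(LINT p|torus2. k (fst p - snd p) * \<bar>U (fst p) - w (snd p)\<bar>) = (LINT z|torus. k z * h z)" .
  have ik: "integrable torus k" by (rule integrable_torus_bounded[OF _ B(2)]) measurable
  have ikh: "integrable torus (\<lambda>z. k z * h z)"
  proof (rule integrable_torus_bounded)
    show "\<bar>k z * h z\<bar> \<le> B * (c0 + \<bar>C\<bar> * real CARD('n))" for z
      unfolding abs_mult using B hb[of z] by (intro mult_mono) auto
  qed measurable
  have iks: "integrable torus (\<lambda>z. \<bar>k z\<bar> * (C * sin_modulus z))"
  proof (rule integrable_torus_bounded)
    show "\<bar>\<bar>k z\<bar> * (C * sin_modulus z)\<bar> \<le> B * (\<bar>C\<bar> * real CARD('n))" for z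
      unfolding abs_mult using B sm[of z] by (intro mult_mono) auto
  qed measurable
  have "(LINT z|torus. k z * h z) - c0 * (LINT z|torus. k z) = (LINT z|torus. k z * h z - c0 * k z)"
    using ik ikh by simp
  also have "\<dots> = (LINT z|torus. k z * (h z - c0))" by (simp add: algebra_simps)
  finally have eq2: "(LINT z|torus. k z * h z) - c0 * (LINT z|torus. k z) = (LINT z|torus. k z * (h z - c0))" .
  have "\<bar>LINT z|torus. k z * (h z - c0)\<bar> \<le> (LINT z|torus. \<bar>k z * (h z - c0)\<bar>)" by (rule integral_abs_bound)
  also have "\<dots> \<le> (LINT z|torus. \<bar>k z\<bar> * (C * sin_modulus z))"
  proof (rule integral_mono[OF _ iks])
    show "integrable torus (\<lambda>z. \<bar>k z * (h z - c0)\<bar>)"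
      using ik ikh by (simp add: right_diff_distrib)
    show "\<bar>k z * (h z - c0)\<bar> \<le> \<bar>k z\<bar> * (C * sin_modulus z)" for z
      unfolding abs_mult by (intro mult_left_mono hc) simp
  qed
  also have "\<dots> = C * (LINT z|torus. \<bar>k z\<bar> * sin_modulus z)"
    by (simp add: mult.left_commute)
  finally show ?thesis unfolding eq c0_def[symmetric] eq2 .
qed

lemma integral_torus2_shift:
  fixes H :: "real^'n::finite \<Rightarrow> real^'n \<Rightarrow> real"
  assumes m: "(\<lambda>p. H (fst p) (snd p)) \<in> borel_measurable borel2" and b: "\<And>x y. \<bar>H x y\<bar> \<le> B"
    and p: "\<And>x. periodic (H x)" "\<And>y. periodic (\<lambda>x. H x y)"
  shows "(LINT p|torus2. H (fst p + z) (snd p + z)) = (LINT p|torus2. H (fst p) (snd p))"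
proof -
  have "(\<lambda>p. (fst p + z, snd p + z)) \<in> (borel :: (real^'n) measure) \<Otimes>\<^sub>M (borel :: (real^'n) measure) \<rightarrow>\<^sub>M borel \<Otimes>\<^sub>M borel" by measurable
  from measurable_compose[OF this m]
  have m': "(\<lambda>p. H (fst p + z) (snd p + z)) \<in> borel_measurable borel2" by simp
  have sl: "H x \<in> borel_measurable borel" for x
  proof -
    have "Pair x \<in> (borel :: (real^'n) measure) \<rightarrow>\<^sub>M borel \<Otimes>\<^sub>M borel" by simp
    from measurable_compose[OF this m] show ?thesis by simp
  qed
  have "(LINT p|torus2. H (fst p + z) (snd p + z)) = (LINT x|torus. (LINT y|torus. H (x + z) (y + z)))"
    by (rule integral_torus2(1)[of "\<lambda>x y. H (x + z) (y + z)", OF m' b])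
  also have "\<dots> = (LINT x|torus. (LINT y|torus. H (x + z) y))"
    by (rule Bochner_Integration.integral_cong[OF refl]) (rule integral_torus_shift(2)[OF sl p(1)])
  also have "\<dots> = (LINT x|torus. (LINT y|torus. H x y))"
  proof (rule integral_torus_shift(2)[of "\<lambda>x. LINT y|torus. H x y"])
    have "(\<lambda>(x, y). H x y) \<in> borel_measurable (borel \<Otimes>\<^sub>M torus)" using m by (simp add: split_beta')
    then show "(\<lambda>x. LINT y|torus. H x y) \<in> borel_measurable borel" by measurable
    have "H (x + axis j (2 * pi)) = H x" for x j
      by (rule ext) (use p(2) in \<open>simp add: periodic_def\<close>)
    then show "periodic (\<lambda>x. LINT y|torus. H x y)" by (simp add: periodic_def)
  qed
  also have "\<dots> = (LINT p|torus2. H (fst p) (snd p))" by (rule integral_torus2(1)[OF m b, symmetric])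
  finally show ?thesis .
qed

text \<open>The jumps of \<open>U\<close> and \<open>w\<close> are combined into one jump of \<open>(x, y)\<close> by \<open>(z, z)\<close>, which preserves the measure on pairs and
the weight \<open>k (x - y)\<close>.\<close>
lemma levy_large_doubled_le:
  fixes U w k :: "real^'n::finite \<Rightarrow> real"
  assumes levy: "levy_measure \<mu>" and r: "0 < r"
    and U [measurable]: "U \<in> borel_measurable borel" and UB: "\<And>x. \<bar>U x\<bar> \<le> A" and Up: "periodic U"
    and w [measurable]: "w \<in> borel_measurable borel" and wB: "\<And>x. \<bar>w x\<bar> \<le> A" and wp: "periodic w"
    and k: "continuous_on UNIV k" "periodic k" "\<And>x. k x \<ge> 0"
  shows "(LINT p|torus2. k (fst p - snd p) * (sgn (U (fst p) - w (snd p)) * (levy_large \<mu> r U (fst p) - levy_large \<mu> r w (snd p)))) \<le> 0"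
proof -
  interpret N: finite_measure "levy_tail \<mu> r" by (rule finite_levy_tail[OF levy r])
  note [measurable_cong] = sets_levy_tail[OF levy]
  have [measurable]: "k \<in> borel_measurable borel" by (rule borel_measurable_continuous_onI[OF k(1)])
  obtain B where B: "B > 0" "\<And>x. \<bar>k x\<bar> \<le> B" using periodic_continuous_bounded[OF k(2,1)] by blast
  have AB: "\<bar>U x - w y\<bar> \<le> 2 * A" for x y using UB[of x] wB[of y] by linarith
  have "(LINT p|torus2. k (fst p - snd p) * (sgn (U (fst p) - w (snd p))
      * (LINT z|levy_tail \<mu> r. (U (fst p + z) - w (snd p + z)) - (U (fst p) - w (snd p))))) \<le> 0"
  proof (rule kato_tail[where B="2 * A" and B'=B])
    show "finite_measure (torus2 :: ((real^'n) \<times> (real^'n)) measure)" by (rule pair_torus(3))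
    show "(LINT p|torus2. k (fst p - snd p) * \<bar>U (fst p + z) - w (snd p + z)\<bar>) = (LINT p|torus2. k (fst p - snd p) * \<bar>U (fst p) - w (snd p)\<bar>)" for z
    proof -
      have b: "\<bar>k (x - y) * \<bar>U x - w y\<bar>\<bar> \<le> B * (2 * A)" for x y
        unfolding abs_mult using AB[of x y] B by (intro mult_mono) auto
      have m: "(\<lambda>p. k (fst p - snd p) * \<bar>U (fst p) - w (snd p)\<bar>) \<in> borel_measurable borel2" by measurable
      have p1: "periodic (\<lambda>y. k (x - y) * \<bar>U x - w y\<bar>)" for x
        using periodic_reflect[OF k(2), of x] wp by (simp add: periodic_def)
      have p2: "periodic (\<lambda>x. k (x - y) * \<bar>U x - w y\<bar>)" for y
        using periodic_shift_diff[OF k(2), of y] Up by (simp add: periodic_def)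
      show ?thesis using integral_torus2_shift[of "\<lambda>x y. k (x - y) * \<bar>U x - w y\<bar>", OF m b p1 p2, of z] by simp
    qed
    show "k (fst p - snd p) \<le> B" for p :: "(real^'n) \<times> (real^'n)" using B(2)[of "fst p - snd p"] by simp
  qed (use AB k(3) in \<open>auto intro: N.finite_measure_axioms\<close>)
  then show ?thesis by (simp add: levy_large_difference[OF levy r U UB w wB])
qed

section \<open>The entropy inequality tested with a product\<close>

text \<open>The spatial part of the entropy inequality for the constant \<open>k\<close> and a test function that is \<open>\<kappa>\<close> in space.\<close>
definition entropy_production ::
  "(real^'n::finite) measure \<Rightarrow> (real \<Rightarrow> real^'n) \<Rightarrow> real \<Rightarrow> (real^'n \<Rightarrow> real) \<Rightarrow> real \<Rightarrow> (real^'n \<Rightarrow> real) \<Rightarrow> real^'n \<Rightarrow> real" where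
  "entropy_production \<mu> f r \<kappa> k w x =
     (\<Sum>j\<in>UNIV. partial j \<kappa> x * (sgn (w x - k) * (f (w x) $ j - f k $ j)))
     + \<bar>w x - k\<bar> * levy_adj_small \<mu> r \<kappa> x
     + \<kappa> x * (sgn (w x - k) * levy_large \<mu> r w x)
     + (levy_drift \<mu> r \<bullet> grad \<kappa> x) * \<bar>w x - k\<bar>"

lemma partial_cmult:
  assumes "\<kappa> differentiable (at x)"
  shows "partial j (\<lambda>x. c * \<kappa> x) x = c * partial j \<kappa> x"
proof -
  have "((\<lambda>x. c * \<kappa> x) has_derivative (\<lambda>v. c * frechet_derivative \<kappa> (at x) v)) (at x)"
    using assms by (auto intro!: derivative_eq_intros simp: frechet_derivative_works)
  from partial_eq[OF this] show ?thesis by (simp add: partial_def)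
qed

lemma grad_cmult:
  assumes "\<And>x. \<kappa> differentiable (at x)"
  shows "grad (\<lambda>x. c * \<kappa> x) x = c *\<^sub>R grad \<kappa> x"
  using partial_cmult[OF assms] by (simp add: grad_def vec_eq_iff)

lemma levy_adj_small_cmult:
  assumes "\<And>x. \<kappa> differentiable (at x)"
  shows "levy_adj_small \<mu> r (\<lambda>x. c * \<kappa> x) x = c * levy_adj_small \<mu> r \<kappa> x"
  unfolding levy_adj_small_def grad_cmult[OF assms] set_lebesgue_integral_def
  by (subst Bochner_Integration.integral_mult_right_zero[symmetric], rule Bochner_Integration.integral_cong)
     (auto simp: algebra_simps)

lemma levy_adj_small_shift:
  assumes "\<And>x. \<kappa> differentiable (at x)"
  shows "levy_adj_small \<mu> r (\<lambda>x. \<kappa> (x + h)) x = levy_adj_small \<mu> r \<kappa> (x + h)"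
proof -
  have "grad (\<lambda>x. \<kappa> (x + h)) x = grad \<kappa> (x + h)"
    by (simp add: grad_def partial_shift(2)[OF assms])
  moreover have "\<kappa> (x - z + h) = \<kappa> (x + h - z)" for z by (simp add: algebra_simps)
  ultimately show ?thesis unfolding levy_adj_small_def by (simp only:)
qed

lemma levy_adj_small_bounded:
  assumes levy: "levy_measure \<mu>" and w: "C2_torus w"
  obtains B where "B > 0" "\<And>x. \<bar>levy_adj_small \<mu> r w x\<bar> \<le> B"
proof -
  note D = C1_torusD[OF C2_torusD(1)[OF w]] C1_torusD(1)[OF C2_torusD(2)[OF w]]
  have 1: "w (x + axis j (2 * pi) - z) = w (x - z)" for x z j
    using periodic_shift_diff[OF D(1), of z] by (simp add: periodic_def)
  have 2: "grad w (x + axis j (2 * pi)) = grad w x" for x j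
    using D(7) by (simp add: grad_def periodic_def)
  have 3: "w (x + axis j (2 * pi)) = w x" for x j using D(1) by (simp add: periodic_def)
  have "periodic (levy_adj_small \<mu> r w)"
    unfolding levy_adj_small_def[abs_def] periodic_def by (simp only: 1 2 3 simp_thms)
  from periodic_continuous_bounded[OF this levy_adj_small_continuous[OF levy w]] that show thesis by blast
qed

lemma flux_continuous:
  assumes f: "\<And>j. Ck_on 1 UNIV (\<lambda>w. f w $ j :: real)"
  shows "continuous_on UNIV (\<lambda>w :: real. f w $ j)"
proof -
  have "Ck_on 0 UNIV (\<lambda>w. f w $ j)" by (rule Ck_on_le[OF f]) simp
  then show ?thesis by simp
qed

lemma entropy_production_measurable:
  fixes f :: "real \<Rightarrow> real^'n::finite" and \<mu> :: "(real^'n) measure"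
  assumes levy: "levy_measure \<mu>" and r: "0 < r" and f: "\<And>j. Ck_on 1 UNIV (\<lambda>w. f w $ j)"
    and \<kappa>: "C2_torus \<kappa>"
    and V: "(\<lambda>p. V (fst p) (snd p)) \<in> borel_measurable borel2"
  shows "(\<lambda>p. entropy_production \<mu> f r \<kappa> k (V (fst p)) (snd p)) \<in> borel_measurable borel2"
proof -
  note [measurable] = V levy_large_measurable[OF levy r V]
    C1_torusD(5,6)[OF C2_torusD(1)[OF \<kappa>]] borel_measurable_continuous_onI[OF levy_adj_small_continuous[OF levy \<kappa>]]
    borel_measurable_continuous_onI[OF flux_continuous[OF f]]
  show ?thesis unfolding entropy_production_def inner_grad by measurable
qed

text \<open>The entropy inequality for the test function \<open>g t * \<kappa> x\<close>, with the solution replaced by its bounded representative.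
Exchanging the two is legitimate although the nonlocal term is evaluated pointwise, by \<open>levy_large_cong_AE\<close>.\<close>
lemma entropy_test_inequality:
  fixes f :: "real \<Rightarrow> real^'n::finite" and \<mu> :: "(real^'n) measure" and \<kappa> :: "real^'n \<Rightarrow> real"
  assumes levy: "levy_measure \<mu>" and f: "\<And>j. Ck_on 1 UNIV (\<lambda>w. f w $ j)"
    and ent: "entropy_solution T \<mu> f u0 u"
    and U: "(\<lambda>p. U (fst p) (snd p)) \<in> borel_measurable borel2" "\<And>t. periodic (U t)"
    and um: "(\<lambda>p. indicator {0..T} (fst p) * u (fst p) (snd p)) \<in> borel_measurable borel2"
    and uU: "\<And>t. t \<in> {0<..<T} \<Longrightarrow> AE x in torus. u t x = U t x"
    and \<kappa>: "\<And>k. Ck_on k UNIV \<kappa>" "periodic \<kappa>" "\<And>x. \<kappa> x \<ge> 0"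
    and \<alpha>: "0 < \<alpha>" "\<alpha> < \<beta>" "\<beta> < T" and g: "time_test \<alpha> \<beta> g g'" and r: "0 < r"
  shows "0 \<le> (LINT p|(timespan \<alpha> \<beta> \<Otimes>\<^sub>M torus). g' (fst p) * (\<kappa> (snd p) * \<bar>U (fst p) (snd p) - k\<bar>)
     + g (fst p) * entropy_production \<mu> f r \<kappa> k (U (fst p)) (snd p))"
proof -
  define H where "H V p = g' (fst p) * (\<kappa> (snd p) * \<bar>V (fst p) (snd p) - k\<bar>)
     + g (fst p) * entropy_production \<mu> f r \<kappa> k (V (fst p)) (snd p)" for V :: "real \<Rightarrow> real^'n \<Rightarrow> real" and p
  define u' where "u' t x = indicator {0..T} t * u t x" for t x
  have \<kappa>2: "C2_torus \<kappa>" by (rule Ck_on_imp_C2_torus[OF \<kappa>(1,2)])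
  note \<kappa>1 = C2_torusD(1)[OF \<kappa>2]
  note \<kappa>d = C1_torusD(2)[OF \<kappa>1]
  have g1: "(g has_real_derivative g' x) (at x)" "continuous_on UNIV g'" "g x \<ge> 0" "Ck_on k UNIV g" for x k
    using g by (auto simp: time_test_def)
  note g0 = time_test_bounded_borel(3,4)[OF g]
  have gc: "continuous_on UNIV g" using g1(1) by (meson DERIV_isCont continuous_at_imp_continuous_on)
  have \<kappa>c: "continuous_on UNIV \<kappa>" by (rule C1_torusD(4)[OF \<kappa>1])
  note [measurable] = borel_measurable_continuous_onI[OF gc] borel_measurable_continuous_onI[OF g1(2)]
    borel_measurable_continuous_onI[OF \<kappa>c]
  have Hm: "H V \<in> borel_measurable borel2" if V: "(\<lambda>p. V (fst p) (snd p)) \<in> borel_measurable borel2" for V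
  proof -
    note [measurable] = V entropy_production_measurable[OF levy r f \<kappa>2 V]
    show ?thesis unfolding H_def[abs_def] by measurable
  qed
  have tf: "test_function T (\<lambda>t x. g t * \<kappa> x)"
    unfolding test_function_def
  proof (intro conjI ballI allI)
    have "Ck_on m ({0<..<T} \<times> (UNIV :: (real^'n) set)) (\<lambda>p. g (fst p) * \<kappa> (snd p))" for m
    proof (rule Ck_on_mult)
      show o: "open ({0<..<T} \<times> (UNIV :: (real^'n) set))" by (rule open_Times) auto
      show "Ck_on m ({0<..<T} \<times> (UNIV :: (real^'n) set)) (\<lambda>p. g (fst p))"
        using Ck_on_affine[OF o bounded_linear_fst g1(4)[of m], where c=0] by simp
      show "Ck_on m ({0<..<T} \<times> (UNIV :: (real^'n) set)) (\<lambda>p. \<kappa> (snd p))"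
        using Ck_on_affine[OF o bounded_linear_snd \<kappa>(1)[of m], where c=0] by simp
    qed
    then show "smooth_on ({0<..<T} \<times> UNIV) (\<lambda>(t, x). g t * \<kappa> x)"
      by (simp add: smooth_on_def split_beta')
    show "periodic (\<lambda>x. g t * \<kappa> x)" for t using \<kappa>(2) by (simp add: periodic_def)
    show "0 \<le> g t * \<kappa> x" for t x by (simp add: g1(3) \<kappa>(3))
    show "\<exists>a b. 0 < a \<and> a < b \<and> b < T \<and> (\<forall>t\<in>{0<..<T} - {a..b}. \<forall>x. g t * \<kappa> x = 0)"
      using \<alpha> g0(1) by (intro exI[of _ \<alpha>] exI[of _ \<beta>]) auto
  qed
  have "0 \<le> (LINT (t, x):{0<..<T} \<times> cell|lborel.
             eta (u t x) k * deriv (\<lambda>s. g s * \<kappa> x) t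
           + entropy_flux f (u t x) k \<bullet> grad (\<lambda>x. g t * \<kappa> x) x
           + eta (u t x) k * levy_adj_small \<mu> r (\<lambda>x. g t * \<kappa> x) x
           + eta' (u t x) k * levy_large \<mu> r (u t) x * (g t * \<kappa> x)
           + eta (u t x) k * (levy_drift \<mu> r \<bullet> grad (\<lambda>x. g t * \<kappa> x) x))"
    using ent r tf unfolding entropy_solution_def by (elim conjE) blast
  also have "\<dots> = (LINT p|lborel. indicator ({0<..<T} \<times> cell) p * H u p)"
    unfolding set_lebesgue_integral_def
  proof (rule Bochner_Integration.integral_cong[OF refl])
    fix p :: "real \<times> (real^'n)"
    obtain t x where p: "p = (t, x)" by (cases p)
    have d: "deriv (\<lambda>s. g s * \<kappa> x) t = g' t * \<kappa> x"
      by (rule DERIV_imp_deriv) (auto intro!: derivative_eq_intros g1(1))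
    show "indicator ({0<..<T} \<times> cell) p *\<^sub>R (case p of (t, x) \<Rightarrow> eta (u t x) k * deriv (\<lambda>s. g s * \<kappa> x) t
           + entropy_flux f (u t x) k \<bullet> grad (\<lambda>x. g t * \<kappa> x) x
           + eta (u t x) k * levy_adj_small \<mu> r (\<lambda>x. g t * \<kappa> x) x
           + eta' (u t x) k * levy_large \<mu> r (u t) x * (g t * \<kappa> x)
           + eta (u t x) k * (levy_drift \<mu> r \<bullet> grad (\<lambda>x. g t * \<kappa> x) x)) = indicator ({0<..<T} \<times> cell) p * H u p"
      unfolding p prod.case d H_def entropy_production_def grad_cmult[OF \<kappa>d] levy_adj_small_cmult[OF \<kappa>d]
      by (simp add: eta_def eta'_def inner_grad entropy_flux_def)
        (simp add: distrib_left mult_ac)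
  qed
  also have "\<dots> = (LINT p|lborel. indicator ({\<alpha>..\<beta>} \<times> cell) p * H u' p)"
  proof (rule Bochner_Integration.integral_cong[OF refl])
    fix p :: "real \<times> (real^'n)"
    obtain t x where p: "p = (t, x)" by (cases p)
    show "indicator ({0<..<T} \<times> cell) p * H u p = indicator ({\<alpha>..\<beta>} \<times> cell) p * H u' p"
    proof (cases "t \<in> {\<alpha>..\<beta>}")
      case True
      then have "t \<in> {0<..<T}" "u' t = u t" using \<alpha> by (auto simp: u'_def)
      then show ?thesis using True by (simp add: p H_def indicator_def)
    next
      case False
      then show ?thesis using g0[OF False] by (simp add: p H_def)
    qed
  qed
  also have "\<dots> = (LINT p|(timespan \<alpha> \<beta> \<Otimes>\<^sub>M torus). H u' p)"
  proof -
    have "timespan \<alpha> \<beta> \<Otimes>\<^sub>M (torus :: (real^'n) measure)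
      = density (lborel \<Otimes>\<^sub>M lborel) (\<lambda>(t, x). indicator {\<alpha>..\<beta>} t * indicator cell x)"
      unfolding timespan_def torus_def
      by (rule pair_measure_density)
        (auto simp flip: torus_def intro: torus.sigma_finite_measure_axioms lborel.sigma_finite_measure_axioms)
    also have "\<dots> = density lborel (\<lambda>p. ennreal (indicator ({\<alpha>..\<beta>} \<times> cell) p))"
      unfolding lborel_prod by (intro arg_cong[where f="density lborel"] ext) (auto simp: indicator_def)
    finally have e: "timespan \<alpha> \<beta> \<Otimes>\<^sub>M (torus :: (real^'n) measure) = density lborel (\<lambda>p. ennreal (indicator ({\<alpha>..\<beta>} \<times> cell) p))" .
    have m: "H u' \<in> borel_measurable borel" using Hm[of u'] um by (simp add: u'_def borel_prod)
    have c: "{\<alpha>..\<beta>} \<times> cell \<in> sets (borel :: (real \<times> (real^'n)) measure)"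
      unfolding borel_prod[symmetric] by (rule pair_measureI) auto
    show ?thesis unfolding e by (subst integral_density) (use m c in auto)
  qed
  also have "\<dots> = (LINT p|(timespan \<alpha> \<beta> \<Otimes>\<^sub>M torus). H U p)"
  proof (rule integral_cong_AE)
    interpret P: pair_sigma_finite "timespan \<alpha> \<beta>" "torus :: (real^'n) measure" by (rule pair_torus(1))
    have m: "H u' \<in> borel_measurable borel2" "H U \<in> borel_measurable borel2"
      using Hm[of u'] Hm[of U] um U(1) by (simp_all add: u'_def)
    then show m': "H u' \<in> borel_measurable (timespan \<alpha> \<beta> \<Otimes>\<^sub>M torus)" "H U \<in> borel_measurable (timespan \<alpha> \<beta> \<Otimes>\<^sub>M torus)"
      by simp_all
    show "AE p in timespan \<alpha> \<beta> \<Otimes>\<^sub>M torus. H u' p = H U p"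
    proof (rule P.AE_pair_measure)
      show "{p \<in> space (timespan \<alpha> \<beta> \<Otimes>\<^sub>M torus). H u' p = H U p} \<in> sets (timespan \<alpha> \<beta> \<Otimes>\<^sub>M torus)"
        using m' by measurable
      show "AE t in timespan \<alpha> \<beta>. AE x in torus. H u' (t, x) = H U (t, x)"
      proof (rule AE_timespanI)
        fix t assume "\<alpha> \<le> t" "t \<le> \<beta>"
        then have t: "t \<in> {0<..<T}" and u't: "u' t = u t" using \<alpha> by (auto simp: u'_def)
        have sl: "(\<lambda>x. V t x) \<in> borel_measurable borel" if "(\<lambda>p. V (fst p) (snd p)) \<in> borel_measurable borel2" for V :: "real \<Rightarrow> real^'n \<Rightarrow> real"
          by (rule measurable_two_arguments[OF that]) auto
        have m1: "u t \<in> borel_measurable borel" using sl[of u'] um u't by (simp add: u'_def[abs_def])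
        have m2: "U t \<in> borel_measurable borel" using sl[OF U(1)] by simp
        have per: "periodic (u t)" using ent t by (simp add: entropy_solution_def)
        show "AE x in torus. H u' (t, x) = H U (t, x)"
          using levy_large_cong_AE[OF levy r m1 m2 per U(2) uU[OF t]] uU[OF t]
          by eventually_elim (simp add: H_def entropy_production_def u't)
      qed
    qed
  qed
  finally show ?thesis by (simp add: H_def)
qed

section \<open>Doubling the space variable\<close>

lemma bounded_borel_levy_large:
  fixes V :: "real \<Rightarrow> real^'n::finite \<Rightarrow> real"
  assumes levy: "levy_measure \<mu>" and r: "0 < r" and V: "(\<lambda>p. V (fst p) (snd p)) \<in> borel_measurable borel2"
    and VB: "\<And>t x. \<bar>V t x\<bar> \<le> M"
  shows "bounded_borel borel2 (\<lambda>p. levy_large \<mu> r (V (fst p)) (snd p))"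
proof (rule bounded_borelI[OF levy_large_measurable[OF levy r V]])
  fix p :: "real \<times> (real^'n)"
  have "V (fst p) \<in> borel_measurable borel"
    using measurable_two_arguments[OF V, of "\<lambda>_. fst p" borel "\<lambda>x. x"] by simp
  then show "\<bar>levy_large \<mu> r (V (fst p)) (snd p)\<bar> \<le> 2 * M * measure (levy_tail \<mu> r) UNIV"
    by (rule levy_large_bounded(2)[OF levy r]) (rule VB)
qed

lemma bounded_borel_torus2: "bounded_borel borel2 h \<Longrightarrow> integrable torus2 h"
  unfolding bounded_borel_def using integrable_torus2 by blast

lemma bounded_borel_slice:
  assumes "bounded_borel (borel \<Otimes>\<^sub>M borel2) (\<lambda>p. H (fst p) (fst (snd p)) (snd (snd p)))"
  shows "bounded_borel borel2 (\<lambda>p. H t (fst p) (snd p))"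
  using bounded_borel_compose[OF assms, of "\<lambda>p. (t, p)"] by simp

lemma measurable_three_arguments:
  assumes "(\<lambda>p. H (fst p) (fst (snd p)) (snd (snd p))) \<in> borel_measurable (borel \<Otimes>\<^sub>M borel2)"
    and "a \<in> borel_measurable N" "b \<in> borel_measurable N" "c \<in> borel_measurable N"
  shows "(\<lambda>q. H (a q) (b q) (c q)) \<in> borel_measurable N"
  using measurable_compose[OF _ assms(1), of "\<lambda>q. (a q, (b q, c q))" N] assms(2-) by simp

lemma integral_time_torus2:
  fixes H :: "real \<Rightarrow> real^'n::finite \<Rightarrow> real^'n \<Rightarrow> real"
  assumes H: "bounded_borel (borel \<Otimes>\<^sub>M borel2) (\<lambda>p. H (fst p) (fst (snd p)) (snd (snd p)))"
  shows "(LINT y|torus. (LINT q|(timespan \<alpha> \<beta> \<Otimes>\<^sub>M torus). H (fst q) (snd q) y))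
    = (LINT t|timespan \<alpha> \<beta>. (LINT p|torus2. H t (fst p) (snd p)))"
proof -
  interpret P: pair_sigma_finite "timespan \<alpha> \<beta>" "torus :: (real^'n) measure" by (rule pair_torus(1))
  interpret Pf: finite_measure "timespan \<alpha> \<beta> \<Otimes>\<^sub>M (torus :: (real^'n) measure)" by (rule pair_torus(2))
  obtain B where B: "\<And>t x y. \<bar>H t x y\<bar> \<le> B"
  proof -
    obtain B where "\<And>p. \<bar>H (fst p) (fst (snd p)) (snd (snd p))\<bar> \<le> B" using H by (auto simp: bounded_borel_def)
    then show thesis by (intro that[of B]) (metis fst_conv snd_conv)
  qed
  note Hm = measurable_three_arguments[OF bounded_borelD[OF H]]
  define h where "h t y = (LINT x|torus. H t x y)" for t y
  have hm: "(\<lambda>(t, y). h t y) \<in> borel_measurable borel2"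
  proof -
    have "(\<lambda>(p, x). H (fst p) x (snd p)) \<in> borel_measurable (borel2 \<Otimes>\<^sub>M torus)"
      unfolding split_beta' by (rule Hm) measurable
    from torus.borel_measurable_lebesgue_integral[OF this] show ?thesis by (simp add: h_def split_beta')
  qed
  have hB: "\<bar>h t y\<bar> \<le> B * measure (torus :: (real^'n) measure) UNIV" for t y
  proof -
    have "(\<lambda>x. H t x y) \<in> borel_measurable borel"
      using measurable_compose[OF _ bounded_borelD[OF H], of "\<lambda>x. (t, (x, y))" borel] by simp
    then have "integrable torus (\<lambda>x. H t x y)" by (rule integrable_torus_bounded) (rule B)
    then have "(LINT x|torus. \<bar>H t x y\<bar>) \<le> (LINT x|(torus :: (real^'n) measure). B)"
      by (intro integral_mono) (auto simp: B)
    moreover have "(LINT x|(torus :: (real^'n) measure). B) = B * measure (torus :: (real^'n) measure) UNIV" by simp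
    moreover have "\<bar>h t y\<bar> \<le> (LINT x|torus. \<bar>H t x y\<bar>)" unfolding h_def by (rule integral_abs_bound)
    ultimately show ?thesis by linarith
  qed
  have ih: "integrable (timespan \<alpha> \<beta> \<Otimes>\<^sub>M torus) (\<lambda>(t, y). h t y)"
    by (rule Pf.integrable_const_bound[where B="B * measure (torus :: (real^'n) measure) UNIV"])
      (use hm hB in \<open>auto simp: split_beta'\<close>)
  have "(LINT q|(timespan \<alpha> \<beta> \<Otimes>\<^sub>M torus). H (fst q) (snd q) y) = (LINT t|timespan \<alpha> \<beta>. h t y)" for y
  proof -
    have "integrable (timespan \<alpha> \<beta> \<Otimes>\<^sub>M torus) (\<lambda>q. H (fst q) (snd q) y)"
    proof (rule Pf.integrable_const_bound[where B=B])
      show "(\<lambda>q. H (fst q) (snd q) y) \<in> borel_measurable (timespan \<alpha> \<beta> \<Otimes>\<^sub>M torus)" by (rule Hm) auto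
    qed (simp add: B)
    from P.integral_fst'[OF this] show ?thesis by (simp add: h_def)
  qed
  then have "(LINT y|torus. (LINT q|(timespan \<alpha> \<beta> \<Otimes>\<^sub>M torus). H (fst q) (snd q) y))
      = (LINT y|torus. (LINT t|timespan \<alpha> \<beta>. h t y))" by simp
  also have "\<dots> = (LINT t|timespan \<alpha> \<beta>. (LINT y|torus. h t y))" by (rule P.Fubini_integral[OF ih])
  also have "\<dots> = (LINT t|timespan \<alpha> \<beta>. (LINT p|torus2. H t (fst p) (snd p)))"
  proof (rule Bochner_Integration.integral_cong[OF refl])
    fix t
    show "(LINT y|torus. h t y) = (LINT p|torus2. H t (fst p) (snd p))"
      unfolding h_def
      by (rule integral_torus2(2)[symmetric]) (use bounded_borelD[OF bounded_borel_slice[OF H]] B in auto)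
  qed
  finally show ?thesis .
qed

text \<open>The function \<open>entropy_production\<close> for the kernel centred at \<open>y\<close> and the constant \<open>w y\<close>. It is written out as a function of
the pair so that its measurability in all variables can be read off.\<close>
definition pair_production ::
  "(real^'n::finite) measure \<Rightarrow> (real \<Rightarrow> real^'n) \<Rightarrow> real \<Rightarrow> (real^'n \<Rightarrow> real) \<Rightarrow> (real^'n \<Rightarrow> real) \<Rightarrow> (real^'n \<Rightarrow> real)
    \<Rightarrow> real^'n \<Rightarrow> real^'n \<Rightarrow> real" where
  "pair_production \<mu> f r K U w x y =
     (\<Sum>j\<in>UNIV. partial j K (x - y) * (sgn (U x - w y) * (f (U x) $ j - f (w y) $ j)))
     + \<bar>U x - w y\<bar> * levy_adj_small \<mu> r K (x - y)
     + K (x - y) * (sgn (U x - w y) * levy_large \<mu> r U x)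
     + (levy_drift \<mu> r \<bullet> grad K (x - y)) * \<bar>U x - w y\<bar>"

lemma entropy_production_translate:
  assumes "\<And>x. K differentiable (at x)"
  shows "entropy_production \<mu> f r (\<lambda>x. K (x - y)) (w y) U x = pair_production \<mu> f r K U w x y"
  using partial_shift(2)[OF assms, of _ "- y" x] levy_adj_small_shift[OF assms, of \<mu> r "- y" x]
  by (simp add: entropy_production_def pair_production_def grad_def)

lemma bounded_borel_pair_production:
  fixes U :: "real \<Rightarrow> real^'n::finite \<Rightarrow> real"
  assumes levy: "levy_measure \<mu>" and r: "0 < r" and f: "\<And>j. Ck_on 1 UNIV (\<lambda>w. f w $ j)"
    and K: "C2_torus K"
    and U: "(\<lambda>p. U (fst p) (snd p)) \<in> borel_measurable borel2" and UB: "\<And>t x. \<bar>U t x\<bar> \<le> A"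
    and w: "continuous_on UNIV w" "periodic w"
  shows "bounded_borel (borel \<Otimes>\<^sub>M borel2) (\<lambda>p. pair_production \<mu> f r K (U (fst p)) w (fst (snd p)) (snd (snd p)))"
    and "bounded_borel (borel \<Otimes>\<^sub>M borel2) (\<lambda>p. K (fst (snd p) - snd (snd p)) * \<bar>U (fst p) (fst (snd p)) - w (snd (snd p))\<bar>)"
proof -
  let ?M = "(borel :: real measure) \<Otimes>\<^sub>M ((borel :: (real^'n) measure) \<Otimes>\<^sub>M (borel :: (real^'n) measure))"
  note D = C1_torusD[OF C2_torusD(1)[OF K]]
  have diff: "bounded_borel ?M (\<lambda>p. h (fst (snd p) - snd (snd p)))" if "continuous_on UNIV h" "periodic h" for h
    by (rule bounded_borel_compose[OF bounded_borel_periodic[OF that]]) measurable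
  have adj: "bounded_borel ?M (\<lambda>p. levy_adj_small \<mu> r K (fst (snd p) - snd (snd p)))"
  proof -
    obtain B where "\<And>x. \<bar>levy_adj_small \<mu> r K x\<bar> \<le> B" using levy_adj_small_bounded[OF levy K] by blast
    then have "bounded_borel borel (levy_adj_small \<mu> r K)"
      by (intro bounded_borelI borel_measurable_continuous_onI levy_adj_small_continuous levy K)
    then show ?thesis by (rule bounded_borel_compose) measurable
  qed
  have tx: "bounded_borel ?M (\<lambda>p. h (fst p) (fst (snd p)))" if "bounded_borel borel2 (\<lambda>p. h (fst p) (snd p))" for h
    using bounded_borel_compose[OF that, of "\<lambda>p. (fst p, fst (snd p))" ?M] by simp
  have U': "bounded_borel ?M (\<lambda>p. U (fst p) (fst (snd p)))" by (rule tx[OF bounded_borelI[OF U UB]])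
  have LL: "bounded_borel ?M (\<lambda>p. levy_large \<mu> r (U (fst p)) (fst (snd p)))"
    by (rule tx[OF bounded_borel_levy_large[OF levy r U UB]])
  have w': "bounded_borel ?M (\<lambda>p. w (snd (snd p)))"
    by (rule bounded_borel_compose[OF bounded_borel_periodic[OF w]]) measurable
  have fU: "bounded_borel ?M (\<lambda>p. f (U (fst p) (fst (snd p))) $ j)" for j
    by (rule bounded_borel_continuous[OF flux_continuous[OF f] U'])
  have fw: "bounded_borel ?M (\<lambda>p. f (w (snd (snd p))) $ j)" for j
    by (rule bounded_borel_continuous[OF flux_continuous[OF f] w'])
  have part: "bounded_borel ?M (\<lambda>p. partial j K (fst (snd p) - snd (snd p)))" for j
    by (rule diff[OF D(3) C1_torusD(1)[OF C2_torusD(2)[OF K]]])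
  have K': "bounded_borel ?M (\<lambda>p. K (fst (snd p) - snd (snd p)))" by (rule diff[OF D(4,1)])
  show "bounded_borel ?M (\<lambda>p. pair_production \<mu> f r K (U (fst p)) w (fst (snd p)) (snd (snd p)))"
    unfolding pair_production_def inner_grad
    by (intro bounded_borel_intros bounded_borel_const U' LL w' fU fw part K' adj)
  show "bounded_borel ?M (\<lambda>p. K (fst (snd p) - snd (snd p)) * \<bar>U (fst p) (fst (snd p)) - w (snd (snd p))\<bar>)"
    by (intro bounded_borel_intros U' w' K')
qed

lemma doubled_entropy_inequality:
  fixes f :: "real \<Rightarrow> real^'n::finite" and \<mu> :: "(real^'n) measure" and K :: "real^'n \<Rightarrow> real"
  assumes levy: "levy_measure \<mu>" and f: "\<And>j. Ck_on 1 UNIV (\<lambda>w. f w $ j)"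
    and ent: "entropy_solution T \<mu> f u0 u"
    and U: "(\<lambda>p. U (fst p) (snd p)) \<in> borel_measurable borel2" "\<And>t. periodic (U t)" and UB: "\<And>t x. \<bar>U t x\<bar> \<le> A"
    and um: "(\<lambda>p. indicator {0..T} (fst p) * u (fst p) (snd p)) \<in> borel_measurable borel2"
    and uU: "\<And>t. t \<in> {0<..<T} \<Longrightarrow> AE x in torus. u t x = U t x"
    and K: "\<And>k. Ck_on k UNIV K" "periodic K" "\<And>x. K x \<ge> 0"
    and \<alpha>: "0 < \<alpha>" "\<alpha> < \<beta>" "\<beta> < T" and g: "time_test \<alpha> \<beta> g g'" and r: "0 < r"
    and w: "continuous_on UNIV w" "periodic w"
  shows "0 \<le> (LINT t|timespan \<alpha> \<beta>. g' t * (LINT p|torus2. K (fst p - snd p) * \<bar>U t (fst p) - w (snd p)\<bar>)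
     + g t * (LINT p|torus2. pair_production \<mu> f r K (U t) w (fst p) (snd p)))"
proof -
  have K2: "C2_torus K" by (rule Ck_on_imp_C2_torus[OF K(1,2)])
  note Kd = C1_torusD(2)[OF C2_torusD(1)[OF K2]]
  note bb = bounded_borel_pair_production[OF levy r f K2 U(1) UB w]
  define H where "H t x y = g' t * (K (x - y) * \<bar>U t x - w y\<bar>) + g t * pair_production \<mu> f r K (U t) w x y" for t x y
  have bH: "bounded_borel (borel \<Otimes>\<^sub>M borel2) (\<lambda>p. H (fst p) (fst (snd p)) (snd (snd p)))"
    unfolding H_def
    by (intro bounded_borel_add bounded_borel_mult[OF _ bb(1)] bounded_borel_mult[OF _ bb(2)]
        bounded_borel_compose[OF time_test_bounded_borel(1)[OF g]] bounded_borel_compose[OF time_test_bounded_borel(2)[OF g]]) measurable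
  have "0 \<le> (LINT q|(timespan \<alpha> \<beta> \<Otimes>\<^sub>M torus). H (fst q) (snd q) y)" for y
  proof -
    have Ky: "Ck_on k UNIV (\<lambda>x. K (x - y))" for k
      using Ck_on_affine[OF open_UNIV bounded_linear_ident K(1)[of k], where c="- y"] by simp
    show ?thesis
      using entropy_test_inequality[OF levy f ent U um uU Ky periodic_shift_diff[OF K(2)] K(3) \<alpha> g r, of "w y"]
      by (simp add: H_def entropy_production_translate[OF Kd])
  qed
  then have "0 \<le> (LINT y|torus. (LINT q|(timespan \<alpha> \<beta> \<Otimes>\<^sub>M torus). H (fst q) (snd q) y))"
    by (intro integral_nonneg_AE) simp
  also have "\<dots> = (LINT t|timespan \<alpha> \<beta>. (LINT p|torus2. H t (fst p) (snd p)))"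
    by (rule integral_time_torus2[OF bH])
  also have "\<dots> = (LINT t|timespan \<alpha> \<beta>. g' t * (LINT p|torus2. K (fst p - snd p) * \<bar>U t (fst p) - w (snd p)\<bar>)
     + g t * (LINT p|torus2. pair_production \<mu> f r K (U t) w (fst p) (snd p)))"
  proof (rule Bochner_Integration.integral_cong[OF refl])
    fix t
    have i: "integrable torus2 (\<lambda>p. K (fst p - snd p) * \<bar>U t (fst p) - w (snd p)\<bar>)"
      by (rule bounded_borel_torus2, rule bounded_borel_compose[OF bb(2), of "\<lambda>p. (t, p)", simplified]) simp
    have i': "integrable torus2 (\<lambda>p. pair_production \<mu> f r K (U t) w (fst p) (snd p))"
      by (rule bounded_borel_torus2, rule bounded_borel_compose[OF bb(1), of "\<lambda>p. (t, p)", simplified]) simp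
    show "(LINT p|torus2. H t (fst p) (snd p)) = g' t * (LINT p|torus2. K (fst p - snd p) * \<bar>U t (fst p) - w (snd p)\<bar>)
     + g t * (LINT p|torus2. pair_production \<mu> f r K (U t) w (fst p) (snd p))"
      unfolding H_def using i i' by simp
  qed
  finally show ?thesis .
qed

lemma integral_le_torus2:
  fixes L R :: "real^'n::finite \<Rightarrow> real^'n \<Rightarrow> real"
  assumes L: "bounded_borel borel2 (\<lambda>p. L (fst p) (snd p))" and R: "bounded_borel borel2 (\<lambda>p. R (fst p) (snd p))"
    and le: "\<And>x. (LINT y|torus. L x y) \<le> (LINT y|torus. R x y)"
  shows "(LINT p|torus2. L (fst p) (snd p)) \<le> (LINT p|torus2. R (fst p) (snd p))"
proof -
  obtain A where "\<And>p. \<bar>L (fst p) (snd p)\<bar> \<le> A" using L by (auto simp: bounded_borel_def)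
  then have A: "\<bar>L x y\<bar> \<le> A" for x y by (metis fst_conv snd_conv)
  obtain B where "\<And>p. \<bar>R (fst p) (snd p)\<bar> \<le> B" using R by (auto simp: bounded_borel_def)
  then have B: "\<bar>R x y\<bar> \<le> B" for x y by (metis fst_conv snd_conv)
  note l = integral_torus2[of L, OF bounded_borelD[OF L] A] and r = integral_torus2[of R, OF bounded_borelD[OF R] B]
  show ?thesis unfolding l(1) r(1) by (rule integral_mono[OF l(3) r(3) le])
qed

lemma reflected_kernel:
  fixes K :: "real^'n::finite \<Rightarrow> real"
  assumes K: "C2_torus K"
  shows "C2_torus (\<lambda>y. K (x - y))" "partial j (\<lambda>y. K (x - y)) y = - partial j K (x - y)"
    "laplacian (\<lambda>y. K (x - y)) y = laplacian K (x - y)"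
proof -
  note D = C2_torusD[OF K]
  have 1: "partial j (\<lambda>y. K (x - y)) = (\<lambda>y. - partial j K (x - y))" for j
    using partial_reflect(2)[OF C1_torusD(2)[OF D(1)]] by (intro ext) simp
  then show "partial j (\<lambda>y. K (x - y)) y = - partial j K (x - y)" by simp
  have 2: "C1_torus (\<lambda>y. partial j K (x - y))" for j by (rule C1_torus_reflect[OF D(2)])
  show "C2_torus (\<lambda>y. K (x - y))"
    unfolding C2_torus_def 1 using C1_torus_reflect[OF D(1)] C1_torus_uminus(1)[OF 2] by simp
  have "partial j (partial j (\<lambda>y. K (x - y))) y = partial j (partial j K) (x - y)" for j
    unfolding 1 C1_torus_uminus(2)[OF 2] using partial_reflect(2)[OF C1_torusD(2)[OF D(2)]] by simp
  then show "laplacian (\<lambda>y. K (x - y)) y = laplacian K (x - y)" by (simp add: laplacian_def)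
qed

text \<open>The second integral is estimated by \<open>kruzkov_pair\<close> for \<open>w\<close> and the constant function \<open>U x\<close>, for each \<open>x\<close>. The
test function is then \<open>\<lambda>y. K (x - y)\<close>, whose gradient has the opposite sign: fluxes and drifts cancel.\<close>
lemma pair_production_le:
  fixes f :: "real \<Rightarrow> real^'n::finite" and \<mu> :: "(real^'n) measure" and U w wt K :: "real^'n \<Rightarrow> real"
  assumes levy: "levy_measure \<mu>" and r: "0 < r" and \<epsilon>: "\<epsilon> \<ge> 0" and f: "\<And>j. Ck_on 1 UNIV (\<lambda>w. f w $ j)"
    and K: "C2_torus K" "\<And>x. K x \<ge> 0" and D: "\<And>x. \<bar>levy_adj_small \<mu> r K x\<bar> \<le> D"
    and U: "U \<in> borel_measurable borel" "periodic U" and UA: "\<And>x. \<bar>U x\<bar> \<le> A"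
    and w: "C2_torus w" and wA: "\<And>x. \<bar>w x\<bar> \<le> A" and wt: "continuous_on UNIV wt" "periodic wt"
    and E: "AE x in torus. \<bar>wt x + divergence (\<lambda>y. f (w y)) x - \<epsilon> * laplacian w x
        - (levy_large \<mu> r w x - levy_drift \<mu> r \<bullet> grad w x)\<bar> \<le> E"
  shows "(LINT p|torus2. pair_production \<mu> f r K U w (fst p) (snd p))
      + (LINT p|torus2. K (fst p - snd p) * (sgn (w (snd p) - U (fst p)) * wt (snd p)))
    \<le> \<epsilon> * (LINT p|torus2. laplacian K (fst p - snd p) * \<bar>U (fst p) - w (snd p)\<bar>)
      + 2 * A * D * measure (torus2 :: ((real^'n) \<times> (real^'n)) measure) UNIV + E * (LINT p|(torus2 :: ((real^'n) \<times> (real^'n)) measure). K (fst p - snd p))"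
proof -
  let ?M = "(borel :: (real^'n) measure) \<Otimes>\<^sub>M (borel :: (real^'n) measure)"
  interpret T2: finite_measure "torus2 :: ((real^'n) \<times> (real^'n)) measure" by (rule pair_torus(3))
  note KD = C1_torusD[OF C2_torusD(1)[OF K(1)]] and wD = C1_torusD[OF C2_torusD(1)[OF w]]
  have Um: "(\<lambda>p. (\<lambda>t::real. U) (fst p) (snd p)) \<in> borel_measurable borel2" using U(1) by simp
  have diff: "bounded_borel ?M (\<lambda>p. h (fst p - snd p))" if "continuous_on UNIV h" "periodic h" for h
    by (rule bounded_borel_compose[OF bounded_borel_periodic[OF that]]) measurable
  have bP: "bounded_borel ?M (\<lambda>p. pair_production \<mu> f r K U w (fst p) (snd p))"
    using bounded_borel_slice[of "\<lambda>t::real. pair_production \<mu> f r K U w"]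
      bounded_borel_pair_production(1)[OF levy r f K(1) Um UA wD(4,1)] by simp
  have bw: "bounded_borel ?M (\<lambda>p. w (snd p))" by (rule bounded_borel_compose[OF bounded_borel_periodic[OF wD(4,1)]]) simp
  have bwt: "bounded_borel ?M (\<lambda>p. wt (snd p))" by (rule bounded_borel_compose[OF bounded_borel_periodic[OF wt]]) simp
  have bU: "bounded_borel ?M (\<lambda>p. U (fst p))" by (rule bounded_borel_compose[OF bounded_borelI[OF U(1) UA]]) simp
  have bfU: "bounded_borel ?M (\<lambda>p. f (U (fst p)) $ j)" for j by (rule bounded_borel_continuous[OF flux_continuous[OF f] bU])
  have bfw: "bounded_borel ?M (\<lambda>p. f (w (snd p)) $ j)" for j by (rule bounded_borel_continuous[OF flux_continuous[OF f] bw])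
  have bK: "bounded_borel ?M (\<lambda>p. K (fst p - snd p))" by (rule diff[OF KD(4,1)])
  have bKj: "bounded_borel ?M (\<lambda>p. partial j K (fst p - snd p))" for j
    by (rule diff[OF KD(3) C1_torusD(1)[OF C2_torusD(2)[OF K(1)]]])
  have bKjj: "bounded_borel ?M (\<lambda>p. partial j (partial j K) (fst p - snd p))" for j
    by (rule diff[OF C1_torusD(3)[OF C2_torusD(2)[OF K(1)]] periodic_partial[OF C1_torusD(1,2)[OF C2_torusD(2)[OF K(1)]]]])
  have blap: "bounded_borel ?M (\<lambda>p. laplacian K (fst p - snd p))"
    unfolding laplacian_def by (intro bounded_borel_sum bKjj)
  have LLb: "bounded_borel borel (levy_large \<mu> r v)" if "v \<in> borel_measurable borel" "\<And>x. \<bar>v x\<bar> \<le> A" for v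
    by (rule bounded_borelI[OF levy_large_bounded(1)[OF levy r that] levy_large_bounded(2)[OF levy r that]])
  have bLw: "bounded_borel ?M (\<lambda>p. levy_large \<mu> r w (snd p))"
    by (rule bounded_borel_compose[OF LLb[OF wD(5) wA]]) simp
  have bLU: "bounded_borel ?M (\<lambda>p. levy_large \<mu> r U (fst p))"
    by (rule bounded_borel_compose[OF LLb[OF U(1) UA]]) simp
  have badj: "bounded_borel ?M (\<lambda>p. levy_adj_small \<mu> r K (fst p - snd p))"
    by (rule bounded_borel_compose[OF bounded_borelI[OF borel_measurable_continuous_onI[OF levy_adj_small_continuous[OF levy K(1)]] D]]) measurable
  note bb = bounded_borel_intros bounded_borel_const bU bw bwt bfU bfw bK bKj blap bLw bLU badj
  define L where "L x y = K (x - y) * (sgn (w y - U x) * wt y)" for x y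
  define R where "R x y = (\<Sum>j\<in>UNIV. - partial j K (x - y) * (sgn (w y - U x) * (f (w y) $ j - f (U x) $ j)))
        + K (x - y) * (sgn (w y - U x) * levy_large \<mu> r w y)
        + (\<Sum>j\<in>UNIV. levy_drift \<mu> r $ j * - partial j K (x - y)) * \<bar>w y - U x\<bar>
        + \<epsilon> * (laplacian K (x - y) * \<bar>w y - U x\<bar>) + E * K (x - y)" for x y
  define S1 where "S1 p = \<epsilon> * (laplacian K (fst p - snd p) * \<bar>U (fst p) - w (snd p)\<bar>)" for p :: "(real^'n) \<times> (real^'n)"
  define S2 where "S2 p = \<bar>U (fst p) - w (snd p)\<bar> * levy_adj_small \<mu> r K (fst p - snd p)" for p :: "(real^'n) \<times> (real^'n)"
  define S3 where "S3 p = K (fst p - snd p) * (sgn (U (fst p) - w (snd p)) * (levy_large \<mu> r U (fst p) - levy_large \<mu> r w (snd p)))" for p :: "(real^'n) \<times> (real^'n)"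
  define S4 where "S4 p = E * K (fst p - snd p)" for p :: "(real^'n) \<times> (real^'n)"
  have bL: "bounded_borel ?M (\<lambda>p. L (fst p) (snd p))" unfolding L_def by (intro bb)
  have bR: "bounded_borel ?M (\<lambda>p. R (fst p) (snd p))"
    unfolding R_def by (intro bb bounded_borel_uminus)
  have bS: "bounded_borel ?M S1" "bounded_borel ?M S2" "bounded_borel ?M S3" "bounded_borel ?M S4"
    unfolding S1_def[abs_def] S2_def[abs_def] S3_def[abs_def] S4_def[abs_def] by (intro bb)+
  have le: "(LINT y|torus. L x y) \<le> (LINT y|torus. R x y)" for x
  proof -
    have c1: "continuous_on UNIV (\<lambda>y::real^'n. 0::real)" by simp
    have E2: "AE y in torus. \<bar>(0::real) + divergence (\<lambda>y. f ((\<lambda>y::real^'n. U x) y)) y - \<epsilon> * laplacian (\<lambda>y. U x) y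
        - (levy_large \<mu> r (\<lambda>y. U x) y - levy_drift \<mu> r \<bullet> grad (\<lambda>y. U x) y)\<bar> \<le> 0"
      by (simp add: divergence_def laplacian_def levy_large_def grad_def C1_torus_const(2)[abs_def] inner_vec_def)
    from kruzkov_pair[OF levy r \<epsilon> f w C2_torus_const[of "U x"] reflected_kernel(1)[OF K(1), of x] K(2) wt c1 periodic_const E E2]
    show ?thesis
      unfolding L_def R_def reflected_kernel(2,3)[OF K(1)] inner_grad
      by (simp add: levy_large_def)
  qed
  have sg: "sgn (a - b) = - sgn (b - a)" for a b :: real by (simp add: sgn_if)
  have id: "pair_production \<mu> f r K U w (fst p) (snd p) + R (fst p) (snd p) = S1 p + S2 p + S3 p + S4 p" for p
  proof -
    have 1: "- partial j K (fst p - snd p) * (sgn (w (snd p) - U (fst p)) * (f (w (snd p)) $ j - f (U (fst p)) $ j))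
      = - (partial j K (fst p - snd p) * (sgn (U (fst p) - w (snd p)) * (f (U (fst p)) $ j - f (w (snd p)) $ j)))" for j
      unfolding sg[of "w (snd p)"] by (simp add: algebra_simps)
    have 2: "(\<Sum>j\<in>UNIV. levy_drift \<mu> r $ j * - partial j K (fst p - snd p)) = - (levy_drift \<mu> r \<bullet> grad K (fst p - snd p))"
      by (simp add: inner_grad sum_negf)
    have 3: "\<bar>w (snd p) - U (fst p)\<bar> = \<bar>U (fst p) - w (snd p)\<bar>" by (rule abs_minus_commute)
    show ?thesis
      unfolding R_def pair_production_def 1 2 3 S1_def S2_def S3_def S4_def sum_negf unfolding sg[of "w (snd p)"]
      by (simp add: algebra_simps)
  qed
  have iP: "integrable torus2 (\<lambda>p. pair_production \<mu> f r K U w (fst p) (snd p))" by (rule bounded_borel_torus2[OF bP])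
  have iR: "integrable torus2 (\<lambda>p. R (fst p) (snd p))" by (rule bounded_borel_torus2[OF bR])
  note iS = bS[THEN bounded_borel_torus2]
  have "(LINT p|torus2. pair_production \<mu> f r K U w (fst p) (snd p)) + (LINT p|torus2. R (fst p) (snd p))
      = (LINT p|torus2. pair_production \<mu> f r K U w (fst p) (snd p) + R (fst p) (snd p))"
    using iP iR by simp
  then have eq: "(LINT p|torus2. pair_production \<mu> f r K U w (fst p) (snd p)) + (LINT p|torus2. R (fst p) (snd p))
      = (LINT p|torus2. S1 p) + (LINT p|torus2. S2 p) + (LINT p|torus2. S3 p) + (LINT p|torus2. S4 p)"
    unfolding id using iS by simp
  have s1: "(LINT p|torus2. S1 p) = \<epsilon> * (LINT p|torus2. laplacian K (fst p - snd p) * \<bar>U (fst p) - w (snd p)\<bar>)"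
    unfolding S1_def by simp
  have s4: "(LINT p|torus2. S4 p) = E * (LINT p|(torus2 :: ((real^'n) \<times> (real^'n)) measure). K (fst p - snd p))"
    unfolding S4_def by simp
  have s3: "(LINT p|torus2. S3 p) \<le> 0"
    unfolding S3_def by (rule levy_large_doubled_le[OF levy r U(1) UA U(2) wD(5) wA wD(1) KD(4,1) K(2)])
  have s2: "(LINT p|torus2. S2 p) \<le> 2 * A * D * measure (torus2 :: ((real^'n) \<times> (real^'n)) measure) UNIV"
  proof -
    have "(LINT p|torus2. S2 p) \<le> (LINT p|(torus2 :: ((real^'n) \<times> (real^'n)) measure). 2 * A * D)"
    proof (rule integral_mono[OF iS(2)])
      fix p :: "(real^'n) \<times> (real^'n)"
      have "\<bar>U (fst p) - w (snd p)\<bar> \<le> 2 * A" using UA[of "fst p"] wA[of "snd p"] by linarith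
      then have "\<bar>S2 p\<bar> \<le> 2 * A * D"
        unfolding S2_def abs_mult abs_abs using UA[of 0] by (intro mult_mono D) auto
      then show "S2 p \<le> 2 * A * D" by linarith
    qed simp
    then show ?thesis by (simp add: space_pair_measure mult_ac)
  qed
  have "(LINT p|torus2. L (fst p) (snd p)) \<le> (LINT p|torus2. R (fst p) (snd p))"
    by (rule integral_le_torus2[OF bL bR le])
  moreover have "(LINT p|torus2. L (fst p) (snd p)) = (LINT p|torus2. K (fst p - snd p) * (sgn (w (snd p) - U (fst p)) * wt (snd p)))"
    by (simp add: L_def)
  ultimately show ?thesis using eq s1 s2 s3 s4 by linarith
qed

text \<open>The factor \<open>CARD('n)\<close> appears twice: once for the second derivatives of the Laplacian and once for the summands of
\<open>sin_modulus\<close>.\<close>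
lemma integral_laplacian_kernel_le:
  fixes U w :: "real^'n::finite \<Rightarrow> real"
  assumes U: "U \<in> borel_measurable borel" and UB: "\<And>x. \<bar>U x\<bar> \<le> A" and Up: "periodic U"
    and w: "w \<in> borel_measurable borel" and wB: "\<And>x. \<bar>w x\<bar> \<le> A" and wp: "periodic w"
    and C: "C \<ge> 0" "\<And>h. (LINT x|torus. \<bar>w (x + h) - w x\<bar>) \<le> C * sin_modulus h" and n: "n \<ge> 1"
  shows "(LINT p|torus2. laplacian (kernel n) (fst p - snd p) * \<bar>U (fst p) - w (snd p)\<bar>)
    \<le> C * (real CARD('n))\<^sup>2 * sqrt (real n)"
proof -
  let ?k = "\<lambda>j. partial j (partial j (kernel n :: real^'n \<Rightarrow> real))"
  have K: "C2_torus (kernel n :: real^'n \<Rightarrow> real)" by (rule C2_torus_kernel)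
  note kD = C1_torusD[OF C2_torusD(2)[OF K]]
  have kp: "periodic (?k j)" for j by (rule periodic_partial[OF kD(1,2)])
  have i: "integrable torus2 (\<lambda>p. ?k j (fst p - snd p) * \<bar>U (fst p) - w (snd p)\<bar>)" for j
  proof (rule bounded_borel_torus2, rule bounded_borel_mult, rule bounded_borel_compose[OF bounded_borel_periodic[OF kD(3) kp]])
    show "bounded_borel borel2 (\<lambda>p. \<bar>U (fst p) - w (snd p)\<bar>)"
      by (intro bounded_borel_intros bounded_borel_compose[OF bounded_borelI[OF U UB]] bounded_borel_compose[OF bounded_borelI[OF w wB]]) auto
  qed measurable
  have le: "(LINT p|torus2. ?k j (fst p - snd p) * \<bar>U (fst p) - w (snd p)\<bar>) \<le> C * (real CARD('n) * sqrt (real n))" for j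
  proof -
    have "C * (LINT z|torus. \<bar>?k j z\<bar> * sin_modulus z) \<le> C * (real CARD('n) * sqrt (real n))"
      by (intro mult_left_mono partial2_kernel_sin_modulus n C)
    moreover have "(LINT z|torus. ?k j z) = 0" by (rule integral_partial_zero[OF C2_torusD(2)[OF K]])
    ultimately show ?thesis using kernel_comparison[where k="?k j", OF U UB Up w wB wp kD(3) kp C(2)] by simp
  qed
  have "(LINT p|torus2. laplacian (kernel n) (fst p - snd p) * \<bar>U (fst p) - w (snd p)\<bar>)
      = (\<Sum>j\<in>UNIV. LINT p|torus2. ?k j (fst p - snd p) * \<bar>U (fst p) - w (snd p)\<bar>)"
    unfolding laplacian_def sum_distrib_right by (rule Bochner_Integration.integral_sum[OF i])
  also have "\<dots> \<le> (\<Sum>j\<in>(UNIV :: 'n set). C * (real CARD('n) * sqrt (real n)))" by (rule sum_mono[OF le])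
  also have "\<dots> = C * (real CARD('n))\<^sup>2 * sqrt (real n)" by (simp add: power2_eq_square)
  finally show ?thesis .
qed

section \<open>Comparison of the entropy solution with the viscous flow\<close>

lemma bounded_borel_integral_torus2:
  assumes H: "bounded_borel (borel \<Otimes>\<^sub>M borel2) (\<lambda>p. H (fst p) (fst (snd p)) (snd (snd p)))"
  shows "bounded_borel (borel :: real measure) (\<lambda>t. LINT p|(torus2 :: ((real^'n::finite) \<times> (real^'n)) measure). H t (fst p) (snd p))"
proof -
  interpret T2: finite_measure "torus2 :: ((real^'n) \<times> (real^'n)) measure" by (rule pair_torus(3))
  obtain B where B: "\<And>p. \<bar>H (fst p) (fst (snd p)) (snd (snd p))\<bar> \<le> B" using H by (auto simp: bounded_borel_def)
  have "(\<lambda>(t, p). H t (fst p) (snd p)) \<in> borel_measurable (borel \<Otimes>\<^sub>M torus2)"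
    using bounded_borelD[OF H] by (simp add: split_beta' cong: measurable_cong_sets)
  from T2.borel_measurable_lebesgue_integral[OF this]
  have m: "(\<lambda>t. LINT p|torus2. H t (fst p) (snd p)) \<in> borel_measurable borel" by simp
  show ?thesis
  proof (rule bounded_borelI[OF m])
    fix t
    have b: "\<bar>H t (fst p) (snd p)\<bar> \<le> B" for p using B[of "(t, p)"] by simp
    have "(LINT p|torus2. \<bar>H t (fst p) (snd p)\<bar>) \<le> (LINT p|(torus2 :: ((real^'n) \<times> (real^'n)) measure). B)"
      by (intro integral_mono integrable_abs bounded_borel_torus2[OF bounded_borel_slice[OF H]] b) simp
    moreover have "(LINT p|(torus2 :: ((real^'n) \<times> (real^'n)) measure). B) = B * measure (torus2 :: ((real^'n) \<times> (real^'n)) measure) UNIV"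
      by (simp add: space_pair_measure)
    moreover have "\<bar>LINT p|torus2. H t (fst p) (snd p)\<bar> \<le> (LINT p|torus2. \<bar>H t (fst p) (snd p)\<bar>)" by (rule integral_abs_bound)
    ultimately show "\<bar>LINT p|torus2. H t (fst p) (snd p)\<bar> \<le> B * measure (torus2 :: ((real^'n) \<times> (real^'n)) measure) UNIV"
      by linarith
  qed
qed

lemma bounded_borel_timespan: "bounded_borel borel h \<Longrightarrow> integrable (timespan a b) h"
proof -
  assume h: "bounded_borel borel h"
  then obtain B where "\<And>p. \<bar>h p\<bar> \<le> B" by (auto simp: bounded_borel_def)
  then show ?thesis
    by (intro timespan.integrable_const_bound[where B=B]) (use bounded_borelD[OF h] in auto)
qed

text \<open>The two solutions after preparation: \<open>U\<close> is a bounded representative of the entropy solution \<open>u\<close>, and \<open>V\<close> is a flow whose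
translates are controlled uniformly in time.\<close>
locale doubling =
  fixes T :: real and \<mu> :: "(real^'n::finite) measure" and f :: "real \<Rightarrow> real^'n" and \<epsilon> :: real
    and u0 :: "real^'n \<Rightarrow> real" and u U V V' :: "real \<Rightarrow> real^'n \<Rightarrow> real" and A C :: real and n :: nat
  assumes levy: "levy_measure \<mu>" and flux: "\<And>j. Ck_on 1 UNIV (\<lambda>w. f w $ j)" and eps: "\<epsilon> \<ge> 0"
    and ent: "entropy_solution T \<mu> f u0 u"
    and U: "(\<lambda>p. U (fst p) (snd p)) \<in> borel_measurable borel2" "\<And>t. periodic (U t)" and UA: "\<And>t x. \<bar>U t x\<bar> \<le> A"
    and um: "(\<lambda>p. indicator {0..T} (fst p) * u (fst p) (snd p)) \<in> borel_measurable borel2"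
    and uU: "\<And>t. t \<in> {0<..<T} \<Longrightarrow> AE x in torus. u t x = U t x"
    and Ucont: "\<And>t e. t \<in> {0<..<T} \<Longrightarrow> e > 0 \<Longrightarrow> \<exists>d>0. \<forall>s\<in>{t..t + d}. (LINT x|torus. \<bar>U s x - U t x\<bar>) \<le> e"
    and flow: "viscous_flow T \<mu> f \<epsilon> V V'"
    and C: "C \<ge> 0" "\<And>t h. t \<in> {0<..<T} \<Longrightarrow> (LINT x|torus. \<bar>V t (x + h) - V t x\<bar>) \<le> C * sin_modulus h"
    and n: "n \<ge> 1"
begin

definition K :: "real^'n \<Rightarrow> real" where "K = kernel n"

definition F :: "real \<Rightarrow> real \<Rightarrow> real" where
  "F t s = (LINT p|torus2. K (fst p - snd p) * \<bar>U t (fst p) - V s (snd p)\<bar>)"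

text \<open>The derivative of \<open>F\<close> in its second variable.\<close>
definition B :: "real \<Rightarrow> real \<Rightarrow> real" where
  "B t s = (LINT p|torus2. K (fst p - snd p) * (sgn (V s (snd p) - U t (fst p)) * V' s (snd p)))"

lemma K: "C2_torus K" "K x \<ge> 0" "\<And>k. Ck_on k UNIV K" "periodic K"
  unfolding K_def by (rule C2_torus_kernel kernel_nonneg Ck_on_kernel periodic_kernel)+

lemma K_bounded: "bounded_borel borel K"
  by (rule bounded_borel_periodic[OF C1_torusD(4,1)[OF C2_torusD(1)[OF K(1)]]])

lemma V_joint: "(\<lambda>p. V (fst p) (snd p)) \<in> borel_measurable borel2"
  "(\<lambda>p. V' (fst p) (snd p)) \<in> borel_measurable borel2"
  using viscous_flowD(1,2)[OF flow] by (simp_all add: split_beta' borel_prod)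

lemma U_slice: "U t \<in> borel_measurable borel"
  using measurable_two_arguments[OF U(1), of "\<lambda>_. t" borel "\<lambda>x. x"] by simp

lemma V_slice: "t \<in> {0<..<T} \<Longrightarrow> continuous_on UNIV (V t)" "t \<in> {0<..<T} \<Longrightarrow> periodic (V t)"
  using C1_torusD(4,1)[OF C2_torusD(1)[OF viscous_flowD(3)[OF flow]]] by auto

lemma V_bound:
  assumes "0 < \<alpha>" "\<beta> < T"
  shows "\<exists>M. A \<le> M \<and> (\<forall>t\<in>{\<alpha>..\<beta>}. \<forall>x. \<bar>V t x\<bar> \<le> M \<and> \<bar>V' t x\<bar> \<le> M)"
proof -
  obtain M where M: "\<forall>t\<in>{\<alpha>..\<beta>}. \<forall>x. \<bar>V t x\<bar> \<le> M \<and> \<bar>V' t x\<bar> \<le> M" using viscous_flowD(9)[OF flow assms] by blast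
  show ?thesis by (rule exI[of _ "max A M"]) (use M in \<open>auto simp: le_max_iff_disj\<close>)
qed

text \<open>The hypothesis on the first variable in \<open>diagonal_estimate\<close>. The cutoff radius tends to 0 only here, after the two
nonlocal contributions have been combined.\<close>
lemma entropy_step:
  assumes \<alpha>: "0 < \<alpha>" "\<alpha> < \<beta>" "\<beta> < T" and g: "time_test \<alpha> \<beta> g g'" and s: "s \<in> {\<alpha>..\<beta>}"
  shows "0 \<le> (LINT t|timespan \<alpha> \<beta>. g' t * F t s + g t * (\<epsilon> * (C * (real CARD('n))\<^sup>2 * sqrt (real n)) - B t s))"
proof -
  let ?c = "\<epsilon> * (C * (real CARD('n))\<^sup>2 * sqrt (real n))"
  have sT: "s \<in> {0<..<T}" using s \<alpha> by auto
  obtain M where M: "A \<le> M" "\<And>x. \<bar>V s x\<bar> \<le> M" using V_bound[OF \<alpha>(1,3)] s by blast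
  have UM: "\<bar>U t x\<bar> \<le> M" for t x using UA[of t x] M(1) by linarith
  obtain E where E: "E \<ge> 0" "\<And>r. 0 < r \<Longrightarrow> r < 1 \<Longrightarrow> AE x in torus. \<bar>V' s x + divergence (\<lambda>y. f (V s y)) x - \<epsilon> * laplacian (V s) x
        - (levy_large \<mu> r (V s) x - levy_drift \<mu> r \<bullet> grad (V s) x)\<bar> \<le> E * levy_core \<mu> r"
    using viscous_flow_residual[OF flow sT levy] by blast
  obtain D where D: "D \<ge> 0" "\<And>r x. 0 < r \<Longrightarrow> r < 1 \<Longrightarrow> \<bar>levy_adj_small \<mu> r K x\<bar> \<le> D * levy_core \<mu> r"
    using levy_operators_split[OF levy K(1)] by metis
  define v2 where "v2 = measure (torus2 :: ((real^'n) \<times> (real^'n)) measure) UNIV"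
  define k2 where "k2 = (LINT p|(torus2 :: ((real^'n) \<times> (real^'n)) measure). K (fst p - snd p))"
  \<comment> \<open>the error that the small jumps leave in both halves of the estimate\<close>
  define R where "R m = (2 * M * D * v2 + E * k2) * levy_core \<mu> (cutoff_radius m)" for m
  have R0: "R \<longlonglongrightarrow> 0"
    unfolding R_def using tendsto_mult[OF tendsto_const cutoff_radius(3)[OF levy], of "2 * M * D * v2 + E * k2"] by simp
  define P where "P m t = (LINT p|torus2. pair_production \<mu> f (cutoff_radius m) K (U t) (V s) (fst p) (snd p))" for m t
  note w = V_slice[OF sT] and w2 = viscous_flowD(3)[OF flow sT]
  have PB: "P m t + B t s \<le> ?c + R m" for m t
  proof -
    note r = cutoff_radius(1,2)[of m]
    have "P m t + B t s \<le> \<epsilon> * (LINT p|torus2. laplacian K (fst p - snd p) * \<bar>U t (fst p) - V s (snd p)\<bar>)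
        + 2 * M * (D * levy_core \<mu> (cutoff_radius m)) * v2 + (E * levy_core \<mu> (cutoff_radius m)) * k2"
      unfolding P_def B_def v2_def k2_def
      by (rule pair_production_le[OF levy r(1) eps flux K(1,2) D(2)[OF r] U_slice U(2) UM w2 M(2)
            viscous_flowD(4,5)[OF flow sT] E(2)[OF r]])
    moreover have "\<epsilon> * (LINT p|torus2. laplacian K (fst p - snd p) * \<bar>U t (fst p) - V s (snd p)\<bar>) \<le> ?c"
      unfolding K_def
      by (intro mult_left_mono eps integral_laplacian_kernel_le[OF U_slice UM U(2) C1_torusD(5)[OF C2_torusD(1)[OF w2]] M(2) w(2) C(1) C(2)[OF sT] n])
    ultimately show ?thesis by (simp add: R_def algebra_simps)
  qed
  have bU: "bounded_borel borel (\<lambda>t. F t s)"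
    unfolding F_def
    by (rule bounded_borel_integral_torus2[OF bounded_borel_pair_production(2)[OF levy zero_less_one flux K(1) U(1) UM w]])
  have bP: "bounded_borel borel (P m)" for m
    unfolding P_def[abs_def]
    by (rule bounded_borel_integral_torus2[OF bounded_borel_pair_production(1)[OF levy cutoff_radius(1) flux K(1) U(1) UM w]])
  have bB: "bounded_borel borel (\<lambda>t. B t s)"
  proof -
    let ?M = "(borel :: real measure) \<Otimes>\<^sub>M ((borel :: (real^'n) measure) \<Otimes>\<^sub>M (borel :: (real^'n) measure))"
    have 1: "bounded_borel ?M (\<lambda>p. U (fst p) (fst (snd p)))"
      using bounded_borel_compose[OF bounded_borelI[OF U(1) UA], of "\<lambda>p. (fst p, fst (snd p))" ?M] by simp
    have 2: "bounded_borel ?M (\<lambda>p. V s (snd (snd p)))" by (rule bounded_borel_compose[OF bounded_borel_periodic[OF w]]) simp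
    have 3: "bounded_borel ?M (\<lambda>p. V' s (snd (snd p)))"
      by (rule bounded_borel_compose[OF bounded_borel_periodic[OF viscous_flowD(4,5)[OF flow sT]]]) simp
    have 4: "bounded_borel ?M (\<lambda>p. K (fst (snd p) - snd (snd p)))"
      by (rule bounded_borel_compose[OF K_bounded]) measurable
    show ?thesis
      unfolding B_def
      by (rule bounded_borel_integral_torus2) (intro bounded_borel_intros 1 2 3 4)
  qed
  note bg = time_test_bounded_borel[OF g]
  have g0: "g t \<ge> 0" for t using g by (simp add: time_test_def)
  define I where "I = (LINT t|timespan \<alpha> \<beta>. g' t * F t s + g t * (?c - B t s))"
  have "0 \<le> I + R m * (LINT t|timespan \<alpha> \<beta>. g t)" for m
  proof -
    have "0 \<le> (LINT t|timespan \<alpha> \<beta>. g' t * F t s + g t * P m t)"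
      unfolding P_def F_def
      by (rule doubled_entropy_inequality[OF levy flux ent U UA um uU K(3,4,2) \<alpha> g cutoff_radius(1) w])
    also have "\<dots> \<le> (LINT t|timespan \<alpha> \<beta>. (g' t * F t s + g t * (?c - B t s)) + R m * g t)"
    proof (rule integral_mono)
      show "integrable (timespan \<alpha> \<beta>) (\<lambda>t. g' t * F t s + g t * P m t)"
        by (intro bounded_borel_timespan bounded_borel_intros bg bU bP)
      show "integrable (timespan \<alpha> \<beta>) (\<lambda>t. (g' t * F t s + g t * (?c - B t s)) + R m * g t)"
        by (intro bounded_borel_timespan bounded_borel_intros bounded_borel_const bg bU bB)
      fix t
      have "g t * P m t \<le> g t * (?c + R m - B t s)" using PB[of m t] by (intro mult_left_mono g0) linarith
      then show "g' t * F t s + g t * P m t \<le> (g' t * F t s + g t * (?c - B t s)) + R m * g t"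
        by (simp add: algebra_simps)
    qed
    also have "\<dots> = I + R m * (LINT t|timespan \<alpha> \<beta>. g t)"
      unfolding I_def
      by (subst Bochner_Integration.integral_add)
        (auto intro!: bounded_borel_timespan bounded_borel_intros bounded_borel_const bg bU bB)
    finally show ?thesis .
  qed
  moreover have "(\<lambda>m. I + R m * (LINT t|timespan \<alpha> \<beta>. g t)) \<longlonglongrightarrow> I + 0 * (LINT t|timespan \<alpha> \<beta>. g t)"
    by (intro tendsto_intros R0)
  ultimately have "0 \<le> I + 0 * (LINT t|timespan \<alpha> \<beta>. g t)"
    by (intro LIMSEQ_le_const) auto
  then show ?thesis by (simp add: I_def)
qed

text \<open>The hypothesis on the second variable in \<open>diagonal_estimate\<close>; \<open>g\<close> vanishes at both ends, so there are no boundary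
terms.\<close>
lemma viscous_step:
  assumes \<alpha>: "0 < \<alpha>" "\<alpha> < \<beta>" "\<beta> < T" and g: "time_test \<alpha> \<beta> g g'"
  shows "0 = (LINT s|timespan \<alpha> \<beta>. g' s * F t s + g s * B t s)"
proof -
  obtain M where M: "A \<le> M" "\<And>s x. s \<in> {\<alpha>..\<beta>} \<Longrightarrow> \<bar>V s x\<bar> \<le> M \<and> \<bar>V' s x\<bar> \<le> M" using V_bound[OF \<alpha>(1,3)] by blast
  obtain KB where KB: "\<And>x. \<bar>K x\<bar> \<le> KB" using K_bounded by (auto simp: bounded_borel_def)
  have UM: "\<bar>U t x\<bar> \<le> M" for t x using UA[of t x] M(1) by linarith
  have M0: "0 \<le> M" using UM[of 0 0] by linarith
  have Km: "K \<in> borel_measurable borel" by (rule bounded_borelD[OF K_bounded])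
  have d: "(g has_real_derivative g' s) (at s)" "continuous_on UNIV g'" for s using g by (auto simp: time_test_def)
  have g0: "g \<alpha> = 0" "g \<beta> = 0" using g by (force simp: time_test_def)+
  let ?a = "\<lambda>s p. V s (snd p) - U t (fst p)" and ?a' = "\<lambda>s p. V' s (snd p)"
  have "g \<beta> * (LINT p|torus2. K (fst p - snd p) * \<bar>?a \<beta> p\<bar>) - g \<alpha> * (LINT p|torus2. K (fst p - snd p) * \<bar>?a \<alpha> p\<bar>)
    = (LINT s|timespan \<alpha> \<beta>. g' s * (LINT p|torus2. K (fst p - snd p) * \<bar>?a s p\<bar>) + g s * (LINT p|torus2. K (fst p - snd p) * (sgn (?a s p) * ?a' s p)))"
  proof (rule integral_abs_increment[where B="2 * M" and B'=KB, OF pair_torus(3) _ _ _ _ _ _ _ _ d])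
    show "\<alpha> \<le> \<beta>" using \<alpha> by simp
    let ?N = "(borel :: real measure) \<Otimes>\<^sub>M (torus2 :: ((real^'n) \<times> (real^'n)) measure)"
    have [measurable]: "(\<lambda>p. V (fst p) (snd (snd p))) \<in> borel_measurable ?N" "(\<lambda>p. V' (fst p) (snd (snd p))) \<in> borel_measurable ?N"
      by (rule measurable_two_arguments[OF V_joint(1)] measurable_two_arguments[OF V_joint(2)]; measurable)+
    have [measurable]: "(\<lambda>p. U t (fst (snd p))) \<in> borel_measurable ?N" by (rule measurable_compose[OF _ U_slice]) measurable
    show "(\<lambda>(s, p). ?a s p) \<in> borel_measurable ?N" "(\<lambda>(s, p). ?a' s p) \<in> borel_measurable ?N"
      unfolding split_beta' by measurable
    show "(\<lambda>p. K (fst p - snd p)) \<in> borel_measurable (torus2 :: ((real^'n) \<times> (real^'n)) measure)"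
      by (rule measurable_compose[OF _ Km]) measurable
    show "\<bar>?a s p\<bar> \<le> 2 * M \<and> \<bar>?a' s p\<bar> \<le> 2 * M" if "s \<in> {\<alpha>..\<beta>}" for s p
      using M(2)[OF that, of "snd p"] UM[of t "fst p"] M0 by linarith
    show "\<bar>K (fst p - snd p)\<bar> \<le> KB" for p by (rule KB)
    show "((\<lambda>s. ?a s p) has_real_derivative ?a' s p) (at s)" if "s \<in> {\<alpha>..\<beta>}" for s p
      by (rule DERIV_diff[OF viscous_flowD(6)[OF flow] DERIV_const, simplified]) (use that \<alpha> in auto)
    show "continuous_on {\<alpha>..\<beta>} (\<lambda>s. ?a' s p)" for p
      by (rule continuous_on_subset[OF viscous_flowD(8)[OF flow]]) (use \<alpha> in auto)
  qed
  then show ?thesis by (simp add: g0 F_def B_def abs_minus_commute)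
qed

end

context doubling
begin

lemma F_B_joint:
  "(\<lambda>(t, s). F t s) \<in> borel_measurable borel2"
  "(\<lambda>(t, s). B t s) \<in> borel_measurable borel2"
proof -
  interpret T2: finite_measure "torus2 :: ((real^'n) \<times> (real^'n)) measure" by (rule pair_torus(3))
  let ?N = "((borel :: real measure) \<Otimes>\<^sub>M (borel :: real measure)) \<Otimes>\<^sub>M (torus2 :: ((real^'n) \<times> (real^'n)) measure)"
  have [measurable]: "(\<lambda>q. U (fst (fst q)) (fst (snd q))) \<in> borel_measurable ?N"
    by (rule measurable_two_arguments[OF U(1)]) measurable
  have [measurable]: "(\<lambda>q. V (snd (fst q)) (snd (snd q))) \<in> borel_measurable ?N"
    by (rule measurable_two_arguments[OF V_joint(1)]) measurable
  have [measurable]: "(\<lambda>q. V' (snd (fst q)) (snd (snd q))) \<in> borel_measurable ?N"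
    by (rule measurable_two_arguments[OF V_joint(2)]) measurable
  have [measurable]: "(\<lambda>q. K (fst (snd q) - snd (snd q))) \<in> borel_measurable ?N"
    by (rule measurable_compose[OF _ bounded_borelD[OF K_bounded]]) measurable
  have "(\<lambda>(q, p). K (fst p - snd p) * \<bar>U (fst q) (fst p) - V (snd q) (snd p)\<bar>) \<in> borel_measurable ?N"
    unfolding split_beta' by measurable
  from T2.borel_measurable_lebesgue_integral[OF this]
  show "(\<lambda>(t, s). F t s) \<in> borel_measurable borel2" by (simp add: F_def split_beta')
  have "(\<lambda>(q, p). K (fst p - snd p) * (sgn (V (snd q) (snd p) - U (fst q) (fst p)) * V' (snd q) (snd p))) \<in> borel_measurable ?N"
    unfolding split_beta' by measurable
  from T2.borel_measurable_lebesgue_integral[OF this]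
  show "(\<lambda>(t, s). B t s) \<in> borel_measurable borel2" by (simp add: B_def split_beta')
qed

lemma integral_torus2_bound:
  assumes "bounded_borel borel2 h" "\<And>p. \<bar>h p\<bar> \<le> M"
  shows "\<bar>LINT p|(torus2 :: ((real^'n) \<times> (real^'n)) measure). h p\<bar> \<le> M * measure (torus2 :: ((real^'n) \<times> (real^'n)) measure) UNIV"
proof -
  interpret T2: finite_measure "torus2 :: ((real^'n) \<times> (real^'n)) measure" by (rule pair_torus(3))
  have "(LINT p|torus2. \<bar>h p\<bar>) \<le> (LINT p|(torus2 :: ((real^'n) \<times> (real^'n)) measure). M)"
    by (intro integral_mono integrable_abs bounded_borel_torus2[OF assms(1)] assms(2)) simp
  moreover have "(LINT p|(torus2 :: ((real^'n) \<times> (real^'n)) measure). M) = M * measure (torus2 :: ((real^'n) \<times> (real^'n)) measure) UNIV"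
    by (simp add: space_pair_measure)
  moreover have "\<bar>LINT p|torus2. h p\<bar> \<le> (LINT p|torus2. \<bar>h p\<bar>)" by (rule integral_abs_bound)
  ultimately show ?thesis by linarith
qed

lemma pair_bounded_borel:
  "bounded_borel borel2 (\<lambda>p. K (fst p - snd p))"
  "bounded_borel borel2 (\<lambda>p. U t (fst p))"
  "s \<in> {0<..<T} \<Longrightarrow> bounded_borel borel2 (\<lambda>p. V s (snd p))"
  "s \<in> {0<..<T} \<Longrightarrow> bounded_borel borel2 (\<lambda>p. V' s (snd p))"
proof -
  show "bounded_borel borel2 (\<lambda>p. K (fst p - snd p))"
    by (rule bounded_borel_compose[OF K_bounded]) measurable
  show "bounded_borel borel2 (\<lambda>p. U t (fst p))"
    by (rule bounded_borel_compose[OF bounded_borelI[OF U_slice UA]]) simp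
  show "bounded_borel borel2 (\<lambda>p. V s (snd p))" if "s \<in> {0<..<T}"
    by (rule bounded_borel_compose[OF bounded_borel_periodic[OF V_slice[OF that]]]) simp
  show "bounded_borel borel2 (\<lambda>p. V' s (snd p))" if "s \<in> {0<..<T}"
    by (rule bounded_borel_compose[OF bounded_borel_periodic[OF viscous_flowD(4,5)[OF flow that]]]) simp
qed

lemma F_B_bounded:
  assumes \<alpha>: "0 < \<alpha>" "\<beta> < T"
  shows "\<exists>M. \<forall>s\<in>{\<alpha>..\<beta>}. \<forall>t. \<bar>F t s\<bar> \<le> M \<and> \<bar>B t s\<bar> \<le> M"
proof -
  obtain M where M: "A \<le> M" "\<And>s x. s \<in> {\<alpha>..\<beta>} \<Longrightarrow> \<bar>V s x\<bar> \<le> M \<and> \<bar>V' s x\<bar> \<le> M" using V_bound[OF \<alpha>] by blast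
  obtain KB where KB: "\<And>x. \<bar>K x\<bar> \<le> KB" using K_bounded by (auto simp: bounded_borel_def)
  have KB0: "0 \<le> KB" using KB[of 0] by linarith
  have UM: "\<bar>U t x\<bar> \<le> M" for t x using UA[of t x] M(1) by linarith
  have M0: "0 \<le> M" using UM[of 0 0] by linarith
  let ?v = "measure (torus2 :: ((real^'n) \<times> (real^'n)) measure) UNIV"
  have "\<bar>F t s\<bar> \<le> KB * (2 * M) * ?v \<and> \<bar>B t s\<bar> \<le> KB * (2 * M) * ?v" if s: "s \<in> {\<alpha>..\<beta>}" for t s
  proof
    have sT: "s \<in> {0<..<T}" using s \<alpha> by auto
    show "\<bar>F t s\<bar> \<le> KB * (2 * M) * ?v"
      unfolding F_def
    proof (rule integral_torus2_bound)
      fix p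
      have "\<bar>U t (fst p) - V s (snd p)\<bar> \<le> 2 * M" using UM[of t "fst p"] M(2)[OF s, of "snd p"] by linarith
      then show "\<bar>K (fst p - snd p) * \<bar>U t (fst p) - V s (snd p)\<bar>\<bar> \<le> KB * (2 * M)"
        unfolding abs_mult abs_abs by (intro mult_mono KB KB0) auto
    qed (intro bounded_borel_intros pair_bounded_borel sT)
    show "\<bar>B t s\<bar> \<le> KB * (2 * M) * ?v"
      unfolding B_def
    proof (rule integral_torus2_bound)
      fix p
      have "\<bar>sgn (V s (snd p) - U t (fst p)) * V' s (snd p)\<bar> \<le> 2 * M"
        using M(2)[OF s, of "snd p"] M0 by (simp add: abs_mult sgn_if)
      then show "\<bar>K (fst p - snd p) * (sgn (V s (snd p) - U t (fst p)) * V' s (snd p))\<bar> \<le> KB * (2 * M)"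
        unfolding abs_mult[of "K (fst p - snd p)"] by (intro mult_mono KB KB0) auto
    qed (intro bounded_borel_intros pair_bounded_borel sT)
  qed
  then show ?thesis by blast
qed

lemma V_Lipschitz:
  assumes \<alpha>: "0 < \<alpha>" "\<beta> < T"
  shows "\<exists>L\<ge>0. \<forall>s\<in>{\<alpha>..\<beta>}. \<forall>t\<in>{\<alpha>..\<beta>}. \<forall>x. \<bar>V s x - V t x\<bar> \<le> L * \<bar>s - t\<bar>"
proof -
  obtain M where M: "\<And>s x. s \<in> {\<alpha>..\<beta>} \<Longrightarrow> \<bar>V s x\<bar> \<le> M \<and> \<bar>V' s x\<bar> \<le> M" using V_bound[OF \<alpha>] by blast
  have "\<bar>V s x - V t x\<bar> \<le> \<bar>M\<bar> * \<bar>s - t\<bar>" if s: "s \<in> {\<alpha>..\<beta>}" and t: "t \<in> {\<alpha>..\<beta>}" for s t x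
  proof -
    have "norm (V s x - V t x) \<le> \<bar>M\<bar> * norm (s - t)"
    proof (rule field_differentiable_bound[of "{\<alpha>..\<beta>}" "\<lambda>s. V s x" "\<lambda>s. V' s x"])
      fix z assume z: "z \<in> {\<alpha>..\<beta>}"
      show "((\<lambda>s. V s x) has_field_derivative V' z x) (at z within {\<alpha>..\<beta>})"
        by (rule has_field_derivative_at_within[OF viscous_flowD(6)[OF flow]]) (use z \<alpha> in auto)
      show "norm (V' z x) \<le> \<bar>M\<bar>" using M[OF z, of x] by auto
    qed (use s t in auto)
    then show ?thesis by simp
  qed
  then show ?thesis by (intro exI[of _ "\<bar>M\<bar>"]) auto
qed

text \<open>In the first variable from continuity of \<open>U\<close> in \<open>L1\<close>, in the second from the Lipschitz bound for \<open>V\<close>; the kernel is bounded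
for fixed \<open>n\<close>.\<close>
lemma F_continuous:
  assumes t: "t \<in> {0<..<T}" and e: "e > 0"
  shows "\<exists>d>0. \<forall>a\<in>{t..t + d}. \<forall>b\<in>{t..t + d}. \<bar>F a b - F t t\<bar> \<le> e"
proof -
  define \<alpha> \<beta> where "\<alpha> = t / 2" and "\<beta> = (t + T) / 2"
  have \<alpha>: "0 < \<alpha>" "\<alpha> < t" "t < \<beta>" "\<beta> < T" using t by (auto simp: \<alpha>_def \<beta>_def)
  obtain L where L: "L \<ge> 0" "\<And>s s' x. s \<in> {\<alpha>..\<beta>} \<Longrightarrow> s' \<in> {\<alpha>..\<beta>} \<Longrightarrow> \<bar>V s x - V s' x\<bar> \<le> L * \<bar>s - s'\<bar>"
    using V_Lipschitz[OF \<alpha>(1,4)] by blast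
  obtain KB where KB: "\<And>x. \<bar>K x\<bar> \<le> KB" using K_bounded by (auto simp: bounded_borel_def)
  have KB0: "0 \<le> KB" using KB[of 0] by linarith
  define v1 where "v1 = measure (torus :: (real^'n) measure) UNIV"
  define v2 where "v2 = measure (torus2 :: ((real^'n) \<times> (real^'n)) measure) UNIV"
  have v: "0 \<le> v1" "0 \<le> v2" by (simp_all add: v1_def v2_def)
  \<comment> \<open>The summand 1 avoids a division by zero and makes the product at most \<open>e / 2\<close>.\<close>
  define e1 where "e1 = e / (2 * (KB * v1 + 1))"
  have Kv: "0 \<le> KB * v1" using KB0 v by simp
  have e1: "e1 > 0" "KB * v1 * e1 \<le> e / 2" using e Kv by (auto simp: e1_def field_simps)
  obtain d1 where d1: "d1 > 0" "\<And>s. s \<in> {t..t + d1} \<Longrightarrow> (LINT x|torus. \<bar>U s x - U t x\<bar>) \<le> e1"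
    using Ucont[OF t e1(1)] by blast
  define d2 where "d2 = e / (2 * (KB * L * v2 + 1))"
  have KLv: "0 \<le> KB * L * v2" using KB0 v L by simp
  have d2: "d2 > 0" "KB * L * v2 * d2 \<le> e / 2" using e KLv by (auto simp: d2_def field_simps)
  define d where "d = min d1 (min d2 (\<beta> - t))"
  have d: "d > 0" "d \<le> d1" "d \<le> d2" "t + d \<le> \<beta>" using d1 d2 \<alpha> by (auto simp: d_def)
  have "\<bar>F a b - F t t\<bar> \<le> e" if a: "a \<in> {t..t + d}" and b: "b \<in> {t..t + d}" for a b
  proof -
    have bT: "b \<in> {0<..<T}" and b\<alpha>: "b \<in> {\<alpha>..\<beta>}" "t \<in> {\<alpha>..\<beta>}" using b d \<alpha> by auto
    note bb = bounded_borel_intros pair_bounded_borel bT t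
    define h where "h p = KB * \<bar>U a (fst p) - U t (fst p)\<bar> + KB * (L * d2)" for p :: "(real^'n) \<times> (real^'n)"
    have bh: "bounded_borel borel2 h" unfolding h_def[abs_def] by (intro bb bounded_borel_const)
    have ip: "integrable torus2 (\<lambda>p. K (fst p - snd p) * \<bar>U a (fst p) - V b (snd p)\<bar>)"
      "integrable torus2 (\<lambda>p. K (fst p - snd p) * \<bar>U t (fst p) - V t (snd p)\<bar>)"
      by (intro bounded_borel_torus2 bb)+
    have "F a b - F t t = (LINT p|torus2. K (fst p - snd p) * \<bar>U a (fst p) - V b (snd p)\<bar> - K (fst p - snd p) * \<bar>U t (fst p) - V t (snd p)\<bar>)"
      unfolding F_def using ip by simp
    then have 1: "\<bar>F a b - F t t\<bar> \<le> (LINT p|torus2. \<bar>K (fst p - snd p) * \<bar>U a (fst p) - V b (snd p)\<bar> - K (fst p - snd p) * \<bar>U t (fst p) - V t (snd p)\<bar>\<bar>)"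
      by (simp only: integral_abs_bound)
    have 2: "(LINT p|torus2. \<bar>K (fst p - snd p) * \<bar>U a (fst p) - V b (snd p)\<bar> - K (fst p - snd p) * \<bar>U t (fst p) - V t (snd p)\<bar>\<bar>)
        \<le> (LINT p|torus2. h p)"
    proof (rule integral_mono[OF integrable_abs[OF Bochner_Integration.integrable_diff[OF ip]] bounded_borel_torus2[OF bh]])
      fix p :: "(real^'n) \<times> (real^'n)"
      have x: "\<bar>V b (snd p) - V t (snd p)\<bar> \<le> L * d2"
      proof -
        have "\<bar>b - t\<bar> \<le> d2" using b d by auto
        then show ?thesis using L(2)[OF b\<alpha>, of "snd p"] mult_left_mono[OF _ L(1), of "\<bar>b - t\<bar>" d2] by linarith
      qed
      have "\<bar>\<bar>U a (fst p) - V b (snd p)\<bar> - \<bar>U t (fst p) - V t (snd p)\<bar>\<bar> \<le> \<bar>U a (fst p) - U t (fst p)\<bar> + L * d2"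
        using x by linarith
      then have "\<bar>K (fst p - snd p)\<bar> * \<bar>\<bar>U a (fst p) - V b (snd p)\<bar> - \<bar>U t (fst p) - V t (snd p)\<bar>\<bar> \<le> KB * (\<bar>U a (fst p) - U t (fst p)\<bar> + L * d2)"
        by (intro mult_mono KB KB0) auto
      then show "\<bar>K (fst p - snd p) * \<bar>U a (fst p) - V b (snd p)\<bar> - K (fst p - snd p) * \<bar>U t (fst p) - V t (snd p)\<bar>\<bar> \<le> h p"
        by (simp add: h_def distrib_left flip: abs_mult right_diff_distrib)
    qed
    have 3: "(LINT p|torus2. h p) = KB * (v1 * (LINT x|torus. \<bar>U a x - U t x\<bar>)) + KB * (L * d2) * v2"
    proof -
      interpret T2: finite_measure "torus2 :: ((real^'n) \<times> (real^'n)) measure" by (rule pair_torus(3))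
      have bu: "bounded_borel borel2 (\<lambda>p :: (real^'n) \<times> (real^'n). \<bar>U a (fst p) - U t (fst p)\<bar>)" by (intro bb)
      have "\<bar>\<bar>U a x - U t x\<bar>\<bar> \<le> 2 * A" for x using UA[of a x] UA[of t x] by linarith
      from integral_torus2(1)[of "\<lambda>x y. \<bar>U a x - U t x\<bar>", OF bounded_borelD[OF bu] this]
      have "(LINT p|(torus2 :: ((real^'n) \<times> (real^'n)) measure). \<bar>U a (fst p) - U t (fst p)\<bar>) = v1 * (LINT x|torus. \<bar>U a x - U t x\<bar>)"
        by (simp add: v1_def)
      moreover have "(LINT p|(torus2 :: ((real^'n) \<times> (real^'n)) measure). KB * (L * d2)) = KB * (L * d2) * v2"
        by (simp add: v2_def space_pair_measure)
      ultimately show ?thesis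
        unfolding h_def by (subst Bochner_Integration.integral_add) (auto intro: bounded_borel_torus2[OF bu])
    qed
    have "KB * (v1 * (LINT x|torus. \<bar>U a x - U t x\<bar>)) \<le> KB * (v1 * e1)"
      by (intro mult_left_mono KB0 v d1(2)) (use a d in auto)
    also have "\<dots> \<le> e / 2" using e1(2) by (simp add: mult.assoc)
    finally have 4: "KB * (v1 * (LINT x|torus. \<bar>U a x - U t x\<bar>)) \<le> e / 2" .
    have 5: "KB * (L * d2) * v2 \<le> e / 2" using d2(2) by (simp add: mult_ac)
    show ?thesis using 1 2 3 4 5 by linarith
  qed
  with d(1) show ?thesis by blast
qed

lemma F_increment:
  assumes t: "0 < t1" "t1 \<le> t2" "t2 < T"
  shows "F t2 t2 - F t1 t1 \<le> \<epsilon> * (C * (real CARD('n))\<^sup>2 * sqrt (real n)) * (t2 - t1)"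
proof -
  define \<alpha> \<beta> where "\<alpha> = t1 / 2" and "\<beta> = (t2 + T) / 2"
  have \<alpha>: "0 < \<alpha>" "\<alpha> < \<beta>" "\<beta> < T" "\<alpha> < t1" "t2 < \<beta>" using t by (auto simp: \<alpha>_def \<beta>_def)
  obtain M where M: "\<And>s t. s \<in> {\<alpha>..\<beta>} \<Longrightarrow> \<bar>F t s\<bar> \<le> M \<and> \<bar>B t s\<bar> \<le> M" using F_B_bounded[OF \<alpha>(1,3)] by blast
  have M0: "0 \<le> M" using M[of \<alpha> \<alpha>] \<alpha> by auto
  \<comment> \<open>\<open>F\<close> and \<open>B\<close> are bounded only for times of \<open>V\<close> away from 0 and \<open>T\<close>; the test functions see no other times.\<close>
  define cut where "cut h a b = indicator {\<alpha>..\<beta>} b * h a b" for h :: "real \<Rightarrow> real \<Rightarrow> real" and a b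
  have cut_eq: "cut h a b = h a b" if "b \<in> {\<alpha>..\<beta>}" for h a b using that by (simp add: cut_def)
  have cut_b: "bounded_borel borel2 (\<lambda>p. cut h (fst p) (snd p))"
    if [measurable]: "(\<lambda>(a, b). h a b) \<in> borel_measurable borel2" and b: "\<And>a b. b \<in> {\<alpha>..\<beta>} \<Longrightarrow> \<bar>h a b\<bar> \<le> M" for h
  proof (rule bounded_borelI)
    have [measurable]: "(\<lambda>p. h (fst p) (snd p)) \<in> borel_measurable borel2" using that(1) by (simp add: split_beta')
    show "(\<lambda>p. cut h (fst p) (snd p)) \<in> borel_measurable borel2" unfolding cut_def by measurable
    show "\<bar>cut h (fst p) (snd p)\<bar> \<le> M" for p using b[of "snd p" "fst p"] M0 by (auto simp: cut_def indicator_def)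
  qed
  have "cut F t2 t2 - cut F t1 t1 \<le> \<epsilon> * (C * (real CARD('n))\<^sup>2 * sqrt (real n)) * (t2 - t1)"
  proof (rule diagonal_estimate[where \<alpha>=\<alpha> and \<beta>=\<beta> and B="cut B", OF cut_b[OF F_B_joint(1)] cut_b[OF F_B_joint(2)] _ _ _ \<alpha>(4) t(2) \<alpha>(5)])
    show "\<bar>F a b\<bar> \<le> M" "\<bar>B a b\<bar> \<le> M" if "b \<in> {\<alpha>..\<beta>}" for a b using M[OF that, of a] by auto
    show "0 \<le> (LINT a|timespan \<alpha> \<beta>. g' a * cut F a b + g a * (\<epsilon> * (C * (real CARD('n))\<^sup>2 * sqrt (real n)) - cut B a b))"
      if "time_test \<alpha> \<beta> g g'" "b \<in> {\<alpha>..\<beta>}" for g g' b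
      using entropy_step[OF \<alpha>(1-3) that] unfolding cut_eq[OF that(2)] .
    show "0 = (LINT b|timespan \<alpha> \<beta>. g' b * cut F a b + g b * cut B a b)" if g: "time_test \<alpha> \<beta> g g'" for g g' a
    proof -
      have "g' b * cut F a b + g b * cut B a b = g' b * F a b + g b * B a b" for b
        using time_test_bounded_borel(3,4)[OF g, of b] by (cases "b \<in> {\<alpha>..\<beta>}") (auto simp: cut_eq)
      then show ?thesis using viscous_step[OF \<alpha>(1-3) g, of a] by simp
    qed
    show "\<exists>d>0. \<forall>a\<in>{s..s + d}. \<forall>b\<in>{s..s + d}. \<bar>cut F a b - cut F s s\<bar> \<le> e" if s: "s \<in> {t1, t2}" and e: "e > 0" for s e
    proof -
      obtain d where d: "d > 0" "\<And>a b. a \<in> {s..s + d} \<Longrightarrow> b \<in> {s..s + d} \<Longrightarrow> \<bar>F a b - F s s\<bar> \<le> e"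
        using F_continuous[OF _ e, of s] s t by auto
      have s\<alpha>: "\<alpha> < s" "s < \<beta>" using s \<alpha> t by auto
      show ?thesis
        by (rule exI[of _ "min d (\<beta> - s)"]) (use d s\<alpha> in \<open>auto simp: cut_eq\<close>)
    qed
  qed
  then show ?thesis using \<alpha> t by (simp add: cut_eq)
qed

text \<open>The kernel has mass one and first moment \<open>O (1 / sqrt n)\<close>.\<close>
lemma F_diagonal:
  assumes t: "t \<in> {0<..<T}"
  shows "\<bar>F t t - (LINT x|torus. \<bar>U t x - V t x\<bar>)\<bar> \<le> C * (real CARD('n) / sqrt (real n))"
proof -
  obtain M where M: "A \<le> M" "\<And>x. \<bar>V t x\<bar> \<le> M" using V_bound[of t t] t by auto
  have UM: "\<bar>U s x\<bar> \<le> M" for s x using UA[of s x] M(1) by linarith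
  have "\<bar>F t t - (LINT x|torus. \<bar>U t x - V t x\<bar>) * (LINT z|torus. K z)\<bar> \<le> C * (LINT z|torus. \<bar>K z\<bar> * sin_modulus z)"
    unfolding F_def
    by (rule kernel_comparison[OF U_slice UM U(2) C1_torusD(5)[OF C2_torusD(1)[OF viscous_flowD(3)[OF flow t]]] M(2) V_slice(2)[OF t]
        C1_torusD(4,1)[OF C2_torusD(1)[OF K(1)]] C(2)[OF t]])
  moreover have "C * (LINT z|torus. \<bar>K z\<bar> * sin_modulus z) \<le> C * (real CARD('n) / sqrt (real n))"
    using kernel_sin_modulus(2)[OF n, where 'n='n] by (intro mult_left_mono C) (simp add: K_def kernel_nonneg)
  moreover have "(LINT z|torus. K z) = 1" by (simp add: K_def integral_kernel)
  ultimately show ?thesis by simp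
qed

lemma L1_distance_increment:
  assumes t: "0 < t1" "t1 \<le> t2" "t2 < T"
  shows "(LINT x|torus. \<bar>U t2 x - V t2 x\<bar>) \<le> (LINT x|torus. \<bar>U t1 x - V t1 x\<bar>)
    + 2 * (C * (real CARD('n) / sqrt (real n))) + \<epsilon> * (C * (real CARD('n))\<^sup>2 * sqrt (real n)) * (t2 - t1)"
  using F_increment[OF t] F_diagonal[of t1] F_diagonal[of t2] t by (simp add: abs_le_iff)

end

section \<open>The rate of convergence\<close>

text \<open>The increment estimate started at times near 0. The entropy solution attains the datum only in the essential sense,
so the starting times are chosen from a set of positive measure.\<close>
lemma viscous_distance_bound:
  fixes f :: "real \<Rightarrow> real^'n::finite"
  assumes levy: "levy_measure \<mu>" and f: "\<And>j. Ck_on 1 UNIV (\<lambda>w. f w $ j)" and \<epsilon>: "\<epsilon> > 0"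
    and u0 [measurable]: "u0 \<in> borel_measurable borel"
    and w: "w \<in> borel_measurable borel" "\<And>x. \<bar>w x\<bar> \<le> A" "periodic w" "AE x in torus. u0 x = w x"
    and C: "C \<ge> 0" "\<And>h. (LINT x|torus. \<bar>w (x + h) - w x\<bar>) \<le> C * sin_modulus h"
    and ent: "entropy_solution T \<mu> f u0 u"
    and U: "(\<lambda>p. U (fst p) (snd p)) \<in> borel_measurable borel2" "\<And>t. periodic (U t)" and UM: "\<And>t x. \<bar>U t x\<bar> \<le> M"
    and um: "(\<lambda>p. indicator {0..T} (fst p) * u (fst p) (snd p)) \<in> borel_measurable borel2"
    and uU: "\<And>t. t \<in> {0<..<T} \<Longrightarrow> AE x in torus. u t x = U t x"
    and Ucont: "\<And>t e. t \<in> {0<..<T} \<Longrightarrow> e > 0 \<Longrightarrow> \<exists>d>0. \<forall>s\<in>{t..t + d}. (LINT x|torus. \<bar>U s x - U t x\<bar>) \<le> e"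
    and v: "viscous_solution T \<mu> f u0 \<epsilon> v"
    and t: "t \<in> {0<..<T}" and n: "n \<ge> 1"
  shows "L1_norm cell (\<lambda>x. u t x - v t x) \<le> 2 * (C * (real CARD('n) / sqrt (real n))) + \<epsilon> * (C * (real CARD('n))\<^sup>2 * sqrt (real n)) * T"
    and "L1_norm cell (\<lambda>x. u t x - v t x) \<le> M * measure (torus :: (real^'n) measure) UNIV + (LINT x|torus. \<bar>w x\<bar>)"
proof -
  obtain v' where v': "viscous_flow T \<mu> f \<epsilon>
      (\<lambda>t x. indicator {0<..<T} t * v t (x + h)) (\<lambda>t x. indicator {0<..<T} t * v' t (x + h))" for h
    using viscous_solution_flow[OF v f] by blast
  define V where "V t x = indicator {0<..<T} t * v t x" for t x
  define V' where "V' t x = indicator {0<..<T} t * v' t x" for t x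
  have flow: "viscous_flow T \<mu> f \<epsilon> V V'" using v'[of 0] by (simp add: V_def[abs_def] V'_def[abs_def])
  have Vv: "V s = v s" if "s \<in> {0<..<T}" for s using that by (auto simp: V_def)
  have trans: "(LINT x|torus. \<bar>V s (x + h) - V s x\<bar>) \<le> C * sin_modulus h" if s: "s \<in> {0<..<T}" for s h
    using viscous_solution_bounds(1)[OF levy f \<epsilon> u0 w v s, of h] C(2)[of h] unfolding Vv[OF s] by linarith
  interpret doubling T \<mu> f \<epsilon> u0 u U V V' M C n
    by unfold_locales (use levy f \<epsilon> ent U UM um uU Ucont flow C(1) trans n in auto)
  have V_C1: "C1_torus (v s)" if "s \<in> {0<..<T}" for s
    using C2_torusD(1)[OF viscous_flowD(3)[OF flow that]] unfolding Vv[OF that] .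
  have vm: "v s \<in> borel_measurable borel" and vb: "bounded_borel borel (v s)" if "s \<in> {0<..<T}" for s
    using C1_torusD(5)[OF V_C1[OF that]] bounded_borel_periodic[OF C1_torusD(4,1)[OF V_C1[OF that]]] by auto
  have uslice: "u s \<in> borel_measurable borel" if "s \<in> {0<..<T}" for s
    using measurable_two_arguments[OF um, of "\<lambda>_. s" borel "\<lambda>x. x"] that by simp
  have Ub: "bounded_borel borel (U s)" for s by (rule bounded_borelI[OF U_slice UM])
  have wb: "bounded_borel borel w" by (rule bounded_borelI[OF w(1,2)])
  have int: "integrable torus h" if "bounded_borel borel h" for h :: "real^'n \<Rightarrow> real"
    using that unfolding bounded_borel_def using integrable_torus_bounded by blast
  define D where "D s = (LINT x|torus. \<bar>U s x - v s x\<bar>)" for s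
  have norm_eq: "L1_norm cell (\<lambda>x. u s x - v s x) = D s" if s: "s \<in> {0<..<T}" for s
  proof -
    have "L1_norm cell (\<lambda>x. u s x - v s x) = (LINT x|torus. \<bar>u s x - v s x\<bar>)"
      by (rule L1_norm_torus) (use uslice[OF s] vm[OF s] in measurable)
    also have "\<dots> = D s"
      unfolding D_def
    proof (rule integral_cong_AE)
      show "AE x in torus. \<bar>u s x - v s x\<bar> = \<bar>U s x - v s x\<bar>" using uU[OF s] by eventually_elim simp
    qed (use uslice[OF s] vm[OF s] U_slice[of s] in auto)
    finally show ?thesis .
  qed
  have inc: "D t \<le> D s + (2 * (C * (real CARD('n) / sqrt (real n))) + \<epsilon> * (C * (real CARD('n))\<^sup>2 * sqrt (real n)) * T)"
    if s: "0 < s" "s \<le> t" for s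
  proof -
    have sT: "s \<in> {0<..<T}" using s t by auto
    have "\<epsilon> * (C * (real CARD('n))\<^sup>2 * sqrt (real n)) * (t - s) \<le> \<epsilon> * (C * (real CARD('n))\<^sup>2 * sqrt (real n)) * T"
      using s t \<epsilon> C(1) by (intro mult_left_mono) auto
    moreover have "t < T" using t by simp
    ultimately show ?thesis
      using L1_distance_increment[OF s] unfolding D_def Vv[OF sT] Vv[OF t] by linarith
  qed
  have small: "\<exists>s. 0 < s \<and> s \<le> t \<and> D s \<le> 2 * e" if e: "e > 0" for e
  proof -
    obtain \<tau> where \<tau>: "\<tau> > 0" "AE s in lborel. 0 < s \<and> s < \<tau> \<longrightarrow> L1_norm cell (\<lambda>x. u s x - u0 x) < e"
      using ent e unfolding entropy_solution_def by (elim conjE) blast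
    have "((\<lambda>s. L1_norm cell (\<lambda>x. v s x - u0 x)) \<longlongrightarrow> 0) (at_right 0)" using v by (simp add: viscous_solution_def)
    then have "eventually (\<lambda>s. L1_norm cell (\<lambda>x. v s x - u0 x) < e) (at_right 0)" by (rule order_tendstoD(2)[OF _ e])
    then obtain \<delta> where \<delta>: "\<delta> > 0" "\<And>s. 0 < s \<Longrightarrow> s < \<delta> \<Longrightarrow> L1_norm cell (\<lambda>x. v s x - u0 x) < e"
      unfolding eventually_at_right_field by blast
    obtain s where s: "s \<in> {0<..<min t (min \<tau> \<delta>)}" "0 < s \<and> s < \<tau> \<longrightarrow> L1_norm cell (\<lambda>x. u s x - u0 x) < e"
      using AE_lborel_ex[OF \<tau>(2), of 0 "min t (min \<tau> \<delta>)"] \<tau>(1) \<delta>(1) t by auto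
    have sT: "s \<in> {0<..<T}" using s(1) t by auto
    have "L1_norm cell (\<lambda>x. u s x - u0 x) = (LINT x|torus. \<bar>U s x - w x\<bar>)"
    proof -
      have "L1_norm cell (\<lambda>x. u s x - u0 x) = (LINT x|torus. \<bar>u s x - u0 x\<bar>)"
        by (rule L1_norm_torus) (use uslice[OF sT] in measurable)
      also have "\<dots> = (LINT x|torus. \<bar>U s x - w x\<bar>)"
      proof (rule integral_cong_AE)
        show "AE x in torus. \<bar>u s x - u0 x\<bar> = \<bar>U s x - w x\<bar>" using uU[OF sT] w(4) by eventually_elim simp
      qed (use uslice[OF sT] w(1) U_slice[of s] in auto)
      finally show ?thesis .
    qed
    then have 1: "(LINT x|torus. \<bar>U s x - w x\<bar>) < e" using s by auto
    have "L1_norm cell (\<lambda>x. v s x - u0 x) = (LINT x|torus. \<bar>v s x - w x\<bar>)"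
    proof -
      have "L1_norm cell (\<lambda>x. v s x - u0 x) = (LINT x|torus. \<bar>v s x - u0 x\<bar>)"
        by (rule L1_norm_torus) (use vm[OF sT] in measurable)
      also have "\<dots> = (LINT x|torus. \<bar>v s x - w x\<bar>)"
      proof (rule integral_cong_AE)
        show "AE x in torus. \<bar>v s x - u0 x\<bar> = \<bar>v s x - w x\<bar>" using w(4) by eventually_elim simp
      qed (use vm[OF sT] w(1) in auto)
      finally show ?thesis .
    qed
    then have 2: "(LINT x|torus. \<bar>v s x - w x\<bar>) < e" using s \<delta>(2)[of s] by auto
    have i: "integrable torus (\<lambda>x. \<bar>U s x - v s x\<bar>)" "integrable torus (\<lambda>x. \<bar>U s x - w x\<bar>)" "integrable torus (\<lambda>x. \<bar>v s x - w x\<bar>)"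
      by (intro int bounded_borel_intros Ub wb vb[OF sT])+
    have "D s \<le> (LINT x|torus. \<bar>U s x - w x\<bar> + \<bar>v s x - w x\<bar>)"
      unfolding D_def by (rule integral_mono[OF i(1) Bochner_Integration.integrable_add[OF i(2,3)]]) linarith
    also have "\<dots> = (LINT x|torus. \<bar>U s x - w x\<bar>) + (LINT x|torus. \<bar>v s x - w x\<bar>)"
      using i(2,3) by simp
    finally have "D s \<le> 2 * e" using 1 2 by linarith
    then show ?thesis using s(1) by (intro exI[of _ s]) auto
  qed
  have "D t \<le> 2 * (C * (real CARD('n) / sqrt (real n))) + \<epsilon> * (C * (real CARD('n))\<^sup>2 * sqrt (real n)) * T"
  proof (rule field_le_epsilon)
    fix e :: real assume "e > 0"
    then obtain s where "0 < s" "s \<le> t" "D s \<le> 2 * (e / 2)" using small[of "e / 2"] by auto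
    with inc[of s] show "D t \<le> 2 * (C * (real CARD('n) / sqrt (real n))) + \<epsilon> * (C * (real CARD('n))\<^sup>2 * sqrt (real n)) * T + e"
      by linarith
  qed
  then show "L1_norm cell (\<lambda>x. u t x - v t x) \<le> 2 * (C * (real CARD('n) / sqrt (real n))) + \<epsilon> * (C * (real CARD('n))\<^sup>2 * sqrt (real n)) * T"
    by (simp only: norm_eq[OF t])
  have i: "integrable torus (\<lambda>x. \<bar>U t x - v t x\<bar>)" "integrable torus (\<lambda>x. \<bar>v t x\<bar>)"
    by (intro int bounded_borel_intros Ub vb[OF t])+
  have iM: "integrable (torus :: (real^'n) measure) (\<lambda>x. M)" by simp
  have "D t \<le> (LINT x|torus. M + \<bar>v t x\<bar>)"
    unfolding D_def
  proof (rule integral_mono[OF i(1) Bochner_Integration.integrable_add[OF iM i(2)]])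
    show "\<bar>U t x - v t x\<bar> \<le> M + \<bar>v t x\<bar>" for x using UM[of t x] by linarith
  qed
  also have "\<dots> = M * measure (torus :: (real^'n) measure) UNIV + (LINT x|torus. \<bar>v t x\<bar>)"
    using i(2) by simp
  finally show "L1_norm cell (\<lambda>x. u t x - v t x) \<le> M * measure (torus :: (real^'n) measure) UNIV + (LINT x|torus. \<bar>w x\<bar>)"
    using viscous_solution_bounds(2)[OF levy f \<epsilon> u0 w v t] unfolding norm_eq[OF t] by linarith
qed

text \<open>The two errors \<open>1 / sqrt n\<close> and \<open>\<epsilon> * sqrt n\<close> are equal for \<open>n = 1 / \<epsilon>\<close>; rounding up costs a constant factor.\<close>
lemma rate_balance:
  assumes \<epsilon>: "0 < \<epsilon>" "\<epsilon> \<le> 1"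
  obtains n :: nat where "n \<ge> 1" "1 / sqrt (real n) \<le> sqrt \<epsilon>" "\<epsilon> * sqrt (real n) \<le> 2 * sqrt \<epsilon>"
proof -
  define n where "n = nat \<lceil>1 / \<epsilon>\<rceil>"
  have "1 \<le> 1 / \<epsilon>" using \<epsilon> by simp
  moreover have "real n = real_of_int \<lceil>1 / \<epsilon>\<rceil>" using \<epsilon> by (simp add: n_def)
  ultimately have n: "1 / \<epsilon> \<le> real n" "real n \<le> 2 * (1 / \<epsilon>)" by linarith+
  have n1: "1 \<le> real n" using n(1) \<open>1 \<le> 1 / \<epsilon>\<close> by linarith
  have "inverse (real n) \<le> \<epsilon>" using n(1) n1 \<epsilon> by (simp add: field_simps)
  then have 1: "1 / sqrt (real n) \<le> sqrt \<epsilon>" by (simp add: divide_inverse flip: real_sqrt_inverse)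
  have "sqrt (real n) \<le> sqrt (4 * (1 / \<epsilon>))" using n \<epsilon> by (intro real_sqrt_le_mono) (simp add: field_simps)
  also have "\<dots> = 2 / sqrt \<epsilon>" by (simp add: real_sqrt_mult real_sqrt_divide)
  finally have "\<epsilon> * sqrt (real n) \<le> \<epsilon> * (2 / sqrt \<epsilon>)" using \<epsilon> by (intro mult_left_mono) auto
  also have "\<dots> = 2 * (\<epsilon> / sqrt \<epsilon>)" by simp
  also have "\<dots> = 2 * sqrt \<epsilon>" using real_div_sqrt[of \<epsilon>] \<epsilon> by simp
  finally show thesis using 1 n1 by (intro that[of n]) auto
qed

theorem theorem2p4:
  fixes f :: "real \<Rightarrow> real^'n::finite"
    and \<mu> :: "(real^'n) measure"
    and u0 :: "real^'n \<Rightarrow> real"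
    and u :: "real \<Rightarrow> real^'n \<Rightarrow> real"
    and T :: real and s :: nat
  assumes T: "T > 0"
    and s: "s > 4 + CARD('n) div 2"
    and f: "\<And>j. Ck_on s UNIV (\<lambda>w. f w $ j)"
    and mu: "levy_measure \<mu>"
    and u0_meas: "u0 \<in> borel_measurable borel"
    and u0_periodic: "periodic u0"
    and u0_bounded: "ess_bounded_on cell u0"
    and u0_BV: "BV_on cell u0"
    and viscous_wellposed: "\<And>\<epsilon>. \<epsilon> > 0 \<Longrightarrow>
          \<exists>v. viscous_solution T \<mu> f u0 \<epsilon> v \<and>
              (\<forall>w. viscous_solution T \<mu> f u0 \<epsilon> w \<longrightarrow> (\<forall>t\<in>{0<..<T}. w t = v t))"
    and u: "entropy_solution T \<mu> f u0 u"
  shows "\<exists>C. \<forall>\<epsilon>>0. \<forall>u\<epsilon>. viscous_solution T \<mu> f u0 \<epsilon> u\<epsilon> \<longrightarrow>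
           (\<forall>t\<in>{0<..<T}. L1_norm cell (\<lambda>x. u t x - u\<epsilon> t x) \<le> C * sqrt \<epsilon>)"
proof -
  have f1: "Ck_on 1 UNIV (\<lambda>w. f w $ j)" for j by (rule Ck_on_le[OF f]) (use s in simp)
  obtain w A C where w: "w \<in> borel_measurable borel" "\<And>x. \<bar>w x\<bar> \<le> A" "periodic w" "AE x in torus. u0 x = w x"
    and C: "C \<ge> 0" "\<And>h. (LINT x|torus. \<bar>w (x + h) - w x\<bar>) \<le> C * sin_modulus h"
    using clip_datum[OF u0_meas u0_periodic u0_bounded u0_BV] by blast
  obtain U M where U: "(\<lambda>p. U (fst p) (snd p)) \<in> borel_measurable borel2" "\<And>t x. \<bar>U t x\<bar> \<le> M" "\<And>t. periodic (U t)"
    "(\<lambda>p. indicator {0..T} (fst p) * u (fst p) (snd p)) \<in> borel_measurable borel2"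
    "\<And>t. t \<in> {0<..<T} \<Longrightarrow> AE x in torus. u t x = U t x"
    "\<And>t e. t \<in> {0<..<T} \<Longrightarrow> e > 0 \<Longrightarrow> \<exists>d>0. \<forall>s\<in>{t..t + d}. (LINT x|torus. \<bar>U s x - U t x\<bar>) \<le> e"
  proof (rule entropy_solution_clip[OF u])
    fix U M
    assume "(\<lambda>p. U (fst p) (snd p)) \<in> borel_measurable borel2" "\<And>t x. \<bar>U t x\<bar> \<le> M" "\<And>t. periodic (U t)"
      "(\<lambda>p. indicator {0..T} (fst p) * u (fst p) (snd p)) \<in> borel_measurable borel2"
      "\<And>t. t \<in> {0<..<T} \<Longrightarrow> AE x in torus. u t x = U t x"
      "\<And>t e. t \<in> {0<..<T} \<Longrightarrow> e > 0 \<Longrightarrow> \<exists>d>0. \<forall>s\<in>{t..t + d}. (LINT x|torus. \<bar>U s x - U t x\<bar>) \<le> e"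
    then show thesis by (rule that)
  qed
  define d where "d = real CARD('n)"
  define C1 where "C1 = M * measure (torus :: (real^'n) measure) UNIV + (LINT x|torus. \<bar>w x\<bar>)"
  define C2 where "C2 = 2 * C * d + 2 * C * d\<^sup>2 * T"
  have M: "0 \<le> M" using U(2)[of 0 0] by linarith
  have nonneg: "0 \<le> C1" "0 \<le> C2" using M C(1) T by (simp_all add: C1_def C2_def d_def)
  have "L1_norm cell (\<lambda>x. u t x - v t x) \<le> (C1 + C2) * sqrt \<epsilon>"
    if \<epsilon>: "\<epsilon> > 0" and v: "viscous_solution T \<mu> f u0 \<epsilon> v" and t: "t \<in> {0<..<T}" for \<epsilon> v t
  proof (cases "\<epsilon> \<le> 1")
    case True
    obtain n :: nat where n: "n \<ge> 1" "1 / sqrt (real n) \<le> sqrt \<epsilon>" "\<epsilon> * sqrt (real n) \<le> 2 * sqrt \<epsilon>"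
      using rate_balance[OF \<epsilon> True] by blast
    have "L1_norm cell (\<lambda>x. u t x - v t x) \<le> 2 * (C * (d / sqrt (real n))) + \<epsilon> * (C * d\<^sup>2 * sqrt (real n)) * T"
      unfolding d_def by (rule viscous_distance_bound(1)[OF mu f1 \<epsilon> u0_meas w C u U(1,3,2,4,5,6) v t n(1)])
    also have "\<dots> = (2 * C * d) * (1 / sqrt (real n)) + (C * d\<^sup>2 * T) * (\<epsilon> * sqrt (real n))" by simp
    also have "\<dots> \<le> (2 * C * d) * sqrt \<epsilon> + (C * d\<^sup>2 * T) * (2 * sqrt \<epsilon>)"
      using C(1) T by (intro add_mono mult_left_mono n) (auto simp: d_def)
    also have "\<dots> = C2 * sqrt \<epsilon>" by (simp add: C2_def algebra_simps)
    also have "\<dots> \<le> (C1 + C2) * sqrt \<epsilon>" using nonneg \<epsilon> by (intro mult_right_mono) auto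
    finally show ?thesis .
  next
    case False
    have "L1_norm cell (\<lambda>x. u t x - v t x) \<le> C1"
      unfolding C1_def by (rule viscous_distance_bound(2)[OF mu f1 \<epsilon> u0_meas w C u U(1,3,2,4,5,6) v t le_refl])
    also have "\<dots> \<le> (C1 + C2) * 1" using nonneg by simp
    also have "\<dots> \<le> (C1 + C2) * sqrt \<epsilon>" using nonneg False by (intro mult_left_mono) auto
    finally show ?thesis .
  qed
  then show ?thesis by blast
qed

end
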